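(* Let $n\ge 1$ and let $W,W'\in(\mathbb{C}^* )^{4n+4}$ be such that exactly the same factors of the principal $A$-determinant $E_A$ vanish at $W$ and at $W'$ (i.e. for every factor $G$ of $E_A$, $G(W)=0$ if and only if $G(W')=0$). 1. If $n=1$, then $\chi(Y_{W,1})=\chi(Y_{W',1})$. 2. If $n=2$, then $\chi(Y_{W,2})=\chi(Y_{W',2})$ provided that either the $2\times2\times3$ hyperdeterminant $H_{012}$ does not vanish (at $W$, equivalently at $W'$), or at least one of the $2\times2\times2$ hyperdeterminants $H_{01},H_{02},H_{12}$ does vanish (at $W$, equivalently at $W'$). 3. If $n>2$, then $\chi(Y_{W,n})=\chi(Y_{W',n})$ provided that none of the $2\times2\times3$ hyperdeterminants $H_{k_1k_2k_3}$, $0\le k_1<k_2<k_3\le n$, vanishes (at $W$, equivalently at $W'$).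
   Context: For $W=(w_{ijk})_{i,j\in\{0,1\},\,0\le k\le n}\in(\mathbb{C}^* )^{4n+4}$ put $f_k=w_{00k}+w_{10k}x_1+w_{01k}y_1+w_{11k}x_1y_1$ and let $Y_{W,n}\subset(\mathbb{C}^* )^{2+n}$ be the hypersurface $f_0+\sum_{k=1}^n z_kf_k=0$ in the coordinates $x_1,y_1,z_1,\dots,z_n$. $\chi$ is the topological Euler characteristic. The principal $A$-determinant $E_A$ of $\mathbb{P}^1\times\mathbb{P}^1\times\mathbb{P}^n$ (here $A$ is the set of lattice points of $\Delta_1\times\Delta_1\times\Delta_n$) is, ignoring the monomial factors $w_{ijk}$, the product of the following polynomials in the $w_{ijk}$, which are called its factors: (a) the 2-minors $F_{\bullet\bullet k}=w_{00k}w_{11k}-w_{01k}w_{10k}$ ($0\le k\le n$), $F_{i\bullet(k_1,k_2)}=w_{i0k_1}w_{i1k_2}-w_{i1k_1}w_{i0k_2}$ and $F_{\bullet j(k_1,k_2)}=w_{0jk_1}w_{1jk_2}-w_{1jk_1}w_{0jk_2}$ ($i,j\in\{0,1\}$, $0\le k_1<k_2\le n$); (b) the $2\times2\times2$ hyperdeterminants, for $0\le k_1<k_2\le n$, $$H_{k_1k_2}=\big[(w_{00k_1}w_{11k_2}-w_{00k_2}w_{11k_1})-(w_{01k_1}w_{10k_2}-w_{01k_2}w_{10k_1})\big]^2-4F_{0\bullet(k_1,k_2)}F_{1\bullet(k_1,k_2)};$$ (c) the $2\times2\times3$ hyperdeterminants $H_{k_1k_2k_3}$, for $0\le k_1<k_2<k_3\le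 n$: the resultant of the three bilinear forms $q_{k_1},q_{k_2},q_{k_3}$, where $q_k=w_{00k}x_0y_0+w_{01k}x_0y_1+w_{10k}x_1y_0+w_{11k}x_1y_1$. It is an irreducible polynomial of degree 6, and it vanishes if and only if $q_{k_1}=q_{k_2}=q_{k_3}=0$ has a solution in $\mathbb{P}^1\times\mathbb{P}^1$. *)

theory Defs
  imports "HOL-Analysis.Analysis" "HOL-Homology.Homology"
begin

text \<open>
  The groups of the homology library are written multiplicatively, so a relation
  \<open>\<Sum> c\<^sub>s s = 0\<close> with integer coefficients reads \<open>\<Otimes> s^c\<^sub>s = \<one>\<close>.
\<close>

definition Z_independent :: "('a, 'm) monoid_scheme \<Rightarrow> 'a set \<Rightarrow> bool" where
  "Z_independent G S \<longleftrightarrow> finite S \<and> S \<subseteq> carrier G \<and>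
     (\<forall>c :: 'a \<Rightarrow> int. finprod G (\<lambda>s. s [^]\<^bsub>G\<^esub> c s) S = \<one>\<^bsub>G\<^esub> \<longrightarrow> (\<forall>s\<in>S. c s = 0))"

text \<open>
  The rank of an abelian group. It is only meaningful when the rank is finite (the maximum of an
  infinite set is unspecified). Likewise \<open>euler_characteristic\<close> is only meaningful for
  spaces whose total Betti number is finite; this holds for every complex algebraic variety.
\<close>

definition Z_rank :: "('a, 'm) monoid_scheme \<Rightarrow> nat" where
  "Z_rank G = Max {card S | S. Z_independent G S}"

definition betti_number :: "nat \<Rightarrow> 'a topology \<Rightarrow> nat" where
  "betti_number p X = Z_rank (homology_group (int p) X)"

definition euler_characteristic :: "'a topology \<Rightarrow> int" where
  "euler_characteristic X = (\<Sum>p | betti_number p X \<noteq> 0. (-1) ^ p * int (betti_number p X))"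

text \<open>The coefficient \<open>w\<^sub>i\<^sub>j\<^sub>k\<close> is \<open>W i j k\<close>; only \<open>i, j \<le> 1\<close> and \<open>k \<le> n\<close> are relevant.\<close>

type_synonym coeffs = "nat \<Rightarrow> nat \<Rightarrow> nat \<Rightarrow> complex"

definition in_torus :: "nat \<Rightarrow> coeffs \<Rightarrow> bool" where
  "in_torus n W \<longleftrightarrow> (\<forall>i\<le>1. \<forall>j\<le>1. \<forall>k\<le>n. W i j k \<noteq> 0)"

definition f_poly :: "coeffs \<Rightarrow> nat \<Rightarrow> complex \<Rightarrow> complex \<Rightarrow> complex" where
  "f_poly W k x y = W 0 0 k + W 1 0 k * x + W 0 1 k * y + W 1 1 k * x * y"

definition affine_space :: "nat \<Rightarrow> (complex \<times> complex \<times> (nat \<Rightarrow> complex)) topology" where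
  "affine_space n =
     prod_topology euclidean (prod_topology euclidean (product_topology (\<lambda>k. euclidean) {1..n}))"

definition Y_hyp :: "coeffs \<Rightarrow> nat \<Rightarrow> (complex \<times> complex \<times> (nat \<Rightarrow> complex)) topology" where
  "Y_hyp W n = subtopology (affine_space n)
     {(x, y, z). x \<noteq> 0 \<and> y \<noteq> 0 \<and> (\<forall>k\<in>{1..n}. z k \<noteq> 0) \<and>
                 f_poly W 0 x y + (\<Sum>k=1..n. z k * f_poly W k x y) = 0}"

definition F_slice :: "nat \<Rightarrow> coeffs \<Rightarrow> complex" where
  "F_slice k W = W 0 0 k * W 1 1 k - W 0 1 k * W 1 0 k"

definition F_row :: "nat \<Rightarrow> nat \<Rightarrow> nat \<Rightarrow> coeffs \<Rightarrow> complex" where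
  "F_row i k1 k2 W = W i 0 k1 * W i 1 k2 - W i 1 k1 * W i 0 k2"

definition F_col :: "nat \<Rightarrow> nat \<Rightarrow> nat \<Rightarrow> coeffs \<Rightarrow> complex" where
  "F_col j k1 k2 W = W 0 j k1 * W 1 j k2 - W 1 j k1 * W 0 j k2"

definition H2 :: "nat \<Rightarrow> nat \<Rightarrow> coeffs \<Rightarrow> complex" where
  "H2 k1 k2 W =
     ((W 0 0 k1 * W 1 1 k2 - W 0 0 k2 * W 1 1 k1) - (W 0 1 k1 * W 1 0 k2 - W 0 1 k2 * W 1 0 k1))\<^sup>2
     - 4 * F_row 0 k1 k2 W * F_row 1 k1 k2 W"

definition q_form :: "coeffs \<Rightarrow> nat \<Rightarrow> complex \<Rightarrow> complex \<Rightarrow> complex \<Rightarrow> complex \<Rightarrow> complex" where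
  "q_form W k x0 x1 y0 y1 =
     W 0 0 k * x0 * y0 + W 0 1 k * x0 * y1 + W 1 0 k * x1 * y0 + W 1 1 k * x1 * y1"

text \<open>
  \<open>H3\<close> is the resultant of \<open>q\<^sub>k\<^sub>1, q\<^sub>k\<^sub>2, q\<^sub>k\<^sub>3\<close>, as an explicit form of degree 6.
  Regarded as linear forms in the Segre coordinates \<open>p\<^sub>i\<^sub>j = x\<^sub>i y\<^sub>j\<close> on 3-space, the three forms
  generically have exactly one common zero, whose coordinates \<open>p\<^sub>0\<^sub>0, p\<^sub>0\<^sub>1, p\<^sub>1\<^sub>0, p\<^sub>1\<^sub>1\<close> are up to
  the signs \<open>+, -, +, -\<close> the maximal minors of the 3 by 4 coefficient matrix. The resultant is the
  value of the equation \<open>p\<^sub>0\<^sub>0 p\<^sub>1\<^sub>1 - p\<^sub>0\<^sub>1 p\<^sub>1\<^sub>0\<close> of the Segre quadric at this point (up to the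
  overall sign, which is a matter of convention). Lemma \<open>H3_eq_0_iff\<close> below verifies the
  vanishing property; as the resultant is irreducible of degree 6, this determines \<open>H3\<close> up
  to a nonzero constant.
\<close>

definition minor3 ::
    "(nat \<Rightarrow> complex) \<Rightarrow> (nat \<Rightarrow> complex) \<Rightarrow> (nat \<Rightarrow> complex) \<Rightarrow> nat \<Rightarrow> nat \<Rightarrow> nat \<Rightarrow> complex" where
  "minor3 a b c k1 k2 k3 =
     det (vector [vector [a k1, b k1, c k1],
                  vector [a k2, b k2, c k2],
                  vector [a k3, b k3, c k3]] :: complex^3^3)"

definition H3 :: "nat \<Rightarrow> nat \<Rightarrow> nat \<Rightarrow> coeffs \<Rightarrow> complex" where
  "H3 k1 k2 k3 W =
     minor3 (W 0 1) (W 1 0) (W 1 1) k1 k2 k3 * minor3 (W 0 0) (W 0 1) (W 1 0) k1 k2 k3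
     - minor3 (W 0 0) (W 1 0) (W 1 1) k1 k2 k3 * minor3 (W 0 0) (W 0 1) (W 1 1) k1 k2 k3"

definition EA_factors :: "nat \<Rightarrow> (coeffs \<Rightarrow> complex) set" where
  "EA_factors n =
     {F_slice k | k. k \<le> n}
     \<union> {F_row i k1 k2 | i k1 k2. i \<le> 1 \<and> k1 < k2 \<and> k2 \<le> n}
     \<union> {F_col j k1 k2 | j k1 k2. j \<le> 1 \<and> k1 < k2 \<and> k2 \<le> n}
     \<union> {H2 k1 k2 | k1 k2. k1 < k2 \<and> k2 \<le> n}
     \<union> {H3 k1 k2 k3 | k1 k2 k3. k1 < k2 \<and> k2 < k3 \<and> k3 \<le> n}"

lemma minor3_expand:
  "minor3 a b c k1 k2 k3 =
     a k1 * (b k2 * c k3 - c k2 * b k3) - b k1 * (a k2 * c k3 - c k2 * a k3)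
     + c k1 * (a k2 * b k3 - b k2 * a k3)"
  by (simp add: minor3_def det_3 algebra_simps)

lemma minor3_relation:
  assumes "\<And>k. k \<in> {k1, k2, k3} \<Longrightarrow> a k * s + b k * t + c k * u + d k * v = 0"
  shows "s * minor3 a c d k1 k2 k3 + t * minor3 b c d k1 k2 k3 = 0"
proof -
  have "s * minor3 a c d k1 k2 k3 + t * minor3 b c d k1 k2 k3
      = minor3 (\<lambda>k. a k * s + b k * t + c k * u + d k * v) c d k1 k2 k3"
    by (simp add: minor3_expand algebra_simps)
  also have "\<dots> = 0"
    using assms by (simp add: minor3_expand)
  finally show ?thesis .
qed

lemma rows_dependent:
  fixes u v w :: "'c \<Rightarrow> complex"
  assumes "\<And>a b c. u a * (v b * w c - v c * w b) - u b * (v a * w c - v c * w a)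
                      + u c * (v a * w b - v b * w a) = 0"
  shows "\<exists>l m n. (l \<noteq> 0 \<or> m \<noteq> 0 \<or> n \<noteq> 0) \<and> (\<forall>c. l * u c + m * v c + n * w c = 0)"
proof (cases "\<exists>a b. v a * w b - v b * w a \<noteq> 0 \<or> u a * w b - u b * w a \<noteq> 0 \<or> u a * v b - u b * v a \<noteq> 0")
  case True
  then obtain a b where ab: "v a * w b - v b * w a \<noteq> 0 \<or> u a * w b - u b * w a \<noteq> 0 \<or> u a * v b - u b * v a \<noteq> 0"
    by blast
  have "(v a * w b - v b * w a) * u c + (- (u a * w b - u b * w a)) * v c + (u a * v b - u b * v a) * w c = 0" for c
    using assms[of a b c] by (simp add: algebra_simps)
  with ab show ?thesis by (metis neg_equal_0_iff_equal)
next
  case False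
  then have z: "u a * v b - u b * v a = 0" for a b by blast
  show ?thesis
  proof (cases "\<exists>a. u a \<noteq> 0")
    case True
    then obtain a where a: "u a \<noteq> 0" by blast
    have "v a * u c + (- u a) * v c + 0 * w c = 0" for c
      using z[of a c] by (simp add: algebra_simps)
    with a show ?thesis by (metis neg_equal_0_iff_equal)
  next
    case False
    then have "1 * u c + 0 * v c + 0 * w c = 0" for c by simp
    then show ?thesis by (metis zero_neq_one)
  qed
qed

lemma binary_quadric_zero:
  fixes a b c :: complex
  shows "\<exists>s t. (s \<noteq> 0 \<or> t \<noteq> 0) \<and> a * s^2 + b * s * t + c * t^2 = 0"
proof (cases "a = 0")
  case True
  then show ?thesis by (intro exI[of _ 1] exI[of _ 0]) simp
next
  case False
  define d where "d = csqrt (b^2 - 4 * a * c)"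
  have d: "d^2 = b^2 - 4 * a * c" by (simp add: d_def)
  have "a * (d - b)^2 + b * (d - b) * (2 * a) + c * (2 * a)^2 = a * (d^2 - (b^2 - 4 * a * c))"
    by (simp add: algebra_simps power2_eq_square)
  also have "\<dots> = 0" using d by simp
  finally have "a * (d - b)^2 + b * (d - b) * (2 * a) + c * (2 * a)^2 = 0" .
  with False show ?thesis by (intro exI[of _ "d - b"] exI[of _ "2 * a"]) simp
qed

lemma two_bilinear_zero:
  fixes a b c d a' b' c' d' :: complex
  shows "\<exists>s t y z. (s \<noteq> 0 \<or> t \<noteq> 0) \<and> (y \<noteq> 0 \<or> z \<noteq> 0) \<and>
           a * s * y + b * s * z + c * t * y + d * t * z = 0 \<and>
           a' * s * y + b' * s * z + c' * t * y + d' * t * z = 0"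
proof -
  obtain s t where st: "s \<noteq> 0 \<or> t \<noteq> 0"
    and *: "(a * b' - b * a') * s^2 + (a * d' + c * b' - b * c' - d * a') * s * t + (c * d' - d * c') * t^2 = 0"
    using binary_quadric_zero by blast
  define g h g' h' where "g = a * s + c * t" and "h = b * s + d * t"
    and "g' = a' * s + c' * t" and "h' = b' * s + d' * t"
  note defs = g_def h_def g'_def h'_def
  have det0: "g * h' - h * g' = 0"
    using * unfolding defs by (simp add: algebra_simps power2_eq_square)
  have "\<exists>y z. (y \<noteq> 0 \<or> z \<noteq> 0) \<and> g * y + h * z = 0 \<and> g' * y + h' * z = 0"
  proof (cases "g = 0 \<and> h = 0")
    case True
    show ?thesis
    proof (cases "g' = 0 \<and> h' = 0")
      case True
      with \<open>g = 0 \<and> h = 0\<close> show ?thesis by (intro exI[of _ 1]) simp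
    next
      case False
      with True show ?thesis by (intro exI[of _ "- h'"] exI[of _ g']) auto
    qed
  next
    case False
    with det0 show ?thesis by (intro exI[of _ "- h"] exI[of _ g]) (auto simp: algebra_simps)
  qed
  then obtain y z where "y \<noteq> 0 \<or> z \<noteq> 0" "g * y + h * z = 0" "g' * y + h' * z = 0" by blast
  with st show ?thesis
    unfolding defs
    by (intro exI[of _ s] exI[of _ t] exI[of _ y] exI[of _ z]) (auto simp: algebra_simps)
qed

lemma rank_one:
  fixes p00 p01 p10 p11 :: complex
  assumes "p00 \<noteq> 0 \<or> p01 \<noteq> 0 \<or> p10 \<noteq> 0 \<or> p11 \<noteq> 0" "p00 * p11 = p01 * p10"
  shows "\<exists>x0 x1 y0 y1. (x0 \<noteq> 0 \<or> x1 \<noteq> 0) \<and> (y0 \<noteq> 0 \<or> y1 \<noteq> 0) \<and>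
           p00 = x0 * y0 \<and> p01 = x0 * y1 \<and> p10 = x1 * y0 \<and> p11 = x1 * y1"
proof -
  consider "p00 \<noteq> 0" | "p00 = 0" "p01 \<noteq> 0" | "p00 = 0" "p01 = 0" "p10 \<noteq> 0 \<or> p11 \<noteq> 0"
    using assms(1) by blast
  then show ?thesis
  proof cases
    case 1
    with assms(2) show ?thesis
      by (intro exI[of _ 1] exI[of _ "p10 / p00"] exI[of _ p00] exI[of _ p01]) (auto simp: field_simps)
  next
    case 2
    with assms(2) show ?thesis
      by (intro exI[of _ 1] exI[of _ "p11 / p01"] exI[of _ p00] exI[of _ p01]) (auto simp: field_simps)
  next
    case 3
    then show ?thesis
      by (intro exI[of _ 0] exI[of _ 1] exI[of _ p10] exI[of _ p11]) auto
  qed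
qed

theorem H3_eq_0_iff:
  "H3 k1 k2 k3 W = 0 \<longleftrightarrow>
     (\<exists>x0 x1 y0 y1. (x0 \<noteq> 0 \<or> x1 \<noteq> 0) \<and> (y0 \<noteq> 0 \<or> y1 \<noteq> 0) \<and>
        q_form W k1 x0 x1 y0 y1 = 0 \<and> q_form W k2 x0 x1 y0 y1 = 0 \<and> q_form W k3 x0 x1 y0 y1 = 0)"
    (is "_ \<longleftrightarrow> ?Z")
proof -
  define p00 p01 p10 p11 where
    "p00 = minor3 (W 0 1) (W 1 0) (W 1 1) k1 k2 k3" and
    "p01 = - minor3 (W 0 0) (W 1 0) (W 1 1) k1 k2 k3" and
    "p10 = minor3 (W 0 0) (W 0 1) (W 1 1) k1 k2 k3" and
    "p11 = - minor3 (W 0 0) (W 0 1) (W 1 0) k1 k2 k3"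
  note pdefs = p00_def p01_def p10_def p11_def
  have H: "H3 k1 k2 k3 W = - (p00 * p11 - p01 * p10)"
    by (simp add: H3_def pdefs)
  define L where "L k = W 0 0 k * p00 + W 0 1 k * p01 + W 1 0 k * p10 + W 1 1 k * p11" for k
  have L: "L k1 = 0" "L k2 = 0" "L k3 = 0"
    unfolding L_def pdefs minor3_expand by (simp_all add: algebra_simps)
  show ?thesis
  proof
    assume "H3 k1 k2 k3 W = 0"
    then have quad: "p00 * p11 = p01 * p10" using H by simp
    show ?Z
    proof (cases "p00 \<noteq> 0 \<or> p01 \<noteq> 0 \<or> p10 \<noteq> 0 \<or> p11 \<noteq> 0")
      case True
      then obtain x0 x1 y0 y1 where x: "x0 \<noteq> 0 \<or> x1 \<noteq> 0" "y0 \<noteq> 0 \<or> y1 \<noteq> 0"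
        and p: "p00 = x0 * y0" "p01 = x0 * y1" "p10 = x1 * y0" "p11 = x1 * y1"
        using rank_one[OF True quad] by blast
      have "q_form W k x0 x1 y0 y1 = L k" for k
        by (simp add: q_form_def L_def p algebra_simps)
      with L x show ?Z by metis
    next
      case False
      define r where "r k e = (case e of (False, False) \<Rightarrow> W 0 0 k | (False, True) \<Rightarrow> W 0 1 k
          | (True, False) \<Rightarrow> W 1 0 k | (True, True) \<Rightarrow> W 1 1 k)" for k e
      have p0: "p00 = 0" "p01 = 0" "p10 = 0" "p11 = 0" using False by auto
      have "r k1 a * (r k2 b * r k3 c - r k2 c * r k3 b) - r k1 b * (r k2 a * r k3 c - r k2 c * r k3 a)
            + r k1 c * (r k2 a * r k3 b - r k2 b * r k3 a) = 0" for a b c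
        using p0 unfolding pdefs minor3_expand r_def
        by (cases a; cases b; cases c) (auto simp: algebra_simps split: bool.splits)
      then obtain l m n where lmn: "l \<noteq> 0 \<or> m \<noteq> 0 \<or> n \<noteq> 0"
        and dep: "\<And>e. l * r k1 e + m * r k2 e + n * r k3 e = 0"
        using rows_dependent[of "r k1" "r k2" "r k3"] by metis
      have dep': "l * W i j k1 + m * W i j k2 + n * W i j k3 = 0" if "i \<in> {0,1}" "j \<in> {0,1}" for i j
        using that dep[of "(False, False)"] dep[of "(False, True)"] dep[of "(True, False)"] dep[of "(True, True)"]
        by (auto simp: r_def)
      have qdep: "l * q_form W k1 x0 x1 y0 y1 + m * q_form W k2 x0 x1 y0 y1 + n * q_form W k3 x0 x1 y0 y1 = 0" for x0 x1 y0 y1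
      proof -
        have "l * q_form W k1 x0 x1 y0 y1 + m * q_form W k2 x0 x1 y0 y1 + n * q_form W k3 x0 x1 y0 y1
          = (l * W 0 0 k1 + m * W 0 0 k2 + n * W 0 0 k3) * (x0 * y0)
          + (l * W 0 1 k1 + m * W 0 1 k2 + n * W 0 1 k3) * (x0 * y1)
          + (l * W 1 0 k1 + m * W 1 0 k2 + n * W 1 0 k3) * (x1 * y0)
          + (l * W 1 1 k1 + m * W 1 1 k2 + n * W 1 1 k3) * (x1 * y1)"
          by (simp add: q_form_def algebra_simps)
        then show ?thesis by (simp add: dep' del: One_nat_def)
      qed
      have two: "\<exists>x0 x1 y0 y1. (x0 \<noteq> 0 \<or> x1 \<noteq> 0) \<and> (y0 \<noteq> 0 \<or> y1 \<noteq> 0) \<and>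
          q_form W k x0 x1 y0 y1 = 0 \<and> q_form W k' x0 x1 y0 y1 = 0" for k k'
        unfolding q_form_def by (rule two_bilinear_zero)
      consider "l \<noteq> 0" | "m \<noteq> 0" | "n \<noteq> 0" using lmn by blast
      then show ?Z
      proof cases
        case 1
        then show ?Z using two[of k2 k3] qdep
          by (metis add.right_neutral mult_eq_0_iff)
      next
        case 2
        then show ?Z using two[of k1 k3] qdep
          by (metis add.right_neutral add.left_neutral mult_eq_0_iff)
      next
        case 3
        then show ?Z using two[of k1 k2] qdep
          by (metis add.left_neutral mult_eq_0_iff)
      qed
    qed
  next
    assume ?Z
    then obtain x0 x1 y0 y1 where x: "x0 \<noteq> 0 \<or> x1 \<noteq> 0" "y0 \<noteq> 0 \<or> y1 \<noteq> 0"
      and q0: "q_form W k1 x0 x1 y0 y1 = 0" "q_form W k2 x0 x1 y0 y1 = 0" "q_form W k3 x0 x1 y0 y1 = 0" by blast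
    define v00 v01 v10 v11 where "v00 = x0 * y0" and "v01 = x0 * y1" and "v10 = x1 * y0" and "v11 = x1 * y1"
    have ne: "v00 \<noteq> 0 \<or> v01 \<noteq> 0 \<or> v10 \<noteq> 0 \<or> v11 \<noteq> 0"
      using x by (auto simp: v00_def v01_def v10_def v11_def)
    have vq: "v00 * v11 = v01 * v10" by (simp add: v00_def v01_def v10_def v11_def)
    have eq: "W 0 0 k * v00 + W 0 1 k * v01 + W 1 0 k * v10 + W 1 1 k * v11 = 0" if "k \<in> {k1,k2,k3}" for k
      using that q0 by (auto simp: q_form_def v00_def v01_def v10_def v11_def algebra_simps)
    let ?m = "\<lambda>a b c. minor3 a b c k1 k2 k3"
    have rel: "s * ?m a c d = - t * ?m b c d"
      if "\<And>k. k \<in> {k1, k2, k3} \<Longrightarrow> a k * s + b k * t + c k * u + d k * v = 0"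
      for a b c d s t u v
      using minor3_relation[OF that] by (simp add: eq_neg_iff_add_eq_0)
    have swap: "?m b a c = - ?m a b c" and rot: "?m c a b = ?m a b c" for a b c
      by (simp_all add: minor3_expand algebra_simps)
    define A B C D where "A = W 0 0" and "B = W 0 1" and "C = W 1 0" and "D = W 1 1"
    have e: "A k * v00 + B k * v01 + C k * v10 + D k * v11 = 0" if "k \<in> {k1,k2,k3}" for k
      using eq[OF that] by (simp add: A_def B_def C_def D_def)
    have r: "v00 * ?m A C D = - v01 * ?m B C D" "v00 * ?m A B D = - v10 * ?m C B D"
        "v00 * ?m A B C = - v11 * ?m D B C" "v01 * ?m B A D = - v10 * ?m C A D"
        "v01 * ?m B A C = - v11 * ?m D A C" "v10 * ?m C A B = - v11 * ?m D A B"
      by (rule rel[of A v00 B v01 C v10 D v11] rel[of A v00 C v10 B v01 D v11]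
            rel[of A v00 D v11 B v01 C v10] rel[of B v01 C v10 A v00 D v11]
            rel[of B v01 D v11 A v00 C v10] rel[of C v10 D v11 A v00 B v01];
          use e in \<open>simp add: add_ac\<close>)+
    have c: "v00 * p01 = v01 * p00" "v00 * p10 = v10 * p00" "v00 * p11 = v11 * p00"
        "v01 * p10 = v10 * p01" "v01 * p11 = v11 * p01" "v10 * p11 = v11 * p10"
      using r swap[of C B D] rot[of D B C] swap[of B A D] swap[of C A D] swap[of B A C]
        rot[of D A C] rot[of C A B] rot[of D A B]
      unfolding pdefs A_def[symmetric] B_def[symmetric] C_def[symmetric] D_def[symmetric]
      by simp_all (metis minus_minus)
    have scale: "v^2 * (p00 * p11 - p01 * p10) = 0"
      if "v * p00 = v00 * r" "v * p01 = v01 * r" "v * p10 = v10 * r" "v * p11 = v11 * r" for v r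
    proof -
      have "v^2 * (p00 * p11 - p01 * p10) = (v * p00) * (v * p11) - (v * p01) * (v * p10)"
        by (simp add: algebra_simps power2_eq_square)
      also have "\<dots> = r^2 * (v00 * v11 - v01 * v10)"
        unfolding that by (simp add: algebra_simps power2_eq_square)
      finally show ?thesis using vq by simp
    qed
    have "v00^2 * (p00 * p11 - p01 * p10) = 0" "v01^2 * (p00 * p11 - p01 * p10) = 0"
         "v10^2 * (p00 * p11 - p01 * p10) = 0" "v11^2 * (p00 * p11 - p01 * p10) = 0"
      using scale[of v00 p00] scale[of v01 p01] scale[of v10 p10] scale[of v11 p11] c by simp_all
    with ne H show "H3 k1 k2 k3 W = 0" by auto
  qed
qed

end

(*
  Project Y to the torus with coordinates (x, y). Over a point where not all f_k vanish, the fibre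
  is a torus times the complement of a generic arrangement, and its Euler characteristic is 0
  unless all f_k are nonzero, when it is (-1)^(n-1). Common zeros of all f_k have the fibre
  (C^* )^n of Euler characteristic 0. Singular homology is not additive over arbitrary strata: over
  the open part additivity comes from Mayer-Vietoris, and at an isolated common zero from the local
  conical structure of Y, which has at worst A_1 singularities along a torus there. Hence chi(Y) is
  (-1)^(n-1) times the Euler characteristic of the locus where no f_k vanishes, unless the f_k are
  all proportional or share a component, and those cases are computed directly.

  Inclusion-exclusion expresses the Euler characteristic of that locus by the Euler characteristics
  of single curves f_k = 0 (governed by the 2-minors F of one slice), the numbers of common zeros of
  two of them (2, minus one for each point on the toric boundary and for a double point, which is
  H_kl = 0), and the number of triple points. There are none if the 2x2x3 hyperdeterminant is
  nonzero; if it vanishes and H_kl = 0, then the double point of f_k = f_l = 0 is the triple point,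
  so whether it lies in the torus can be read off from the 2-minors.
*)
theory Submission
  imports Defs "HOL-Library.Extended_Nat"
begin

section \<open>Ranks of abelian groups\<close>

text \<open>Each gluing step has to prove finiteness of homology along with the value, since
  Mayer-Vietoris delivers the fourth space only when three are known to be finite. Ranks therefore
  live in \<open>enat\<close>, where rank-nullity holds without finiteness and a long exact sequence
  passes finiteness on. Over the (x, y)-torus this asks for finiteness of all unions and
  intersections of the sets f_k \<noteq> 0; it is reduced to unions, whose complements are points, a
  line or one curve.

  The fibre over a common zero has characteristic 0, so restoring the zero must not change the
  value; the work lies in additivity near that fibre. New coordinates bring Y there into the form
  \<eta>_1 x + \<eta>_2 y = 0 (two forms transverse) or m (x + y) + c x y = 0 (all tangent to one
  direction); whatever escapes both belongs to the families computed directly. Both normal forms use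
  two free coefficients, so n = 1 is first thickened by a disc of values of the homogenizing
  variable.\<close>

definition zcomb :: "('a, 'm) monoid_scheme \<Rightarrow> ('a \<Rightarrow> int) \<Rightarrow> 'a set \<Rightarrow> 'a" where
  "zcomb G c S = finprod G (\<lambda>s. s [^]\<^bsub>G\<^esub> c s) S"

text \<open>The supremum lies in \<open>enat\<close>, so that infinite rank is a value, and ranges
  over subsets of \<open>K\<close>, so that kernels and images are measured inside the ambient group
  without forming subgroups.\<close>

definition set_rank :: "('a, 'm) monoid_scheme \<Rightarrow> 'a set \<Rightarrow> enat" where
  "set_rank G K = (SUP S\<in>{S. Z_independent G S \<and> S \<subseteq> K}. enat (card S))"

text \<open>Gaussian elimination by induction on the equations, with cross-multiplication by the
  pivot in place of division, so that the coefficients stay integral.\<close>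

lemma homogeneous_integer_system:
  fixes a :: "'s \<Rightarrow> 't \<Rightarrow> int"
  assumes "finite T" "finite S" "card T < card S"
  shows "\<exists>x. (\<exists>s\<in>S. x s \<noteq> 0) \<and> (\<forall>t\<in>T. (\<Sum>s\<in>S. x s * a s t) = 0)"
  using assms
proof (induction T arbitrary: S a rule: finite_induct)
  case empty
  then obtain s where "s \<in> S" by fastforce
  then show ?case by (intro exI[of _ "\<lambda>_. 1"]) auto
next
  case (insert t T)
  show ?case
  proof (cases "\<forall>s\<in>S. a s t = 0")
    case True
    have "card T < card S" using insert by simp
    from insert.IH[OF insert.prems(1) this, of a] True show ?thesis by auto
  next
    case False
    then obtain s0 where s0: "s0 \<in> S" "a s0 t \<noteq> 0" by blast
    let ?S = "S - {s0}"
    have "card T < card ?S" using insert s0 by simp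
    from insert.IH[OF _ this, of "\<lambda>s u. a s0 t * a s u - a s t * a s0 u"] insert.prems obtain x s1
      where s1: "s1 \<in> ?S" "x s1 \<noteq> 0"
        and x: "\<And>u. u \<in> T \<Longrightarrow> (\<Sum>s\<in>?S. x s * (a s0 t * a s u - a s t * a s0 u)) = 0"
      by auto
    \<comment> \<open>The pivot entry is chosen to satisfy equation \<open>t\<close>; the other
      entries carry the factor \<open>a s0 t\<close> that cross-multiplication introduced.\<close>
    define y where "y s = (if s = s0 then - (\<Sum>s\<in>?S. x s * a s t) else a s0 t * x s)" for s
    have sum: "(\<Sum>s\<in>S. y s * a s u) = (\<Sum>s\<in>?S. x s * (a s0 t * a s u - a s t * a s0 u))" for u
    proof -
      have "(\<Sum>s\<in>S. y s * a s u) = y s0 * a s0 u + (\<Sum>s\<in>?S. y s * a s u)"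
        using insert.prems s0 by (simp add: sum.remove)
      also have "(\<Sum>s\<in>?S. y s * a s u) = (\<Sum>s\<in>?S. a s0 t * x s * a s u)"
        by (rule sum.cong) (auto simp: y_def)
      finally show ?thesis
        by (simp add: y_def[of s0] sum_distrib_left sum_distrib_right sum_subtractf right_diff_distrib mult_ac)
    qed
    have "y s1 \<noteq> 0" using s1 s0 by (auto simp: y_def)
    moreover have "(\<Sum>s\<in>S. y s * a s u) = 0" if "u \<in> insert t T" for u
      using that x[of u] sum[of u] by (cases "u = t") (simp_all add: algebra_simps)
    ultimately show ?thesis using s1 by blast
  qed
qed

lemma Z_independent_iff:
  "Z_independent G S \<longleftrightarrow> finite S \<and> S \<subseteq> carrier G \<and>
     (\<forall>c. zcomb G c S = \<one>\<^bsub>G\<^esub> \<longrightarrow> (\<forall>s\<in>S. c s = 0))"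
  by (simp add: Z_independent_def zcomb_def)

context comm_group begin

lemma pow_funcset: "S \<subseteq> carrier G \<Longrightarrow> (\<lambda>s. s [^] (c s :: int)) \<in> S \<rightarrow> carrier G"
  by auto

lemma zcomb_closed [simp]: "S \<subseteq> carrier G \<Longrightarrow> zcomb G c S \<in> carrier G"
  unfolding zcomb_def by (intro finprod_closed pow_funcset)

lemma zcomb_empty [simp]: "zcomb G c {} = \<one>"
  by (simp add: zcomb_def)

lemma zcomb_insert:
  "finite S \<Longrightarrow> insert a S \<subseteq> carrier G \<Longrightarrow> a \<notin> S \<Longrightarrow> zcomb G c (insert a S) = a [^] c a \<otimes> zcomb G c S"
  unfolding zcomb_def by (rule finprod_insert) auto

lemma zcomb_cong:
  "S \<subseteq> carrier G \<Longrightarrow> (\<And>s. s \<in> S \<Longrightarrow> c s = d s) \<Longrightarrow> zcomb G c S = zcomb G d S"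
  unfolding zcomb_def by (rule finprod_cong') auto

lemma zcomb_zero: "(\<And>s. s \<in> S \<Longrightarrow> c s = 0) \<Longrightarrow> zcomb G c S = \<one>"
  unfolding zcomb_def by (rule finprod_one_eqI) auto

lemma zcomb_Un:
  "finite S \<Longrightarrow> finite T \<Longrightarrow> S \<union> T \<subseteq> carrier G \<Longrightarrow> S \<inter> T = {} \<Longrightarrow>
    zcomb G c (S \<union> T) = zcomb G c S \<otimes> zcomb G c T"
  unfolding zcomb_def by (rule finprod_Un_disjoint) auto

lemma zcomb_add:
  "S \<subseteq> carrier G \<Longrightarrow> zcomb G (\<lambda>s. c s + d s) S = zcomb G c S \<otimes> zcomb G d S"
proof (induction S rule: infinite_finite_induct)
  case (insert a S)
  then show ?case by (simp add: zcomb_insert int_pow_mult m_ac)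
qed (simp_all add: zcomb_def)

lemma zcomb_pow:
  "S \<subseteq> carrier G \<Longrightarrow> zcomb G c S [^] (k::int) = zcomb G (\<lambda>s. k * c s) S"
proof (induction S rule: infinite_finite_induct)
  case (insert a S)
  then show ?case by (simp add: zcomb_insert int_pow_distrib int_pow_pow mult.commute)
qed (simp_all add: zcomb_def)

lemma zcomb_single: "finite S \<Longrightarrow> S \<subseteq> carrier G \<Longrightarrow> a \<in> S \<Longrightarrow> zcomb G (\<lambda>s. if s = a then 1 else 0) S = a"
proof -
  assume a: "finite S" "S \<subseteq> carrier G" "a \<in> S"
  then have "zcomb G (\<lambda>s. if s = a then 1 else 0) (insert a (S - {a})) = a \<otimes> \<one>"
    by (subst zcomb_insert) (use zcomb_zero[of "S - {a}" "\<lambda>s. if s = a then 1 else 0"] in \<open>auto simp: subset_iff\<close>)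
  with a show ?thesis by (simp add: insert_absorb subset_iff)
qed

lemma Z_independent_subset:
  assumes "Z_independent G S" "T \<subseteq> S"
  shows "Z_independent G T"
  unfolding Z_independent_iff
proof (intro conjI allI impI)
  have fin: "finite S" and SG: "S \<subseteq> carrier G" using assms by (auto simp: Z_independent_def)
  show "finite T" "T \<subseteq> carrier G" using fin SG assms(2) finite_subset by auto
  fix c assume c: "zcomb G c T = \<one>"
  let ?d = "\<lambda>s. if s \<in> T then c s else 0"
  have "zcomb G ?d (T \<union> (S - T)) = zcomb G ?d T \<otimes> zcomb G ?d (S - T)"
    using fin SG assms(2) by (intro zcomb_Un) (auto intro: finite_subset)
  also have "zcomb G ?d T = zcomb G c T" by (rule zcomb_cong) (use \<open>T \<subseteq> carrier G\<close> in auto)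
  also have "zcomb G ?d (S - T) = \<one>" by (rule zcomb_zero) auto
  finally have "zcomb G ?d S = \<one>" using c assms(2) by (simp add: Un_absorb1)
  then have "\<forall>s\<in>S. ?d s = 0" using assms(1) unfolding Z_independent_iff by blast
  then show "\<forall>s\<in>T. c s = 0" using assms(2) by (metis subsetD)
qed

lemma one_notin_Z_independent:
  assumes "Z_independent G S"
  shows "\<one> \<notin> S"
proof
  assume "\<one> \<in> S"
  then have "Z_independent G {\<one>}" using assms Z_independent_subset by simp
  moreover have "zcomb G (\<lambda>_. 1) {\<one>} = \<one>" by (simp add: zcomb_insert)
  ultimately show False unfolding Z_independent_iff by fastforce
qed

text \<open>Steinitz bound up to torsion: it is enough that nonzero multiples of the elements of
  \<open>S\<close> lie in the span of \<open>T\<close>. With more elements than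
  \<open>card T\<close>, the integer system of their exponents has a nontrivial solution, which is a
  relation in \<open>S\<close>.\<close>

lemma card_Z_independent_le:
  assumes S: "Z_independent G S" and T: "finite T" "T \<subseteq> carrier G"
    and span: "\<And>s. s \<in> S \<Longrightarrow> \<exists>N c. N \<noteq> (0::int) \<and> s [^] N = zcomb G c T"
  shows "card S \<le> card T"
proof (rule ccontr)
  assume less: "\<not> card S \<le> card T"
  have fin: "finite S" and SG: "S \<subseteq> carrier G" using S by (auto simp: Z_independent_def)
  obtain N c where N: "\<And>s. s \<in> S \<Longrightarrow> N s \<noteq> (0::int)" "\<And>s. s \<in> S \<Longrightarrow> s [^] N s = zcomb G (c s) T"
    using span by metis
  obtain x s1 where x: "s1 \<in> S" "x s1 \<noteq> 0" "\<And>t. t \<in> T \<Longrightarrow> (\<Sum>s\<in>S. x s * c s t) = 0"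
    using homogeneous_integer_system[OF T(1) fin, of c] less by auto
  have "zcomb G (\<lambda>s. N s * x s) R = zcomb G (\<lambda>t. \<Sum>s\<in>R. x s * c s t) T" if "R \<subseteq> S" for R
    using finite_subset[OF that fin] that
  proof (induction R rule: finite_induct)
    case empty
    then show ?case by (simp add: zcomb_zero)
  next
    case (insert r R)
    then have r: "r \<in> carrier G" "r \<in> S" using SG by auto
    have "r [^] (N r * x r) = zcomb G (\<lambda>t. x r * c r t) T"
      using int_pow_pow[OF r(1), of "N r" "x r"] N(2)[OF r(2)] zcomb_pow[OF T(2)] by metis
    with insert SG T show ?case by (subst zcomb_insert) (auto simp: zcomb_add)
  qed
  from this[of S] have "zcomb G (\<lambda>s. N s * x s) S = zcomb G (\<lambda>t. \<Sum>s\<in>S. x s * c s t) T" by simp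
  also have "\<dots> = \<one>" using x(3) by (rule zcomb_zero)
  finally have "\<forall>s\<in>S. N s * x s = 0" using S unfolding Z_independent_iff by blast
  with x N show False by force
qed

lemma set_rank_ge: "Z_independent G S \<Longrightarrow> S \<subseteq> K \<Longrightarrow> enat (card S) \<le> set_rank G K"
  unfolding set_rank_def by (rule SUP_upper) simp

lemma set_rank_le: "(\<And>S. Z_independent G S \<Longrightarrow> S \<subseteq> K \<Longrightarrow> enat (card S) \<le> m) \<Longrightarrow> set_rank G K \<le> m"
  unfolding set_rank_def by (rule SUP_least) simp

lemma Z_independent_empty [simp]: "Z_independent G {}"
  by (simp add: Z_independent_iff)

text \<open>The supremum is attained at every finite level: were all independent sets smaller than
  \<open>m\<close>, it would be at most \<open>m - 1\<close>, and a larger set can be cut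
  down.\<close>

lemma set_rank_ge_iff:
  "enat m \<le> set_rank G K \<longleftrightarrow> (\<exists>S. Z_independent G S \<and> S \<subseteq> K \<and> card S = m)"
proof
  assume m: "enat m \<le> set_rank G K"
  have "\<exists>S. Z_independent G S \<and> S \<subseteq> K \<and> m \<le> card S"
  proof (rule ccontr)
    assume "\<not> ?thesis"
    then have less: "Z_independent G S \<Longrightarrow> S \<subseteq> K \<Longrightarrow> card S < m" for S by (meson not_le)
    from less[of "{}"] have m0: "0 < m" by simp
    then have "Z_independent G S \<Longrightarrow> S \<subseteq> K \<Longrightarrow> enat (card S) \<le> enat (m - 1)" for S
      using less[of S] by simp
    from set_rank_le[OF this] m have "enat m \<le> enat (m - 1)" using order_trans by blast
    with m0 show False by simp
  qed
  then obtain S where S: "Z_independent G S" "S \<subseteq> K" "m \<le> card S" by blast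
  then obtain T where "T \<subseteq> S" "card T = m" using obtain_subset_with_card_n by metis
  with S show "\<exists>S. Z_independent G S \<and> S \<subseteq> K \<and> card S = m"
    using Z_independent_subset by blast
next
  assume "\<exists>S. Z_independent G S \<and> S \<subseteq> K \<and> card S = m"
  then show "enat m \<le> set_rank G K" using set_rank_ge by blast
qed

text \<open>A maximal independent set: adjoining any \<open>g\<close> creates a relation, in which
  the exponent of \<open>g\<close> is nonzero because the set itself is independent. Over the
  integers this expresses only a nonzero multiple of \<open>g\<close>.\<close>

lemma set_rank_basis:
  assumes rank: "set_rank G K = enat m" and K: "K \<subseteq> carrier G"
  obtains B where "Z_independent G B" "B \<subseteq> K" "card B = m"
    "\<forall>g\<in>K. \<exists>N c. N \<noteq> (0::int) \<and> g [^] N = zcomb G c B"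
proof -
  obtain B where B: "Z_independent G B" "B \<subseteq> K" "card B = m"
    using rank set_rank_ge_iff by (metis order_refl)
  have fin: "finite B" and BG: "B \<subseteq> carrier G" using B by (auto simp: Z_independent_def)
  have "\<exists>N c. N \<noteq> (0::int) \<and> g [^] N = zcomb G c B" if g: "g \<in> K" for g
  proof (cases "g \<in> B")
    case True
    with fin BG show ?thesis by (metis zcomb_single int_pow_1 subsetD zero_neq_one)
  next
    case False
    have gG: "g \<in> carrier G" using g K by blast
    have "\<not> Z_independent G (insert g B)"
    proof
      assume "Z_independent G (insert g B)"
      from set_rank_ge[OF this, of K] rank B g False fin show False by simp
    qed
    then obtain c where c: "zcomb G c (insert g B) = \<one>" "\<exists>s\<in>insert g B. c s \<noteq> 0"
      using fin BG gG unfolding Z_independent_iff by auto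
    have eq: "g [^] c g \<otimes> zcomb G c B = \<one>" using c(1) fin BG gG False by (simp add: zcomb_insert)
    have "c g \<noteq> 0"
    proof
      assume 0: "c g = 0"
      with eq BG have "zcomb G c B = \<one>" by simp
      with B(1) have "\<forall>s\<in>B. c s = 0" unfolding Z_independent_iff by blast
      with c(2) 0 show False by blast
    qed
    moreover have "g [^] c g = zcomb G c B [^] (-1::int)"
      using eq BG gG by (simp add: int_pow_neg inv_equality)
    then have "g [^] c g = zcomb G (\<lambda>s. -1 * c s) B"
      using zcomb_pow[OF BG, of c "-1"] by simp
    ultimately show ?thesis by blast
  qed
  then have "\<forall>g\<in>K. \<exists>N c. N \<noteq> (0::int) \<and> g [^] N = zcomb G c B" by (rule ballI)
  with B show ?thesis by (rule that)
qed

end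

text \<open>Tests the inequality on finite lower bounds, which also covers infinite summands:
  against \<open>c = enat k\<close> the lower bound \<open>Suc k\<close> is already a
  contradiction.\<close>

lemma enat_add_le_iff:
  fixes a b c :: enat
  assumes "\<And>m n. enat m \<le> a \<Longrightarrow> enat n \<le> b \<Longrightarrow> enat (m + n) \<le> c"
  shows "a + b \<le> c"
proof (cases c)
  case (enat k)
  have "a \<noteq> \<infinity>"
  proof
    assume "a = \<infinity>"
    then show False using assms[of "Suc k" 0] enat by (simp flip: zero_enat_def)
  qed
  moreover have "b \<noteq> \<infinity>"
  proof
    assume "b = \<infinity>"
    then show False using assms[of 0 "Suc k"] enat by (simp flip: zero_enat_def)
  qed
  ultimately obtain m n where "a = enat m" "b = enat n" by auto
  then show ?thesis using assms[of m n] by simp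
qed simp

section \<open>Rank-nullity for homomorphisms of abelian groups\<close>

lemma hom_zcomb:
  assumes "comm_group G" "comm_group H" "f \<in> hom G H" "inj_on f S" "S \<subseteq> carrier G" "finite S"
  shows "f (zcomb G (\<lambda>s. c (f s)) S) = zcomb H c (f ` S)"
proof -
  interpret G: comm_group G by fact
  interpret H: comm_group H by fact
  interpret gh: group_hom G H f
    using assms by (simp add: group_hom_def group_hom_axioms_def G.is_group H.is_group)
  show ?thesis
    using assms(6,4,5)
  proof (induction S rule: finite_induct)
    case (insert a S)
    then have "zcomb H c (f ` insert a S) = f a [^]\<^bsub>H\<^esub> c (f a) \<otimes>\<^bsub>H\<^esub> zcomb H c (f ` S)"
      by (simp only: image_insert, intro H.zcomb_insert) auto
    with insert show ?case by (simp add: G.zcomb_insert gh.hom_int_pow)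
  qed (simp add: gh.hom_one)
qed

text \<open>A basis of the kernel together with lifts of a basis of the image spans the group up to
  multiples and is independent. The two inequalities are proved separately because either side may
  be infinite.\<close>

lemma rank_kernel_image:
  assumes G: "comm_group G" and H: "comm_group H" and f: "f \<in> hom G H"
  shows "set_rank G (carrier G) = set_rank G (kernel G H f) + set_rank H (f ` carrier G)"
proof -
  interpret G: comm_group G by fact
  interpret H: comm_group H by fact
  interpret gh: group_hom G H f
    using assms by (simp add: group_hom_def group_hom_axioms_def G.is_group H.is_group)
  have fG: "f ` carrier G \<subseteq> carrier H" using gh.hom_closed by blast
  have kG: "kernel G H f \<subseteq> carrier G" by (auto simp: kernel_def)
  have lift: "\<exists>C. inj_on f C \<and> C \<subseteq> carrier G \<and> f ` C = T \<and> finite C \<and> card C = card T"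
    if "Z_independent H T" "T \<subseteq> f ` carrier G" for T
  proof -
    obtain C where C: "C \<subseteq> carrier G" "inj_on f C" "f ` C = T"
      using \<open>T \<subseteq> f ` carrier G\<close> unfolding subset_image_inj by blast
    have "finite T" using \<open>Z_independent H T\<close> by (simp add: Z_independent_def)
    then have "finite C" using C finite_imageD by blast
    moreover have "card C = card T" using C card_image[of f C] by simp
    ultimately show ?thesis using C by (intro exI[of _ C]) simp
  qed
  show ?thesis
  proof (rule antisym)
    show "set_rank G (carrier G) \<le> set_rank G (kernel G H f) + set_rank H (f ` carrier G)"
    proof (cases "set_rank G (kernel G H f)"; cases "set_rank H (f ` carrier G)")
      fix m n assume m: "set_rank G (kernel G H f) = enat m" and n: "set_rank H (f ` carrier G) = enat n"
      obtain B where B: "Z_independent G B" "B \<subseteq> kernel G H f" "card B = m"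
        "\<forall>g\<in>kernel G H f. \<exists>N c. N \<noteq> (0::int) \<and> g [^]\<^bsub>G\<^esub> N = zcomb G c B"
        by (rule G.set_rank_basis[OF m kG])
      obtain T where T: "Z_independent H T" "T \<subseteq> f ` carrier G" "card T = n"
        "\<forall>g\<in>f ` carrier G. \<exists>N c. N \<noteq> (0::int) \<and> g [^]\<^bsub>H\<^esub> N = zcomb H c T"
        by (rule H.set_rank_basis[OF n fG])
      obtain C where C: "inj_on f C" "C \<subseteq> carrier G" "f ` C = T" "finite C" "card C = card T"
        using lift[OF T(1,2)] by (elim exE conjE) (rule that)
      have Bfin: "finite B" "B \<subseteq> carrier G" using B(1) by (auto simp: Z_independent_def)
      have disj: "B \<inter> C = {}"
      proof -
        have "f x = \<one>\<^bsub>H\<^esub>" if "x \<in> B" for x using that B(2) by (auto simp: kernel_def)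
        moreover have "f x \<noteq> \<one>\<^bsub>H\<^esub>" if "x \<in> C" for x
          using that C(3) H.one_notin_Z_independent[OF T(1)] by (metis image_eqI)
        ultimately show ?thesis by blast
      qed
      have "card S \<le> card (B \<union> C)" if S: "Z_independent G S" for S
      proof (rule G.card_Z_independent_le[OF S])
        show "finite (B \<union> C)" "B \<union> C \<subseteq> carrier G" using Bfin C by auto
        fix s assume "s \<in> S"
        then have sG: "s \<in> carrier G" using S by (auto simp: Z_independent_def)
        then obtain N c where N: "N \<noteq> (0::int)" "f s [^]\<^bsub>H\<^esub> N = zcomb H c T" using T(4) by blast
        let ?z = "zcomb G (\<lambda>x. c (f x)) C"
        have fz: "f ?z = zcomb H c T" using hom_zcomb[OF G H f C(1,2,4)] C(3) by simp
        have zG: "?z \<in> carrier G" using C by simp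
        \<comment> \<open>The power of \<open>s\<close> and the lift \<open>?z\<close> of its image
          differ by an element of the kernel, a multiple of which is spanned by
          \<open>B\<close>.\<close>
        let ?k = "s [^]\<^bsub>G\<^esub> N \<otimes>\<^bsub>G\<^esub> inv\<^bsub>G\<^esub> ?z"
        have zH: "zcomb H c T \<in> carrier H" using T(1) by (simp add: Z_independent_def)
        have "?k \<in> kernel G H f"
          using sG zG zH fz N by (simp add: kernel_def gh.hom_int_pow gh.hom_inv)
        then obtain M d where M: "M \<noteq> (0::int)" "?k [^]\<^bsub>G\<^esub> M = zcomb G d B" using B(4) by blast
        have "s [^]\<^bsub>G\<^esub> N = ?k \<otimes>\<^bsub>G\<^esub> ?z"
          using sG zG by (simp add: G.m_assoc)
        then have "s [^]\<^bsub>G\<^esub> (N * M) = (?k \<otimes>\<^bsub>G\<^esub> ?z) [^]\<^bsub>G\<^esub> M"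
          using sG by (simp flip: G.int_pow_pow)
        also have "\<dots> = zcomb G d B \<otimes>\<^bsub>G\<^esub> ?z [^]\<^bsub>G\<^esub> M"
          using sG zG M by (simp add: G.int_pow_distrib del: G.r_one)
        also have "?z [^]\<^bsub>G\<^esub> M = zcomb G (\<lambda>x. M * c (f x)) C" using C by (simp add: G.zcomb_pow)
        finally have "s [^]\<^bsub>G\<^esub> (N * M) = zcomb G d B \<otimes>\<^bsub>G\<^esub> zcomb G (\<lambda>x. M * c (f x)) C" .
        moreover
        let ?e = "\<lambda>x. if x \<in> B then d x else M * c (f x)"
        have "zcomb G ?e (B \<union> C) = zcomb G ?e B \<otimes>\<^bsub>G\<^esub> zcomb G ?e C"
          using Bfin C disj by (intro G.zcomb_Un) auto
        moreover have "zcomb G ?e B = zcomb G d B" by (rule G.zcomb_cong) (use Bfin in auto)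
        moreover have "zcomb G ?e C = zcomb G (\<lambda>x. M * c (f x)) C"
          by (rule G.zcomb_cong) (use C disj in auto)
        ultimately have "s [^]\<^bsub>G\<^esub> (N * M) = zcomb G ?e (B \<union> C)" by simp
        with N M show "\<exists>N c. N \<noteq> (0::int) \<and> s [^]\<^bsub>G\<^esub> N = zcomb G c (B \<union> C)"
          by (intro exI[of _ "N * M"] exI[of _ ?e]) simp
      qed
      moreover have "card (B \<union> C) = m + n"
        using Bfin C disj B T by (simp add: card_Un_disjoint)
      ultimately have "set_rank G (carrier G) \<le> enat (m + n)" by (intro G.set_rank_le) auto
      then show ?thesis using m n by simp
    qed auto
    show "set_rank G (kernel G H f) + set_rank H (f ` carrier G) \<le> set_rank G (carrier G)"
    proof (rule enat_add_le_iff)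
      fix m n assume "enat m \<le> set_rank G (kernel G H f)" "enat n \<le> set_rank H (f ` carrier G)"
      then obtain B T where B: "Z_independent G B" "B \<subseteq> kernel G H f" "card B = m"
        and T: "Z_independent H T" "T \<subseteq> f ` carrier G" "card T = n"
        using G.set_rank_ge_iff H.set_rank_ge_iff by metis
      obtain C where C: "inj_on f C" "C \<subseteq> carrier G" "f ` C = T" "finite C" "card C = card T"
        using lift[OF T(1,2)] by (elim exE conjE) (rule that)
      have Bfin: "finite B" "B \<subseteq> carrier G" using B(1) by (auto simp: Z_independent_def)
      have disj: "B \<inter> C = {}"
      proof -
        have "f x = \<one>\<^bsub>H\<^esub>" if "x \<in> B" for x using that B(2) by (auto simp: kernel_def)
        moreover have "f x \<noteq> \<one>\<^bsub>H\<^esub>" if "x \<in> C" for x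
          using that C(3) H.one_notin_Z_independent[OF T(1)] by (metis image_eqI)
        ultimately show ?thesis by blast
      qed
      have fB: "f (zcomb G c B) = \<one>\<^bsub>H\<^esub>" for c
        using Bfin(1,2) B(2)
      proof (induction B rule: finite_induct)
        case (insert b B)
        then show ?case by (simp add: G.zcomb_insert gh.hom_int_pow kernel_def)
      qed (simp add: gh.hom_one)
      have "Z_independent G (B \<union> C)"
        unfolding Z_independent_iff
      proof (intro conjI allI impI)
        show "finite (B \<union> C)" "B \<union> C \<subseteq> carrier G" using Bfin C by auto
        fix c assume "zcomb G c (B \<union> C) = \<one>\<^bsub>G\<^esub>"
        moreover have "zcomb G c (B \<union> C) = zcomb G c B \<otimes>\<^bsub>G\<^esub> zcomb G c C"
          using Bfin C disj by (intro G.zcomb_Un) auto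
        ultimately have eq: "zcomb G c B \<otimes>\<^bsub>G\<^esub> zcomb G c C = \<one>\<^bsub>G\<^esub>" by simp
        \<comment> \<open>The exponents on \<open>C\<close> are carried to \<open>T\<close> along
          the injective \<open>f\<close>; applying \<open>f\<close> to the relation kills the part
          that comes from \<open>B\<close>.\<close>
        define c' where "c' = (\<lambda>t. c (inv_into C f t))"
        have c': "c' (f x) = c x" if "x \<in> C" for x using that C(1) by (simp add: c'_def)
        have zz: "zcomb G c C = zcomb G (\<lambda>x. c' (f x)) C"
          by (rule G.zcomb_cong) (use C c' in auto)
        have "f (zcomb G c B) \<otimes>\<^bsub>H\<^esub> f (zcomb G c C) = \<one>\<^bsub>H\<^esub>"
          using eq Bfin C by (metis G.zcomb_closed gh.hom_mult gh.hom_one)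
        moreover have "zcomb H c' T \<in> carrier H" using T(1) by (simp add: Z_independent_def)
        moreover have "f (zcomb G c C) = zcomb H c' T"
          using C hom_zcomb[OF G H f C(1,2,4), of c'] zz by simp
        ultimately have "zcomb H c' T = \<one>\<^bsub>H\<^esub>" using fB by simp
        then have "\<forall>t\<in>T. c' t = 0" using T(1) unfolding Z_independent_iff by blast
        then have cC: "\<forall>x\<in>C. c x = 0" using C(3) c' by auto
        then have "zcomb G c C = \<one>\<^bsub>G\<^esub>" by (intro G.zcomb_zero) auto
        with eq Bfin have "zcomb G c B = \<one>\<^bsub>G\<^esub>" by simp
        then have "\<forall>x\<in>B. c x = 0" using B(1) unfolding Z_independent_iff by blast
        with cC show "\<forall>s\<in>B \<union> C. c s = 0" by blast
      qed
      moreover have "card (B \<union> C) = m + n" "B \<union> C \<subseteq> carrier G"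
        using Bfin C disj B T by (auto simp: card_Un_disjoint)
      ultimately show "enat (m + n) \<le> set_rank G (carrier G)" using G.set_rank_ge by metis
    qed
  qed
qed

lemma set_rank_trivial:
  assumes "comm_group G" "K \<subseteq> {\<one>\<^bsub>G\<^esub>}"
  shows "set_rank G K = 0"
proof -
  interpret comm_group G by fact
  have "S = {}" if "Z_independent G S" "S \<subseteq> K" for S
    using that assms(2) one_notin_Z_independent by fastforce
  then have "enat (card S) \<le> 0" if "Z_independent G S" "S \<subseteq> K" for S
    using that card.empty by (metis order_refl zero_enat_def)
  then have "set_rank G K \<le> 0" by (rule set_rank_le)
  then show ?thesis by simp
qed

lemma set_rank_iso:
  assumes "comm_group G" "comm_group H" "G \<cong> H"
  shows "set_rank G (carrier G) = set_rank H (carrier H)"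
proof -
  obtain f where f: "f \<in> iso G H" using assms(3) by (auto simp: is_iso_def)
  then have hom: "f \<in> hom G H" and bij: "bij_betw f (carrier G) (carrier H)"
    by (auto simp: iso_def)
  interpret gh: group_hom G H f
    using assms hom by (simp add: group_hom_def group_hom_axioms_def comm_group_def)
  have "kernel G H f = {\<one>\<^bsub>G\<^esub>}"
    using bij gh.inj_iff_trivial_ker by (simp add: bij_betw_def)
  moreover have "f ` carrier G = carrier H" using bij by (simp add: bij_betw_def)
  ultimately show ?thesis
    using rank_kernel_image[OF assms(1,2) hom] set_rank_trivial[OF assms(1)] by simp
qed

lemma set_rank_integer_group: "set_rank integer_group UNIV = 1"
proof -
  interpret comm_group integer_group by (rule abelian_integer_group)
  have "set_rank integer_group UNIV \<le> enat 1"
  proof (rule set_rank_le)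
    fix S assume S: "Z_independent integer_group S"
    have "card S \<le> card {1::int}"
    proof (rule card_Z_independent_le[OF S])
      fix s assume "s \<in> S"
      have "s [^]\<^bsub>integer_group\<^esub> (1::int) = zcomb integer_group (\<lambda>_. s) {1}"
        by (simp add: zcomb_insert)
      then show "\<exists>N c. N \<noteq> (0::int) \<and> s [^]\<^bsub>integer_group\<^esub> N = zcomb integer_group c {1}"
        by (intro exI[of _ 1] exI[of _ "\<lambda>_. s"]) simp
    qed auto
    then show "enat (card S) \<le> enat 1" by simp
  qed
  moreover have "Z_independent integer_group {1}"
    unfolding Z_independent_iff by (auto simp: zcomb_insert)
  from set_rank_ge[OF this] have "enat 1 \<le> set_rank integer_group UNIV" by simp
  ultimately show ?thesis by (simp add: one_enat_def antisym)
qed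

lemma Z_rank_eq:
  assumes "comm_group G" "set_rank G (carrier G) \<noteq> \<infinity>"
  shows "Z_rank G = the_enat (set_rank G (carrier G))"
proof -
  interpret comm_group G by fact
  obtain m where m: "set_rank G (carrier G) = enat m" using assms(2) by auto
  have "Max {card S | S. Z_independent G S} = m"
  proof (rule Max_eqI)
    have le: "card S \<le> m" if "Z_independent G S" for S
      using set_rank_ge[OF that, of "carrier G"] that m by (simp add: Z_independent_def)
    then show "finite {card S | S. Z_independent G S}" by (auto intro!: finite_subset[of _ "{..m}"])
    show "m \<in> {card S | S. Z_independent G S}" using set_rank_ge_iff[of m "carrier G"] m by auto
    show "\<And>y. y \<in> {card S | S. Z_independent G S} \<Longrightarrow> y \<le> m" using le by blast
  qed
  then show ?thesis by (simp add: Z_rank_def m)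
qed

section \<open>Euler characteristics of pairs and Mayer--Vietoris\<close>

definition finite_betti :: "(nat \<Rightarrow> enat) \<Rightarrow> bool" where
  "finite_betti b \<longleftrightarrow> (\<forall>p. b p \<noteq> \<infinity>) \<and> (\<exists>N. \<forall>p\<ge>N. b p = 0)"

definition alternating_sum :: "(nat \<Rightarrow> enat) \<Rightarrow> int" where
  "alternating_sum b = (\<Sum>p | b p \<noteq> 0. (-1) ^ p * int (the_enat (b p)))"

lemma alternating_sum_eq:
  assumes "\<And>p. p \<ge> N \<Longrightarrow> b p = 0"
  shows "alternating_sum b = (\<Sum>p<N. (-1) ^ p * int (the_enat (b p)))"
  unfolding alternating_sum_def
  by (rule sum.mono_neutral_left) (use assms in \<open>auto simp: zero_enat_def not_less[symmetric]\<close>)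

text \<open>The ranks in a long exact sequence \<open>a \<rightarrow> b \<rightarrow> c \<rightarrow> a\<close> are sums of ranks
  of consecutive images; the degree of the connecting map shifts \<open>d\<close>.\<close>

definition exact_ranks :: "(nat \<Rightarrow> enat) \<Rightarrow> (nat \<Rightarrow> enat) \<Rightarrow> (nat \<Rightarrow> enat) \<Rightarrow> bool" where
  "exact_ranks a b c \<longleftrightarrow> (\<exists>d e f. d 0 = 0 \<and>
     (\<forall>p. a p = d (Suc p) + e p \<and> b p = e p + f p \<and> c p = f p + d p))"

lemma finite_betti_bound:
  assumes "finite_betti a" "finite_betti b"
  shows "\<exists>N. \<forall>p\<ge>N. a p = 0 \<and> b p = 0"
proof -
  obtain M N where "\<forall>p\<ge>M. a p = 0" "\<forall>p\<ge>N. b p = 0"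
    using assms unfolding finite_betti_def by blast
  then show ?thesis by (intro exI[of _ "max M N"]) simp
qed

text \<open>Each of the image ranks \<open>d\<close>, \<open>e\<close>, \<open>f\<close> occurs in
  two of the three sequences, so two finite sequences control all of them and hence the
  third.\<close>

lemma exact_ranks_finite:
  assumes "exact_ranks a b c"
    and "finite_betti a \<and> finite_betti b \<or> finite_betti b \<and> finite_betti c \<or> finite_betti a \<and> finite_betti c"
  shows "finite_betti a \<and> finite_betti b \<and> finite_betti c"
proof -
  obtain d e f where d: "d 0 = 0" and a: "\<And>p. a p = d (Suc p) + e p" and b: "\<And>p. b p = e p + f p"
    and c: "\<And>p. c p = f p + d p"
    using assms(1) unfolding exact_ranks_def by blast
  \<comment> \<open>The sequence \<open>a\<close> sees only the shifted ranks
    \<open>d (Suc p)\<close>; the missing value is \<open>d 0 = 0\<close>.\<close>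
  have D: "d p \<noteq> \<infinity> \<and> (\<exists>N. \<forall>q\<ge>N. d q = 0)"
    if fin_d: "\<And>p. d (Suc p) \<noteq> \<infinity>" and zero_d: "\<exists>N. \<forall>q\<ge>N. d (Suc q) = 0" for p
  proof
    show "d p \<noteq> \<infinity>" using d fin_d by (cases p) auto
    obtain N where N: "\<forall>q\<ge>N. d (Suc q) = 0" using zero_d by blast
    have "d q = 0" if "q \<ge> Suc N" for q using that N by (cases q) auto
    then show "\<exists>N. \<forall>q\<ge>N. d q = 0" by blast
  qed
  consider "finite_betti a" "finite_betti b" | "finite_betti b" "finite_betti c" | "finite_betti a" "finite_betti c"
    using assms(2) by blast
  then show ?thesis
  proof cases
    case 1
    then obtain N where N: "\<And>p. p \<ge> N \<Longrightarrow> a p = 0 \<and> b p = 0"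
      using finite_betti_bound[of a b] by blast
    have "\<And>p. d p \<noteq> \<infinity> \<and> (\<exists>N. \<forall>q\<ge>N. d q = 0)"
      by (rule D) (use 1 N a in \<open>auto simp: finite_betti_def plus_eq_infty_iff_enat\<close>)
    then obtain M where M: "\<And>p. d p \<noteq> \<infinity>" "\<And>q. q \<ge> M \<Longrightarrow> d q = 0" by metis
    have "c p \<noteq> \<infinity>" for p
      using 1(2) M(1)[of p] b[of p] c[of p]
      unfolding finite_betti_def by (metis plus_eq_infty_iff_enat)
    moreover have "c p = 0" if "p \<ge> max N M" for p using that N[of p] M b[of p] c[of p] by auto
    ultimately show ?thesis using 1 unfolding finite_betti_def by blast
  next
    case 2
    then obtain N where N: "\<And>p. p \<ge> N \<Longrightarrow> b p = 0 \<and> c p = 0"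
      using finite_betti_bound[of b c] by blast
    have "a p \<noteq> \<infinity>" for p
      using 2 b[of p] c[of "Suc p"] a[of p]
      unfolding finite_betti_def by (metis plus_eq_infty_iff_enat)
    moreover have "a p = 0" if "p \<ge> N" for p
      using that N[of p] N[of "Suc p"] a[of p] b[of p] c[of "Suc p"] by auto
    ultimately show ?thesis using 2 unfolding finite_betti_def by blast
  next
    case 3
    then obtain N where N: "\<And>p. p \<ge> N \<Longrightarrow> a p = 0 \<and> c p = 0"
      using finite_betti_bound[of a c] by blast
    have "b p \<noteq> \<infinity>" for p
      using 3 b[of p] c[of p] a[of p]
      unfolding finite_betti_def by (metis plus_eq_infty_iff_enat)
    moreover have "b p = 0" if "p \<ge> N" for p
      using that N[of p] a[of p] b[of p] c[of p] by auto
    ultimately show ?thesis using 3 unfolding finite_betti_def by blast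
  qed
qed

text \<open>In the alternating sum of \<open>a\<close>, \<open>b\<close> and \<open>c\<close> the
  ranks \<open>e\<close> and \<open>f\<close> cancel, while \<open>d\<close> enters in two
  consecutive degrees with opposite signs and telescopes.\<close>

lemma exact_ranks_alternating_sum:
  assumes "exact_ranks a b c" "finite_betti a" "finite_betti b"
  shows "alternating_sum b = alternating_sum a + alternating_sum c"
proof -
  obtain d e f where d: "d 0 = 0" and a: "\<And>p. a p = d (Suc p) + e p" and b: "\<And>p. b p = e p + f p"
    and c: "\<And>p. c p = f p + d p"
    using assms(1) unfolding exact_ranks_def by blast
  have fc: "finite_betti c" using assms exact_ranks_finite by blast
  obtain Na Nb Nc where Nabc: "\<And>p. p \<ge> Na \<Longrightarrow> a p = 0" "\<And>p. p \<ge> Nb \<Longrightarrow> b p = 0" "\<And>p. p \<ge> Nc \<Longrightarrow> c p = 0"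
    using assms fc unfolding finite_betti_def by metis
  define N where "N = Na + Nb + Nc"
  have N: "a p = 0" "b p = 0" "c p = 0" if "p \<ge> N" for p
    using that Nabc by (auto simp: N_def)
  have fin: "d p \<noteq> \<infinity>" "e p \<noteq> \<infinity>" "f p \<noteq> \<infinity>" for p
    using assms(2,3) fc a[of p] b[of p] c[of p] unfolding finite_betti_def
    by (metis plus_eq_infty_iff_enat)+
  define D E F where "D = (\<lambda>p. int (the_enat (d p)))" and "E = (\<lambda>p. int (the_enat (e p)))"
    and "F = (\<lambda>p. int (the_enat (f p)))"
  have the_add: "int (the_enat (x + y)) = int (the_enat x) + int (the_enat y)" if "x \<noteq> \<infinity>" "y \<noteq> \<infinity>" for x y
    using that by auto
  have A: "int (the_enat (a p)) = D (Suc p) + E p" "int (the_enat (b p)) = E p + F p"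
      "int (the_enat (c p)) = F p + D p" for p
    using fin by (simp_all add: a b c D_def E_def F_def the_add)
  \<comment> \<open>Both boundary terms vanish: \<open>D 0\<close> by hypothesis, and
    \<open>D N\<close> because \<open>N\<close> lies beyond the range of all three
    sequences.\<close>
  have tele: "(\<Sum>p<M. (-1) ^ p * (D (Suc p) + D p)) = D 0 - (-1) ^ M * D M" for M
    by (induction M) (simp_all add: algebra_simps)
  have "d N = 0" using c[of N] N[of N] by auto
  then have "D N = 0" by (simp add: D_def zero_enat_def)
  moreover have "D 0 = 0" by (simp add: D_def d zero_enat_def)
  ultimately have "(\<Sum>p<N. (-1) ^ p * (D (Suc p) + D p)) = 0" using tele[of N] by simp
  moreover have "alternating_sum a + alternating_sum c - alternating_sum b
      = (\<Sum>p<N. (-1) ^ p * (D (Suc p) + D p))"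
  proof -
    have "alternating_sum a + alternating_sum c - alternating_sum b
        = (\<Sum>p<N. (-1) ^ p * (D (Suc p) + E p) + (-1) ^ p * (F p + D p) - (-1) ^ p * (E p + F p))"
      by (simp add: alternating_sum_eq[of N] N A sum.distrib sum_subtractf)
    also have "\<dots> = (\<Sum>p<N. (-1) ^ p * (D (Suc p) + D p))"
      by (rule sum.cong) (simp_all add: algebra_simps)
    finally show ?thesis .
  qed
  ultimately show ?thesis by simp
qed

section \<open>The long exact sequence of a pair, and excision\<close>

definition betti_rank :: "'a topology \<Rightarrow> nat \<Rightarrow> enat" where
  "betti_rank X p = set_rank (homology_group (int p) X) (carrier (homology_group (int p) X))"

definition relative_betti_rank :: "'a topology \<Rightarrow> 'a set \<Rightarrow> nat \<Rightarrow> enat" where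
  "relative_betti_rank X S p =
     set_rank (relative_homology_group (int p) X S) (carrier (relative_homology_group (int p) X S))"

text \<open>Rank-nullity for the three maps of the long exact sequence, where each kernel is the
  preceding image. The number \<open>d p\<close> is the rank of the boundary map out of degree
  \<open>p\<close>, whose target is trivial for p = 0.\<close>

lemma exact_ranks_pair:
  "exact_ranks (betti_rank (subtopology X S)) (betti_rank X) (relative_betti_rank X S)"
proof -
  define A where "A p = homology_group p (subtopology X S)" for p
  define B where "B p = homology_group p X" for p
  define C where "C p = relative_homology_group p X S" for p
  define i where "i p = hom_induced p (subtopology X S) {} X {} id" for p
  define j where "j p = hom_induced p X {} X S id" for p
  define bd where "bd p = hom_boundary p X S" for p
  have cg: "comm_group (A p)" "comm_group (B p)" "comm_group (C p)" for p
    by (simp_all add: A_def B_def C_def abelian_homology_group)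
  have "exact_seq ([C p, B p, A p], [j p, i p])" "exact_seq ([A (p - 1), C p, B p], [bd p, j p])"
    "exact_seq ([B (p - 1), A (p - 1), C p], [i (p - 1), bd p])" for p
    unfolding A_def B_def C_def i_def j_def bd_def
    by (rule homology_exactness_axiom_1 homology_exactness_axiom_2 homology_exactness_axiom_3)+
  then have hom: "i p \<in> hom (A p) (B p)" "j p \<in> hom (B p) (C p)" "bd p \<in> hom (C p) (A (p - 1))"
    and ker: "kernel (B p) (C p) (j p) = i p ` carrier (A p)"
      "kernel (C p) (A (p - 1)) (bd p) = j p ` carrier (B p)"
      "kernel (A (p - 1)) (B (p - 1)) (i (p - 1)) = bd p ` carrier (C p)" for p
    by (simp_all add: group_hom_def group_hom_axioms_def)
  define d where "d p = set_rank (A (int p - 1)) (bd (int p) ` carrier (C (int p)))" for p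
  define e where "e p = set_rank (B (int p)) (i (int p) ` carrier (A (int p)))" for p
  define f where "f p = set_rank (C (int p)) (j (int p) ` carrier (B (int p)))" for p
  have "betti_rank (subtopology X S) p = d (Suc p) + e p" for p
    using rank_kernel_image[OF cg(1) cg(2) hom(1)] ker(3)[of "int (Suc p)"]
    by (simp add: betti_rank_def d_def e_def A_def)
  moreover have "betti_rank X p = e p + f p" for p
    using rank_kernel_image[OF cg(2) cg(3) hom(2)] ker(1)
    by (simp add: betti_rank_def e_def f_def B_def)
  moreover have "relative_betti_rank X S p = f p + d p" for p
    using rank_kernel_image[OF cg(3) cg(1) hom(3)] ker(2)
    by (simp add: relative_betti_rank_def f_def d_def C_def)
  moreover have "d 0 = 0"
  proof -
    have "trivial_group (A (- 1))" by (simp add: A_def trivial_homology_group)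
    then have "bd 0 ` carrier (C 0) \<subseteq> {\<one>\<^bsub>A (- 1)\<^esub>}"
      using hom(3)[of 0] by (auto simp: hom_def trivial_group_def Pi_iff)
    then show ?thesis unfolding d_def using set_rank_trivial[OF cg(1)[of "- 1"]] by simp
  qed
  ultimately show ?thesis unfolding exact_ranks_def by blast
qed

definition finite_homology :: "'a topology \<Rightarrow> bool" where
  "finite_homology X \<longleftrightarrow> finite_betti (betti_rank X)"

lemma euler_characteristic_eq:
  assumes "finite_homology X"
  shows "euler_characteristic X = alternating_sum (betti_rank X)"
proof -
  have fin: "betti_rank X p \<noteq> \<infinity>" for p
    using assms by (simp add: finite_homology_def finite_betti_def)
  have "betti_number p X = the_enat (betti_rank X p)" for p
    unfolding betti_number_def betti_rank_def
    by (rule Z_rank_eq[OF abelian_homology_group]) (use fin in \<open>simp add: betti_rank_def\<close>)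
  moreover have "the_enat (betti_rank X p) \<noteq> 0 \<longleftrightarrow> betti_rank X p \<noteq> 0" for p
    using fin[of p] by (auto simp: zero_enat_def)
  ultimately show ?thesis
    unfolding euler_characteristic_def alternating_sum_def by simp
qed

text \<open>Excision of the complement of \<open>B\<close>, which is closed and lies in the open set
  \<open>A\<close>.\<close>

lemma Mayer_Vietoris_ranks:
  assumes "openin X A" "openin X B" "topspace X = A \<union> B"
  shows "relative_betti_rank (subtopology X B) (A \<inter> B) = relative_betti_rank X A"
proof
  fix p
  let ?U = "topspace X - B"
  have U: "X closure_of ?U \<subseteq> X interior_of A"
  proof -
    have "closedin X ?U" using assms by blast
    moreover have "X interior_of A = A" using assms interior_of_openin by blast
    ultimately show ?thesis using assms(3) by (auto simp: closure_of_closedin)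
  qed
  have eq: "topspace X - ?U = B" "A - ?U = A \<inter> B" "subtopology X (topspace X) = X"
    using assms(3) subtopology_topspace[of X] by auto
  have "A \<subseteq> topspace X" using assms openin_subset by auto
  from homology_excision_axiom[OF U this, of "int p"]
  have "relative_homology_group (int p) (subtopology X B) (A \<inter> B) \<cong> relative_homology_group (int p) X A"
    unfolding eq by (auto simp: is_iso_def)
  from set_rank_iso[OF _ _ this]
  show "relative_betti_rank (subtopology X B) (A \<inter> B) p = relative_betti_rank X A p"
    by (simp add: relative_betti_rank_def)
qed

text \<open>The pairs (X, A) and (B, A \<inter> B) have equal relative ranks, so their long exact
  sequences share a term, through which finiteness and values are passed on. The last alternative of
  \<open>fin\<close> finds one piece from the union, the intersection and the other piece.\<close>

lemma Mayer_Vietoris: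
  assumes "openin X A" "openin X B" "topspace X = A \<union> B"
  defines "XA \<equiv> subtopology X A" and "XB \<equiv> subtopology X B" and "XAB \<equiv> subtopology X (A \<inter> B)"
  assumes fin: "finite_homology XA \<and> finite_homology XB \<and> finite_homology XAB
      \<or> finite_homology XA \<and> finite_homology XB \<and> finite_homology X
      \<or> finite_homology XA \<and> finite_homology X \<and> finite_homology XAB"
  shows "finite_homology X \<and> finite_homology XA \<and> finite_homology XB \<and> finite_homology XAB \<and>
    euler_characteristic X + euler_characteristic XAB = euler_characteristic XA + euler_characteristic XB"
proof -
  let ?r = "relative_betti_rank X A"
  have 1: "exact_ranks (betti_rank XA) (betti_rank X) ?r"
    unfolding XA_def by (rule exact_ranks_pair)
  have "subtopology XB (A \<inter> B) = XAB"
    by (simp add: XB_def XAB_def subtopology_subtopology inf.absorb2 Int_commute)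
  then have 2: "exact_ranks (betti_rank XAB) (betti_rank XB) ?r"
    using exact_ranks_pair[of XB "A \<inter> B"] Mayer_Vietoris_ranks[OF assms(1-3)] by (simp add: XB_def)
  have all: "finite_homology X" "finite_homology XA" "finite_homology XB" "finite_homology XAB" "finite_betti ?r"
    using fin exact_ranks_finite[OF 1] exact_ranks_finite[OF 2] unfolding finite_homology_def by blast+
  then show ?thesis
    using exact_ranks_alternating_sum[OF 1] exact_ranks_alternating_sum[OF 2]
    by (simp add: euler_characteristic_eq) (simp add: finite_homology_def)
qed

lemma homotopy_equivalent_finite_homology:
  assumes "X homotopy_equivalent_space Y"
  shows "finite_homology X \<longleftrightarrow> finite_homology Y" "euler_characteristic X = euler_characteristic Y"
proof -
  have iso: "homology_group p X \<cong> homology_group p Y" for p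
    using assms by (rule homotopy_equivalent_space_imp_isomorphic_homology_groups)
  have "betti_rank X = betti_rank Y"
    unfolding betti_rank_def by (intro ext set_rank_iso abelian_homology_group iso)
  then show "finite_homology X \<longleftrightarrow> finite_homology Y" by (simp add: finite_homology_def)
  \<comment> \<open>No finiteness is assumed here: \<open>Max\<close> of an infinite set is
    unspecified, but both sides take it of the same set, because the rank determines which
    cardinalities occur.\<close>
  have "betti_number p X = betti_number p Y" for p
  proof -
    have "{card S | S. Z_independent (homology_group (int p) X) S}
        = {n. enat n \<le> betti_rank X p}"
      using comm_group.set_rank_ge_iff[OF abelian_homology_group, of _ "int p" X]
      unfolding betti_rank_def by (auto simp: Z_independent_def)
    moreover have "{card S | S. Z_independent (homology_group (int p) Y) S}
        = {n. enat n \<le> betti_rank Y p}"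
      using comm_group.set_rank_ge_iff[OF abelian_homology_group, of _ "int p" Y]
      unfolding betti_rank_def by (auto simp: Z_independent_def)
    ultimately show ?thesis
      by (simp add: betti_number_def Z_rank_def \<open>betti_rank X = betti_rank Y\<close>)
  qed
  then show "euler_characteristic X = euler_characteristic Y"
    by (simp add: euler_characteristic_def)
qed

subsection \<open>Subsets of topological spaces\<close>

definition fin_hom :: "'a::topological_space set \<Rightarrow> bool" where
  "fin_hom S \<longleftrightarrow> finite_homology (top_of_set S)"

definition chi :: "'a::topological_space set \<Rightarrow> int" where
  "chi S = euler_characteristic (top_of_set S)"

text \<open>Bundles finiteness with the value, which is the form in which both propagate.\<close>

definition has_chi :: "'a::topological_space set \<Rightarrow> int \<Rightarrow> bool" where
  "has_chi S c \<longleftrightarrow> fin_hom S \<and> chi S = c"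

lemma has_chi_chi: "fin_hom S \<Longrightarrow> has_chi S (chi S)"
  by (simp add: has_chi_def)

lemma homotopy_eqv_has_chi:
  assumes "S homotopy_eqv T"
  shows "has_chi S c \<longleftrightarrow> has_chi T c"
  using homotopy_equivalent_finite_homology[OF assms]
  by (simp add: has_chi_def fin_hom_def chi_def)

lemma homeomorphic_has_chi: "S homeomorphic T \<Longrightarrow> has_chi S c \<longleftrightarrow> has_chi T c"
  by (rule homotopy_eqv_has_chi) (rule homeomorphic_imp_homotopy_eqv)

lemma has_chi_empty: "has_chi ({} :: 'a::topological_space set) 0"
proof -
  have "betti_rank (top_of_set ({} :: 'a set)) p = 0" for p
  proof -
    have "trivial_group (homology_group (int p) (top_of_set ({} :: 'a set)))"
      by (rule trivial_homology_group_empty) simp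
    then show ?thesis
      unfolding betti_rank_def trivial_group_def
      by (intro set_rank_trivial[OF abelian_homology_group]) blast
  qed
  then have "betti_rank (top_of_set ({} :: 'a set)) = (\<lambda>_. 0)" by blast
  moreover from this have "finite_homology (top_of_set ({} :: 'a set))"
    by (simp add: finite_homology_def finite_betti_def)
  ultimately show ?thesis
    by (simp add: has_chi_def fin_hom_def chi_def euler_characteristic_eq alternating_sum_def)
qed

lemma has_chi_singleton: "has_chi {a} 1"
proof -
  let ?X = "top_of_set {a}"
  have X: "topspace ?X = {a}" by simp
  have "betti_rank ?X p = (if p = 0 then 1 else 0)" for p
  proof (cases "p = 0")
    case True
    have "betti_rank ?X 0 = set_rank integer_group (carrier integer_group)"
      unfolding betti_rank_def
      by (rule set_rank_iso[OF abelian_homology_group abelian_integer_group])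
         (use homology_coefficients[OF X] in simp)
    then show ?thesis using True by (simp add: set_rank_integer_group)
  next
    case False
    have "trivial_group (homology_group (int p) ?X)"
      by (rule homology_dimension_axiom[OF X]) (use False in simp)
    then have "betti_rank ?X p = 0"
      unfolding betti_rank_def
      by (intro set_rank_trivial[OF abelian_homology_group]) (simp add: trivial_group_def)
    then show ?thesis using False by simp
  qed
  then have b: "betti_rank ?X = (\<lambda>p. if p = 0 then 1 else 0)" by blast
  then have "finite_homology ?X"
    by (auto simp: finite_homology_def finite_betti_def one_enat_def zero_enat_def intro!: exI[of _ 1])
  moreover have "{p. (if p = 0 then 1 else 0) \<noteq> (0::enat)} = {0::nat}" by auto
  then have "alternating_sum (betti_rank ?X) = 1"
    unfolding b alternating_sum_def by (simp add: one_enat_def)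
  ultimately show ?thesis
    by (simp add: has_chi_def fin_hom_def chi_def euler_characteristic_eq)
qed

lemma has_chi_contractible:
  assumes "contractible S" "S \<noteq> {}"
  shows "has_chi S 1"
proof -
  obtain a where a: "a \<in> S" "top_of_set S homotopy_equivalent_space subtopology (top_of_set S) {a}"
    using assms contractible_eq_homotopy_equivalent_singleton_subtopology[of "top_of_set S"]
    by (auto simp flip: null_topspace_iff_trivial)
  then have "S homotopy_eqv {a}" by (simp add: subtopology_subtopology)
  from homotopy_eqv_has_chi[OF this] show ?thesis using has_chi_singleton by blast
qed

lemma set_Mayer_Vietoris:
  assumes A: "openin (top_of_set S) A" and B: "openin (top_of_set S) B" and S: "S = A \<union> B"
    and fin: "fin_hom A \<and> fin_hom B \<and> fin_hom (A \<inter> B) \<or> fin_hom A \<and> fin_hom B \<and> fin_hom S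
      \<or> fin_hom A \<and> fin_hom S \<and> fin_hom (A \<inter> B)"
  shows "fin_hom S \<and> fin_hom A \<and> fin_hom B \<and> fin_hom (A \<inter> B) \<and> chi S + chi (A \<inter> B) = chi A + chi B"
proof -
  have sub: "A \<subseteq> S" "B \<subseteq> S" using S by auto
  then have eq: "subtopology (top_of_set S) A = top_of_set A" "subtopology (top_of_set S) B = top_of_set B"
    "subtopology (top_of_set S) (A \<inter> B) = top_of_set (A \<inter> B)"
    by (simp_all add: subtopology_subtopology Int_absorb1 le_infI1 inf.absorb2)
  show ?thesis
    using Mayer_Vietoris[OF A B] fin unfolding eq fin_hom_def chi_def using S by auto
qed

lemma has_chi_Un:
  assumes "openin (top_of_set (A \<union> B)) A" "openin (top_of_set (A \<union> B)) B"
    "has_chi A a" "has_chi B b" "has_chi (A \<inter> B) c"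
  shows "has_chi (A \<union> B) (a + b - c)"
  using set_Mayer_Vietoris[OF assms(1,2) refl] assms(3-) by (auto simp: has_chi_def)

lemma has_chi_Int:
  assumes "openin (top_of_set (A \<union> B)) A" "openin (top_of_set (A \<union> B)) B"
    "has_chi A a" "has_chi B b" "has_chi (A \<union> B) c"
  shows "has_chi (A \<inter> B) (a + b - c)"
  using set_Mayer_Vietoris[OF assms(1,2) refl] assms(3-) by (auto simp: has_chi_def)

lemma has_chi_part:
  assumes "openin (top_of_set (A \<union> B)) A" "openin (top_of_set (A \<union> B)) B"
    "has_chi A a" "has_chi (A \<inter> B) b" "has_chi (A \<union> B) c"
  shows "has_chi B (c + b - a)"
  using set_Mayer_Vietoris[OF assms(1,2) refl] assms(3-) by (auto simp: has_chi_def)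

subsection \<open>Deformations, products and punctured discs\<close>

lemma has_chi_homeomorphism:
  assumes "continuous_on S f" "continuous_on T g" "\<And>x. x \<in> S \<Longrightarrow> f x \<in> T \<and> g (f x) = x"
    "\<And>y. y \<in> T \<Longrightarrow> g y \<in> S \<and> f (g y) = y"
  shows "has_chi S c \<longleftrightarrow> has_chi T c"
proof (rule homeomorphic_has_chi)
  have "homeomorphism S T f g"
    unfolding homeomorphism_def
  proof (intro conjI ballI)
    show "f ` S = T"
    proof
      show "T \<subseteq> f ` S" using assms(4) by (metis image_eqI subsetI)
    qed (use assms(3) in auto)
    show "g ` T = S"
    proof
      show "S \<subseteq> g ` T" using assms(3) by (metis image_eqI subsetI)
    qed (use assms(4) in auto)
  qed (use assms in auto)
  then show "S homeomorphic T" unfolding homeomorphic_def by blast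
qed

text \<open>Time runs backwards: \<open>H 1\<close> is the identity and \<open>H 0\<close> retracts
  onto \<open>R\<close>. At intermediate times the points of \<open>R\<close> may move within
  \<open>S\<close>.\<close>

lemma has_chi_deformation:
  assumes RS: "R \<subseteq> S" and H: "continuous_on ({0..1} \<times> S) (\<lambda>(t, x). H t x)"
    and HS: "\<And>t x. 0 \<le> t \<Longrightarrow> t \<le> (1::real) \<Longrightarrow> x \<in> S \<Longrightarrow> H t x \<in> S"
    and H1: "\<And>x. x \<in> S \<Longrightarrow> H 1 x = x" and H0: "\<And>x. x \<in> S \<Longrightarrow> H 0 x \<in> R"
    and R: "\<And>x. x \<in> R \<Longrightarrow> H 0 x = x"
  shows "has_chi S c \<longleftrightarrow> has_chi R c"
proof (rule homotopy_eqv_has_chi)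
  have cont0: "continuous_on S (H 0)"
  proof -
    have "continuous_on S ((\<lambda>(t, x). H t x) \<circ> (\<lambda>x. (0, x)))"
      by (intro continuous_on_compose continuous_intros continuous_on_subset[OF H]) auto
    then show ?thesis by (simp add: o_def)
  qed
  have 1: "homotopic_with (\<lambda>_. True) (top_of_set S) (top_of_set S) (id \<circ> H 0) id"
    by (subst homotopic_with) (use H HS H1 in \<open>auto intro!: exI[of _ "\<lambda>(t, x). H t x"]\<close>)
  have 2: "homotopic_with (\<lambda>_. True) (top_of_set R) (top_of_set R) (H 0 \<circ> id) id"
  proof (rule homotopic_with_equal)
    show "continuous_map (top_of_set R) (top_of_set R) (H 0 \<circ> id)"
      using continuous_on_subset[OF cont0 RS] R by auto
  qed (use R in auto)
  show "S homotopy_eqv R"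
    unfolding homotopy_equivalent_space_def
  proof (intro exI conjI)
    show "continuous_map (top_of_set S) (top_of_set R) (H 0)" using cont0 H0 by auto
    show "continuous_map (top_of_set R) (top_of_set S) id" using RS by auto
  qed (use 1 2 in auto)
qed

lemma has_chi_starlike_factor:
  fixes U :: "'b::real_normed_vector set"
  assumes "u0 \<in> U" "\<And>u. u \<in> U \<Longrightarrow> closed_segment u0 u \<subseteq> U"
  shows "has_chi (X \<times> U) c \<longleftrightarrow> has_chi X c"
proof -
  have "u0 + t *\<^sub>R (u - u0) \<in> U" if "0 \<le> t" "t \<le> 1" "u \<in> U" for t u
  proof -
    have "u0 + t *\<^sub>R (u - u0) \<in> closed_segment u0 u"
      using that unfolding closed_segment_def by (auto simp: algebra_simps intro!: exI[of _ t])
    with assms(2)[OF that(3)] show ?thesis by blast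
  qed
  then have "has_chi (X \<times> U) c \<longleftrightarrow> has_chi (X \<times> {u0}) c"
    using assms(1)
    by (intro has_chi_deformation[where H = "\<lambda>t p. (fst p, u0 + t *\<^sub>R (snd p - u0))"])
       (auto simp: case_prod_unfold intro!: continuous_intros)
  also have "has_chi (X \<times> {u0}) c \<longleftrightarrow> has_chi X c"
    by (rule has_chi_homeomorphism[where f = fst and g = "\<lambda>x. (x, u0)"]) (auto intro!: continuous_intros)
  finally show ?thesis .
qed

lemma has_chi_convex_factor:
  fixes U :: "'b::real_normed_vector set"
  assumes "convex U" "U \<noteq> {}"
  shows "has_chi (X \<times> U) c \<longleftrightarrow> has_chi X c"
proof -
  obtain u0 where "u0 \<in> U" using assms by blast
  then show ?thesis
  proof (rule has_chi_starlike_factor)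
    fix u assume "u \<in> U"
    then show "closed_segment u0 u \<subseteq> U" using \<open>u0 \<in> U\<close> assms(1) by (simp add: closed_segment_subset)
  qed
qed

lemma has_chi_disjoint_Un:
  assumes "openin (top_of_set (A \<union> B)) A" "openin (top_of_set (A \<union> B)) B" "A \<inter> B = {}"
    "has_chi A a" "has_chi B b"
  shows "has_chi (A \<union> B) (a + b)"
  using has_chi_Un[OF assms(1,2,4,5), of 0] has_chi_empty assms(3) by simp

lemma openin_Times_factor:
  assumes "open U" "U \<subseteq> V"
  shows "openin (top_of_set (X \<times> V)) (X \<times> U)"
proof -
  have "X \<times> U = (X \<times> V) \<inter> (UNIV \<times> U)" using assms by auto
  then show ?thesis using assms openin_open_Int open_Times open_UNIV by metis
qed

text \<open>The punctured region is covered by two slit regions, without the ray to the right of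
  \<open>a\<close> and without the ray to the left. Both are starlike and they meet in two convex
  halves, which gives c + c - 2 c = 0. This is the vanishing for a circle, carried along with a
  factor \<open>X\<close>.\<close>

lemma has_chi_punctured_factor:
  fixes U :: "complex set"
  assumes U: "convex U" "open U" "a \<in> U" and X: "has_chi X c"
  shows "has_chi (X \<times> (U - {a})) 0"
proof -
  obtain d where d: "d > 0" "ball a d \<subseteq> U" using U open_contains_ball by blast
  \<comment> \<open>The points \<open>a - h\<close> and \<open>a + h\<close> are the star centres of
    the two slit regions.\<close>
  define h where "h = complex_of_real (d / 2)"
  have hU: "a + h \<in> U" "a - h \<in> U"
    using d by (auto simp: h_def dist_norm intro!: subsetD[OF d(2)])
  let ?A = "{z \<in> U. Im (z - a) \<noteq> 0 \<or> Re (z - a) < 0}"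
  let ?B = "{z \<in> U. Im (z - a) \<noteq> 0 \<or> Re (z - a) > 0}"
  let ?P = "{z \<in> U. Im (z - a) > 0}" and ?N = "{z \<in> U. Im (z - a) < 0}"
  have opens: "open ?A" "open ?B" "open ?P" "open ?N"
  proof -
    have eqs: "?A = U \<inter> ({z. Im (z - a) \<noteq> 0} \<union> {z. Re (z - a) < 0})"
      "?B = U \<inter> ({z. Im (z - a) \<noteq> 0} \<union> {z. Re (z - a) > 0})"
      "?P = U \<inter> {z. Im (z - a) > 0}" "?N = U \<inter> {z. Im (z - a) < 0}" by auto
    show "open ?A" "open ?B" "open ?P" "open ?N"
      unfolding eqs
      by (intro open_Int open_Un U open_Collect_neq open_Collect_less continuous_intros)+
  qed
  have segU: "closed_segment u z \<subseteq> U" if "u \<in> U" "z \<in> U" for u z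
    using U that by (simp add: closed_segment_subset)
  have 1: "has_chi (X \<times> ?A) c"
    using X
  proof (subst has_chi_starlike_factor[of "a - h"])
    show "a - h \<in> ?A" using hU d by (simp add: h_def)
    fix z assume z: "z \<in> ?A"
    show "closed_segment (a - h) z \<subseteq> ?A"
    proof
      fix w assume w: "w \<in> closed_segment (a - h) z"
      then obtain t where t: "0 \<le> t" "t \<le> 1" "w = (1 - t) *\<^sub>R (a - h) + t *\<^sub>R z"
        by (auto simp: closed_segment_def)
      have "w - a = t *\<^sub>R (z - a) - (1 - t) *\<^sub>R h"
        by (simp add: t algebra_simps)
      then have im: "Im (w - a) = t * Im (z - a)" and re: "Re (w - a) = t * Re (z - a) - (1 - t) * (d / 2)"
        by (simp_all add: h_def)
      have "Re (w - a) < 0" if "t * Im (z - a) = 0"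
      proof (cases "t = 0")
        case True with re d show ?thesis by simp
      next
        case False
        with that z have "Re (z - a) < 0" by auto
        with False t have "t * Re (z - a) < 0" by (simp add: mult_pos_neg)
        moreover have "(1 - t) * (d / 2) \<ge> 0" using t d by simp
        ultimately show ?thesis using re by linarith
      qed
      then show "w \<in> ?A" using segU[OF hU(2), of z] z w im by auto
    qed
  qed
  have 2: "has_chi (X \<times> ?B) c"
    using X
  proof (subst has_chi_starlike_factor[of "a + h"])
    show "a + h \<in> ?B" using hU d by (simp add: h_def)
    fix z assume z: "z \<in> ?B"
    show "closed_segment (a + h) z \<subseteq> ?B"
    proof
      fix w assume w: "w \<in> closed_segment (a + h) z"
      then obtain t where t: "0 \<le> t" "t \<le> 1" "w = (1 - t) *\<^sub>R (a + h) + t *\<^sub>R z"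
        by (auto simp: closed_segment_def)
      have "w - a = t *\<^sub>R (z - a) + (1 - t) *\<^sub>R h"
        by (simp add: t algebra_simps)
      then have im: "Im (w - a) = t * Im (z - a)" and re: "Re (w - a) = t * Re (z - a) + (1 - t) * (d / 2)"
        by (simp_all add: h_def)
      have "Re (w - a) > 0" if "t * Im (z - a) = 0"
      proof (cases "t = 0")
        case True with re d show ?thesis by simp
      next
        case False
        with that z have "Re (z - a) > 0" by auto
        with False t have "t * Re (z - a) > 0" by simp
        moreover have "(1 - t) * (d / 2) \<ge> 0" using t d by simp
        ultimately show ?thesis using re by linarith
      qed
      then show "w \<in> ?B" using segU[OF hU(1), of z] z w im by auto
    qed
  qed
  let ?i = "\<i> * complex_of_real (d / 2)"
  have iU: "a + ?i \<in> ?P" "a - ?i \<in> ?N"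
    using d by (auto simp: dist_norm norm_mult intro!: subsetD[OF d(2)])
  have conv: "convex ?P" "convex ?N"
  proof -
    have eqs: "?P = U \<inter> {z. Im z > Im a}" "?N = U \<inter> {z. Im z < Im a}" by auto
    show "convex ?P" "convex ?N" unfolding eqs
      by (intro convex_Int U convex_halfspace_Im_gt convex_halfspace_Im_lt)+
  qed
  have "has_chi (X \<times> ?P) c" "has_chi (X \<times> ?N) c"
    using X conv iU by (subst has_chi_convex_factor; blast)+
  moreover have PN: "X \<times> ?P \<union> X \<times> ?N = X \<times> (?P \<union> ?N)" by auto
  have "openin (top_of_set (X \<times> ?P \<union> X \<times> ?N)) (X \<times> ?P)"
    unfolding PN by (rule openin_Times_factor[OF opens(3)]) auto
  moreover have "openin (top_of_set (X \<times> ?P \<union> X \<times> ?N)) (X \<times> ?N)"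
    unfolding PN by (rule openin_Times_factor[OF opens(4)]) auto
  moreover have "X \<times> ?P \<inter> X \<times> ?N = {}" by auto
  ultimately have "has_chi (X \<times> ?P \<union> X \<times> ?N) (c + c)"
    using has_chi_disjoint_Un by blast
  moreover have "X \<times> ?P \<union> X \<times> ?N = X \<times> ?A \<inter> X \<times> ?B" by auto
  ultimately have 3: "has_chi (X \<times> ?A \<inter> X \<times> ?B) (c + c)" by simp
  have un: "X \<times> ?A \<union> X \<times> ?B = X \<times> (?A \<union> ?B)" by auto
  have chi_un: "has_chi (X \<times> ?A \<union> X \<times> ?B) (c + c - (c + c))"
    by (rule has_chi_Un[OF _ _ 1 2 3]; unfold un; rule openin_Times_factor) (use opens in auto)
  have "?A \<union> ?B = U - {a}" by (auto simp: complex_eq_iff)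
  then show ?thesis using chi_un unfolding un by (simp only: diff_self)
qed

text \<open>A small disc around the removed point contributes \<open>x\<close>, and its overlap with
  the remainder, a punctured disc, contributes 0.\<close>

lemma has_chi_remove_points_factor:
  fixes U F :: "complex set"
  assumes "open U" "has_chi (X \<times> U) a" "has_chi X x" "finite F" "F \<subseteq> U"
  shows "has_chi (X \<times> (U - F)) (a - int (card F) * x)"
  using assms(4,5)
proof (induction F rule: finite_induct)
  case empty
  then show ?case using assms by simp
next
  case (insert z F)
  have "open (U - F)" using insert assms by (simp add: open_Diff finite_imp_closed)
  moreover have "z \<in> U - F" using insert by auto
  ultimately obtain e where e: "e > 0" "ball z e \<subseteq> U - F" using open_contains_ball by blast
  let ?A = "X \<times> ball z e" and ?B = "X \<times> (U - insert z F)"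
  have un: "?A \<union> ?B = X \<times> (U - F)" using e \<open>z \<in> U - F\<close> by auto
  have int: "?A \<inter> ?B = X \<times> (ball z e - {z})" using e by auto
  have "has_chi ?A x" using has_chi_convex_factor[of "ball z e" X x] e assms by simp
  moreover have "has_chi (?A \<inter> ?B) 0"
    unfolding int using has_chi_punctured_factor[of "ball z e" z X x] e assms by simp
  moreover have "has_chi (?A \<union> ?B) (a - int (card F) * x)" unfolding un using insert by simp
  moreover have "openin (top_of_set (?A \<union> ?B)) ?A"
    unfolding un by (rule openin_Times_factor) (use e in auto)
  moreover have "openin (top_of_set (?A \<union> ?B)) ?B"
    unfolding un by (rule openin_Times_factor) (use insert assms in \<open>auto simp: open_Diff finite_imp_closed\<close>)
  ultimately have "has_chi ?B (a - int (card F) * x + 0 - x)"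
    using has_chi_part by blast
  then show ?case using insert by (simp add: algebra_simps)
qed

text \<open>Dividing the fibre coordinate by \<open>r\<close> turns the bundle into a product. The
  scale-invariant \<open>P\<close> lets one proof serve full and punctured discs.\<close>

lemma has_chi_disc_bundle_homeomorphism:
  fixes r :: "'a::topological_space \<Rightarrow> real"
  assumes r: "continuous_on E r" "\<And>e. e \<in> E \<Longrightarrow> r e > 0"
    and P: "\<And>s t. t > 0 \<Longrightarrow> P (s * complex_of_real t) \<longleftrightarrow> P s"
  shows "has_chi {(e, s::complex). e \<in> E \<and> P s \<and> norm s < r e} c
      \<longleftrightarrow> has_chi (E \<times> {s. P s \<and> norm s < 1}) c"
proof -
  let ?f = "\<lambda>p::'a \<times> complex. (fst p, snd p / complex_of_real (r (fst p)))"
  let ?g = "\<lambda>p::'a \<times> complex. (fst p, snd p * complex_of_real (r (fst p)))"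
  let ?D = "{(e, s::complex). e \<in> E \<and> P s \<and> norm s < r e}"
  have cr: "continuous_on A (\<lambda>p. r (fst p))" if "fst ` A \<subseteq> E" for A :: "('a \<times> complex) set"
    by (rule continuous_on_compose2[OF r(1) _ that]) (intro continuous_intros)
  have nz: "e \<in> E \<Longrightarrow> r e \<noteq> 0" for e using r(2)[of e] by simp
  have Pd: "P (s / complex_of_real t) \<longleftrightarrow> P s" if "t > 0" for s t
    using P[OF that, of "s / complex_of_real t"] that by simp
  show ?thesis
  proof (rule has_chi_homeomorphism)
    show "continuous_on ?D ?f" "continuous_on (E \<times> {s. P s \<and> norm s < 1}) ?g"
      by (intro continuous_intros cr; use nz in force)+
    fix x assume "x \<in> ?D"
    then show "?f x \<in> E \<times> {s. P s \<and> norm s < 1} \<and> ?g (?f x) = x"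
      using r(2)[of "fst x"] nz[of "fst x"] Pd[of "r (fst x)"] by (auto simp: norm_divide)
  next
    fix y assume "y \<in> E \<times> {s. P s \<and> norm s < 1}"
    then show "?g y \<in> ?D \<and> ?f (?g y) = y"
      using r(2)[of "fst y"] nz[of "fst y"] P[of "r (fst y)"] by (auto simp: norm_mult)
  qed
qed

lemma has_chi_disc_bundle:
  fixes r :: "'a::topological_space \<Rightarrow> real"
  assumes r: "continuous_on E r" "\<And>e. e \<in> E \<Longrightarrow> r e > 0"
  shows "has_chi {(e, s::complex). e \<in> E \<and> norm s < r e} c \<longleftrightarrow> has_chi E c"
proof -
  have "{s::complex. norm s < 1} = ball 0 1" by auto
  then show ?thesis
    using has_chi_disc_bundle_homeomorphism[OF r, of "\<lambda>_. True" c] has_chi_convex_factor[of "ball (0::complex) 1" E c]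
    by simp
qed

lemma has_chi_punctured_disc_bundle:
  fixes r :: "'a::topological_space \<Rightarrow> real"
  assumes r: "continuous_on E r" "\<And>e. e \<in> E \<Longrightarrow> r e > 0" and E: "has_chi E c"
  shows "has_chi {(e, s::complex). e \<in> E \<and> s \<noteq> 0 \<and> norm s < r e} 0"
proof -
  have "{s::complex. s \<noteq> 0 \<and> norm s < 1} = ball 0 1 - {0}" by auto
  then show ?thesis
    using has_chi_disc_bundle_homeomorphism[OF r, of "\<lambda>s. s \<noteq> 0" 0]
      has_chi_punctured_factor[of "ball 0 1" 0 E c] E
    by simp
qed

subsection \<open>Additivity along a closed subset\<close>

text \<open>A genuine condition, since \<open>chi\<close> is not compactly supported: it fails for a
  point on the real line, where 1 is not 2 + 1. It is therefore established from local models and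
  then glued.\<close>

definition additive :: "'a::topological_space set \<Rightarrow> 'a set \<Rightarrow> bool" where
  "additive X Z \<longleftrightarrow> fin_hom X \<and> fin_hom (X - Z) \<and> fin_hom (X \<inter> Z) \<and> chi X = chi (X - Z) + chi (X \<inter> Z)"

lemma openin_restrict:
  assumes "openin (top_of_set S) A"
  shows "openin (top_of_set (S \<inter> T)) (A \<inter> T)"
proof -
  obtain V where "open V" "A = S \<inter> V" using assms by (auto simp: openin_open)
  then show ?thesis by (auto simp: openin_open intro!: exI[of _ V])
qed

text \<open>Mayer-Vietoris is applied three times: to the sets themselves, to their parts off
  \<open>Z\<close> and to their parts in \<open>Z\<close>.\<close>

lemma additive_Un:
  assumes op: "openin (top_of_set (A \<union> B)) A" "openin (top_of_set (A \<union> B)) B"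
    and add: "additive A Z" "additive B Z" "additive (A \<inter> B) Z"
  shows "additive (A \<union> B) Z"
proof -
  have part: "fin_hom ((A \<union> B) \<inter> T) \<and>
      chi ((A \<union> B) \<inter> T) = chi (A \<inter> T) + chi (B \<inter> T) - chi (A \<inter> B \<inter> T)"
    if "fin_hom (A \<inter> T)" "fin_hom (B \<inter> T)" "fin_hom (A \<inter> B \<inter> T)" for T
  proof -
    have eqs: "(A \<inter> T) \<inter> (B \<inter> T) = A \<inter> B \<inter> T" "(A \<union> B) \<inter> T = A \<inter> T \<union> B \<inter> T" by auto
    show ?thesis
      using set_Mayer_Vietoris[OF openin_restrict[OF op(1)] openin_restrict[OF op(2)] eqs(2)] that
      unfolding eqs(1) by auto
  qed
  from part[of UNIV] part[of "- Z"] part[of Z] add show ?thesis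
    by (simp add: additive_def Diff_eq)
qed

text \<open>The set \<open>X\<close> is the union of \<open>N\<close> and \<open>X - Z\<close>,
  which meet in \<open>N - Z\<close>; hence additivity only has to be known near
  \<open>Z\<close>.\<close>

lemma additive_enlarge:
  assumes N: "openin (top_of_set X) N" "X \<inter> Z \<subseteq> N" and Z: "closed Z"
    and add: "additive N Z" and fin: "fin_hom (X - Z)"
  shows "additive X Z"
proof -
  have sub: "N \<subseteq> X" using N by (auto simp: openin_open)
  have "openin (top_of_set X) (X - Z)" using Z by (simp add: openin_open Diff_eq open_Compl) blast
  moreover have "X = N \<union> (X - Z)" "N \<inter> (X - Z) = N - Z" "X \<inter> Z = N \<inter> Z" using N(2) sub by auto
  ultimately show ?thesis
    using set_Mayer_Vietoris[OF N(1), of "X - Z"] add fin by (auto simp: additive_def)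
qed

lemma additive_has_chi:
  assumes "additive X Z" "has_chi (X \<inter> Z) z" "has_chi (X - Z) c"
  shows "has_chi X (c + z)"
  using assms by (simp add: additive_def has_chi_def)

lemma additiveI:
  assumes "has_chi X (c + z)" "has_chi (X - Z) c" "has_chi (X \<inter> Z) z"
  shows "additive X Z"
  using assms by (simp add: additive_def has_chi_def)

section \<open>Linear equations with coefficients depending on a parameter\<close>

lemma continuous_on_snd_coordinate [continuous_intros]:
  "continuous_on S f \<Longrightarrow> continuous_on S (\<lambda>x. snd (f x) k)"
  for f :: "'a::topological_space \<Rightarrow> 'd::topological_space \<times> ('b \<Rightarrow> 'c::topological_space)"
  by (rule continuous_on_product_then_coordinatewise) (rule continuous_on_snd)

text \<open>Coordinates outside \<open>J\<close> are pinned to 0, so that tori of all dimensions are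
  subsets of one function space.\<close>

definition torus :: "nat set \<Rightarrow> (nat \<Rightarrow> complex) set" where
  "torus J = {z. (\<forall>k\<in>J. z k \<noteq> 0) \<and> (\<forall>k. k \<notin> J \<longrightarrow> z k = 0)}"

text \<open>Normalizing the sum to 1 splits off a scaling factor: the locus where the sum is nonzero
  is \<open>level\<close> times the punctured plane.\<close>

definition level :: "nat set \<Rightarrow> (nat \<Rightarrow> 'a::topological_space \<Rightarrow> complex) \<Rightarrow> 'a set \<Rightarrow> ('a \<times> (nat \<Rightarrow> complex)) set" where
  "level J g V = {(v, z). v \<in> V \<and> z \<in> torus J \<and> (\<Sum>k\<in>J. z k * g k v) = 1}"

text \<open>\<open>z\<^sub>0\<close> is the homogenizing variable.\<close>

definition hyper :: "nat \<Rightarrow> (nat \<Rightarrow> 'a::topological_space \<Rightarrow> complex) \<Rightarrow> 'a set \<Rightarrow> ('a \<times> (nat \<Rightarrow> complex)) set" where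
  "hyper n f V = {(v, z). v \<in> V \<and> z \<in> torus {..n} \<and> z 0 = 1 \<and> (\<Sum>k\<le>n. z k * f k v) = 0}"

lemma has_chi_times_torus:
  fixes X :: "'a::topological_space set"
  assumes "finite J" "has_chi X c"
  shows "has_chi (X \<times> torus J) (if J = {} then c else 0)"
  using assms(1)
proof (induction J rule: finite_induct)
  case empty
  have "torus {} = {\<lambda>_. 0}" by (auto simp: torus_def)
  moreover have "has_chi (X \<times> {\<lambda>_::nat. 0::complex}) c \<longleftrightarrow> has_chi X c"
    by (rule has_chi_homeomorphism[where f = fst and g = "\<lambda>x. (x, \<lambda>_. 0)"]) (auto intro!: continuous_intros)
  ultimately show ?case using assms by simp
next
  case (insert m J)
  have "has_chi (X \<times> torus (insert m J)) 0 \<longleftrightarrow> has_chi ((X \<times> torus J) \<times> (UNIV - {0::complex})) 0"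
  proof (rule has_chi_homeomorphism)
    let ?f = "\<lambda>p::'a \<times> (nat \<Rightarrow> complex). ((fst p, \<lambda>k. if k = m then 0 else snd p k), snd p m)"
    let ?g = "\<lambda>q::('a \<times> (nat \<Rightarrow> complex)) \<times> complex. (fst (fst q), \<lambda>k. if k = m then snd q else snd (fst q) k)"
    show "continuous_on (X \<times> torus (insert m J)) ?f"
      by (intro continuous_intros; rename_tac k; case_tac "k = m"; simp add: continuous_intros)
    show "continuous_on ((X \<times> torus J) \<times> (UNIV - {0::complex})) ?g"
      by (intro continuous_intros; rename_tac k; case_tac "k = m"; simp add: continuous_intros)
    fix x assume "x \<in> X \<times> torus (insert m J)"
    then show "?f x \<in> (X \<times> torus J) \<times> (UNIV - {0::complex}) \<and> ?g (?f x) = x"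
      using insert by (auto simp: torus_def fun_eq_iff)
  next
    let ?f = "\<lambda>p::'a \<times> (nat \<Rightarrow> complex). ((fst p, \<lambda>k. if k = m then 0 else snd p k), snd p m)"
    let ?g = "\<lambda>q::('a \<times> (nat \<Rightarrow> complex)) \<times> complex. (fst (fst q), \<lambda>k. if k = m then snd q else snd (fst q) k)"
    fix y assume "y \<in> (X \<times> torus J) \<times> (UNIV - {0::complex})"
    then show "?g y \<in> X \<times> torus (insert m J) \<and> ?f (?g y) = y"
      using insert by (auto simp: torus_def fun_eq_iff)
  qed
  moreover have "has_chi ((X \<times> torus J) \<times> (UNIV - {0::complex})) 0"
    by (rule has_chi_punctured_factor[OF _ _ _ insert.IH]) auto
  ultimately show ?case by simp
qed

section \<open>Gluing over the open sets where some function does not vanish\<close>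

definition nz_support :: "nat set \<Rightarrow> (nat \<Rightarrow> 'a \<Rightarrow> complex) \<Rightarrow> 'a \<Rightarrow> nat set" where
  "nz_support J g v = {k\<in>J. g k v \<noteq> 0}"

text \<open>The members of the lattice of open sets generated by the sets \<open>{v \<in> V. g\<^sub>k v \<noteq> 0}\<close>
  are the sets of the \<open>v\<close> whose set of nonvanishing \<open>g\<^sub>k\<close> lies in an up-closed family.\<close>

definition upclosed :: "nat set set \<Rightarrow> bool" where
  "upclosed F \<longleftrightarrow> (\<forall>A B. A \<in> F \<and> A \<subseteq> B \<longrightarrow> B \<in> F)"

text \<open>Gluing over a cover meets unions and intersections of the sets g_k \<noteq> 0 in many
  combinations, so finiteness is demanded of the whole lattice at once.\<close>

definition finite_lattice :: "nat set \<Rightarrow> (nat \<Rightarrow> 'a::topological_space \<Rightarrow> complex) \<Rightarrow> 'a set \<Rightarrow> bool" where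
  "finite_lattice J g V \<longleftrightarrow> (\<forall>F. upclosed F \<longrightarrow> fin_hom {v\<in>V. nz_support J g v \<in> F})"

lemma finite_lattice_restrict:
  assumes "finite_lattice J g V" "upclosed F"
  shows "finite_lattice J g {v\<in>V. nz_support J g v \<in> F}"
  unfolding finite_lattice_def
proof (intro allI impI)
  fix G assume "upclosed G"
  with assms(2) have "upclosed (F \<inter> G)" unfolding upclosed_def by blast
  then have "fin_hom {v\<in>V. nz_support J g v \<in> F \<inter> G}" using assms(1) unfolding finite_lattice_def by blast
  moreover have "{v\<in>V. nz_support J g v \<in> F \<inter> G} = {v \<in> {v\<in>V. nz_support J g v \<in> F}. nz_support J g v \<in> G}" by auto
  ultimately show "fin_hom {v \<in> {v\<in>V. nz_support J g v \<in> F}. nz_support J g v \<in> G}" by simp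
qed

lemma finite_lattice_index_subset:
  assumes "finite_lattice J g V" "I \<subseteq> J"
  shows "finite_lattice I g V"
  unfolding finite_lattice_def
proof (intro allI impI)
  fix F assume F: "upclosed F"
  then have "upclosed {A. A \<inter> I \<in> F}"
    unfolding upclosed_def by (metis Int_mono mem_Collect_eq order_refl)
  then have "fin_hom {v\<in>V. nz_support J g v \<in> {A. A \<inter> I \<in> F}}" using assms(1) unfolding finite_lattice_def by blast
  moreover have "nz_support J g v \<inter> I = nz_support I g v" for v using assms(2) by (auto simp: nz_support_def)
  ultimately show "fin_hom {v\<in>V. nz_support I g v \<in> F}" by simp
qed

lemma finite_lattice_fin_hom:
  assumes "finite_lattice J g V" "upclosed F"
  shows "fin_hom {v\<in>V. nz_support J g v \<in> F}"
  using assms unfolding finite_lattice_def by blast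

definition complement :: "nat set \<Rightarrow> (nat \<Rightarrow> 'a \<Rightarrow> complex) \<Rightarrow> 'a set \<Rightarrow> 'a set" where
  "complement J g V = {v\<in>V. \<forall>k\<in>J. g k v \<noteq> 0}"

text \<open>The set \<open>complement J g V\<close> lies inside every {g_m \<noteq> 0} with m in
  \<open>J\<close>. All pieces of the cover and their intersections thus carry the same value, and
  gluing gives v + v - v = v.\<close>

lemma has_chi_over_cover:
  assumes "finite I" "I \<noteq> {}" "I \<subseteq> J" "finite_lattice J g V"
    and cont: "\<And>k. k \<in> J \<Longrightarrow> continuous_on V (g k)"
    and loc: "\<And>m W. m \<in> I \<Longrightarrow> W \<subseteq> V \<Longrightarrow> (\<And>v. v \<in> W \<Longrightarrow> g m v \<noteq> 0) \<Longrightarrow> finite_lattice J g W \<Longrightarrow>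
        has_chi {p\<in>T. fst p \<in> W} (c * chi (complement J g W))"
  shows "has_chi {p\<in>T. fst p \<in> V \<and> (\<exists>k\<in>I. g k (fst p) \<noteq> 0)} (c * chi (complement J g V))"
  using assms(1-4) cont loc
proof (induction I arbitrary: V rule: finite_ne_induct)
  case (singleton m)
  let ?W = "{v\<in>V. nz_support J g v \<in> {A. m \<in> A}}"
  have "finite_lattice J g ?W"
    by (rule finite_lattice_restrict[OF singleton.prems(2)]) (auto simp: upclosed_def)
  then have "has_chi {p\<in>T. fst p \<in> ?W} (c * chi (complement J g ?W))"
    by (intro singleton.prems(4)[of m]) (auto simp: nz_support_def)
  moreover have "complement J g ?W = complement J g V" "{p\<in>T. fst p \<in> ?W} = {p\<in>T. fst p \<in> V \<and> (\<exists>k\<in>{m}. g k (fst p) \<noteq> 0)}"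
    using singleton.prems(1) by (auto simp: complement_def nz_support_def)
  ultimately show ?case by simp
next
  case (insert m I)
  let ?W = "{v\<in>V. nz_support J g v \<in> {A. m \<in> A}}"
  have W: "finite_lattice J g ?W"
    by (rule finite_lattice_restrict[OF insert.prems(2)]) (auto simp: upclosed_def)
  have WV: "?W \<subseteq> V" by auto
  have cW: "complement J g ?W = complement J g V"
    using insert.prems(1) by (auto simp: complement_def nz_support_def)
  define A where "A = {p\<in>T. fst p \<in> ?W}"
  define B where "B = {p\<in>T. fst p \<in> V \<and> (\<exists>k\<in>I. g k (fst p) \<noteq> 0)}"
  have "has_chi A (c * chi (complement J g ?W))"
    unfolding A_def by (intro insert.prems(4)[of m] W) (auto simp: nz_support_def)
  then have 1: "has_chi A (c * chi (complement J g V))" unfolding cW .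
  have 2: "has_chi B (c * chi (complement J g V))"
    unfolding B_def
  proof (rule insert.IH)
    fix k U assume "k \<in> I" "U \<subseteq> V" "\<And>v. v \<in> U \<Longrightarrow> g k v \<noteq> 0" "finite_lattice J g U"
    then show "has_chi {p\<in>T. fst p \<in> U} (c * chi (complement J g U))"
      by (intro insert.prems(4)[of k]) auto
  qed (use insert.prems(1,2,3) in auto)
  \<comment> \<open>The intersection is the induction hypothesis with \<open>?W\<close> in place of
    \<open>V\<close>; this is why the induction keeps \<open>V\<close> arbitrary.\<close>
  have "has_chi {p\<in>T. fst p \<in> ?W \<and> (\<exists>k\<in>I. g k (fst p) \<noteq> 0)} (c * chi (complement J g ?W))"
  proof (rule insert.IH)
    show "finite_lattice J g ?W" by (rule W)
    show "continuous_on ?W (g k)" if "k \<in> J" for k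
      using insert.prems(3)[OF that] WV by (rule continuous_on_subset)
    fix k U assume "k \<in> I" "U \<subseteq> ?W" "\<And>v. v \<in> U \<Longrightarrow> g k v \<noteq> 0" "finite_lattice J g U"
    then show "has_chi {p\<in>T. fst p \<in> U} (c * chi (complement J g U))"
      by (intro insert.prems(4)[of k]) auto
  qed (use insert.prems(1) in auto)
  moreover have "{p\<in>T. fst p \<in> ?W \<and> (\<exists>k\<in>I. g k (fst p) \<noteq> 0)} = A \<inter> B"
    by (auto simp: A_def B_def)
  ultimately have 3: "has_chi (A \<inter> B) (c * chi (complement J g V))" unfolding cW by simp
  have op: "openin (top_of_set (A \<union> B)) {p \<in> A \<union> B. g k (fst p) \<in> - {0}}" if "k \<in> J" for k
  proof (rule continuous_openin_preimage_gen[where S = "A \<union> B" and f = "\<lambda>p. g k (fst p)" and T = "- {0}", simplified vimage_def Int_def mem_Collect_eq])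
    show "continuous_on (A \<union> B) (\<lambda>p. g k (fst p))"
      by (rule continuous_on_compose2[OF insert.prems(3)[OF that]])
         (auto simp: A_def B_def intro!: continuous_intros)
  qed (simp add: open_Compl)
  have "A = {p \<in> A \<union> B. g m (fst p) \<in> - {0}}"
    using insert.prems(1) by (auto simp: A_def B_def nz_support_def)
  then have oA: "openin (top_of_set (A \<union> B)) A" using op[of m] insert.prems(1) by simp
  have "B = (\<Union>k\<in>I. {p \<in> A \<union> B. g k (fst p) \<in> - {0}})"
    by (auto simp: A_def B_def nz_support_def)
  moreover have "openin (top_of_set (A \<union> B)) (\<Union>k\<in>I. {p \<in> A \<union> B. g k (fst p) \<in> - {0}})"
    using op insert.prems(1) by (intro openin_Union) auto
  ultimately have oB: "openin (top_of_set (A \<union> B)) B" by simp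
  have "A \<union> B = {p\<in>T. fst p \<in> V \<and> (\<exists>k\<in>insert m I. g k (fst p) \<noteq> 0)}"
    using insert.prems(1) by (auto simp: A_def B_def nz_support_def)
  with has_chi_Un[OF oA oB 1 2 3] show ?case by simp
qed

lemma continuous_on_torus_map:
  assumes "\<And>k. k \<in> J \<Longrightarrow> continuous_on S (\<lambda>p. F p k)"
  shows "continuous_on S (\<lambda>p k. if k \<in> J then F p k else (0::complex))"
proof (intro continuous_on_coordinatewise_then_product)
  fix k show "continuous_on S (\<lambda>p. if k \<in> J then F p k else 0)"
    using assms by (cases "k \<in> J") auto
qed

lemma continuous_on_fst_compose:
  "continuous_on V f \<Longrightarrow> fst ` S \<subseteq> V \<Longrightarrow> continuous_on S (\<lambda>p. f (fst p))"
  by (rule continuous_on_compose2) (auto intro: continuous_intros)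

text \<open>Where \<open>g m\<close> is nonzero the equation is solved for \<open>z m\<close>, which
  is nonzero exactly when the remaining sum \<open>h\<close> differs from 1. Off h = 0 the remaining
  variables form a \<open>level\<close> with one variable fewer times a free scale, and excluding h
  = 1 there contributes a factor -1 for each variable eliminated.\<close>

lemma level_has_chi:
  assumes "finite J" "J \<noteq> {}" "finite_lattice J g V" "\<And>k. k \<in> J \<Longrightarrow> continuous_on V (g k)"
  shows "has_chi (level J g V) ((-1) ^ (card J - 1) * chi (complement J g V))"
  using assms
proof (induction "card J" arbitrary: J V)
  case 0
  then show ?case by simp
next
  case (Suc n)
  have loc: "has_chi {p \<in> level J g V. fst p \<in> W} ((-1) ^ (card J - 1) * chi (complement J g W))"
    if m: "m \<in> J" and WV: "W \<subseteq> V" and nz: "\<And>v. v \<in> W \<Longrightarrow> g m v \<noteq> 0" and W: "finite_lattice J g W" for m W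
  proof -
    define I where "I = J - {m}"
    have I: "finite I" "m \<notin> I" "J = insert m I" "card I = n" using m Suc by (auto simp: I_def)
    have contW: "continuous_on W (g k)" if "k \<in> J" for k
      using Suc.prems(4)[OF that] WV by (rule continuous_on_subset)
    define h where "h p = (\<Sum>k\<in>I. snd p k * g k (fst p))" for p :: "'a \<times> (nat \<Rightarrow> complex)"
    have conth: "continuous_on S h" if "fst ` S \<subseteq> W" for S
      unfolding h_def
      by (intro continuous_intros continuous_on_fst_compose[OF contW] that) (use I in auto)
    define X where "X = W \<times> torus I"
    have fX: "fst ` X \<subseteq> W" by (auto simp: X_def)
    let ?L = "{p \<in> level J g V. fst p \<in> W}"
    \<comment> \<open>\<open>A\<close> and \<open>B\<close> cover \<open>X\<close>, as
      \<open>h\<close> is never 0 and 1 at once. If \<open>I\<close> is nonempty, \<open>X\<close>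
      and \<open>A\<close> have value 0, so \<open>B\<close> has the value of
      \<open>A \<inter> B\<close>, a \<open>level\<close> times the plane without two
      points.\<close>
    define A where "A = {p\<in>X. h p \<in> - {0}}"
    define B where "B = {p\<in>X. h p \<in> - {1}}"
    have LB: "has_chi ?L c \<longleftrightarrow> has_chi B c" for c
    proof (rule has_chi_homeomorphism)
      let ?f = "\<lambda>p::'a \<times> (nat \<Rightarrow> complex). (fst p, \<lambda>k. if k \<in> I then snd p k else 0)"
      let ?g = "\<lambda>p::'a \<times> (nat \<Rightarrow> complex). (fst p, \<lambda>k. if k \<in> J then (if k = m then (1 - h p) / g m (fst p) else snd p k) else 0)"
      have hf: "h (?f p) = h p" for p unfolding h_def by (auto intro: sum.cong)
      have hsum: "(\<Sum>k\<in>J. z k * g k v) = z m * g m v + h (v, z)" for v z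
        using I by (simp add: h_def)
      have hg: "h (?g p) = h p" for p unfolding h_def by (rule sum.cong) (use I in auto)
      show "continuous_on ?L ?f"
        by (intro continuous_intros continuous_on_torus_map)
      have "continuous_on B (\<lambda>p. if k = m then (1 - h p) / g m (fst p) else snd p k)" for k
        by (cases "k = m"; simp)
           (intro continuous_intros conth continuous_on_fst_compose[OF contW[OF m]]; use nz in \<open>auto simp: B_def X_def\<close>)+
      then show "continuous_on B ?g"
        by (intro continuous_intros continuous_on_torus_map)
      fix p assume p: "p \<in> ?L"
      then have v: "fst p \<in> W" and z: "snd p \<in> torus J" and eq: "snd p m * g m (fst p) + h p = 1"
        using hsum[of "snd p" "fst p"] by (auto simp: level_def)
      have zm: "snd p m \<noteq> 0" using z m by (simp add: torus_def)
      have "h p \<noteq> 1" using eq zm nz[OF v] by auto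
      moreover have "(1 - h p) / g m (fst p) = snd p m" using eq nz[OF v] by (simp add: field_simps)
      ultimately show "?f p \<in> B \<and> ?g (?f p) = p"
        using v z I by (auto simp: B_def X_def hf torus_def fun_eq_iff prod_eq_iff)
    next
      let ?f = "\<lambda>p::'a \<times> (nat \<Rightarrow> complex). (fst p, \<lambda>k. if k \<in> I then snd p k else 0)"
      let ?g = "\<lambda>p::'a \<times> (nat \<Rightarrow> complex). (fst p, \<lambda>k. if k \<in> J then (if k = m then (1 - h p) / g m (fst p) else snd p k) else 0)"
      have hsum: "(\<Sum>k\<in>J. z k * g k v) = z m * g m v + h (v, z)" for v z
        using I by (simp add: h_def)
      have hg: "h (?g p) = h p" for p unfolding h_def by (rule sum.cong) (use I in auto)
      fix p assume p: "p \<in> B"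
      then have v: "fst p \<in> W" and z: "snd p \<in> torus I" and h1: "h p \<noteq> 1" by (auto simp: B_def X_def)
      have "snd (?g p) \<in> torus J" using z h1 nz[OF v] by (auto simp: torus_def I(3))
      moreover have "(\<Sum>k\<in>J. snd (?g p) k * g k (fst p)) = 1"
        using hsum[of "snd (?g p)" "fst p"] hg[of p] nz[OF v] m by simp
      ultimately have "?g p \<in> ?L" using v WV by (auto simp: level_def)
      then show "?g p \<in> ?L \<and> ?f (?g p) = p"
        using z I by (auto simp: torus_def fun_eq_iff prod_eq_iff)
    qed
    have hW: "has_chi W (chi W)"
      using finite_lattice_fin_hom[OF W, of UNIV] by (simp add: upclosed_def has_chi_chi)
    have X: "has_chi X (if I = {} then chi W else 0)"
      unfolding X_def by (rule has_chi_times_torus[OF I(1) hW])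
    show ?thesis
    proof (cases "I = {}")
      case True
      then have "B = X" by (auto simp: B_def h_def)
      moreover have "complement J g W = W" using nz True I by (auto simp: complement_def)
      ultimately show ?thesis using LB X True I by simp
    next
      case False
      let ?c = "(-1) ^ (card I - 1) * chi (complement I g W)"
      have E: "has_chi (level I g W) ?c"
      proof (rule Suc.hyps(1))
        show "finite_lattice I g W" using W finite_lattice_index_subset I by blast
        show "\<And>k. k \<in> I \<Longrightarrow> continuous_on W (g k)" using contW I by blast
      qed (use I False in auto)
      \<comment> \<open>Dividing \<open>z\<close> by \<open>h\<close> normalizes the sum to 1, and
        \<open>h\<close> itself becomes the second coordinate.\<close>
      have prod: "has_chi {p\<in>X. h p \<in> P} c \<longleftrightarrow> has_chi (level I g W \<times> P) c" if P: "0 \<notin> P" for P c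
      proof (rule has_chi_homeomorphism)
        let ?f = "\<lambda>p::'a \<times> (nat \<Rightarrow> complex). ((fst p, \<lambda>k. if k \<in> I then snd p k / h p else 0), h p)"
        let ?g = "\<lambda>q::('a \<times> (nat \<Rightarrow> complex)) \<times> complex. (fst (fst q), \<lambda>k. if k \<in> I then snd (fst q) k * snd q else 0)"
        show "continuous_on {p\<in>X. h p \<in> P} ?f"
          by (intro continuous_intros continuous_on_torus_map conth; use fX P in auto)
        show "continuous_on (level I g W \<times> P) ?g"
          by (intro continuous_intros continuous_on_torus_map)
        fix p assume p: "p \<in> {p\<in>X. h p \<in> P}"
        then have "h p \<noteq> 0" using P by auto
        moreover have "(\<Sum>k\<in>I. (if k \<in> I then snd p k / h p else 0) * g k (fst p)) = h p / h p"
          unfolding h_def sum_divide_distrib by (rule sum.cong) simp_all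
        ultimately show "?f p \<in> level I g W \<times> P \<and> ?g (?f p) = p"
          using p by (auto simp: X_def level_def torus_def fun_eq_iff prod_eq_iff)
      next
        let ?f = "\<lambda>p::'a \<times> (nat \<Rightarrow> complex). ((fst p, \<lambda>k. if k \<in> I then snd p k / h p else 0), h p)"
        let ?g = "\<lambda>q::('a \<times> (nat \<Rightarrow> complex)) \<times> complex. (fst (fst q), \<lambda>k. if k \<in> I then snd (fst q) k * snd q else 0)"
        fix q assume q: "q \<in> level I g W \<times> P"
        then have 1: "snd q \<noteq> 0" "(\<Sum>k\<in>I. snd (fst q) k * g k (fst (fst q))) = 1"
          using P by (auto simp: level_def)
        have "h (?g q) = snd q * (\<Sum>k\<in>I. snd (fst q) k * g k (fst (fst q)))"
          unfolding h_def sum_distrib_left by (rule sum.cong) auto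
        then have "h (?g q) = snd q" using 1 by simp
        then show "?g q \<in> {p\<in>X. h p \<in> P} \<and> ?f (?g q) = q"
          using q 1 by (auto simp: X_def level_def torus_def fun_eq_iff prod_eq_iff)
      qed
      have "has_chi (level I g W \<times> (UNIV - {0::complex})) 0"
        by (rule has_chi_punctured_factor[OF _ _ _ E]) auto
      then have A0: "has_chi A 0" using prod[of "- {0}"] by (simp add: A_def Compl_eq_Diff_UNIV)
      have "has_chi (level I g W \<times> (UNIV - {0::complex, 1})) (?c - int (card {0, 1::complex}) * ?c)"
        using E has_chi_convex_factor[of "UNIV :: complex set" "level I g W" ?c]
        by (intro has_chi_remove_points_factor) auto
      moreover have "{p\<in>X. h p \<in> UNIV - {0::complex, 1}} = A \<inter> B" by (auto simp: A_def B_def)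
      ultimately have AB: "has_chi (A \<inter> B) (- ?c)" using prod[of "UNIV - {0::complex, 1}"] by (simp add: mult.commute)
      have un: "A \<union> B = X" by (auto simp: A_def B_def)
      have op: "openin (top_of_set (A \<union> B)) {p\<in>X. h p \<in> U}" if "open U" for U
        unfolding un using continuous_openin_preimage_gen[OF conth[OF fX] that]
        by (simp add: vimage_def Int_def)
      have "has_chi B (0 + - ?c - 0)"
        by (rule has_chi_part[OF _ _ A0 AB])
           (use op[of "- {0}"] op[of "- {1}"] X un False in \<open>auto simp: A_def B_def open_Compl\<close>)
      moreover have "complement J g W = complement I g W" using nz I by (auto simp: complement_def)
      moreover have "card J - 1 = Suc (card I - 1)" using I False card_gt_0_iff[of I] by simp
      ultimately show ?thesis using LB by simp
    qed
  qed
  have "has_chi {p \<in> level J g V. fst p \<in> V \<and> (\<exists>k\<in>J. g k (fst p) \<noteq> 0)} ((-1) ^ (card J - 1) * chi (complement J g V))"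
    by (rule has_chi_over_cover) (use Suc.prems loc in auto)
  moreover have "{p \<in> level J g V. fst p \<in> V \<and> (\<exists>k\<in>J. g k (fst p) \<noteq> 0)} = level J g V"
  proof -
    have "\<exists>k\<in>J. g k v \<noteq> 0" if "(\<Sum>k\<in>J. z k * g k v) = 1" for v z
    proof (rule ccontr)
      assume "\<not> (\<exists>k\<in>J. g k v \<noteq> 0)"
      then have "(\<Sum>k\<in>J. z k * g k v) = 0" by (intro sum.neutral) simp
      with that show False by simp
    qed
    then show ?thesis by (auto simp: level_def)
  qed
  ultimately show ?case by simp
qed

text \<open>The equation is homogeneous in \<open>z\<close>. Where \<open>f m\<close> is nonzero a
  solution is rescaled from z_0 = 1 to z_m f_m = -1; the other coordinates then form a
  \<open>level\<close> in n variables, whence the exponent \<open>n - 1\<close>.\<close>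

lemma hyper_has_chi:
  fixes V :: "'a::topological_space set"
  assumes n: "n \<ge> 1" and V: "finite_lattice {..n} f V" and cont: "\<And>k. k \<le> n \<Longrightarrow> continuous_on V (f k)"
  shows "has_chi {p \<in> hyper n f V. \<exists>k\<le>n. f k (fst p) \<noteq> 0} ((-1) ^ (n - 1) * chi (complement {..n} f V))"
proof -
  have "has_chi {p \<in> hyper n f V. fst p \<in> V \<and> (\<exists>k\<in>{..n}. f k (fst p) \<noteq> 0)}
      ((-1) ^ (n - 1) * chi (complement {..n} f V))"
  proof (rule has_chi_over_cover[where J = "{..n}"])
    fix m W assume m: "m \<in> {..n}" and WV: "W \<subseteq> V" and nz: "\<And>v. v \<in> W \<Longrightarrow> f m v \<noteq> 0"
      and W: "finite_lattice {..n} f W"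
    define I where "I = {..n} - {m}"
    have I: "finite I" "I \<noteq> {}" "card I = n" "m \<notin> I" "{..n} = insert m I"
    proof -
      show c: "card I = n" using m by (simp add: I_def)
      then show "I \<noteq> {}" using n by (cases "I = {}") auto
    qed (use m in \<open>auto simp: I_def\<close>)
    have contW: "continuous_on W (f k)" if "k \<le> n" for k
      using cont[OF that] WV by (rule continuous_on_subset)
    let ?L = "{p \<in> hyper n f V. fst p \<in> W}"
    define F where "F p = (fst p, \<lambda>k. if k \<in> I then - snd p k / (f m (fst p) * snd p m) else 0)"
      for p :: "'a \<times> (nat \<Rightarrow> complex)"
    \<comment> \<open>The rescaled solution; dividing by its entry at 0 restores z_0 = 1, also when
      m = 0.\<close>
    define w where "w p k = (if k = m then - 1 / f m (fst p) else snd p k)"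
      for p :: "'a \<times> (nat \<Rightarrow> complex)" and k
    define G where "G p = (fst p, \<lambda>k. if k \<in> {..n} then w p k / w p 0 else 0)" for p
    have sumw: "(\<Sum>k\<le>n. w p k * f k (fst p)) = (\<Sum>k\<in>I. snd p k * f k (fst p)) - 1"
      if "fst p \<in> W" for p
    proof -
      have "(\<Sum>k\<in>I. w p k * f k (fst p)) = (\<Sum>k\<in>I. snd p k * f k (fst p))"
        by (rule sum.cong) (use I in \<open>auto simp: w_def\<close>)
      then show ?thesis using I nz[OF that] by (simp add: I(5)) (simp add: w_def)
    qed
    have "has_chi ?L c \<longleftrightarrow> has_chi (level I f W) c" for c
    proof (rule has_chi_homeomorphism)
      have LW: "fst ` ?L \<subseteq> W" by auto
      have "\<forall>p\<in>?L. f m (fst p) * snd p m \<noteq> 0"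
        using nz m by (fastforce simp: hyper_def torus_def)
      then show "continuous_on ?L F"
        unfolding F_def
        by (intro continuous_intros continuous_on_torus_map continuous_on_fst_compose[OF contW LW]) (use m in auto)
      have LW': "fst ` level I f W \<subseteq> W" by (auto simp: level_def)
      have wc: "continuous_on (level I f W) (\<lambda>p. w p k)" for k
        unfolding w_def
        by (cases "k = m"; simp)
           (intro continuous_intros continuous_on_fst_compose[OF contW LW']; use m nz in \<open>auto simp: level_def\<close>)+
      have "\<forall>p\<in>level I f W. w p 0 \<noteq> 0"
      proof
        fix p assume "p \<in> level I f W"
        then show "w p 0 \<noteq> 0" using nz[of "fst p"] I by (auto simp: level_def torus_def w_def)
      qed
      then show "continuous_on (level I f W) G"
        unfolding G_def by (intro continuous_intros continuous_on_torus_map wc)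
      fix p assume p: "p \<in> ?L"
      then have v: "fst p \<in> W" and z: "snd p \<in> torus {..n}" "snd p 0 = 1"
        and eq: "(\<Sum>k\<le>n. snd p k * f k (fst p)) = 0" by (auto simp: hyper_def)
      have zm: "snd p m \<noteq> 0" "f m (fst p) \<noteq> 0" using z m nz[OF v] by (auto simp: torus_def)
      have "(\<Sum>k\<in>I. snd (F p) k * f k (fst p)) = (\<Sum>k\<in>I. snd p k * f k (fst p)) * (- 1 / (f m (fst p) * snd p m))"
        unfolding sum_distrib_right F_def by (rule sum.cong) auto
      also have "(\<Sum>k\<in>I. snd p k * f k (fst p)) = - (snd p m * f m (fst p))"
        using eq I by (simp add: I(5) eq_neg_iff_add_eq_0 add.commute)
      finally have "(\<Sum>k\<in>I. snd (F p) k * f k (fst p)) = 1" using zm by (simp add: field_simps)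
      then have FL: "F p \<in> level I f W"
        using v z zm I by (auto simp: level_def F_def torus_def)
      have w: "w (F p) k = - snd p k / (f m (fst p) * snd p m)" if "k \<le> n" for k
        using that zm I by (auto simp: w_def F_def divide_simps)
      have "G (F p) = p"
      proof (rule prod_eqI)
        show "snd (G (F p)) = snd p"
        proof
          fix k
          have "snd p k = 0" if "\<not> k \<le> n" using z that by (auto simp: torus_def)
          moreover have "w (F p) k / w (F p) 0 = snd p k" if "k \<le> n"
            using w[OF that] w[of 0] z zm by simp
          ultimately show "snd (G (F p)) k = snd p k" by (simp add: G_def)
        qed
      qed (simp add: G_def F_def)
      with FL show "F p \<in> level I f W \<and> G (F p) = p" by blast
    next
      fix p assume p: "p \<in> level I f W"
      then have v: "fst p \<in> W" and z: "snd p \<in> torus I" and eq: "(\<Sum>k\<in>I. snd p k * f k (fst p)) = 1"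
        by (auto simp: level_def)
      have fm: "f m (fst p) \<noteq> 0" using nz v by blast
      have wnz: "w p k \<noteq> 0" if "k \<le> n" for k using z that fm I by (auto simp: w_def torus_def)
      have "(\<Sum>k\<le>n. snd (G p) k * f k (fst p)) = (\<Sum>k\<le>n. w p k * f k (fst p)) / w p 0"
        unfolding G_def sum_divide_distrib by (rule sum.cong) auto
      then have "(\<Sum>k\<le>n. snd (G p) k * f k (fst p)) = 0" using sumw[OF v] eq by simp
      then have "G p \<in> ?L" using v WV wnz by (auto simp: hyper_def G_def torus_def)
      moreover have "F (G p) = p"
      proof (rule prod_eqI)
        have Gk: "snd (G p) k = w p k / w p 0" if "k \<le> n" for k using that by (simp add: G_def)
        have wm: "w p m = - 1 / f m (fst p)" by (simp add: w_def)
        show "snd (F (G p)) = snd p"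
        proof
          fix k
          show "snd (F (G p)) k = snd p k"
          proof (cases "k \<in> I")
            case True
            then have "k \<le> n" "k \<noteq> m" using I by auto
            then have "snd (F (G p)) k = - (w p k / w p 0) / (f m (fst p) * (w p m / w p 0))"
              using True m Gk by (simp add: F_def G_def)
            also have "\<dots> = snd p k"
              unfolding wm using fm wnz[of 0] \<open>k \<noteq> m\<close> by (simp add: w_def field_simps)
            finally show ?thesis .
          next
            case False
            then show ?thesis using z by (auto simp: F_def torus_def)
          qed
        qed
      qed (simp add: G_def F_def)
      ultimately show "G p \<in> ?L \<and> F (G p) = p" by blast
    qed
    moreover have "has_chi (level I f W) ((-1) ^ (card I - 1) * chi (complement I f W))"
    proof (rule level_has_chi)
      show "finite_lattice I f W" using W finite_lattice_index_subset I by blast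
    qed (use I contW in auto)
    moreover have "complement I f W = complement {..n} f W"
      using nz I by (auto simp: complement_def)
    ultimately show "has_chi ?L ((-1) ^ (n - 1) * chi (complement {..n} f W))" using I by simp
  qed (use V cont in auto)
  moreover have "{p \<in> hyper n f V. fst p \<in> V \<and> (\<exists>k\<in>{..n}. f k (fst p) \<noteq> 0)} = {p \<in> hyper n f V. \<exists>k\<le>n. f k (fst p) \<noteq> 0}"
    by (auto simp: hyper_def)
  ultimately show ?thesis by simp
qed

section \<open>The hypersurface as a family over the torus of (x, y)\<close>

definition unit_plane :: "(complex \<times> complex) set" where
  "unit_plane = {(x, y). x \<noteq> 0 \<and> y \<noteq> 0}"

definition form :: "coeffs \<Rightarrow> nat \<Rightarrow> complex \<times> complex \<Rightarrow> complex" where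
  "form W k v = f_poly W k (fst v) (snd v)"

text \<open>The encodings differ only in the coordinates of \<open>z\<close> outside
  \<open>{1..n}\<close>: undefined in \<open>Y_hyp\<close>, but 1 at index 0 and 0 beyond
  \<open>n\<close> in \<open>hyper\<close>.\<close>

lemma euler_characteristic_Y_hyp:
  "euler_characteristic (Y_hyp W n) = chi (hyper n (form W) unit_plane)"
proof -
  let ?S = "{(x, y, z). x \<noteq> 0 \<and> y \<noteq> 0 \<and> (\<forall>k\<in>{1..n}. z k \<noteq> 0) \<and>
                 f_poly W 0 x y + (\<Sum>k=1..n. z k * f_poly W k x y) = 0}"
  let ?f = "\<lambda>p::complex \<times> complex \<times> (nat \<Rightarrow> complex). ((fst p, fst (snd p)), \<lambda>k. if k = 0 then 1 else if k \<in> {1..n} then snd (snd p) k else 0)"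
  let ?g = "\<lambda>p::(complex \<times> complex) \<times> (nat \<Rightarrow> complex). (fst (fst p), snd (fst p), restrict (snd p) {1..n})"
  have set: "{..n} = insert 0 {1..n}" by auto
  have "homeomorphic_maps (Y_hyp W n) (top_of_set (hyper n (form W) unit_plane)) ?f ?g"
    unfolding homeomorphic_maps_def
  proof (intro conjI ballI)
    have c1: "continuous_map (affine_space n) euclidean (\<lambda>p. fst p)"
      "continuous_map (affine_space n) euclidean (\<lambda>p. fst (snd p))"
      "k \<in> {1..n} \<Longrightarrow> continuous_map (affine_space n) euclidean (\<lambda>p. snd (snd p) k)" for k
      unfolding affine_space_def
      by (auto intro!: continuous_map_fst_of continuous_map_snd_of continuous_map_compose[OF continuous_map_snd, unfolded o_def]
           continuous_map_fst continuous_map_snd continuous_map_product_projection)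
    have eucl: "(euclidean :: ((complex \<times> complex) \<times> (nat \<Rightarrow> complex)) topology)
        = prod_topology (prod_topology euclidean euclidean) (product_topology (\<lambda>_. euclidean) UNIV)"
      by (simp add: euclidean_product_topology)
    have "continuous_map (affine_space n) euclidean ?f"
      unfolding eucl continuous_map_pairwise o_def fst_conv snd_conv continuous_map_componentwise_UNIV
      using c1 by auto
    then show "continuous_map (Y_hyp W n) (top_of_set (hyper n (form W) unit_plane)) ?f"
      unfolding Y_hyp_def continuous_map_in_subtopology
      by (auto simp: continuous_map_from_subtopology hyper_def unit_plane_def torus_def set form_def)
    have "continuous_map euclidean (affine_space n) ?g"
      unfolding affine_space_def continuous_map_pairwise o_def fst_conv snd_conv continuous_map_componentwise
      by (auto intro!: continuous_intros continuous_on_subset[OF continuous_on_snd_coordinate])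
    then show "continuous_map (top_of_set (hyper n (form W) unit_plane)) (Y_hyp W n) ?g"
      unfolding Y_hyp_def continuous_map_in_subtopology
      by (auto simp: continuous_map_from_subtopology hyper_def unit_plane_def torus_def set form_def)
  next
    fix x assume "x \<in> topspace (Y_hyp W n)"
    then have "snd (snd x) \<in> extensional {1..n}" 
      by (auto simp: Y_hyp_def affine_space_def PiE_def)
    then show "?g (?f x) = x"
      by (auto simp: prod_eq_iff fun_eq_iff extensional_def)
  next
    fix y assume "y \<in> topspace (top_of_set (hyper n (form W) unit_plane))"
    then show "?f (?g y) = y"
      by (auto simp: prod_eq_iff fun_eq_iff hyper_def torus_def)
  qed
  then have "Y_hyp W n homeomorphic_space top_of_set (hyper n (form W) unit_plane)"
    unfolding homeomorphic_space_def by blast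
  then show ?thesis
    unfolding chi_def by (intro homotopy_equivalent_finite_homology homeomorphic_imp_homotopy_equivalent_space)
qed

section \<open>Local structure at a common zero\<close>

lemma additive_homeo:
  assumes "continuous_on X f" "continuous_on Y g"
    and f: "\<And>x. x \<in> X \<Longrightarrow> f x \<in> Y \<and> g (f x) = x \<and> (f x \<in> Z' \<longleftrightarrow> x \<in> Z)"
    and g: "\<And>y. y \<in> Y \<Longrightarrow> g y \<in> X \<and> f (g y) = y"
    and Y: "additive Y Z'"
  shows "additive X Z"
proof -
  have gZ: "g y \<in> Z \<longleftrightarrow> y \<in> Z'" if "y \<in> Y" for y using f[of "g y"] g[OF that] by auto
  have part: "has_chi (X \<inter> P) c \<longleftrightarrow> has_chi (Y \<inter> Q) c"
    if "\<And>x. x \<in> X \<Longrightarrow> f x \<in> Q \<longleftrightarrow> x \<in> P" for P Q c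
  proof (rule has_chi_homeomorphism)
    show "continuous_on (X \<inter> P) f" "continuous_on (Y \<inter> Q) g"
      using assms(1,2) continuous_on_subset by blast+
    show "x \<in> X \<inter> P \<Longrightarrow> f x \<in> Y \<inter> Q \<and> g (f x) = x" for x using f[of x] that[of x] by auto
    show "y \<in> Y \<inter> Q \<Longrightarrow> g y \<in> X \<inter> P \<and> f (g y) = y" for y using g[of y] that[of "g y"] by auto
  qed
  have "has_chi (X - Z) c \<longleftrightarrow> has_chi (Y - Z') c" for c
    using part[of "- Z'" "- Z"] f by (simp add: Diff_eq)
  moreover have "has_chi (X \<inter> Z) c \<longleftrightarrow> has_chi (Y \<inter> Z') c" for c
    using part[of "Z'" "Z"] f by blast
  moreover have "has_chi X c \<longleftrightarrow> has_chi Y c" for c using part[of UNIV UNIV] by simp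
  ultimately show ?thesis using Y unfolding additive_def has_chi_def by metis
qed

text \<open>The bundle contracts to its zero section, and the punctured bundle has value 0.\<close>

lemma additive_disc_bundle:
  fixes r :: "'a::topological_space \<Rightarrow> real"
  assumes r: "continuous_on E r" "\<And>e. e \<in> E \<Longrightarrow> r e > 0" and E: "fin_hom E"
  shows "additive {(e, s::complex). e \<in> E \<and> norm s < r e} (UNIV \<times> {0})"
proof (rule additiveI)
  let ?D = "{(e, s::complex). e \<in> E \<and> norm s < r e}"
  show "has_chi ?D (0 + chi E)" using has_chi_disc_bundle[OF r] has_chi_chi[OF E] by simp
  have "?D - UNIV \<times> {0} = {(e, s). e \<in> E \<and> s \<noteq> 0 \<and> norm s < r e}" by auto
  then show "has_chi (?D - UNIV \<times> {0}) 0"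
    using has_chi_punctured_disc_bundle[OF r has_chi_chi[OF E]] by simp
  have "?D \<inter> UNIV \<times> {0} = E \<times> {0}" using r(2) by auto
  then show "has_chi (?D \<inter> UNIV \<times> {0}) (chi E)"
    using has_chi_convex_factor[of "{0::complex}" E] has_chi_chi[OF E] by simp
qed

lemma has_chi_swap:
  "has_chi {(a, b). P a b} c \<longleftrightarrow> has_chi {(b, a). P a b} c"
  by (rule has_chi_homeomorphism[where f = prod.swap and g = prod.swap])
     (auto simp: prod.swap_def intro!: continuous_intros)

definition polydisc :: "real \<Rightarrow> (complex \<times> complex) set" where
  "polydisc r = {(a, b). norm a < r \<and> norm b < r}"

lemma polydisc_eq: "polydisc r = ball 0 r \<times> ball 0 r"
  by (auto simp: polydisc_def)

lemma zero_in_polydisc [simp]: "0 \<in> polydisc r \<longleftrightarrow> r > 0"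
  by (simp add: polydisc_def zero_prod_def)

lemma has_chi_polydisc: "r > 0 \<Longrightarrow> has_chi (polydisc r) 1"
  unfolding polydisc_eq
  by (rule has_chi_contractible) (auto intro!: convex_imp_contractible convex_Times)

lemma open_polydisc: "open (polydisc r)"
  unfolding polydisc_eq by (intro open_Times open_ball)

lemma has_chi_punctured_convex:
  fixes U :: "complex set"
  assumes "convex U" "open U" "a \<in> U"
  shows "has_chi (U - {a}) 0"
proof -
  have "has_chi (U - {a}) 0 \<longleftrightarrow> has_chi ({0::complex} \<times> (U - {a})) 0"
    by (rule has_chi_homeomorphism[where f = "\<lambda>u. (0, u)" and g = snd]) (auto intro!: continuous_intros)
  then show ?thesis using has_chi_punctured_factor[OF assms has_chi_singleton] by simp
qed

text \<open>Covered by the two parts in which one given coordinate is nonzero; these parts and their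
  intersection all have a punctured disc as a factor.\<close>

lemma has_chi_punctured_polydisc:
  assumes "r > 0"
  shows "has_chi (polydisc r - {0}) 0"
proof -
  let ?B = "ball (0::complex) r" and ?P = "ball (0::complex) r - {0}"
  have B: "has_chi ?B 1" using assms by (intro has_chi_contractible) (auto intro!: convex_imp_contractible)
  have P: "has_chi ?P 0"
    using assms by (intro has_chi_punctured_convex) auto
  have 1: "has_chi (?B \<times> ?P) 0" using has_chi_punctured_factor[of ?B 0 ?B 1] B assms by simp
  have 2: "has_chi (?P \<times> ?B) 0" using has_chi_convex_factor[of ?B ?P 0] P assms by simp
  have 3: "has_chi (?P \<times> ?B \<inter> ?B \<times> ?P) 0"
  proof -
    have "?P \<times> ?B \<inter> ?B \<times> ?P = ?P \<times> ?P" by auto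
    then show ?thesis using has_chi_punctured_factor[of ?B 0 ?P 0] P assms by simp
  qed
  have "polydisc r - {0} = ?P \<times> ?B \<union> ?B \<times> ?P" by (auto simp: polydisc_def zero_prod_def)
  moreover have "has_chi (?P \<times> ?B \<union> ?B \<times> ?P) (0 + 0 - 0)"
    by (rule has_chi_Un[OF _ _ 2 1 3]) (auto intro!: open_subset open_Times open_Diff)
  ultimately show ?thesis by simp
qed

lemma fin_hom_remove_origin:
  assumes "open T" "fin_hom T"
  shows "fin_hom (T - {0 :: complex \<times> complex})"
proof (cases "0 \<in> T")
  case True
  then obtain e where e: "e > 0" "ball 0 e \<subseteq> T" using assms(1) open_contains_ball by blast
  have sub: "polydisc (e / 2) \<subseteq> T"
  proof
    fix p assume "p \<in> polydisc (e / 2)"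
    then have "norm (fst p) + norm (snd p) < e" by (auto simp: polydisc_def)
    then have "norm p < e" using norm_Pair_le[of "fst p" "snd p"] by simp
    then show "p \<in> T" using e by auto
  qed
  let ?D = "polydisc (e / 2)"
  have un: "?D \<union> (T - {0}) = T" and int: "?D \<inter> (T - {0}) = ?D - {0}"
    using sub True e by auto
  have "has_chi (T - {0}) (chi T + 0 - 1)"
  proof (rule has_chi_part[of ?D])
    show "has_chi (?D \<inter> (T - {0})) 0" unfolding int using has_chi_punctured_polydisc[of "e / 2"] e by simp
    show "has_chi (?D \<union> (T - {0})) (chi T)" unfolding un by (rule has_chi_chi[OF assms(2)])
    show "has_chi ?D 1" using has_chi_polydisc[of "e / 2"] e by simp
    show "openin (top_of_set (?D \<union> (T - {0}))) ?D" "openin (top_of_set (?D \<union> (T - {0}))) (T - {0})"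
      unfolding un using sub assms(1) open_polydisc by (auto intro!: open_subset open_Diff)
  qed
  then show ?thesis by (simp add: has_chi_def)
qed (use assms in simp)

text \<open>The distance to the complement is a continuous choice of radius, from which the tubes
  below are cut out. The whole space is treated apart because \<open>infdist\<close> to the empty
  set is 0.\<close>

lemma open_radius:
  fixes S :: "'a::metric_space set"
  assumes "open S"
  obtains r :: "'a \<Rightarrow> real" where "continuous_on UNIV r" "\<And>q. q \<in> S \<Longrightarrow> r q > 0"
    "\<And>q q'. q \<in> S \<Longrightarrow> dist q q' < r q \<Longrightarrow> q' \<in> S"
proof (cases "S = UNIV")
  case True
  then show ?thesis using that[of "\<lambda>_. 1"] by auto
next
  case False
  let ?r = "\<lambda>q. infdist q (- S)"
  have ne: "- S \<noteq> {}" using False by auto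
  have cl: "closed (- S)" using assms by (simp add: closed_Compl)
  show ?thesis
  proof (rule that[of ?r])
    show "continuous_on UNIV ?r" by (intro continuous_intros)
    show "?r q > 0" if "q \<in> S" for q
      using in_closed_iff_infdist_zero[OF cl ne, of q] infdist_nonneg[of q "- S"] that by auto
    show "q' \<in> S" if "q \<in> S" "dist q q' < ?r q" for q q'
    proof (rule ccontr)
      assume "q' \<notin> S"
      then have "?r q \<le> dist q q'" by (intro infdist_le) auto
      with that show False by simp
    qed
  qed
qed

subsection \<open>Linear pencils\<close>

abbreviation origin_fibre :: "((complex \<times> complex) \<times> 'b) set" where
  "origin_fibre \<equiv> {0} \<times> UNIV"

text \<open>Normal form of the hypersurface at a zero where two forms are transverse:
  \<open>v\<close> holds the values of these two forms and \<eta> their shifted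
  coefficients.\<close>

definition linear_cone :: "((complex \<times> complex) \<times> (complex \<times> complex)) set \<Rightarrow> ((complex \<times> complex) \<times> (complex \<times> complex)) set" where
  "linear_cone W = {(v, \<eta>) \<in> W. fst \<eta> * fst v + snd \<eta> * snd v = 0}"

text \<open>For \<eta> \<noteq> 0 the solutions \<open>v\<close> are the multiples of (\<eta>_2,
  -\<eta>_1), so the tube is a disc bundle over \<open>E\<close> whose zero section is
  \<open>origin_fibre\<close>.\<close>

lemma linear_tube_additive:
  fixes r :: "complex \<times> complex \<Rightarrow> real"
  assumes E: "0 \<notin> E" "fin_hom E" and r: "continuous_on E r" "\<And>e. e \<in> E \<Longrightarrow> r e > 0"
  shows "additive (linear_cone {(v, \<eta>). \<eta> \<in> E \<and> v \<in> polydisc (r \<eta>)}) origin_fibre"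
proof -
  \<comment> \<open>\<open>m\<close> converts the bound on \<open>v\<close> into one on the scalar
    \<open>s\<close>; \<open>q\<close>, the squared norm of \<eta>, serves to recover
    \<open>s\<close> from \<open>v\<close> by a Hermitian product.\<close>
  define m where "m \<eta> = max (norm (fst \<eta>)) (norm (snd \<eta>))" for \<eta> :: "complex \<times> complex"
  define q where "q \<eta> = fst \<eta> * cnj (fst \<eta>) + snd \<eta> * cnj (snd \<eta>)" for \<eta> :: "complex \<times> complex"
  have m: "m \<eta> > 0" if "\<eta> \<in> E" for \<eta>
    using that E(1) by (cases \<eta>) (auto simp: m_def zero_prod_def less_max_iff_disj)
  have qnz: "q \<eta> \<noteq> 0" if "\<eta> \<in> E" for \<eta>
  proof -
    have "q \<eta> = complex_of_real ((norm (fst \<eta>))\<^sup>2 + (norm (snd \<eta>))\<^sup>2)"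
      by (simp only: q_def complex_norm_square of_real_add)
    then show ?thesis using that E(1)
      by (cases \<eta>) (auto simp: zero_prod_def sum_power2_eq_zero_iff simp del: of_real_add)
  qed
  let ?X = "linear_cone {(v, \<eta>). \<eta> \<in> E \<and> v \<in> polydisc (r \<eta>)}"
  let ?Y = "{(e, s::complex). e \<in> E \<and> norm s < r e / m e}"
  let ?f = "\<lambda>p::(complex \<times> complex) \<times> (complex \<times> complex).
     (snd p, (fst (fst p) * cnj (snd (snd p)) - snd (fst p) * cnj (fst (snd p))) / q (snd p))"
  let ?g = "\<lambda>p::(complex \<times> complex) \<times> complex. ((snd p * snd (fst p), - (snd p * fst (fst p))), fst p)"
  show ?thesis
  proof (rule additive_homeo[where f = ?f and g = ?g and Y = ?Y and Z' = "UNIV \<times> {0}"])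
    have "\<forall>p\<in>?X. q (snd p) \<noteq> 0" using qnz by (auto simp: linear_cone_def)
    then show "continuous_on ?X ?f" unfolding q_def by (intro continuous_intros)
    show "continuous_on ?Y ?g" by (intro continuous_intros)
    have "continuous_on E m" unfolding m_def by (intro continuous_intros)
    then have "continuous_on E (\<lambda>e. r e / m e)" using r m by (intro continuous_on_divide) force+
    then show "additive ?Y (UNIV \<times> {0})" using r m E by (intro additive_disc_bundle) auto
    fix p assume p: "p \<in> ?X"
    obtain v1 v2 e1 e2 where pp: "p = ((v1, v2), (e1, e2))" by (metis prod.collapse)
    define s where "s = snd (?f p)"
    have eE: "(e1, e2) \<in> E" and v: "norm v1 < r (e1, e2)" "norm v2 < r (e1, e2)" and eq: "e1 * v1 + e2 * v2 = 0"
      using p by (auto simp: pp linear_cone_def polydisc_def)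
    have s: "s * q (e1, e2) = v1 * cnj e2 - v2 * cnj e1" using qnz[OF eE] by (simp add: s_def pp)
    have "s * e2 * q (e1, e2) = v1 * q (e1, e2)"
    proof -
      have "s * e2 * q (e1, e2) = (v1 * cnj e2 - v2 * cnj e1) * e2" using s by (simp add: mult_ac)
      also have "\<dots> = v1 * q (e1, e2) - cnj e1 * (e1 * v1 + e2 * v2)" by (simp add: q_def algebra_simps)
      finally show ?thesis using eq by simp
    qed
    then have v1: "s * e2 = v1" using qnz[OF eE] by simp
    have "- (s * e1) * q (e1, e2) = v2 * q (e1, e2)"
    proof -
      have "- (s * e1) * q (e1, e2) = - (v1 * cnj e2 - v2 * cnj e1) * e1" unfolding s[symmetric] by (simp add: mult_ac)
      also have "\<dots> = v2 * q (e1, e2) - cnj e2 * (e1 * v1 + e2 * v2)" by (simp add: q_def algebra_simps)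
      finally show ?thesis using eq by simp
    qed
    then have v2: "- (s * e1) = v2" using qnz[OF eE] mult_right_cancel[of "q (e1, e2)" "- (s * e1)" v2] by blast
    have "norm s * m (e1, e2) < r (e1, e2)"
      using v by (auto simp: m_def max_def norm_mult simp flip: v1 v2)
    then have "norm s < r (e1, e2) / m (e1, e2)" using m[OF eE] by (simp add: field_simps)
    moreover have "s = 0 \<longleftrightarrow> (v1 = 0 \<and> v2 = 0)" using v1 v2 E(1) eE by (auto simp: zero_prod_def)
    ultimately show "?f p \<in> ?Y \<and> ?g (?f p) = p \<and> (?f p \<in> UNIV \<times> {0} \<longleftrightarrow> p \<in> origin_fibre)"
      using eE v1 v2 s_def by (auto simp: pp zero_prod_def)
  next
    fix p assume p: "p \<in> ?Y"
    obtain e1 e2 s where pp: "p = ((e1, e2), s)" by (metis prod.collapse)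
    have eE: "(e1, e2) \<in> E" and s: "norm s < r (e1, e2) / m (e1, e2)" using p by (auto simp: pp)
    have sm: "norm s * m (e1, e2) < r (e1, e2)" using s m[OF eE] by (simp add: field_simps)
    have "norm s * norm e1 \<le> norm s * m (e1, e2)" "norm s * norm e2 \<le> norm s * m (e1, e2)"
      by (auto simp: m_def intro!: mult_left_mono)
    then have "(s * e2, - (s * e1)) \<in> polydisc (r (e1, e2))"
      using sm by (auto simp: polydisc_def norm_mult)
    moreover have "(s * e2 * cnj e2 - - (s * e1) * cnj e1) / q (e1, e2) = s * q (e1, e2) / q (e1, e2)"
      by (simp add: q_def algebra_simps)
    ultimately show "?g p \<in> ?X \<and> ?f (?g p) = p"
      using eE qnz[OF eE] by (auto simp: pp linear_cone_def)
  qed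
qed

text \<open>Contracting the second factor is compatible with the equation, since it is linear in \<open>\<eta>\<close>.\<close>

lemma has_chi_contract_pencil:
  fixes a b :: "complex \<times> complex \<Rightarrow> complex"
  assumes "e > 0"
  shows "has_chi {(v, \<eta>). v \<in> V \<and> \<eta> \<in> polydisc e \<and> fst \<eta> * a v + snd \<eta> * b v = 0} c \<longleftrightarrow> has_chi V c"
proof -
  let ?S = "{(v, \<eta>). v \<in> V \<and> \<eta> \<in> polydisc e \<and> fst \<eta> * a v + snd \<eta> * b v = 0}"
  have "has_chi ?S c \<longleftrightarrow> has_chi (V \<times> {0 :: complex \<times> complex}) c"
  proof (rule has_chi_deformation[where H = "\<lambda>t p. (fst p, t *\<^sub>R snd p)"])
    show "V \<times> {0 :: complex \<times> complex} \<subseteq> ?S" using assms by (auto simp: polydisc_def zero_prod_def)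
    show "continuous_on ({0..1} \<times> ?S) (\<lambda>(t, p). (fst p, t *\<^sub>R snd p))"
      unfolding case_prod_unfold by (intro continuous_intros)
    fix t :: real and p assume t: "0 \<le> t" "t \<le> 1" and p: "p \<in> ?S"
    have "norm (t *\<^sub>R z) < e" if "norm z < e" for z :: complex
      using that t mult_left_le_one_le[of "norm z" t] by simp
    moreover have "fst (t *\<^sub>R \<eta>) * a v + snd (t *\<^sub>R \<eta>) * b v = t *\<^sub>R (fst \<eta> * a v + snd \<eta> * b v)" for v \<eta>
      by (simp add: algebra_simps)
    ultimately show "(fst p, t *\<^sub>R snd p) \<in> ?S"
      using p by (auto simp: polydisc_def)
  qed (auto simp: zero_prod_def)
  also have "\<dots> \<longleftrightarrow> has_chi V c" by (rule has_chi_convex_factor) auto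
  finally show ?thesis .
qed

text \<open>At \<eta> = 0 the line of solutions is not determined, but contracting \<eta> leaves the
  polydisc in \<open>v\<close>. The total value is 1, the part off \<open>v = 0\<close> has value 0,
  and the fibre is a polydisc in \<eta>.\<close>

lemma pencil_polydisc_additive:
  fixes a b :: "complex \<times> complex \<Rightarrow> complex"
  assumes "d > 0" "e > 0" "a 0 = 0" "b 0 = 0"
  shows "additive {(v, \<eta>). v \<in> polydisc d \<and> \<eta> \<in> polydisc e \<and> fst \<eta> * a v + snd \<eta> * b v = 0} origin_fibre"
    (is "additive ?X _")
proof (rule additiveI)
  show "has_chi ?X (0 + 1)"
    using has_chi_contract_pencil[OF assms(2), of "polydisc d"] has_chi_polydisc[OF assms(1)] by simp
  have "?X - origin_fibre = {(v, \<eta>). v \<in> polydisc d - {0} \<and> \<eta> \<in> polydisc e \<and> fst \<eta> * a v + snd \<eta> * b v = 0}"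
    by auto
  then show "has_chi (?X - origin_fibre) 0"
    using has_chi_contract_pencil[OF assms(2), of "polydisc d - {0}"] has_chi_punctured_polydisc[OF assms(1)] by simp
  have "?X \<inter> origin_fibre = {0} \<times> polydisc e" using assms by auto
  moreover have "has_chi ({0 :: complex \<times> complex} \<times> polydisc e) 1"
    using has_chi_convex_factor[of "polydisc e" "{0 :: complex \<times> complex}" 1] has_chi_singleton assms
    by (auto simp: polydisc_eq convex_Times)
  ultimately show "has_chi (?X \<inter> origin_fibre) 1" by simp
qed

lemma openin_Int_open: "open B \<Longrightarrow> A = S \<inter> B \<Longrightarrow> openin (top_of_set S) A"
  by (auto simp: openin_open)

lemma polydisc_dist:
  assumes "v \<in> polydisc r"
  shows "dist (0, \<eta>) (v, \<eta>) < 2 * r"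
proof -
  have "norm v \<le> norm (fst v) + norm (snd v)" using norm_Pair_le[of "fst v" "snd v"] by simp
  moreover have "dist (0, \<eta>) (v, \<eta>) = norm v" by (simp add: dist_Pair_Pair)
  ultimately show ?thesis using assms by (auto simp: polydisc_def)
qed

lemma open_contains_polydiscs:
  assumes "open W" "(0, 0) \<in> W"
  obtains e where "e > 0" "polydisc e \<times> polydisc e \<subseteq> W"
proof -
  obtain d where d: "d > 0" "ball (0, 0) d \<subseteq> W" using assms open_contains_ball by blast
  have "polydisc (d / 4) \<times> polydisc (d / 4) \<subseteq> W"
  proof
    fix p :: "(complex \<times> complex) \<times> (complex \<times> complex)" assume "p \<in> polydisc (d / 4) \<times> polydisc (d / 4)"
    then have *: "norm (fst (fst p)) < d / 4" "norm (snd (fst p)) < d / 4"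
      "norm (fst (snd p)) < d / 4" "norm (snd (snd p)) < d / 4" by (auto simp: polydisc_def)
    have "norm p \<le> norm (fst p) + norm (snd p)" using norm_Pair_le[of "fst p" "snd p"] by simp
    also have "norm (fst p) \<le> norm (fst (fst p)) + norm (snd (fst p))"
      using norm_Pair_le[of "fst (fst p)" "snd (fst p)"] by simp
    also have "norm (snd p) \<le> norm (fst (snd p)) + norm (snd (snd p))"
      using norm_Pair_le[of "fst (snd p)" "snd (snd p)"] by simp
    finally have "norm p < d" using * by simp
    then show "p \<in> W" using d(2) by (auto simp: zero_prod_def[symmetric])
  qed
  then show ?thesis using that[of "d / 4"] d by simp
qed

text \<open>Two charts cover the fibre: a tube where \<eta> \<noteq> 0, and a product of polydiscs
  around \<eta> = 0 if that point occurs. They meet in a tube over a punctured polydisc.\<close>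

lemma linear_cone_additive:
  assumes W: "open W" and fin: "fin_hom {\<eta>. (0, \<eta>) \<in> W}"
  shows "\<exists>N. openin (top_of_set (linear_cone W)) N \<and> linear_cone W \<inter> origin_fibre \<subseteq> N \<and> additive N origin_fibre"
proof -
  define T where "T = {\<eta>. (0, \<eta>) \<in> W}"
  obtain \<rho> where rho: "continuous_on UNIV \<rho>" "\<And>q. q \<in> W \<Longrightarrow> \<rho> q > 0"
    "\<And>q q'. q \<in> W \<Longrightarrow> dist q q' < \<rho> q \<Longrightarrow> q' \<in> W" using open_radius[OF W] by metis
  \<comment> \<open>Half of \<rho>, because a point of \<open>polydisc r\<close> may have norm up to
    2 r.\<close>
  define r where "r \<eta> = \<rho> (0, \<eta>) / 2" for \<eta>
  have contr: "continuous_on S r" for S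
    unfolding r_def by (intro continuous_intros continuous_on_compose2[OF rho(1)]) auto
  have rpos: "r \<eta> > 0" if "\<eta> \<in> T" for \<eta> using that rho(2) by (simp add: T_def r_def)
  have rW: "(v, \<eta>) \<in> W" if "\<eta> \<in> T" "v \<in> polydisc (r \<eta>)" for v \<eta>
    using polydisc_dist[OF that(2), of \<eta>] that(1) rho(3)[of "(0, \<eta>)" "(v, \<eta>)"] by (simp add: T_def r_def)
  have openT: "open T"
  proof -
    have "T = (\<lambda>\<eta>. (0, \<eta>)) -` W" by (auto simp: T_def)
    then show ?thesis using W by (auto intro!: open_vimage continuous_intros)
  qed
  define N1 where "N1 = linear_cone {(v, \<eta>). \<eta> \<in> T - {0} \<and> v \<in> polydisc (r \<eta>)}"
  have add1: "additive N1 origin_fibre"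
    unfolding N1_def using fin rpos
    by (intro linear_tube_additive contr) (auto simp: T_def[symmetric] intro: fin_hom_remove_origin openT)
  let ?O = "{p::(complex \<times> complex) \<times> (complex \<times> complex). snd p \<in> T - {0} \<and> norm (fst (fst p)) < r (snd p) \<and> norm (snd (fst p)) < r (snd p)}"
  have "open ?O"
  proof -
    have "?O = snd -` (T - {0}) \<inter> {p. norm (fst (fst p)) < r (snd p)} \<inter> {p. norm (snd (fst p)) < r (snd p)}"
      by auto
    moreover have "open (snd -` (T - {0}) :: ((complex \<times> complex) \<times> (complex \<times> complex)) set)" using openT by (intro open_vimage_snd open_Diff) auto
    moreover have "open {p::(complex \<times> complex) \<times> (complex \<times> complex). norm (fst (fst p)) < r (snd p)}"
      "open {p::(complex \<times> complex) \<times> (complex \<times> complex). norm (snd (fst p)) < r (snd p)}"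
      by (intro open_Collect_less continuous_intros continuous_on_compose2[OF contr]; auto)+
    ultimately show ?thesis by (simp only: open_Int)
  qed
  then have op1: "openin (top_of_set (linear_cone W)) N1"
    by (rule openin_Int_open) (use rW in \<open>auto simp: N1_def linear_cone_def polydisc_def\<close>)
  show ?thesis
  proof (cases "0 \<in> T")
    case False
    then have "linear_cone W \<inter> origin_fibre \<subseteq> N1"
      using rpos by (auto simp: N1_def linear_cone_def T_def)
    with add1 op1 show ?thesis by blast
  next
    case True
    then have "(0, 0) \<in> W" by (simp add: T_def)
    from open_contains_polydiscs[OF W this]
    obtain e where e: "e > 0" "polydisc e \<times> polydisc e \<subseteq> W" by blast
    define N2 where "N2 = linear_cone (polydisc e \<times> polydisc e)"
    have "N2 = {(v, \<eta>). v \<in> polydisc e \<and> \<eta> \<in> polydisc e \<and> fst \<eta> * fst v + snd \<eta> * snd v = 0}"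
      by (auto simp: N2_def linear_cone_def)
    then have add2: "additive N2 origin_fibre"
      using pencil_polydisc_additive[of e e fst snd] e by simp
    have op2: "openin (top_of_set (linear_cone W)) N2"
      by (rule openin_Int_open[OF open_Times[OF open_polydisc open_polydisc, of e e]])
         (use e in \<open>auto simp: N2_def linear_cone_def\<close>)
    have eT: "polydisc e \<subseteq> T" using e by (auto simp: T_def)
    have "N1 \<inter> N2 = linear_cone {(v, \<eta>). \<eta> \<in> polydisc e - {0} \<and> v \<in> polydisc (min e (r \<eta>))}"
      using eT by (auto simp: N1_def N2_def linear_cone_def polydisc_def)
    moreover have "additive (linear_cone {(v, \<eta>). \<eta> \<in> polydisc e - {0} \<and> v \<in> polydisc (min e (r \<eta>))}) origin_fibre"
      using has_chi_punctured_polydisc[OF e(1)] rpos eT e(1)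
      by (intro linear_tube_additive continuous_intros contr) (auto simp: has_chi_def)
    ultimately have add3: "additive (N1 \<inter> N2) origin_fibre" by simp
    have op: "openin (top_of_set (linear_cone W)) (N1 \<union> N2)" using op1 op2 by (rule openin_Un)
    have sub: "N1 \<union> N2 \<subseteq> linear_cone W" using op openin_imp_subset by blast
    have "additive (N1 \<union> N2) origin_fibre"
      using openin_subset_trans[OF op1 _ sub] openin_subset_trans[OF op2 _ sub] add1 add2 add3
      by (intro additive_Un) auto
    moreover have "linear_cone W \<inter> origin_fibre \<subseteq> N1 \<union> N2"
      using rpos e by (auto simp: N1_def N2_def linear_cone_def T_def)
    ultimately show ?thesis using op by blast
  qed
qed

subsection \<open>Pencils through a double point\<close>

text \<open>Normal form at a zero where all linear parts are proportional: \<open>m\<close>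
  multiplies the common linear part, scaled to x + y, and \<open>c\<close> the mixed term.\<close>

definition quadratic_cone :: "((complex \<times> complex) \<times> (complex \<times> complex)) set \<Rightarrow> ((complex \<times> complex) \<times> (complex \<times> complex)) set" where
  "quadratic_cone W = {((x, y), (m, c)) \<in> W. m * (x + y) + c * (x * y) = 0}"

definition smooth_tube :: "(complex \<times> complex) set \<Rightarrow> (complex \<times> complex \<Rightarrow> real) \<Rightarrow> ((complex \<times> complex) \<times> (complex \<times> complex)) set" where
  "smooth_tube E r = {((x, y), (m, c)). (m, c) \<in> E \<and> norm x < r (m, c) \<and> m * (x + y) + c * (x * y) = 0}"

text \<open>The bound on \<open>r\<close> keeps the norm of \<open>c * x\<close> below half of that
  of \<open>m\<close>, so the equation can be solved for \<open>y\<close>.\<close>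

lemma smooth_tube_bound:
  fixes m c x y :: complex
  assumes "m * (x + y) + c * (x * y) = 0" "m \<noteq> 0" "norm x < r" "2 * r * norm c \<le> norm m"
  shows "m + c * x \<noteq> 0" "y = - (m * x) / (m + c * x)" "norm y \<le> 2 * norm x"
proof -
  have "norm c * norm x \<le> norm c * r" using assms(3) by (intro mult_left_mono) auto
  then have cx: "norm (c * x) \<le> norm m / 2" using assms(4) by (simp add: norm_mult mult_ac)
  have "norm m - norm (c * x) \<le> norm (m + c * x)" using norm_diff_ineq by blast
  then have big: "norm (m + c * x) \<ge> norm m / 2" using cx by simp
  then show nz: "m + c * x \<noteq> 0" using assms(2) by auto
  have "y * (m + c * x) = - (m * x)" using assms(1) by (simp add: algebra_simps eq_neg_iff_add_eq_0)
  then show y: "y = - (m * x) / (m + c * x)" using nz by (metis nonzero_mult_div_cancel_right)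
  have "norm y * (norm m / 2) \<le> norm y * norm (m + c * x)" using big by (intro mult_left_mono) auto
  also have "\<dots> = norm m * norm x" using \<open>y * (m + c * x) = - (m * x)\<close> by (metis norm_minus_cancel norm_mult)
  finally have "norm m * norm y \<le> norm m * (2 * norm x)" by (simp add: mult_ac)
  then show "norm y \<le> 2 * norm x" using assms(2) by simp
qed

text \<open>As \<open>y\<close> is a function of the other variables, the tube is a disc bundle with
  fibre coordinate \<open>x\<close>.\<close>

lemma smooth_tube_additive:
  assumes E: "\<And>m c. (m, c) \<in> E \<Longrightarrow> m \<noteq> 0 \<and> r (m, c) > 0 \<and> 2 * r (m, c) * norm c \<le> norm m"
    and fin: "fin_hom E" and r: "continuous_on E r"
  shows "additive (smooth_tube E r) origin_fibre"
proof (rule additive_homeo)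
  let ?f = "\<lambda>p::(complex \<times> complex) \<times> (complex \<times> complex). (snd p, fst (fst p))"
  let ?g = "\<lambda>p::(complex \<times> complex) \<times> complex.
    ((snd p, - (fst (fst p) * snd p) / (fst (fst p) + snd (fst p) * snd p)), fst p)"
  let ?Y = "{(e, s::complex). e \<in> E \<and> norm s < r e}"
  show "additive ?Y (UNIV \<times> {0})" using E fin r by (intro additive_disc_bundle) auto
  show "continuous_on (smooth_tube E r) ?f" by (intro continuous_intros)
  have nz: "m + c * x \<noteq> 0" if "(m, c) \<in> E" "norm x < r (m, c)" for m c x
  proof
    assume "m + c * x = 0"
    then have "norm m = norm c * norm x" by (metis add_eq_0_iff norm_minus_cancel norm_mult)
    also have "2 * \<dots> \<le> 2 * (norm c * r (m, c))" using that by (intro mult_left_mono) auto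
    also have "\<dots> \<le> norm m" using E[OF that(1)] by (simp add: mult_ac)
    finally show False using E[OF that(1)] by simp
  qed
  then show "continuous_on ?Y ?g" by (intro continuous_intros) auto
  show "?f p \<in> ?Y \<and> ?g (?f p) = p \<and> (?f p \<in> UNIV \<times> {0} \<longleftrightarrow> p \<in> origin_fibre)" if p: "p \<in> smooth_tube E r" for p
  proof -
    obtain x y m c where pp: "p = ((x, y), (m, c))" by (metis prod.collapse)
    have *: "(m, c) \<in> E" "norm x < r (m, c)" "m * (x + y) + c * (x * y) = 0" using p by (auto simp: pp smooth_tube_def)
    have "y = - (m * x) / (m + c * x)" using smooth_tube_bound(2)[OF *(3) _ *(2)] E[OF *(1)] by blast
    then show ?thesis using * by (auto simp: pp zero_prod_def)
  qed
  show "?g p \<in> smooth_tube E r \<and> ?f (?g p) = p" if p: "p \<in> ?Y" for p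
  proof -
    obtain x m c where pp: "p = ((m, c), x)" by (metis prod.collapse)
    have *: "(m, c) \<in> E" "norm x < r (m, c)" using p by (auto simp: pp)
    define y where "y = - (m * x) / (m + c * x)"
    have "y * (m + c * x) = - (m * x)" using nz[OF *] by (simp add: y_def)
    then have "m * (x + y) + c * (x * y) = 0" by (simp add: algebra_simps eq_neg_iff_add_eq_0)
    with * show ?thesis by (auto simp: pp smooth_tube_def y_def)
  qed
qed

text \<open>For \<open>c \<noteq> 0\<close> the total space over a neighbourhood of \<open>m = 0\<close> has an \<open>A\<^sub>1\<close> singularity along
  \<open>m = x = y = 0\<close>, and it is a cone: the equation is homogeneous in \<open>(x, y, m)\<close>.\<close>

definition node_tube :: "complex set \<Rightarrow> (complex \<Rightarrow> real) \<Rightarrow> ((complex \<times> complex) \<times> (complex \<times> complex)) set" where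
  "node_tube S \<sigma> = {((x, y), (m, c)). c \<in> S \<and> norm x < \<sigma> c \<and> norm y < \<sigma> c \<and> norm m < \<sigma> c \<and> m * (x + y) + c * (x * y) = 0}"

text \<open>The cone contracts to its vertices, a copy of \<open>S\<close>. Off the fibre x + y is
  nonzero because c is, and the coordinates c, w = x / (x + y) and L = x + y exhibit a punctured
  disc bundle, of value 0. The fibre itself is a disc bundle over \<open>S\<close>.\<close>

lemma node_tube_additive:
  assumes S: "0 \<notin> S" "fin_hom S" and s: "continuous_on S \<sigma>" "\<And>c. c \<in> S \<Longrightarrow> \<sigma> c > 0"
  shows "additive (node_tube S \<sigma>) origin_fibre"
proof (rule additiveI)
  let ?X = "node_tube S \<sigma>"
  have chiS: "has_chi S (chi S)" by (rule has_chi_chi[OF S(2)])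
  let ?R = "{p :: (complex \<times> complex) \<times> (complex \<times> complex). fst p = 0 \<and> fst (snd p) = 0 \<and> snd (snd p) \<in> S}"
  have "has_chi ?X (chi S) \<longleftrightarrow> has_chi ?R (chi S)"
  proof (rule has_chi_deformation[where H = "\<lambda>t p. (t *\<^sub>R fst p, (t *\<^sub>R fst (snd p), snd (snd p)))"])
    show "?R \<subseteq> ?X" using s(2) by (auto simp: node_tube_def zero_prod_def)
    show "continuous_on ({0..1} \<times> ?X) (\<lambda>(t, p). (t *\<^sub>R fst p, (t *\<^sub>R fst (snd p), snd (snd p))))"
      unfolding case_prod_unfold by (intro continuous_intros)
    fix t :: real and p assume t: "0 \<le> t" "t \<le> 1" and p: "p \<in> ?X"
    obtain x y m c where pp: "p = ((x, y), (m, c))" by (metis prod.collapse)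
    have eq: "m * (x + y) + c * (x * y) = 0" using p by (simp add: pp node_tube_def)
    have small: "norm (t *\<^sub>R z) < e" if "norm z < e" for z :: complex and e
      using that t mult_left_le_one_le[of "norm z" t] by simp
    have "(t *\<^sub>R m) * (t *\<^sub>R x + t *\<^sub>R y) + c * ((t *\<^sub>R x) * (t *\<^sub>R y)) = t *\<^sub>R t *\<^sub>R (m * (x + y) + c * (x * y))"
      by (simp add: algebra_simps scaleR_conv_of_real)
    then have "(t *\<^sub>R m) * (t *\<^sub>R x + t *\<^sub>R y) + c * ((t *\<^sub>R x) * (t *\<^sub>R y)) = 0" unfolding eq by simp
    then show "(t *\<^sub>R fst p, (t *\<^sub>R fst (snd p), snd (snd p))) \<in> ?X"
      using p small by (auto simp: pp node_tube_def)
  qed (auto simp: node_tube_def zero_prod_def)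
  also have "\<dots> \<longleftrightarrow> has_chi S (chi S)"
    by (rule has_chi_homeomorphism[where f = "\<lambda>p. snd (snd p)" and g = "\<lambda>c. (0, (0, c))"])
       (auto intro!: continuous_intros)
  finally show "has_chi ?X (0 + chi S)" using chiS by simp
  have "?X \<inter> origin_fibre = {(v, (m, c)). v = 0 \<and> c \<in> S \<and> norm m < \<sigma> c}"
    using s(2) by (auto simp: node_tube_def zero_prod_def)
  moreover have "has_chi {(v :: complex \<times> complex, (m :: complex, c)). v = 0 \<and> c \<in> S \<and> norm m < \<sigma> c} (chi S)
      \<longleftrightarrow> has_chi {(c, m :: complex). c \<in> S \<and> norm m < \<sigma> c} (chi S)"
    by (rule has_chi_homeomorphism[where f = "\<lambda>p. (snd (snd p), fst (snd p))" and g = "\<lambda>p. (0, (snd p, fst p))"])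
       (auto intro!: continuous_intros)
  ultimately show "has_chi (?X \<inter> origin_fibre) (chi S)"
    using has_chi_disc_bundle[OF s] chiS by simp
  \<comment> \<open>The largest factor multiplying L in x = L w, y = L (1 - w) and m = - c L w (1 -
    w); it is positive because w and 1 - w do not vanish together.\<close>
  define \<mu> where "\<mu> e = max (max (norm (snd e)) (norm (1 - snd e))) (norm (fst e) * norm (snd e) * norm (1 - snd e))"
    for e :: "complex \<times> complex"
  have mu: "\<mu> e > 0" for e
  proof -
    have "norm (snd e) > 0 \<or> norm (1 - snd e) > 0" by auto
    then show ?thesis unfolding \<mu>_def less_max_iff_disj by blast
  qed
  define \<tau> where "\<tau> e = \<sigma> (fst e) / \<mu> e" for e
  let ?D = "{(e, L::complex). e \<in> S \<times> UNIV \<and> L \<noteq> 0 \<and> norm L < \<tau> e}"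
  have cond: "norm L < \<tau> (c, w) \<longleftrightarrow> norm (L * w) < \<sigma> c \<and> norm (L * (1 - w)) < \<sigma> c \<and> norm (c * L * w * (1 - w)) < \<sigma> c"
    if "c \<in> S" for L c w
  proof -
    have "norm L < \<tau> (c, w) \<longleftrightarrow> norm L * \<mu> (c, w) < \<sigma> c"
      using mu[of "(c, w)"] by (simp add: \<tau>_def pos_less_divide_eq)
    also have "norm L * \<mu> (c, w) = max (max (norm (L * w)) (norm (L * (1 - w)))) (norm (c * L * w * (1 - w)))"
      by (simp add: \<mu>_def max_mult_distrib_left norm_mult mult_ac)
    finally show ?thesis by simp
  qed
  have "has_chi (?X - origin_fibre) 0 \<longleftrightarrow> has_chi ?D 0"
  proof (rule has_chi_homeomorphism)
    let ?f = "\<lambda>p::(complex \<times> complex) \<times> (complex \<times> complex).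
      ((snd (snd p), fst (fst p) / (fst (fst p) + snd (fst p))), fst (fst p) + snd (fst p))"
    let ?g = "\<lambda>q::(complex \<times> complex) \<times> complex.
      ((snd q * snd (fst q), snd q * (1 - snd (fst q))), (- (fst (fst q) * snd q * snd (fst q) * (1 - snd (fst q))), fst (fst q)))"
    have L0: "x + y \<noteq> 0" if "m * (x + y) + c * (x * y) = 0" "c \<in> S" "(x, y) \<noteq> 0" for x y m c
    proof
      assume 0: "x + y = 0"
      then have "y = - x" by (simp add: add_eq_0_iff2)
      have "c \<noteq> 0" using that(2) S(1) by auto
      with that(1) 0 have "x * y = 0" by simp
      with \<open>y = - x\<close> that(3) show False by (auto simp: zero_prod_def)
    qed
    have "\<forall>p\<in>?X - origin_fibre. fst (fst p) + snd (fst p) \<noteq> 0"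
    proof
      fix p assume p: "p \<in> ?X - origin_fibre"
      obtain x y m c where pp: "p = ((x, y), (m, c))" by (metis prod.collapse)
      from p show "fst (fst p) + snd (fst p) \<noteq> 0"
        using L0[of m x y c] by (simp add: pp node_tube_def)
    qed
    then show "continuous_on (?X - origin_fibre) ?f" by (intro continuous_intros)
    show "continuous_on ?D ?g" by (intro continuous_intros)
    show "?f p \<in> ?D \<and> ?g (?f p) = p" if p: "p \<in> ?X - origin_fibre" for p
    proof -
      obtain x y m c where pp: "p = ((x, y), (m, c))" by (metis prod.collapse)
      have cS: "c \<in> S" and eq: "m * (x + y) + c * (x * y) = 0" and v: "(x, y) \<noteq> 0"
        and sm: "norm x < \<sigma> c" "norm y < \<sigma> c" "norm m < \<sigma> c"
        using p by (auto simp: pp node_tube_def)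
      define L w where "L = x + y" and "w = x / (x + y)"
      have L: "L \<noteq> 0" using L0[OF eq cS v] by (simp add: L_def)
      have x: "L * w = x" using L by (simp add: L_def w_def)
      then have y: "L * (1 - w) = y" by (simp add: L_def algebra_simps)
      have "L * (- (c * L * w * (1 - w))) = - (c * (L * w) * (L * (1 - w)))" by (simp add: mult_ac)
      also have "\<dots> = L * m" unfolding x y using eq by (simp add: L_def algebra_simps eq_neg_iff_add_eq_0 neg_eq_iff_add_eq_0)
      finally have m: "- (c * L * w * (1 - w)) = m" using L mult_left_cancel[OF L] by blast
      then have "norm (c * L * w * (1 - w)) = norm m" by (metis norm_minus_cancel)
      then have "norm L < \<tau> (c, w)" using cond[OF cS, of L w] sm x y by simp
      then have "((c, w), L) \<in> ?D" using cS L by simp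
      moreover have "x / L = w" by (simp add: L_def w_def)
      ultimately show ?thesis using x y m by (simp add: pp L_def[symmetric])
    qed
    show "?g q \<in> ?X - origin_fibre \<and> ?f (?g q) = q" if q: "q \<in> ?D" for q
    proof -
      obtain c w L where qq: "q = ((c, w), L)" by (metis prod.collapse)
      have cS: "c \<in> S" and L: "L \<noteq> 0" and sm: "norm L < \<tau> (c, w)" using q by (auto simp: qq)
      have eq: "- (c * L * w * (1 - w)) * (L * w + L * (1 - w)) + c * (L * w * (L * (1 - w))) = 0"
        by (simp add: algebra_simps)
      have "(L * w, L * (1 - w)) \<noteq> 0" using L by (auto simp: zero_prod_def)
      then have "?g q \<in> ?X - origin_fibre"
        using cond[OF cS, of L w] sm cS eq by (auto simp: qq node_tube_def norm_mult)
      moreover have "L * w + L * (1 - w) = L" by (simp add: algebra_simps)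
      ultimately show ?thesis using L by (simp add: qq)
    qed
  qed
  moreover have "has_chi ?D 0"
  proof (rule has_chi_punctured_disc_bundle)
    show "has_chi (S \<times> (UNIV :: complex set)) (chi S)"
      using has_chi_convex_factor[of "UNIV :: complex set" S] chiS by simp
    have "continuous_on (S \<times> UNIV) \<mu>" unfolding \<mu>_def by (intro continuous_intros)
    then show "continuous_on (S \<times> UNIV) \<tau>"
      unfolding \<tau>_def using mu
      by (intro continuous_intros continuous_on_compose2[OF s(1)]) (auto simp: less_imp_neq[symmetric])
    show "\<tau> e > 0" if "e \<in> S \<times> UNIV" for e using that s(2) mu by (auto simp: \<tau>_def)
  qed
  ultimately show "has_chi (?X - origin_fibre) 0" by simp
qed

lemma fin_hom_remove_point:
  fixes U :: "complex set"
  assumes "open U" "fin_hom U"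
  shows "fin_hom (U - {a})"
proof (cases "a \<in> U")
  case True
  then obtain e where e: "e > 0" "ball a e \<subseteq> U" using assms(1) open_contains_ball by blast
  have un: "ball a e \<union> (U - {a}) = U" and int: "ball a e \<inter> (U - {a}) = ball a e - {a}"
    using e True by auto
  have "has_chi (U - {a}) (chi U + 0 - 1)"
  proof (rule has_chi_part[of "ball a e"])
    show "has_chi (ball a e) 1"
      using e by (intro has_chi_contractible) (auto intro!: convex_imp_contractible)
    show "has_chi (ball a e \<inter> (U - {a})) 0"
      unfolding int using e by (intro has_chi_punctured_convex) auto
  qed (unfold un, use e assms has_chi_chi in \<open>auto intro!: open_subset open_Diff\<close>)
  then show ?thesis by (simp add: has_chi_def)
qed (use assms in simp)

lemma has_chi_swapped_bundle:
  assumes "continuous_on S \<sigma>" "\<And>c. c \<in> S \<Longrightarrow> \<sigma> c > 0" "fin_hom S"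
  shows "has_chi {(m::complex, c). c \<in> S \<and> norm m < \<sigma> c} (chi S)"
    "has_chi {(m::complex, c). c \<in> S \<and> m \<noteq> 0 \<and> norm m < \<sigma> c} 0"
proof -
  have "has_chi {(c, m::complex). c \<in> S \<and> norm m < \<sigma> c} (chi S)"
    using has_chi_disc_bundle[OF assms(1,2)] has_chi_chi[OF assms(3)] by blast
  then show "has_chi {(m::complex, c). c \<in> S \<and> norm m < \<sigma> c} (chi S)"
    using has_chi_swap[of "\<lambda>c (m::complex). c \<in> S \<and> norm m < \<sigma> c"] by simp
  have "has_chi {(c, m::complex). c \<in> S \<and> m \<noteq> 0 \<and> norm m < \<sigma> c} 0"
    by (rule has_chi_punctured_disc_bundle[OF assms(1,2) has_chi_chi[OF assms(3)]])
  then show "has_chi {(m::complex, c). c \<in> S \<and> m \<noteq> 0 \<and> norm m < \<sigma> c} 0"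
    using has_chi_swap[of "\<lambda>c (m::complex). c \<in> S \<and> m \<noteq> 0 \<and> norm m < \<sigma> c"] by simp
qed

text \<open>A disc bundle around the line m = 0 is finite, and so is its overlap with the complement
  of the line; Mayer-Vietoris then yields that complement.\<close>

lemma fin_hom_remove_line:
  fixes T :: "(complex \<times> complex) set"
  assumes T: "open T" "fin_hom T" and S: "fin_hom {c. (0, c) \<in> T}"
  shows "fin_hom {p\<in>T. fst p \<noteq> 0}"
proof -
  let ?S = "{c. (0, c) \<in> T}"
  obtain \<rho> where rho: "continuous_on UNIV \<rho>" "\<And>q. q \<in> T \<Longrightarrow> \<rho> q > 0"
    "\<And>q q'. q \<in> T \<Longrightarrow> dist q q' < \<rho> q \<Longrightarrow> q' \<in> T" using open_radius[OF T(1)] by metis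
  define \<sigma> where "\<sigma> c = \<rho> (0, c)" for c
  have conts: "continuous_on X \<sigma>" for X
    unfolding \<sigma>_def by (intro continuous_intros continuous_on_compose2[OF rho(1)]) auto
  have spos: "\<sigma> c > 0" if "c \<in> ?S" for c using that rho(2) by (simp add: \<sigma>_def)
  let ?A = "{(m::complex, c). c \<in> ?S \<and> norm m < \<sigma> c}" and ?B = "{p\<in>T. fst p \<noteq> 0}"
  have AT: "?A \<subseteq> T"
  proof clarify
    fix m c :: complex assume "(0, c) \<in> T" "norm m < \<sigma> c"
    then show "(m, c) \<in> T" using rho(3)[of "(0, c)" "(m, c)"] by (simp add: dist_Pair_Pair \<sigma>_def)
  qed
  have un: "?A \<union> ?B = T" using AT spos by (auto simp: Collect_case_prod_mono)
  have int: "?A \<inter> ?B = {(m, c). c \<in> ?S \<and> m \<noteq> 0 \<and> norm m < \<sigma> c}" using AT by auto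
  have "openin (top_of_set T) ?A"
  proof (rule openin_Int_open)
    have "{p::complex \<times> complex. (0, snd p) \<in> T \<and> norm (fst p) < \<sigma> (snd p)} = (\<lambda>p. (0, snd p)) -` T \<inter> {p. norm (fst p) < \<sigma> (snd p)}" by auto
    moreover have "open ((\<lambda>p::complex \<times> complex. (0, snd p)) -` T)" using T by (intro open_vimage) (auto intro!: continuous_intros)
    moreover have "open {p::complex \<times> complex. norm (fst p) < \<sigma> (snd p)}"
      by (intro open_Collect_less continuous_intros continuous_on_compose2[OF conts]; auto)
    ultimately show "open {p::complex \<times> complex. (0, snd p) \<in> T \<and> norm (fst p) < \<sigma> (snd p)}" by (simp only: open_Int)
  qed (use AT in auto)
  moreover have "openin (top_of_set T) ?B"
  proof (rule openin_Int_open)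
    show "open {p::complex \<times> complex. fst p \<noteq> 0}" by (intro open_Collect_neq continuous_intros)
  qed auto
  ultimately have "has_chi ?B (chi T + 0 - chi ?S)"
    using has_chi_swapped_bundle[OF conts spos S] has_chi_chi[OF T(2)]
    by (intro has_chi_part[of ?A]) (simp_all only: un int)
  then show ?thesis by (simp add: has_chi_def)
qed

text \<open>Three charts cover the fibre: smooth tubes where m \<noteq> 0, node tubes near m = 0
  with c \<noteq> 0, and a product of polydiscs around m = c = 0 if that point occurs. The radii are
  chosen so that every overlap is a smooth or a node tube again.\<close>

lemma quadratic_cone_additive:
  assumes W: "open W" and fin: "fin_hom {\<eta>. (0, \<eta>) \<in> W}" "fin_hom {c. (0, (0, c)) \<in> W}"
  shows "\<exists>N. openin (top_of_set (quadratic_cone W)) N \<and> quadratic_cone W \<inter> origin_fibre \<subseteq> N \<and> additive N origin_fibre"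
proof -
  define T where "T = {\<eta>. (0, \<eta>) \<in> W}"
  obtain \<rho> where rho: "continuous_on UNIV \<rho>" "\<And>q. q \<in> W \<Longrightarrow> \<rho> q > 0"
    "\<And>q q'. q \<in> W \<Longrightarrow> dist q q' < \<rho> q \<Longrightarrow> q' \<in> W" using open_radius[OF W] by metis
  have near: "((x, y), (m + m', c)) \<in> W" if "(0, (m, c)) \<in> W" "norm x + norm y + norm m' < \<rho> (0, (m, c))" for x y m m' c
  proof (rule rho(3)[OF that(1)])
    have "dist (0, (m, c)) ((x, y), (m + m', c)) = norm ((x, y), (m', 0::complex))"
      by (simp add: dist_norm norm_minus_commute zero_prod_def norm_Pair)
    also have "\<dots> \<le> norm (x, y) + norm (m', 0::complex)" by (rule norm_Pair_le)
    also have "\<dots> \<le> norm x + norm y + norm m'" using norm_Pair_le[of x y] by (simp add: norm_Pair)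
    finally show "dist (0, (m, c)) ((x, y), (m + m', c)) < \<rho> (0, (m, c))" using that(2) by simp
  qed
  have openT: "open T"
  proof -
    have "T = (\<lambda>\<eta>. (0, \<eta>)) -` W" by (auto simp: T_def)
    then show ?thesis using W by (auto intro!: open_vimage continuous_intros)
  qed
  \<comment> \<open>Dividing \<rho> by 3 makes room for |x| + |y| with |y| \<le> 2 |x|. The second
    bound gives 2 r |c| \<le> |m| and 2 r \<le> |m|; the latter keeps |x| and |y| below |m|, so that
    overlaps with the other charts are described by conditions on (m, c) alone.\<close>
  define r where "r \<eta> = min (\<rho> (0, \<eta>) / 3) (norm (fst \<eta>) / (2 * (norm (snd \<eta>) + 1)))" for \<eta>
  have contr: "continuous_on S r" for S
    unfolding r_def
    by (intro continuous_intros continuous_on_compose2[OF rho(1)]) (auto simp: add_nonneg_eq_0_iff)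
  have r: "r (m, c) > 0 \<and> 2 * r (m, c) * norm c \<le> norm m \<and> 2 * r (m, c) \<le> norm m" if "(m, c) \<in> T" "m \<noteq> 0" for m c
  proof -
    have "r (m, c) > 0" using that rho(2) by (simp add: r_def T_def add_nonneg_pos)
    moreover have "r (m, c) \<le> norm m / (2 * (norm c + 1))" by (simp add: r_def)
    then have "r (m, c) * (2 * (norm c + 1)) \<le> norm m"
      by (simp add: pos_le_divide_eq add_nonneg_pos)
    then have "2 * r (m, c) * norm c + 2 * r (m, c) \<le> norm m" by (simp add: algebra_simps)
    moreover have "2 * r (m, c) * norm c \<ge> 0" using \<open>r (m, c) > 0\<close> by simp
    ultimately show ?thesis by linarith
  qed
  define \<sigma> where "\<sigma> c = \<rho> (0, (0, c)) / 3" for c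
  have conts: "continuous_on S \<sigma>" for S
    unfolding \<sigma>_def by (intro continuous_intros continuous_on_compose2[OF rho(1)]) auto
  define S where "S = {c. (0, (0, c)) \<in> W} - {0}"
  have spos: "\<sigma> c > 0" if "c \<in> S" for c using that rho(2) by (simp add: \<sigma>_def S_def)
  have openS: "open {c. (0, (0, c)) \<in> W}"
  proof -
    have "{c. (0, (0, c)) \<in> W} = (\<lambda>c. (0, (0, c))) -` W" by auto
    then show ?thesis using W by (auto intro!: open_vimage continuous_intros)
  qed
  have finS: "fin_hom S" unfolding S_def by (rule fin_hom_remove_point[OF openS fin(2)])
  have sT: "(m, c) \<in> T" if "c \<in> S" "norm m < \<sigma> c" for m c
    using near[of 0 c 0 0 m] that spos[OF that(1)] by (simp add: T_def S_def \<sigma>_def zero_prod_def)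
  define E where "E = {p\<in>T. fst p \<noteq> 0}"
  define N1 where "N1 = smooth_tube E r"
  define N2 where "N2 = node_tube S \<sigma>"
  have tube: "additive (smooth_tube E' r) origin_fibre" if "E' \<subseteq> E" "fin_hom E'" for E'
    using that r by (intro smooth_tube_additive contr) (auto simp: E_def)
  have finE: "fin_hom E"
    unfolding E_def by (rule fin_hom_remove_line[OF openT]) (use fin in \<open>auto simp: T_def\<close>)
  have add1: "additive N1 origin_fibre" unfolding N1_def by (rule tube) (use finE in auto)
  have add2: "additive N2 origin_fibre"
    unfolding N2_def by (rule node_tube_additive) (use finS conts spos in \<open>auto simp: S_def\<close>)
  have small: "norm y \<le> 2 * norm x \<and> norm x < norm m / 2"
    if "(m, c) \<in> E" "norm x < r (m, c)" "m * (x + y) + c * (x * y) = 0" for m c x y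
    using smooth_tube_bound(3)[OF that(3) _ that(2)] r[of m c] that(1,2) by (auto simp: E_def)
  have N1W: "N1 \<subseteq> quadratic_cone W"
  proof clarify
    fix x y m c assume p: "((x, y), (m, c)) \<in> N1"
    then have *: "(m, c) \<in> E" "norm x < r (m, c)" "m * (x + y) + c * (x * y) = 0"
      by (auto simp: N1_def smooth_tube_def)
    have "norm x + norm y < \<rho> (0, (m, c))" using small[OF *] *(2) by (simp add: r_def)
    then show "((x, y), (m, c)) \<in> quadratic_cone W"
      using near[of m c x y 0] *(1,3) by (simp add: quadratic_cone_def E_def T_def)
  qed
  have op1: "openin (top_of_set (quadratic_cone W)) N1"
  proof (rule openin_Int_open)
    have "{p::(complex \<times> complex) \<times> (complex \<times> complex). snd p \<in> T \<and> fst (snd p) \<noteq> 0 \<and> norm (fst (fst p)) < r (snd p)}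
        = snd -` T \<inter> {p. fst (snd p) \<noteq> 0} \<inter> {p. norm (fst (fst p)) < r (snd p)}" by auto
    moreover have "open (snd -` T :: ((complex \<times> complex) \<times> (complex \<times> complex)) set)" using openT by (rule open_vimage_snd)
    moreover have "open {p::(complex \<times> complex) \<times> (complex \<times> complex). fst (snd p) \<noteq> 0}"
      by (intro open_Collect_neq continuous_intros)
    moreover have "open {p::(complex \<times> complex) \<times> (complex \<times> complex). norm (fst (fst p)) < r (snd p)}"
      by (intro open_Collect_less continuous_intros continuous_on_compose2[OF contr]; auto)
    ultimately show "open {p::(complex \<times> complex) \<times> (complex \<times> complex). snd p \<in> T \<and> fst (snd p) \<noteq> 0 \<and> norm (fst (fst p)) < r (snd p)}"
      by (simp only: open_Int)
    show "N1 = quadratic_cone W \<inter> {p. snd p \<in> T \<and> fst (snd p) \<noteq> 0 \<and> norm (fst (fst p)) < r (snd p)}"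
      using N1W by (auto simp: N1_def E_def smooth_tube_def quadratic_cone_def)
  qed
  have N2W: "N2 \<subseteq> quadratic_cone W"
  proof clarify
    fix x y m c assume p: "((x, y), (m, c)) \<in> N2"
    then have *: "c \<in> S" "norm x < \<sigma> c" "norm y < \<sigma> c" "norm m < \<sigma> c" "m * (x + y) + c * (x * y) = 0"
      by (auto simp: N2_def node_tube_def)
    then have "norm x + norm y + norm m < \<rho> (0, (0, c))" by (simp add: \<sigma>_def)
    then show "((x, y), (m, c)) \<in> quadratic_cone W"
      using near[of 0 c x y m] *(1,5) by (simp add: quadratic_cone_def S_def)
  qed
  have op2: "openin (top_of_set (quadratic_cone W)) N2"
  proof (rule openin_Int_open)
    let ?O = "\<lambda>h. {p::(complex \<times> complex) \<times> (complex \<times> complex). norm (h p) < \<sigma> (snd (snd p))}"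
    have "{p::(complex \<times> complex) \<times> (complex \<times> complex). snd (snd p) \<in> S \<and> norm (fst (fst p)) < \<sigma> (snd (snd p)) \<and> norm (snd (fst p)) < \<sigma> (snd (snd p)) \<and> norm (fst (snd p)) < \<sigma> (snd (snd p))}
        = (\<lambda>p. snd (snd p)) -` S \<inter> ?O (\<lambda>p. fst (fst p)) \<inter> ?O (\<lambda>p. snd (fst p)) \<inter> ?O (\<lambda>p. fst (snd p))" by auto
    moreover have "open ((\<lambda>p::(complex \<times> complex) \<times> (complex \<times> complex). snd (snd p)) -` S)"
      using openS by (intro open_vimage) (auto simp: S_def intro!: continuous_intros)
    moreover have "open (?O (\<lambda>p. fst (fst p)))" "open (?O (\<lambda>p. snd (fst p)))" "open (?O (\<lambda>p. fst (snd p)))"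
      by (intro open_Collect_less continuous_intros continuous_on_compose2[OF conts]; auto)+
    ultimately show "open {p::(complex \<times> complex) \<times> (complex \<times> complex). snd (snd p) \<in> S \<and> norm (fst (fst p)) < \<sigma> (snd (snd p)) \<and> norm (snd (fst p)) < \<sigma> (snd (snd p)) \<and> norm (fst (snd p)) < \<sigma> (snd (snd p))}"
      by (simp only: open_Int)
    show "N2 = quadratic_cone W \<inter> {p. snd (snd p) \<in> S \<and> norm (fst (fst p)) < \<sigma> (snd (snd p)) \<and> norm (snd (fst p)) < \<sigma> (snd (snd p)) \<and> norm (fst (snd p)) < \<sigma> (snd (snd p))}"
      using N2W by (auto simp: N2_def node_tube_def quadratic_cone_def)
  qed
  \<comment> \<open>Stated for smaller \<open>S'\<close> and \<open>\<sigma>'\<close> as well,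
    because the triple overlap with \<open>N3\<close> below is of the same shape.\<close>
  have int12: "N1 \<inter> node_tube S' \<sigma>' = smooth_tube {(m, c). c \<in> S' \<and> m \<noteq> 0 \<and> norm m < \<sigma>' c} r"
    if S': "S' \<subseteq> S" "\<And>c. c \<in> S' \<Longrightarrow> \<sigma>' c \<le> \<sigma> c" for S' \<sigma>'
  proof -
    have sub: "{(m, c). c \<in> S' \<and> m \<noteq> 0 \<and> norm m < \<sigma>' c} \<subseteq> E"
      using sT S' unfolding E_def by fastforce
    show ?thesis
    proof (rule Set.set_eqI)
      fix p :: "(complex \<times> complex) \<times> (complex \<times> complex)"
      obtain x y m c where pp: "p = ((x, y), (m, c))" by (metis prod.collapse)
      show "p \<in> N1 \<inter> node_tube S' \<sigma>' \<longleftrightarrow> p \<in> smooth_tube {(m, c). c \<in> S' \<and> m \<noteq> 0 \<and> norm m < \<sigma>' c} r"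
      proof
        assume "p \<in> N1 \<inter> node_tube S' \<sigma>'"
        then show "p \<in> smooth_tube {(m, c). c \<in> S' \<and> m \<noteq> 0 \<and> norm m < \<sigma>' c} r"
          by (auto simp: pp N1_def smooth_tube_def node_tube_def E_def)
      next
        assume "p \<in> smooth_tube {(m, c). c \<in> S' \<and> m \<noteq> 0 \<and> norm m < \<sigma>' c} r"
        then have *: "c \<in> S'" "m \<noteq> 0" "norm m < \<sigma>' c" "norm x < r (m, c)" "m * (x + y) + c * (x * y) = 0"
          by (auto simp: pp smooth_tube_def)
        then have mE: "(m, c) \<in> E" using sub by auto
        then have "norm x < norm m" "norm y < norm m"
          using small[OF mE *(4,5)] norm_ge_zero[of x] by linarith+
        with mE * show "p \<in> N1 \<inter> node_tube S' \<sigma>'"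
          by (auto simp: pp N1_def smooth_tube_def node_tube_def)
      qed
    qed
  qed
  have add12': "additive (N1 \<inter> node_tube S' \<sigma>') origin_fibre"
    if S': "S' \<subseteq> S" "\<And>c. c \<in> S' \<Longrightarrow> \<sigma>' c \<le> \<sigma> c \<and> 0 < \<sigma>' c" "continuous_on S' \<sigma>'" "fin_hom S'" for S' \<sigma>'
  proof -
    have "fin_hom {(m::complex, c). c \<in> S' \<and> m \<noteq> 0 \<and> norm m < \<sigma>' c}"
      using has_chi_swapped_bundle(2)[OF S'(3) _ S'(4)] S'(2) by (auto simp: has_chi_def)
    moreover have "{(m, c). c \<in> S' \<and> m \<noteq> 0 \<and> norm m < \<sigma>' c} \<subseteq> E"
      using sT S'(1,2) unfolding E_def by fastforce
    ultimately show ?thesis using int12[of S' \<sigma>'] S' tube by simp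
  qed
  have add12: "additive (N1 \<inter> N2) origin_fibre"
    unfolding N2_def by (rule add12') (use spos conts finS in auto)
  have op12: "openin (top_of_set (quadratic_cone W)) (N1 \<union> N2)" using op1 op2 by (rule openin_Un)
  have sub12: "N1 \<union> N2 \<subseteq> quadratic_cone W" using op12 openin_imp_subset by blast
  have addU: "additive (N1 \<union> N2) origin_fibre"
    using openin_subset_trans[OF op1 _ sub12] openin_subset_trans[OF op2 _ sub12] add1 add2 add12
    by (intro additive_Un) auto
  have cover: "p \<in> N1 \<union> N2" if "p \<in> quadratic_cone W" "p \<in> origin_fibre" "snd p \<noteq> 0" for p
  proof -
    obtain m c where p: "p = ((0, 0), (m, c))" using \<open>p \<in> origin_fibre\<close> by (cases p) (auto simp: zero_prod_def)
    have T: "(m, c) \<in> T" and mc: "m \<noteq> 0 \<or> c \<noteq> 0"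
      using that by (auto simp: p quadratic_cone_def T_def zero_prod_def)
    show ?thesis
    proof (cases "m = 0")
      case True
      with T mc have "c \<in> S" by (simp add: S_def T_def)
      with True spos show ?thesis by (simp add: p N2_def node_tube_def)
    next
      case False
      with T r[OF T] show ?thesis by (simp add: p N1_def E_def smooth_tube_def)
    qed
  qed
  show ?thesis
  proof (cases "0 \<in> T")
    case False
    have "p \<in> N1 \<union> N2" if p: "p \<in> quadratic_cone W" "p \<in> origin_fibre" for p
    proof (rule cover[OF p])
      have "p \<in> W" using p(1) by (auto simp: quadratic_cone_def)
      moreover have "p = (0, snd p)" using p(2) by auto
      ultimately show "snd p \<noteq> 0" using False by (metis T_def mem_Collect_eq)
    qed
    then have "quadratic_cone W \<inter> origin_fibre \<subseteq> N1 \<union> N2" by blast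
    with addU op12 show ?thesis by blast
  next
    case True
    then have "(0, 0) \<in> W" by (simp add: T_def)
    from open_contains_polydiscs[OF W this]
    obtain e where e: "e > 0" "polydisc e \<times> polydisc e \<subseteq> W" by blast
    have eW: "(v, \<eta>) \<in> W" if "v \<in> polydisc e" "\<eta> \<in> polydisc e" for v \<eta> using e that by auto
    define N3 where "N3 = quadratic_cone (polydisc e \<times> polydisc e)"
    have "N3 = {(v, \<eta>). v \<in> polydisc e \<and> \<eta> \<in> polydisc e \<and> fst \<eta> * (fst v + snd v) + snd \<eta> * (fst v * snd v) = 0}"
      by (auto simp: N3_def quadratic_cone_def)
    then have add3: "additive N3 origin_fibre"
      using pencil_polydisc_additive[of e e "\<lambda>v. fst v + snd v" "\<lambda>v. fst v * snd v"] e by simp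
    have op3: "openin (top_of_set (quadratic_cone W)) N3"
      by (rule openin_Int_open[OF open_Times[OF open_polydisc open_polydisc, of e e]])
         (use e in \<open>auto simp: N3_def quadratic_cone_def\<close>)
    let ?B = "ball (0::complex) e - {0}"
    let ?s = "\<lambda>c. min (\<sigma> c) e"
    have BS: "?B \<subseteq> S"
      using eW[of 0 "(0, _)"] e by (auto simp: S_def polydisc_def zero_prod_def)
    have finB: "has_chi ?B 0" using e by (intro has_chi_punctured_convex) auto
    have eT: "polydisc e \<subseteq> T" using eW e by (auto simp: T_def)
    have "N2 \<inter> N3 = node_tube ?B ?s"
      using BS by (auto simp: N2_def N3_def node_tube_def quadratic_cone_def polydisc_def S_def)
    moreover have "additive (node_tube ?B ?s) origin_fibre"
      using finB conts spos e BS
      by (intro node_tube_additive continuous_intros) (auto simp: has_chi_def subset_iff)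
    ultimately have add23: "additive (N2 \<inter> N3) origin_fibre" by simp
    have "additive (N1 \<inter> node_tube ?B ?s) origin_fibre"
      by (rule add12') (use BS spos e finB in \<open>auto simp: has_chi_def subset_iff intro!: continuous_intros conts\<close>)
    moreover have "(N1 \<inter> N3) \<inter> (N2 \<inter> N3) = N1 \<inter> node_tube ?B ?s"
      unfolding \<open>N2 \<inter> N3 = node_tube ?B ?s\<close>[symmetric] by auto
    ultimately have add123: "additive ((N1 \<inter> N3) \<inter> (N2 \<inter> N3)) origin_fibre" by simp
    let ?E = "?B \<times> ball (0::complex) e"
    have "has_chi ?E 0" using finB e has_chi_convex_factor[of "ball (0::complex) e" ?B 0] by simp
    moreover have "?E \<subseteq> E" using eT by (auto simp: E_def polydisc_def)
    ultimately have "additive (smooth_tube ?E r) origin_fibre" by (intro tube) (auto simp: has_chi_def)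
    moreover have "N1 \<inter> N3 = smooth_tube ?E r"
    proof (rule Set.set_eqI)
      fix p :: "(complex \<times> complex) \<times> (complex \<times> complex)"
      obtain x y m c where pp: "p = ((x, y), (m, c))" by (metis prod.collapse)
      show "p \<in> N1 \<inter> N3 \<longleftrightarrow> p \<in> smooth_tube ?E r"
      proof
        assume "p \<in> N1 \<inter> N3"
        then show "p \<in> smooth_tube ?E r"
          by (auto simp: pp N1_def N3_def smooth_tube_def quadratic_cone_def polydisc_def E_def)
      next
        assume "p \<in> smooth_tube ?E r"
        then have *: "(m, c) \<in> ?E" "norm x < r (m, c)" "m * (x + y) + c * (x * y) = 0"
          by (auto simp: pp smooth_tube_def)
        then have mE: "(m, c) \<in> E" using \<open>?E \<subseteq> E\<close> by auto
        then have "norm x < norm m" "norm y < norm m"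
          using small[OF mE *(2,3)] norm_ge_zero[of x] by linarith+
        with mE * show "p \<in> N1 \<inter> N3"
          by (auto simp: pp N1_def N3_def smooth_tube_def quadratic_cone_def polydisc_def)
      qed
    qed
    ultimately have add13: "additive (N1 \<inter> N3) origin_fibre" by simp
    have op': "openin (top_of_set (quadratic_cone W)) (N1 \<inter> N3)" "openin (top_of_set (quadratic_cone W)) (N2 \<inter> N3)"
      using op1 op2 op3 by (auto intro: openin_Int)
    have sub': "N1 \<inter> N3 \<union> N2 \<inter> N3 \<subseteq> quadratic_cone W" using sub12 by auto
    have "additive (N1 \<inter> N3 \<union> N2 \<inter> N3) origin_fibre"
      using openin_subset_trans[OF op'(1) _ sub'] openin_subset_trans[OF op'(2) _ sub'] add13 add23 add123
      by (intro additive_Un) auto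
    moreover have "N1 \<inter> N3 \<union> N2 \<inter> N3 = (N1 \<union> N2) \<inter> N3" by auto
    ultimately have addI: "additive ((N1 \<union> N2) \<inter> N3) origin_fibre" by simp
    have op: "openin (top_of_set (quadratic_cone W)) (N1 \<union> N2 \<union> N3)" using op12 op3 by (rule openin_Un)
    have sub: "N1 \<union> N2 \<union> N3 \<subseteq> quadratic_cone W" using op openin_imp_subset by blast
    have "additive (N1 \<union> N2 \<union> N3) origin_fibre"
      using openin_subset_trans[OF op12 _ sub] openin_subset_trans[OF op3 _ sub] addU add3 addI
      by (intro additive_Un[of "N1 \<union> N2" N3]) auto
    moreover have "quadratic_cone W \<inter> origin_fibre \<subseteq> N1 \<union> N2 \<union> N3"
    proof
      fix p assume p: "p \<in> quadratic_cone W \<inter> origin_fibre"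
      show "p \<in> N1 \<union> N2 \<union> N3"
      proof (cases "snd p = 0")
        case True
        with p e show ?thesis by (auto simp: N3_def quadratic_cone_def polydisc_def zero_prod_def)
      qed (use p cover in blast)
    qed
    ultimately show ?thesis using op by blast
  qed
qed

subsection \<open>Pencils of bilinear forms\<close>

text \<open>Of three forms one has its coefficient normalized to 1. The domain \<open>T\<close> of
  the other two coefficients is kept variable because the cases n = 1 and n = 2 need different
  ones.\<close>

definition sol :: "('a \<Rightarrow> complex) \<Rightarrow> ('a \<Rightarrow> complex) \<Rightarrow> ('a \<Rightarrow> complex) \<Rightarrow> (complex \<times> complex) set \<Rightarrow> 'a set \<Rightarrow> ('a \<times> (complex \<times> complex)) set" where
  "sol h u1 u2 T V = {(v, z). v \<in> V \<and> z \<in> T \<and> h v + fst z * u1 v + snd z * u2 v = 0}"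

text \<open>The Taylor expansion at \<open>p\<close>, exact for a bilinear form that vanishes
  there.\<close>

definition germ :: "complex \<times> complex \<Rightarrow> complex \<Rightarrow> complex \<Rightarrow> complex \<Rightarrow> complex \<times> complex \<Rightarrow> complex" where
  "germ p a b c v = a * (fst v - fst p) + b * (snd v - snd p) + c * ((fst v - fst p) * (snd v - snd p))"

lemma continuous_on_germ [continuous_intros]:
  "continuous_on S f \<Longrightarrow> continuous_on S (\<lambda>x. germ p a b c (f x))"
  unfolding germ_def by (intro continuous_intros)

lemma germ_at [simp]: "germ p a b c p = 0"
  by (simp add: germ_def)

lemma openin_sol: "open U \<Longrightarrow> openin (top_of_set (sol h u1 u2 T V)) (sol h u1 u2 T (V \<inter> U))"
  by (rule openin_Int_open[where B = "fst -` U"]) (auto simp: sol_def open_vimage_fst)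

text \<open>The fibre over \<open>p\<close> is a copy of \<open>T\<close>, of value 0; given
  additivity near it, restoring \<open>p\<close> leaves the value unchanged.\<close>

lemma sol_insert_zero:
  fixes h :: "'a::t1_space \<Rightarrow> complex"
  assumes N: "openin (top_of_set (sol h u1 u2 T (V \<inter> U))) N" "sol h u1 u2 T (V \<inter> U) \<inter> {p} \<times> UNIV \<subseteq> N"
      "additive N ({p} \<times> UNIV)"
    and U: "open U" "p \<in> U" and p: "p \<in> V" "h p = 0" "u1 p = 0" "u2 p = 0"
    and T: "has_chi T 0" and c: "has_chi (sol h u1 u2 T (V - {p})) c"
  shows "has_chi (sol h u1 u2 T V) c"
proof -
  let ?X = "sol h u1 u2 T V"
  have 1: "openin (top_of_set ?X) N" using openin_trans[OF N(1) openin_sol[OF U(1)]] .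
  have 2: "?X \<inter> {p} \<times> UNIV \<subseteq> N" using N(2) U(2) by (auto simp: sol_def)
  have 3: "closed ({p} \<times> (UNIV :: (complex \<times> complex) set))" by (intro closed_Times) auto
  have diff: "?X - {p} \<times> UNIV = sol h u1 u2 T (V - {p})" by (auto simp: sol_def)
  then have "fin_hom (?X - {p} \<times> UNIV)" using c by (simp add: has_chi_def)
  then have "additive ?X ({p} \<times> UNIV)" by (rule additive_enlarge[OF 1 2 3 N(3)])
  moreover have "?X \<inter> {p} \<times> UNIV = {p} \<times> T" using p by (auto simp: sol_def)
  moreover have "has_chi ({p} \<times> T) 0 \<longleftrightarrow> has_chi T 0"
    by (rule has_chi_homeomorphism[where f = snd and g = "\<lambda>z. (p, z)"]) (auto intro!: continuous_intros)
  ultimately show ?thesis using additive_has_chi[of ?X "{p} \<times> UNIV" 0 c] T c diff by simp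
qed

text \<open>The linear parts are invertible, and on a small ball the mixed terms vary too little to
  compensate for them. The second conclusion keeps the determinant for Cramer's rule nonzero in the
  factorization of a third germ.\<close>

lemma transverse_germs_inj:
  assumes d: "a1 * b2 - a2 * b1 \<noteq> 0"
  shows "\<exists>e>0. inj_on (\<lambda>v. (germ p a1 b1 c1 v, germ p a2 b2 c2 v)) (ball p e) \<and>
    (\<forall>v\<in>ball p e. a1 * (b2 + c2 * (fst v - fst p)) - a2 * (b1 + c1 * (fst v - fst p)) \<noteq> 0)"
proof -
  define D where "D = a1 * b2 - a2 * b1"
  have D: "norm D > 0" using d by (simp add: D_def)
  \<comment> \<open>Eliminating either unknown multiplies the difference of the mixed terms by one
    of these two coefficients; \<open>e\<close> is then chosen with
    \<open>K * e < norm D\<close>.\<close>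
  define K where "K = norm (c1 * b2 - c2 * b1) + norm (a1 * c2 - a2 * c1)"
  have K: "K \<ge> 0" by (simp add: K_def)
  define e where "e = norm D / (2 * (K + 1))"
  have e: "e > 0" "K * e < norm D"
  proof -
    show "e > 0" using D K by (simp add: e_def)
    have "K * e = norm D * (K / (2 * (K + 1)))" using K by (simp add: e_def)
    also have "\<dots> < norm D * 1" using D K by (intro mult_strict_left_mono) (auto simp: divide_less_eq)
    finally show "K * e < norm D" by simp
  qed
  have near: "norm (fst v - fst p) < e" "norm (snd v - snd p) < e" if "v \<in> ball p e" for v
  proof -
    have "dist (fst p) (fst v) \<le> dist p v" "dist (snd p) (snd v) \<le> dist p v"
      by (rule dist_fst_le dist_snd_le)+
    then show "norm (fst v - fst p) < e" "norm (snd v - snd p) < e"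
      using that by (auto simp: dist_norm norm_minus_commute)
  qed
  have inj: "inj_on (\<lambda>v. (germ p a1 b1 c1 v, germ p a2 b2 c2 v)) (ball p e)"
  proof (rule inj_onI)
    fix v w assume v: "v \<in> ball p e" and w: "w \<in> ball p e"
      and eq: "(germ p a1 b1 c1 v, germ p a2 b2 c2 v) = (germ p a1 b1 c1 w, germ p a2 b2 c2 w)"
    define X Y X' Y' where "X = fst v - fst p" and "Y = snd v - snd p" and "X' = fst w - fst p" and "Y' = snd w - snd p"
    define \<Delta> where "\<Delta> = X * Y - X' * Y'"
    have 1: "a1 * (X - X') + b1 * (Y - Y') = - (c1 * \<Delta>)" "a2 * (X - X') + b2 * (Y - Y') = - (c2 * \<Delta>)"
      using eq by (simp_all add: germ_def X_def Y_def X'_def Y'_def \<Delta>_def algebra_simps)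
    have "D * (X - X') = b2 * (a1 * (X - X') + b1 * (Y - Y')) - b1 * (a2 * (X - X') + b2 * (Y - Y'))"
      by (simp add: D_def algebra_simps)
    also have "\<dots> = - ((c1 * b2 - c2 * b1) * \<Delta>)" unfolding 1 by (simp add: algebra_simps)
    finally have "norm D * norm (X - X') = norm (c1 * b2 - c2 * b1) * norm \<Delta>"
      by (metis norm_minus_cancel norm_mult)
    moreover have "D * (Y - Y') = a1 * (a2 * (X - X') + b2 * (Y - Y')) - a2 * (a1 * (X - X') + b1 * (Y - Y'))"
      by (simp add: D_def algebra_simps)
    then have "D * (Y - Y') = - ((a1 * c2 - a2 * c1) * \<Delta>)" unfolding 1 by (simp add: algebra_simps)
    then have "norm D * norm (Y - Y') = norm (a1 * c2 - a2 * c1) * norm \<Delta>"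
      by (metis norm_minus_cancel norm_mult)
    ultimately have DK: "norm D * (norm (X - X') + norm (Y - Y')) = K * norm \<Delta>"
      by (simp add: K_def algebra_simps)
    have "\<Delta> = X * (Y - Y') + Y' * (X - X')" by (simp add: \<Delta>_def algebra_simps)
    then have "norm \<Delta> \<le> norm X * norm (Y - Y') + norm Y' * norm (X - X')"
      by (metis norm_mult norm_triangle_ineq)
    also have "\<dots> \<le> e * norm (Y - Y') + e * norm (X - X')"
      using near[OF v] near[OF w] by (intro add_mono mult_right_mono) (auto simp: X_def Y'_def)
    finally have "K * norm \<Delta> \<le> K * (e * (norm (X - X') + norm (Y - Y')))"
      using K by (intro mult_left_mono) (auto simp: algebra_simps)
    then have "norm D * (norm (X - X') + norm (Y - Y')) \<le> (K * e) * (norm (X - X') + norm (Y - Y'))"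
      using DK by (simp add: mult_ac)
    then have "norm (X - X') + norm (Y - Y') \<le> 0"
      using e(2) by (meson mult_le_cancel_right not_less)
    then have "X = X'" "Y = Y'" by (smt (verit) norm_ge_zero norm_le_zero_iff eq_iff_diff_eq_0)+
    then show "v = w" by (simp add: prod_eq_iff X_def Y_def X'_def Y'_def)
  qed
  have "a1 * (b2 + c2 * (fst v - fst p)) - a2 * (b1 + c1 * (fst v - fst p)) \<noteq> 0" if v: "v \<in> ball p e" for v
  proof
    define X where "X = fst v - fst p"
    assume "a1 * (b2 + c2 * (fst v - fst p)) - a2 * (b1 + c1 * (fst v - fst p)) = 0"
    then have "D = - ((a1 * c2 - a2 * c1) * X)" by (simp add: D_def X_def algebra_simps)
    then have "norm D = norm (a1 * c2 - a2 * c1) * norm X" by (metis norm_minus_cancel norm_mult)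
    also have "\<dots> \<le> K * e"
      using near[OF v] by (intro mult_mono) (auto simp: K_def X_def)
    finally show False using e by simp
  qed
  with inj e show ?thesis by blast
qed

text \<open>Near \<open>p\<close> one has h = g_1 u_1 + g_2 u_2 with continuous g, so the equation
  is linear in the shifted coefficients z + g. With (u_1, u_2) as coordinates it becomes
  \<open>linear_cone\<close>; invariance of domain makes the inverse of these coordinates
  continuous.\<close>

lemma transverse_zero_has_chi:
  fixes V :: "(complex \<times> complex) set" and a0 b0 c0 a1 b1 c1 a2 b2 c2 :: complex and p
  assumes d: "a1 * b2 - a2 * b1 \<noteq> 0" and V: "open V" "p \<in> V" and T: "open T" "has_chi T 0"
  defines "h \<equiv> germ p a0 b0 c0" and "u1 \<equiv> germ p a1 b1 c1" and "u2 \<equiv> germ p a2 b2 c2"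
  assumes c: "has_chi (sol h u1 u2 T (V - {p})) c"
  shows "has_chi (sol h u1 u2 T V) c"
proof -
  obtain e where e: "e > 0" "inj_on (\<lambda>v. (u1 v, u2 v)) (ball p e)"
    "\<And>v. v \<in> ball p e \<Longrightarrow> a1 * (b2 + c2 * (fst v - fst p)) - a2 * (b1 + c1 * (fst v - fst p)) \<noteq> 0"
    using transverse_germs_inj[OF d, of p c1 c2] unfolding u1_def u2_def by blast
  define U where "U = V \<inter> ball p e"
  have U: "open U" "p \<in> U" "U \<subseteq> ball p e" using V e by (auto simp: U_def)
  define u where "u v = (u1 v, u2 v)" for v
  have contu: "continuous_on S u" for S unfolding u_def u1_def u2_def by (intro continuous_intros)
  have inju: "inj_on u U" using e(2) U(3) unfolding u_def by (rule inj_on_subset)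
  have "open (u ` U)" by (rule invariance_of_domain[OF contu U(1) inju])
  obtain i where i: "homeomorphism U (u ` U) u i"
    using invariance_of_domain_homeomorphism[OF U(1) contu _ inju] by auto
  have iu: "i (u v) = v" if "v \<in> U" for v using i that by (simp add: homeomorphism_def)
  have ui: "i w \<in> U \<and> u (i w) = w" if "w \<in> u ` U" for w using i that by (auto simp: homeomorphism_def)
  have conti: "continuous_on (u ` U) i" using i by (simp add: homeomorphism_def)
  define X where "X v = fst v - fst p" for v :: "complex \<times> complex"
  define D where "D v = a1 * (b2 + c2 * X v) - a2 * (b1 + c1 * X v)" for v
  \<comment> \<open>With X and Y the coordinates relative to \<open>p\<close>, a germ reads a X + (b
    + c X) Y; Cramer's rule with these two coefficients expresses \<open>h\<close> by
    \<open>u1\<close> and \<open>u2\<close>.\<close>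
  define g where "g v = ((a0 * (b2 + c2 * X v) - (b0 + c0 * X v) * a2) / D v,
      ((b0 + c0 * X v) * a1 - a0 * (b1 + c1 * X v)) / D v)" for v
  have Dnz: "D v \<noteq> 0" if "v \<in> U" for v using e(3)[of v] that U by (auto simp: D_def X_def)
  have contg: "continuous_on U g"
    unfolding g_def D_def X_def using Dnz
    by (intro continuous_intros) (auto simp: D_def X_def)
  have hg: "h v = fst (g v) * u1 v + snd (g v) * u2 v" if "v \<in> U" for v
  proof -
    define Y where "Y = snd v - snd p"
    have "(a0 * (b2 + c2 * X v) - (b0 + c0 * X v) * a2) * u1 v + ((b0 + c0 * X v) * a1 - a0 * (b1 + c1 * X v)) * u2 v = D v * h v"
      unfolding h_def u1_def u2_def germ_def D_def X_def Y_def[symmetric] by (simp add: algebra_simps)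
    moreover have "fst (g v) * u1 v + snd (g v) * u2 v
        = ((a0 * (b2 + c2 * X v) - (b0 + c0 * X v) * a2) * u1 v + ((b0 + c0 * X v) * a1 - a0 * (b1 + c1 * X v)) * u2 v) / D v"
      by (simp add: g_def add_divide_distrib)
    ultimately show ?thesis using Dnz[OF that] by simp
  qed
  define W where "W = {(w, \<eta>). w \<in> u ` U \<and> \<eta> - g (i w) \<in> T}"
  have openW: "open W"
  proof -
    have "continuous_on (u ` U \<times> UNIV) (\<lambda>q. snd q - g (i (fst q)))"
      by (intro continuous_intros continuous_on_compose2[OF contg] continuous_on_compose2[OF conti]) (auto simp: iu)
    from continuous_open_preimage[OF this _ T(1)]
    have "open (u ` U \<times> UNIV \<inter> (\<lambda>q. snd q - g (i (fst q))) -` T)"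
      using \<open>open (u ` U)\<close> by (simp add: open_Times)
    moreover have "W = u ` U \<times> UNIV \<inter> (\<lambda>q. snd q - g (i (fst q))) -` T" by (auto simp: W_def)
    ultimately show ?thesis by simp
  qed
  have up: "u p = 0" by (simp add: u_def u1_def u2_def zero_prod_def)
  have u0: "v = p" if "v \<in> U" "u v = 0" for v using inju that U(2) up by (metis inj_onD)
  have i0: "i 0 = p" using iu[OF U(2)] up by simp
  have "has_chi {\<eta>. (0, \<eta>) \<in> W} 0 \<longleftrightarrow> has_chi T 0"
    by (rule has_chi_homeomorphism[where f = "\<lambda>\<eta>. \<eta> - g p" and g = "\<lambda>z. z + g p"])
       (use U(2) up i0 in \<open>auto simp: W_def image_iff intro!: continuous_intros\<close>)
  then have "fin_hom {\<eta>. (0, \<eta>) \<in> W}" using T(2) by (simp add: has_chi_def)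
  from linear_cone_additive[OF openW this] obtain N where
    N: "openin (top_of_set (linear_cone W)) N" "linear_cone W \<inter> origin_fibre \<subseteq> N" "additive N origin_fibre"
    by blast
  let ?S = "sol h u1 u2 T U"
  define F where "F q = (u (fst q), snd q + g (fst q))" for q
  define G where "G q = (i (fst q), snd q - g (i (fst q)))" for q
  have eqF: "fst (snd q + g v) * u1 v + snd (snd q + g v) * u2 v = h v + fst (snd q) * u1 v + snd (snd q) * u2 v"
    if "v \<in> U" for q v using hg[OF that] by (simp add: algebra_simps)
  have F: "F q \<in> linear_cone W \<and> G (F q) = q" if "q \<in> ?S" for q
    using that eqF[of "fst q" q] iu by (auto simp: F_def G_def sol_def linear_cone_def W_def u_def)
  have G: "G q \<in> ?S \<and> F (G q) = q" if q: "q \<in> linear_cone W" for q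
  proof -
    have w: "fst q \<in> u ` U" and t: "snd q - g (i (fst q)) \<in> T" and eq: "fst (snd q) * fst (fst q) + snd (snd q) * snd (fst q) = 0"
      using q by (auto simp: linear_cone_def W_def)
    have "u1 (i (fst q)) = fst (fst q)" "u2 (i (fst q)) = snd (fst q)"
      using ui[OF w] by (auto simp: u_def prod_eq_iff)
    then have "G q \<in> ?S" using ui[OF w] t eq eqF[of "i (fst q)" "G q"] by (auto simp: G_def sol_def)
    moreover have "F (G q) = q" using ui[OF w] by (simp add: F_def G_def)
    ultimately show ?thesis by blast
  qed
  have contF: "continuous_on ?S F"
    unfolding F_def
    by (intro continuous_intros continuous_on_compose2[OF contu[of UNIV]] continuous_on_compose2[OF contg])
       (auto simp: sol_def)
  have contG: "continuous_on (linear_cone W) G"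
    unfolding G_def
    by (intro continuous_intros continuous_on_compose2[OF conti] continuous_on_compose2[OF contg])
       (auto simp: linear_cone_def W_def iu)
  define N' where "N' = {q \<in> ?S. F q \<in> N}"
  have NW: "N \<subseteq> linear_cone W" using N(1) openin_imp_subset by blast
  have "openin (top_of_set ?S) (?S \<inter> F -` N)"
    by (rule continuous_openin_preimage[OF contF _ N(1)]) (use F in auto)
  then have 1: "openin (top_of_set ?S) N'" by (simp add: N'_def vimage_def Int_def)
  have fib: "F q \<in> origin_fibre \<longleftrightarrow> q \<in> {p} \<times> UNIV" if "q \<in> ?S" for q
  proof -
    have "fst q \<in> U" using that by (auto simp: sol_def)
    then have "u (fst q) = 0 \<longleftrightarrow> fst q = p" using u0 up by blast
    then show ?thesis by (cases q) (simp add: F_def)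
  qed
  have 2: "additive N' ({p} \<times> UNIV)"
  proof (rule additive_homeo[OF _ _ _ _ N(3)])
    show "continuous_on N' F" using contF by (rule continuous_on_subset) (auto simp: N'_def)
    show "continuous_on N G" using contG NW by (rule continuous_on_subset)
    show "F x \<in> N \<and> G (F x) = x \<and> (F x \<in> origin_fibre \<longleftrightarrow> x \<in> {p} \<times> UNIV)" if "x \<in> N'" for x
      using that F[of x] fib[of x] by (simp add: N'_def)
    show "G y \<in> N' \<and> F (G y) = y" if "y \<in> N" for y
      using that NW G[of y] by (auto simp: N'_def)
  qed
  have 3: "?S \<inter> {p} \<times> UNIV \<subseteq> N'"
  proof
    fix q assume q: "q \<in> ?S \<inter> {p} \<times> UNIV"
    then have "F q \<in> linear_cone W \<inter> origin_fibre" using F[of q] fib[of q] by blast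
    then show "q \<in> N'" using N(2) q by (auto simp: N'_def)
  qed
  have hu: "h p = 0" "u1 p = 0" "u2 p = 0" by (simp_all add: h_def u1_def u2_def)
  have "p \<in> ball p e" using e(1) by simp
  from sol_insert_zero[OF 1[unfolded U_def] 3[unfolded U_def] 2 open_ball this V(2) hu T(2) c]
  show ?thesis .
qed

text \<open>The equation reads M (a X + b Y) + C X Y = 0 with M and C affine in z and, by
  \<open>d\<close>, independent. Scaling x = a X, y = b Y gives \<open>quadratic_cone\<close> with
  coefficients M and C / (a b). Its nodes lie over the line M = 0 of the z-plane, whose part in
  \<open>T\<close> must have finite homology; this is the purpose of \<open>lines\<close>.\<close>

lemma tangent_zero_has_chi:
  fixes V :: "(complex \<times> complex) set" and a b m0 c0 m1 c1 m2 c2 :: complex and p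
  assumes ab: "a \<noteq> 0" "b \<noteq> 0" and d: "m1 * c2 - m2 * c1 \<noteq> 0" and V: "open V" "p \<in> V"
    and T: "open T" "has_chi T 0"
    and lines: "\<And>s1 t1 s2 t2. t1 \<noteq> 0 \<or> t2 \<noteq> 0 \<Longrightarrow> fin_hom {t. (s1 + t1 * t, s2 + t2 * t) \<in> T}"
  defines "h \<equiv> germ p (m0 * a) (m0 * b) c0" and "u1 \<equiv> germ p (m1 * a) (m1 * b) c1" and "u2 \<equiv> germ p (m2 * a) (m2 * b) c2"
  assumes c: "has_chi (sol h u1 u2 T (V - {p})) c"
  shows "has_chi (sol h u1 u2 T V) c"
proof -
  define \<delta> where "\<delta> = m1 * c2 - m2 * c1"
  have dnz: "\<delta> \<noteq> 0" using d by (simp add: \<delta>_def)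
  \<comment> \<open>The inverse, by Cramer's rule, of the affine map from z to M and C / (a
    b).\<close>
  define Z where "Z \<eta> = (((fst \<eta> - m0) * c2 - (a * b * snd \<eta> - c0) * m2) / \<delta>,
      (m1 * (a * b * snd \<eta> - c0) - c1 * (fst \<eta> - m0)) / \<delta>)" for \<eta>
  define M where "M z = m0 + fst z * m1 + snd z * m2" for z
  define C where "C z = c0 + fst z * c1 + snd z * c2" for z
  have contZ: "continuous_on S Z" for S unfolding Z_def using dnz by (intro continuous_intros) auto
  have MZ: "M (Z \<eta>) = fst \<eta>" for \<eta>
  proof -
    have "(M (Z \<eta>) - m0) * \<delta> = (fst \<eta> - m0) * \<delta>"
      using dnz by (simp add: M_def Z_def distrib_right) (simp add: \<delta>_def algebra_simps)
    then show ?thesis using dnz by simp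
  qed
  have CZ: "C (Z \<eta>) = a * b * snd \<eta>" for \<eta>
  proof -
    have "(C (Z \<eta>) - c0) * \<delta> = (a * b * snd \<eta> - c0) * \<delta>"
      using dnz by (simp add: C_def Z_def distrib_right) (simp add: \<delta>_def algebra_simps)
    then show ?thesis using dnz by simp
  qed
  have ZM: "Z (M z, C z / (a * b)) = z" for z
  proof -
    have "(M z - m0) * c2 - (C z - c0) * m2 = fst z * \<delta>" "m1 * (C z - c0) - c1 * (M z - m0) = snd z * \<delta>"
      by (simp_all add: M_def C_def \<delta>_def algebra_simps)
    moreover have "a * b * (C z / (a * b)) = C z" using ab by simp
    ultimately show ?thesis using dnz by (simp add: Z_def prod_eq_iff)
  qed
  define P where "P w = (fst p + fst w / a, snd p + snd w / b)" for w
  have contP: "continuous_on S P" for S unfolding P_def using ab by (intro continuous_intros) auto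
  define W where "W = {(w, \<eta>). P w \<in> V \<and> Z \<eta> \<in> T}"
  have "W = P -` V \<times> Z -` T" by (auto simp: W_def)
  then have openW: "open W"
    using V T by (auto intro!: open_Times open_vimage contP contZ)
  have P0: "P 0 = p" by (simp add: P_def)
  have "has_chi {\<eta>. (0, \<eta>) \<in> W} 0 \<longleftrightarrow> has_chi T 0"
  proof (rule has_chi_homeomorphism[where f = Z and g = "\<lambda>z. (M z, C z / (a * b))"])
    show "continuous_on T (\<lambda>z. (M z, C z / (a * b)))"
      unfolding M_def C_def using ab by (intro continuous_intros) auto
  qed (use V P0 MZ CZ ZM ab contZ in \<open>auto simp: W_def\<close>)
  then have fin1: "fin_hom {\<eta>. (0, \<eta>) \<in> W}" using T(2) by (simp add: has_chi_def)
  have "fin_hom {t. ((- m0 * c2 + c0 * m2) / \<delta> + (- a * b * m2 / \<delta>) * t, (- m1 * c0 + c1 * m0) / \<delta> + (m1 * a * b / \<delta>) * t) \<in> T}"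
    by (rule lines) (use d ab dnz in auto)
  moreover have "Z (0, t) = ((- m0 * c2 + c0 * m2) / \<delta> + (- a * b * m2 / \<delta>) * t, (- m1 * c0 + c1 * m0) / \<delta> + (m1 * a * b / \<delta>) * t)" for t
    using dnz by (simp add: Z_def diff_divide_distrib add_divide_distrib algebra_simps)
  ultimately have fin2: "fin_hom {c. (0, (0, c)) \<in> W}"
    using V P0 by (simp add: W_def)
  from quadratic_cone_additive[OF openW fin1 fin2] obtain N where
    N: "openin (top_of_set (quadratic_cone W)) N" "quadratic_cone W \<inter> origin_fibre \<subseteq> N" "additive N origin_fibre"
    by blast
  let ?S = "sol h u1 u2 T V"
  define F where "F q = ((a * (fst (fst q) - fst p), b * (snd (fst q) - snd p)), (M (snd q), C (snd q) / (a * b)))"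
    for q :: "(complex \<times> complex) \<times> (complex \<times> complex)"
  define G where "G q = (P (fst q), Z (snd q))" for q
  have eq: "h v + fst z * u1 v + snd z * u2 v
      = M z * (a * (fst v - fst p) + b * (snd v - snd p)) + C z / (a * b) * ((a * (fst v - fst p)) * (b * (snd v - snd p)))" for v z
  proof -
    have "C z / (a * b) * ((a * (fst v - fst p)) * (b * (snd v - snd p))) = C z * ((fst v - fst p) * (snd v - snd p))"
      using ab by simp
    then show ?thesis by (simp add: h_def u1_def u2_def germ_def M_def C_def algebra_simps)
  qed
  have PF: "P (fst (F q)) = fst q" for q using ab by (simp add: P_def F_def)
  have F: "F q \<in> quadratic_cone W \<and> G (F q) = q" if "q \<in> ?S" for q
  proof -
    have "P (fst (F q)) \<in> V" "Z (snd (F q)) = snd q" using PF that ZM by (auto simp: sol_def F_def)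
    moreover have "snd q \<in> T" using that by (auto simp: sol_def)
    ultimately have "F q \<in> W" "G (F q) = q"
      using PF[of q] unfolding W_def G_def by (simp_all add: case_prod_unfold)
    moreover have "h (fst q) + fst (snd q) * u1 (fst q) + snd (snd q) * u2 (fst q) = 0"
      using that by (auto simp: sol_def)
    ultimately show ?thesis unfolding eq by (simp add: quadratic_cone_def F_def)
  qed
  have FG: "F (G q) = q" for q using MZ CZ ab by (simp add: F_def G_def P_def prod_eq_iff)
  have G: "G q \<in> ?S" if q: "q \<in> quadratic_cone W" for q
  proof -
    obtain x y m c' where qq: "q = ((x, y), (m, c'))" by (metis prod.collapse)
    have W: "P (x, y) \<in> V" "Z (m, c') \<in> T" and e: "m * (x + y) + c' * (x * y) = 0"
      using q by (auto simp: qq quadratic_cone_def W_def)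
    have "h (P (x, y)) + fst (Z (m, c')) * u1 (P (x, y)) + snd (Z (m, c')) * u2 (P (x, y)) = 0"
      unfolding eq using MZ[of "(m, c')"] CZ[of "(m, c')"] e ab by (simp add: P_def)
    then show ?thesis using W by (simp add: qq G_def sol_def)
  qed
  have contF: "continuous_on S F" for S
    unfolding F_def M_def C_def using ab by (intro continuous_intros) auto
  have contG: "continuous_on S G" for S
    unfolding G_def by (intro continuous_intros continuous_on_compose2[OF contP[of UNIV]] continuous_on_compose2[OF contZ[of UNIV]]) auto
  define N' where "N' = {q \<in> ?S. F q \<in> N}"
  have NW: "N \<subseteq> quadratic_cone W" using N(1) openin_imp_subset by blast
  have "openin (top_of_set ?S) (?S \<inter> F -` N)"
    by (rule continuous_openin_preimage[OF contF _ N(1)]) (use F in auto)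
  then have 1: "openin (top_of_set ?S) N'" by (simp add: N'_def vimage_def Int_def)
  have fib: "F q \<in> origin_fibre \<longleftrightarrow> q \<in> {p} \<times> UNIV" for q
  proof -
    have "F q \<in> origin_fibre \<longleftrightarrow> fst q = p" using ab by (simp add: F_def zero_prod_def prod_eq_iff mem_Times_iff)
    then show ?thesis by (simp add: mem_Times_iff)
  qed
  have 2: "additive N' ({p} \<times> UNIV)"
  proof (rule additive_homeo[OF contF contG _ _ N(3)])
    show "F x \<in> N \<and> G (F x) = x \<and> (F x \<in> origin_fibre \<longleftrightarrow> x \<in> {p} \<times> UNIV)" if "x \<in> N'" for x
      using that F[of x] fib[of x] by (simp add: N'_def)
    show "G y \<in> N' \<and> F (G y) = y" if "y \<in> N" for y
      using that G[of y] FG[of y] subsetD[OF NW that] by (simp add: N'_def)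
  qed
  have 3: "?S \<inter> {p} \<times> UNIV \<subseteq> N'"
  proof
    fix q assume q: "q \<in> ?S \<inter> {p} \<times> UNIV"
    then have "F q \<in> quadratic_cone W \<inter> origin_fibre" using F fib by blast
    then show "q \<in> N'" using N(2) q by (auto simp: N'_def)
  qed
  show ?thesis
  proof (rule sol_insert_zero[OF _ _ 2 open_UNIV UNIV_I V(2) _ _ _ T(2) c])
    show "openin (top_of_set (sol h u1 u2 T (V \<inter> UNIV))) N'" "sol h u1 u2 T (V \<inter> UNIV) \<inter> {p} \<times> UNIV \<subseteq> N'"
      using 1 3 by simp_all
  qed (simp_all add: h_def u1_def u2_def)
qed

section \<open>Restoring common zeros for one or two free coefficients\<close>

abbreviation punctured_plane :: "complex set" where
  "punctured_plane \<equiv> UNIV - {0}"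

text \<open>A line meets the first factor in everything, nothing, a disc or all but one point, and
  the second factor removes at most one point or everything.\<close>

lemma fin_hom_line_section:
  assumes "t1 \<noteq> 0 \<or> t2 \<noteq> 0" and D: "D = punctured_plane \<or> D = ball 1 (1 / 2)"
  shows "fin_hom {t. (s1 + t1 * t, s2 + t2 * t) \<in> D \<times> punctured_plane}"
proof -
  have empty: "fin_hom ({} :: complex set)" using has_chi_empty by (auto simp: has_chi_def)
  have univ: "fin_hom (UNIV :: complex set)"
    using has_chi_contractible[of "UNIV :: complex set"] by (auto simp: has_chi_def)
  have A: "open {t. s1 + t1 * t \<in> D} \<and> fin_hom {t. s1 + t1 * t \<in> D}"
  proof (cases "t1 = 0")
    case True
    then show ?thesis using empty univ by (cases "s1 \<in> D") auto
  next
    case False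
    from D show ?thesis
    proof
      assume "D = punctured_plane"
      then have "{t. s1 + t1 * t \<in> D} = UNIV - {- s1 / t1}"
        using False by (auto simp: field_simps eq_neg_iff_add_eq_0 add.commute)
      then show ?thesis using fin_hom_remove_point[OF open_UNIV univ] by (simp add: open_Diff)
    next
      assume DB: "D = ball 1 (1 / 2)"
      have "dist 1 (s1 + t1 * t) = norm t1 * dist ((1 - s1) / t1) t" for t
      proof -
        have "1 - (s1 + t1 * t) = t1 * ((1 - s1) / t1 - t)" using False by (simp add: field_simps)
        then show ?thesis by (simp add: dist_norm norm_mult)
      qed
      then have "{t. s1 + t1 * t \<in> D} = ball ((1 - s1) / t1) (1 / (2 * norm t1))"
        using False DB by (auto simp: field_simps)
      moreover have "has_chi (ball ((1 - s1) / t1) (1 / (2 * norm t1))) 1"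
        using False by (intro has_chi_contractible) (auto intro!: convex_imp_contractible)
      ultimately show ?thesis by (simp add: has_chi_def)
    qed
  qed
  show ?thesis
  proof (cases "t2 = 0")
    case True
    then show ?thesis using A empty by (cases "s2 = 0") auto
  next
    case False
    then have "{t. (s1 + t1 * t, s2 + t2 * t) \<in> D \<times> punctured_plane} = {t. s1 + t1 * t \<in> D} - {- s2 / t2}"
      by (auto simp: field_simps eq_neg_iff_add_eq_0 add.commute)
    then show ?thesis using fin_hom_remove_point A by simp
  qed
qed

lemma has_chi_section_domain:
  assumes "D = punctured_plane \<or> D = ball 1 (1 / 2)"
  shows "has_chi (D \<times> punctured_plane) 0" "open (D \<times> punctured_plane)"
proof -
  have "has_chi (ball (1::complex) (1/2)) 1" by (rule has_chi_contractible) (auto intro: convex_imp_contractible)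
  moreover have "has_chi punctured_plane 0" by (rule has_chi_punctured_convex) auto
  ultimately obtain c where c: "has_chi D c" using assms by blast
  show "has_chi (D \<times> punctured_plane) 0" by (rule has_chi_punctured_factor[OF _ _ _ c]) auto
  show "open (D \<times> punctured_plane)" using assms by (auto intro!: open_Times open_Diff)
qed

text \<open>The two situations in which an isolated common zero of a pencil or net of bilinear forms can be handled:
  two members meet transversally, or all members are tangent to one direction.\<close>

definition tame_zero :: "nat \<Rightarrow> (nat \<Rightarrow> complex) \<Rightarrow> (nat \<Rightarrow> complex) \<Rightarrow> (nat \<Rightarrow> complex) \<Rightarrow> bool" where
  "tame_zero n a b c \<longleftrightarrow> (\<exists>i j. i \<le> n \<and> j \<le> n \<and> a i * b j - a j * b i \<noteq> 0) \<or>
     (\<exists>\<alpha> \<beta> m. \<alpha> \<noteq> 0 \<and> \<beta> \<noteq> 0 \<and> (\<forall>k\<le>n. a k = m k * \<alpha> \<and> b k = m k * \<beta>) \<and>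
        (\<exists>i j. i \<le> n \<and> j \<le> n \<and> m i * c j - m j * c i \<noteq> 0))"

lemma tame_zero_sol_has_chi:
  assumes "(a i * b j - a j * b i \<noteq> 0) \<or>
     (\<exists>\<alpha> \<beta> m. \<alpha> \<noteq> 0 \<and> \<beta> \<noteq> 0 \<and> (\<forall>l\<in>{i, j, k}. a l = m l * \<alpha> \<and> b l = m l * \<beta>) \<and> m i * c j - m j * c i \<noteq> 0)"
    and D: "D = punctured_plane \<or> D = ball 1 (1 / 2)" and V: "open V" "p \<in> V"
  defines "f \<equiv> \<lambda>l. germ p (a l) (b l) (c l)"
  assumes x: "has_chi (sol (f k) (f i) (f j) (D \<times> punctured_plane) (V - {p})) x"
  shows "has_chi (sol (f k) (f i) (f j) (D \<times> punctured_plane) V) x"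
  using assms(1)
proof
  assume "a i * b j - a j * b i \<noteq> 0"
  from transverse_zero_has_chi[OF this V has_chi_section_domain(2,1)[OF D]] x
  show ?thesis unfolding f_def by blast
next
  assume "\<exists>\<alpha> \<beta> m. \<alpha> \<noteq> 0 \<and> \<beta> \<noteq> 0 \<and> (\<forall>l\<in>{i, j, k}. a l = m l * \<alpha> \<and> b l = m l * \<beta>) \<and> m i * c j - m j * c i \<noteq> 0"
  then obtain \<alpha> \<beta> m where ab: "\<alpha> \<noteq> 0" "\<beta> \<noteq> 0" and l: "\<forall>l\<in>{i, j, k}. a l = m l * \<alpha> \<and> b l = m l * \<beta>"
    and m: "m i * c j - m j * c i \<noteq> 0" by blast
  from l have f: "f k = germ p (m k * \<alpha>) (m k * \<beta>) (c k)" "f i = germ p (m i * \<alpha>) (m i * \<beta>) (c i)"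
    "f j = germ p (m j * \<alpha>) (m j * \<beta>) (c j)" by (simp_all add: f_def)
  show ?thesis
    using tangent_zero_has_chi[OF ab m V has_chi_section_domain(2,1)[OF D] fin_hom_line_section[OF _ D]] x
    unfolding f by blast
qed

lemma hyper_2_has_chi:
  "has_chi (hyper 2 f V) c \<longleftrightarrow> has_chi (sol (f 0) (f 1) (f 2) (punctured_plane \<times> punctured_plane) V) c"
proof (rule has_chi_homeomorphism)
  let ?f = "\<lambda>p::'a \<times> (nat \<Rightarrow> complex). (fst p, (snd p 1, snd p 2))"
  let ?w = "\<lambda>(q::'a \<times> (complex \<times> complex)) k. if k = 0 then 1 else if k = 1 then fst (snd q) else snd (snd q)"
  let ?g = "\<lambda>q::'a \<times> (complex \<times> complex). (fst q, \<lambda>k. if k \<in> {..2} then ?w q k else 0)"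
  have set: "{..2::nat} = {0, 1, 2}" by auto
  show "continuous_on (hyper 2 f V) ?f" by (intro continuous_intros)
  have "continuous_on S (\<lambda>q. ?w q k)" for S :: "('a \<times> (complex \<times> complex)) set" and k
    by (cases "k = 0"; cases "k = 1"; simp add: continuous_intros)
  then show "continuous_on (sol (f 0) (f 1) (f 2) (punctured_plane \<times> punctured_plane) V) ?g"
    by (intro continuous_on_Pair continuous_on_torus_map continuous_intros)
  show "?f p \<in> sol (f 0) (f 1) (f 2) (punctured_plane \<times> punctured_plane) V \<and> ?g (?f p) = p" if "p \<in> hyper 2 f V" for p
  proof -
    obtain v z where p: "p = (v, z)" by (metis prod.collapse)
    have *: "z \<in> torus {..2}" "z 0 = 1" "v \<in> V" "(\<Sum>k\<le>2. z k * f k v) = 0"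
      using that by (auto simp: hyper_def p)
    have nz: "z 1 \<noteq> 0" "z 2 \<noteq> 0" using *(1) by (auto simp: torus_def)
    have "z k = (if k \<in> {..2} then if k = 0 then 1 else if k = 1 then z 1 else z 2 else 0)" for k
      using *(1,2) unfolding set by (simp add: torus_def set)
    then have zz: "(\<lambda>k. if k \<in> {..2} then if k = 0 then 1 else if k = 1 then z 1 else z 2 else 0) = z" by auto
    have "?g (?f p) = p" unfolding p fst_conv snd_conv zz by (rule refl)
    moreover have "f 0 v + z 1 * f 1 v + z 2 * f 2 v = 0" using *(2,4) unfolding set by (simp add: add_ac)
    ultimately show ?thesis using * nz by (simp add: sol_def p)
  qed
  show "?g q \<in> hyper 2 f V \<and> ?f (?g q) = q" if "q \<in> sol (f 0) (f 1) (f 2) (punctured_plane \<times> punctured_plane) V" for q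
    using that by (auto simp: sol_def hyper_def torus_def set add.assoc)
qed

text \<open>For n = 1 there is only one free coefficient. Multiplying the equation by
  \<open>d\<close> from a disc that avoids 0 adds a contractible parameter and yields d f_0 + e f_1
  = 0, with two free coefficients and constant term 0.\<close>

lemma hyper_1_has_chi:
  "has_chi (hyper 1 f V) c \<longleftrightarrow> has_chi (sol (\<lambda>_. 0) (f 0) (f 1) (ball 1 (1 / 2) \<times> punctured_plane) V) c"
proof -
  let ?D = "ball (1::complex) (1 / 2)"
  have D0: "d \<noteq> 0" if "d \<in> ?D" for d using that by auto
  have "has_chi (hyper 1 f V \<times> ?D) c \<longleftrightarrow> has_chi (hyper 1 f V) c" by (rule has_chi_convex_factor) auto
  moreover have "has_chi (hyper 1 f V \<times> ?D) c \<longleftrightarrow> has_chi (sol (\<lambda>_. 0) (f 0) (f 1) (?D \<times> punctured_plane) V) c"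
  proof (rule has_chi_homeomorphism)
    let ?f = "\<lambda>p::('a \<times> (nat \<Rightarrow> complex)) \<times> complex. (fst (fst p), (snd p, snd (fst p) 1 * snd p))"
    let ?w = "\<lambda>(q::'a \<times> (complex \<times> complex)) k. if k = 0 then 1 else snd (snd q) / fst (snd q)"
    let ?g = "\<lambda>q::'a \<times> (complex \<times> complex). ((fst q, \<lambda>k. if k \<in> {..1} then ?w q k else 0), fst (snd q))"
    have set: "{..1::nat} = {0, 1}" by auto
    show "continuous_on (hyper 1 f V \<times> ?D) ?f" by (intro continuous_intros)
    have "continuous_on (sol (\<lambda>_. 0) (f 0) (f 1) (?D \<times> punctured_plane) V) (\<lambda>q. ?w q k)" for k
      using D0 by (cases "k = 0") (auto simp: sol_def intro!: continuous_intros)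
    then show "continuous_on (sol (\<lambda>_. 0) (f 0) (f 1) (?D \<times> punctured_plane) V) ?g"
      by (intro continuous_on_Pair continuous_on_torus_map continuous_intros)
    show "?f p \<in> sol (\<lambda>_. 0) (f 0) (f 1) (?D \<times> punctured_plane) V \<and> ?g (?f p) = p" if "p \<in> hyper 1 f V \<times> ?D" for p
    proof -
      obtain v z d where p: "p = ((v, z), d)" by (metis prod.collapse)
      have *: "z \<in> torus {..1}" "z 0 = 1" "v \<in> V" "(\<Sum>k\<le>1. z k * f k v) = 0" and d: "d \<in> ?D"
        using that by (auto simp: hyper_def p)
      have "z k = 0" if "k \<noteq> 0" "k \<noteq> 1" for k using *(1) that by (cases "k \<le> 1") (auto simp: torus_def)
      moreover have "d * f 0 v + z 1 * d * f 1 v = 0"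
      proof -
        have "d * f 0 v + z 1 * d * f 1 v = d * (\<Sum>k\<le>1. z k * f k v)" using *(2) by (simp add: algebra_simps)
        then show ?thesis using *(4) by simp
      qed
      ultimately show ?thesis
        using * d D0[OF d] by (auto simp: p sol_def torus_def fun_eq_iff)
    qed
    show "?g q \<in> hyper 1 f V \<times> ?D \<and> ?f (?g q) = q" if "q \<in> sol (\<lambda>_. 0) (f 0) (f 1) (?D \<times> punctured_plane) V" for q
    proof -
      obtain v d e where q: "q = (v, (d, e))" by (metis prod.collapse)
      have *: "v \<in> V" "d \<in> ?D" "e \<noteq> 0" "d * f 0 v + e * f 1 v = 0" using that by (auto simp: q sol_def)
      have "f 0 v + e / d * f 1 v = (d * f 0 v + e * f 1 v) / d" using D0[OF *(2)] by (simp add: field_simps)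
      then have "f 0 v + e / d * f 1 v = 0" using * by simp
      then show ?thesis using * D0[OF *(2)] by (auto simp: q hyper_def torus_def set)
    qed
  qed
  ultimately show ?thesis by blast
qed

lemma sol_swap_has_chi:
  "has_chi (sol h u1 u2 (punctured_plane \<times> punctured_plane) V) c \<longleftrightarrow>
   has_chi (sol h u2 u1 (punctured_plane \<times> punctured_plane) V) c"
  by (rule has_chi_homeomorphism[where f = "\<lambda>q. (fst q, prod.swap (snd q))" and g = "\<lambda>q. (fst q, prod.swap (snd q))"])
     (auto simp: sol_def prod.swap_def add_ac intro!: continuous_intros)

text \<open>The coefficients (1, z_1, z_2) are homogeneous; dividing by z_1 normalizes the
  coefficient of another form.\<close>

lemma sol_rotate_has_chi:
  "has_chi (sol h u1 u2 (punctured_plane \<times> punctured_plane) V) c \<longleftrightarrow>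
   has_chi (sol u1 h u2 (punctured_plane \<times> punctured_plane) V) c"
proof (rule has_chi_homeomorphism)
  let ?T = "punctured_plane \<times> punctured_plane"
  let ?f = "\<lambda>q::'a \<times> (complex \<times> complex). (fst q, (1 / fst (snd q), snd (snd q) / fst (snd q)))"
  show "continuous_on (sol h u1 u2 ?T V) ?f" "continuous_on (sol u1 h u2 ?T V) ?f"
    by (intro continuous_intros; auto simp: sol_def)+
  have "?f q \<in> sol b a d ?T V \<and> ?f (?f q) = q" if "q \<in> sol a b d ?T V" for q and a b d :: "'a \<Rightarrow> complex"
  proof -
    obtain v x y where q: "q = (v, (x, y))" by (metis prod.collapse)
    have *: "v \<in> V" "x \<noteq> 0" "y \<noteq> 0" "a v + x * b v + y * d v = 0" using that by (auto simp: q sol_def)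
    have "b v + 1 / x * a v + y / x * d v = (a v + x * b v + y * d v) / x" using * by (simp add: field_simps)
    then show ?thesis using * by (simp add: q sol_def)
  qed
  then show "q \<in> sol h u1 u2 ?T V \<Longrightarrow> ?f q \<in> sol u1 h u2 ?T V \<and> ?f (?f q) = q"
    "q \<in> sol u1 h u2 ?T V \<Longrightarrow> ?f q \<in> sol h u1 u2 ?T V \<and> ?f (?f q) = q" for q
    by blast+
qed

text \<open>The local lemmas want the independent pair among the forms with free coefficients. For n
  = 2 a permutation of the homogeneous coefficients achieves this; for n = 1 both forms are free
  already.\<close>

lemma tame_zero_has_chi:
  fixes V :: "(complex \<times> complex) set" and a b c :: "nat \<Rightarrow> complex"
  assumes n: "n = 1 \<or> n = 2" and tame: "tame_zero n a b c" and V: "open V" "p \<in> V"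
    and f: "\<And>k. k \<le> n \<Longrightarrow> f k = germ p (a k) (b k) (c k)"
    and x: "has_chi (hyper n f (V - {p})) x"
  shows "has_chi (hyper n f V) x"
proof -
  define P where "P k i j \<longleftrightarrow> (a i * b j - a j * b i \<noteq> 0) \<or>
     (\<exists>\<alpha> \<beta> m. \<alpha> \<noteq> 0 \<and> \<beta> \<noteq> 0 \<and> (\<forall>l\<in>{i, j, k}. a l = m l * \<alpha> \<and> b l = m l * \<beta>) \<and> m i * c j - m j * c i \<noteq> 0)" for k i j
  obtain i j where ij: "i \<le> n" "j \<le> n" "i \<noteq> j" and P: "\<And>k. k \<le> n \<Longrightarrow> P k i j"
  proof -
    from tame consider (1) i j where "i \<le> n" "j \<le> n" "a i * b j - a j * b i \<noteq> 0"
      | (2) \<alpha> \<beta> m i j where "\<alpha> \<noteq> 0" "\<beta> \<noteq> 0" "\<forall>k\<le>n. a k = m k * \<alpha> \<and> b k = m k * \<beta>" "i \<le> n" "j \<le> n" "m i * c j - m j * c i \<noteq> 0"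
      unfolding tame_zero_def by blast
    then show ?thesis
    proof cases
      case 1
      then have "i \<noteq> j" by auto
      with 1 show ?thesis using that[of i j] unfolding P_def by blast
    next
      case 2
      then have "i \<noteq> j" by auto
      moreover have "P k i j" if "k \<le> n" for k
        unfolding P_def using 2 that by (intro disjI2 exI[of _ \<alpha>] exI[of _ \<beta>] exI[of _ m]) auto
      ultimately show ?thesis using 2 that by blast
    qed
  qed
  have swap: "P k j i" if "P k i j" for k i j
    using that unfolding P_def
  proof (elim disjE exE conjE)
    fix \<alpha> \<beta> m assume "\<alpha> \<noteq> 0" "\<beta> \<noteq> 0" "\<forall>l\<in>{i, j, k}. a l = m l * \<alpha> \<and> b l = m l * \<beta>" "m i * c j - m j * c i \<noteq> 0"
    then show "a j * b i - a i * b j \<noteq> 0 \<or>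
     (\<exists>\<alpha> \<beta> m. \<alpha> \<noteq> 0 \<and> \<beta> \<noteq> 0 \<and> (\<forall>l\<in>{j, i, k}. a l = m l * \<alpha> \<and> b l = m l * \<beta>) \<and> m j * c i - m i * c j \<noteq> 0)"
      by (intro disjI2 exI[of _ \<alpha>] exI[of _ \<beta>] exI[of _ m]) auto
  qed auto
  from n show ?thesis
  proof
    assume n1: "n = 1"
    then have "i = 0 \<and> j = 1 \<or> i = 1 \<and> j = 0" using ij by auto
    then have "P k 0 1" if "k \<le> 1" for k using P[of k] swap n1 that by auto
    from this[of 0] have P01: "P 0 0 1" by simp
    \<comment> \<open>Index 2 receives the zero germ as the constant term \<open>h\<close> of the
      thickened equation; \<open>m(2 := 0)\<close> below extends the tangency data to it.\<close>
    define a' b' c' where "a' = a(2 := 0)" and "b' = b(2 := 0)" and "c' = c(2 := 0)"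
    have "(a' 0 * b' 1 - a' 1 * b' 0 \<noteq> 0) \<or>
      (\<exists>\<alpha> \<beta> m. \<alpha> \<noteq> 0 \<and> \<beta> \<noteq> 0 \<and> (\<forall>l\<in>{0, 1, 2}. a' l = m l * \<alpha> \<and> b' l = m l * \<beta>) \<and> m 0 * c' 1 - m 1 * c' 0 \<noteq> 0)"
      using P01 unfolding P_def
    proof (elim disjE exE conjE)
      fix \<alpha> \<beta> m assume "\<alpha> \<noteq> 0" "\<beta> \<noteq> 0" "\<forall>l\<in>{0, 1, 0}. a l = m l * \<alpha> \<and> b l = m l * \<beta>" "m 0 * c 1 - m 1 * c 0 \<noteq> 0"
      then show ?thesis
        by (intro disjI2 exI[of _ \<alpha>] exI[of _ \<beta>] exI[of _ "m(2 := 0)"]) (auto simp: a'_def b'_def c'_def)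
    qed (simp add: a'_def b'_def)
    from tame_zero_sol_has_chi[OF this _ V, where D = "ball 1 (1/2)" and x = x]
    have "has_chi (sol (germ p 0 0 0) (f 0) (f 1) (ball 1 (1/2) \<times> punctured_plane) (V - {p})) x \<Longrightarrow>
      has_chi (sol (germ p 0 0 0) (f 0) (f 1) (ball 1 (1/2) \<times> punctured_plane) V) x"
      using f n1 by (simp add: a'_def b'_def c'_def)
    moreover have "germ p 0 0 0 = (\<lambda>_. 0)" by (simp add: germ_def fun_eq_iff)
    ultimately show ?thesis using x hyper_1_has_chi[of f V x] hyper_1_has_chi[of f "V - {p}" x] n1 by simp
  next
    assume n2: "n = 2"
    have main: "has_chi (sol (f k) (f i) (f j) (punctured_plane \<times> punctured_plane) (V - {p})) x \<Longrightarrow>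
      has_chi (sol (f k) (f i) (f j) (punctured_plane \<times> punctured_plane) V) x"
      if "k \<le> 2" "i \<le> 2" "j \<le> 2" "P k i j" for k i j
      using tame_zero_sol_has_chi[OF that(4)[unfolded P_def] _ V, where D = punctured_plane and x = x] f n2 that by simp
    let ?H = "\<lambda>k i j V. has_chi (sol (f k) (f i) (f j) (punctured_plane \<times> punctured_plane) V) x"
    have H: "has_chi (hyper 2 f V) x \<longleftrightarrow> ?H 0 1 2 V" for V by (rule hyper_2_has_chi)
    have "(\<exists>k. k \<le> 2 \<and> k \<noteq> i \<and> k \<noteq> j)"
      using ij n2 by (metis (no_types, lifting) One_nat_def Suc_1 le_0_eq le_SucI le_Suc_eq less_numeral_extra(4) n_not_Suc_n nat.distinct(1) order_refl zero_le)
    then obtain k where k: "k \<le> 2" "k \<noteq> i" "k \<noteq> j" by blast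
    have perm: "?H 0 1 2 V \<longleftrightarrow> ?H k i j V" for V
    proof -
      have rot: "?H 0 1 2 V \<longleftrightarrow> ?H 1 0 2 V" and sw: "?H 0 1 2 V \<longleftrightarrow> ?H 0 2 1 V" "?H 1 0 2 V \<longleftrightarrow> ?H 1 2 0 V"
        and rot2: "?H 0 2 1 V \<longleftrightarrow> ?H 2 0 1 V" and sw2: "?H 2 0 1 V \<longleftrightarrow> ?H 2 1 0 V"
        by (rule sol_rotate_has_chi sol_swap_has_chi)+
      have "(k, i, j) \<in> {(0,1,2), (0,2,1), (1,0,2), (1,2,0), (2,0,1), (2,1,0)}"
        using k ij n2 by (auto simp: le_Suc_eq numeral_2_eq_2)
      then show ?thesis using rot sw rot2 sw2 by auto
    qed
    have "?H k i j (V - {p})" using x unfolding n2 H perm .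
    then have "?H k i j V" using k ij P[of k] n2 by (intro main) auto
    then show ?thesis unfolding n2 H perm .
  qed
qed

section \<open>Degenerate families\<close>

lemma has_chi_Times_swap: "has_chi (A \<times> B) c \<longleftrightarrow> has_chi (B \<times> A) c"
  by (rule has_chi_homeomorphism[where f = prod.swap and g = prod.swap])
     (auto simp: prod.swap_def intro!: continuous_intros)

text \<open>Two components meeting along \<open>{a} \<times> L\<close>.\<close>

lemma cross_has_chi:
  fixes A :: "complex set"
  assumes A: "open A" "a \<in> A" and "L \<subseteq> E" and E: "has_chi E e" and L: "has_chi L l"
    and AL: "has_chi ((A - {a}) \<times> L) c"
  shows "has_chi {(x, v). x \<in> A \<and> v \<in> E \<and> (x = a \<or> v \<in> L)} (c + e)"
proof -
  obtain r where r: "r > 0" "ball a r \<subseteq> A" using A open_contains_ball by blast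
  let ?X = "{(x, v). x \<in> A \<and> v \<in> E \<and> (x = a \<or> v \<in> L)}"
  let ?M = "{(x, v). x \<in> ball a r \<and> v \<in> E \<and> (x = a \<or> v \<in> L)}" and ?N = "(A - {a}) \<times> L"
  have un: "?M \<union> ?N = ?X" using r A assms(3) by auto
  have int: "?M \<inter> ?N = (ball a r - {a}) \<times> L" using r assms(3) by auto
  have "openin (top_of_set ?X) ?M"
    by (rule openin_Int_open[OF open_vimage_fst[OF open_ball, of a r]]) (use r in auto)
  moreover have "openin (top_of_set ?X) ?N"
    by (rule openin_Int_open[OF open_vimage_fst[of "- {a}"]]) (use assms(3) in \<open>auto simp: open_Compl\<close>)
  moreover have "has_chi ?M e"
  proof -
    have "has_chi ?M e \<longleftrightarrow> has_chi ({a} \<times> E) e"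
    proof (rule has_chi_deformation[where H = "\<lambda>t p. (a + t *\<^sub>R (fst p - a), snd p)"])
      show "continuous_on ({0..1} \<times> ?M) (\<lambda>(t, p). (a + t *\<^sub>R (fst p - a), snd p))"
        unfolding case_prod_unfold by (intro continuous_intros)
      fix t :: real and p assume t: "0 \<le> t" "t \<le> 1" and p: "p \<in> ?M"
      have "dist a (a + t *\<^sub>R (fst p - a)) = t * dist a (fst p)"
        using t by (simp add: dist_norm norm_minus_commute)
      also have "\<dots> \<le> dist a (fst p)" using t by (simp add: mult_left_le_one_le)
      finally show "(a + t *\<^sub>R (fst p - a), snd p) \<in> ?M" using p by auto
    qed (use r in auto)
    also have "\<dots> \<longleftrightarrow> has_chi E e"
      by (rule has_chi_homeomorphism[where f = snd and g = "\<lambda>v. (a, v)"]) (auto intro!: continuous_intros)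
    finally show ?thesis using E by simp
  qed
  moreover have "has_chi (?M \<inter> ?N) 0"
  proof -
    have "has_chi ((ball a r - {a}) \<times> L) 0 \<longleftrightarrow> has_chi (L \<times> (ball a r - {a})) 0"
      by (rule has_chi_Times_swap)
    then show ?thesis unfolding int using has_chi_punctured_factor[of "ball a r" a L l] L r by simp
  qed
  ultimately show ?thesis
    using has_chi_Un[of ?M ?N e c 0] AL unfolding un by (simp add: add.commute)
qed

lemma has_chi_punctured_plane: "has_chi punctured_plane 0"
  by (rule has_chi_punctured_convex) auto

lemma has_chi_remove_points:
  fixes U :: "complex set"
  assumes "open U" "has_chi U a" "finite F" "F \<subseteq> U"
  shows "has_chi (U - F) (a - int (card F))"
proof -
  have eq: "has_chi ({0::complex} \<times> S) c \<longleftrightarrow> has_chi S c" for S :: "complex set" and c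
    by (rule has_chi_homeomorphism[where f = snd and g = "\<lambda>v. (0, v)"]) (auto intro!: continuous_intros)
  show ?thesis
    using has_chi_remove_points_factor[OF assms(1), of "{0::complex}" a 1 F] assms has_chi_singleton[of "0::complex"]
    by (simp add: eq)
qed

lemma has_chi_punctured_plane_minus:
  "finite F \<Longrightarrow> 0 \<notin> F \<Longrightarrow> has_chi (punctured_plane - F) (- int (card F))"
  using has_chi_remove_points[of punctured_plane 0 F] has_chi_punctured_plane by auto

lemma has_chi_Times_punctured_plane_minus:
  assumes "has_chi X x" "finite F" "0 \<notin> F"
  shows "has_chi (X \<times> (punctured_plane - F)) (- int (card F) * x)"
  using has_chi_remove_points_factor[of punctured_plane X 0 x F] has_chi_punctured_factor[OF _ _ _ assms(1), of UNIV 0] assms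
  by auto

text \<open>If \<open>J\<close> is in \<open>F\<close>, only finitely many \<open>y\<close> have a
  support outside \<open>F\<close>; otherwise no subset of \<open>J\<close> is in the up-closed
  \<open>F\<close> and the set is empty.\<close>

lemma finite_lattice_line:
  fixes X :: "'b::topological_space set"
  assumes "finite J" "\<And>k. k \<in> J \<Longrightarrow> finite {y \<in> punctured_plane. g k y = 0}" and X: "has_chi X x"
  shows "finite_lattice J (\<lambda>k p. g k (snd p)) (X \<times> punctured_plane)"
  unfolding finite_lattice_def
proof (intro allI impI)
  fix F assume F: "upclosed F"
  let ?S = "{p \<in> X \<times> punctured_plane. nz_support J (\<lambda>k p. g k (snd p)) p \<in> F}"
  show "fin_hom ?S"
  proof (cases "J \<in> F")
    case True
    define Q where "Q = {y \<in> punctured_plane. nz_support J g y \<notin> F}"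
    have "Q \<subseteq> (\<Union>k\<in>J. {y \<in> punctured_plane. g k y = 0})"
    proof
      fix y assume y: "y \<in> Q"
      then have "nz_support J g y \<noteq> J" using True by (auto simp: Q_def)
      then show "y \<in> (\<Union>k\<in>J. {y \<in> punctured_plane. g k y = 0})" using y by (auto simp: nz_support_def Q_def)
    qed
    then have "finite Q" using assms(1,2) by (meson finite_UN finite_subset)
    moreover have "?S = X \<times> (punctured_plane - Q)" by (auto simp: Q_def nz_support_def)
    ultimately show ?thesis
      using has_chi_Times_punctured_plane_minus[OF X, of Q] by (auto simp: has_chi_def Q_def)
  next
    case False
    have "nz_support J (\<lambda>k p. g k (snd p)) p \<notin> F" for p :: "'b \<times> complex"
    proof
      assume "nz_support J (\<lambda>k p. g k (snd p)) p \<in> F"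
      moreover have "nz_support J (\<lambda>k p. g k (snd p)) p \<subseteq> J" by (auto simp: nz_support_def)
      ultimately have "J \<in> F" using F unfolding upclosed_def by blast
      with False show False ..
    qed
    then have "?S = {}" by simp
    then show ?thesis using has_chi_empty[where 'a = "'b \<times> complex"] by (simp only: has_chi_def)
  qed
qed

lemma finite_lattice_punctured_plane:
  assumes "finite J" "\<And>k. k \<in> J \<Longrightarrow> finite {y \<in> punctured_plane. g k y = 0}"
  shows "finite_lattice J g punctured_plane"
  unfolding finite_lattice_def
proof (intro allI impI)
  fix F assume "upclosed F"
  have eq: "has_chi ({0::complex} \<times> S) c \<longleftrightarrow> has_chi S c" for S :: "complex set" and c
    by (rule has_chi_homeomorphism[where f = snd and g = "\<lambda>v. (0, v)"]) (auto intro!: continuous_intros)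
  from \<open>upclosed F\<close> have "fin_hom {p \<in> {0::complex} \<times> punctured_plane. nz_support J (\<lambda>k p. g k (snd p)) p \<in> F}"
    using finite_lattice_line[of J g "{0::complex}" 1, OF assms has_chi_singleton] unfolding finite_lattice_def by blast
  moreover have "{p \<in> {0::complex} \<times> punctured_plane. nz_support J (\<lambda>k p. g k (snd p)) p \<in> F}
     = {0} \<times> {y \<in> punctured_plane. nz_support J g y \<in> F}" by (auto simp: nz_support_def)
  ultimately have "fin_hom ({0::complex} \<times> {y \<in> punctured_plane. nz_support J g y \<in> F})" by simp
  from eq[THEN iffD1, OF has_chi_chi[OF this]]
  show "fin_hom {y \<in> punctured_plane. nz_support J g y \<in> F}" by (simp add: has_chi_def)
qed

text \<open>Here x is the ratio z_1 / z_0 of a point of \<open>level\<close>, whose scale is fixed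
  by the nonzero value g_0 + x g_1; so this is \<open>level_has_chi\<close> for two
  functions.\<close>

lemma bilinear_complement_has_chi:
  assumes V: "finite_lattice {0, 1} g V" and cont: "\<And>k. k \<in> {0, 1} \<Longrightarrow> continuous_on V (g k)"
  shows "has_chi {(v, x). v \<in> V \<and> x \<noteq> 0 \<and> g 0 v + x * g 1 v \<noteq> 0} (- chi (complement {0, 1} g V))"
proof -
  let ?D = "{(v, x). v \<in> V \<and> x \<noteq> 0 \<and> g 0 v + x * g 1 v \<noteq> 0}"
  have "has_chi (level {0, 1} g V) c \<longleftrightarrow> has_chi ?D c" for c
  proof (rule has_chi_homeomorphism)
    let ?h = "\<lambda>q. g 0 (fst q) + snd q * g 1 (fst q)"
    let ?f = "\<lambda>p::'a \<times> (nat \<Rightarrow> complex). (fst p, snd p 1 / snd p 0)"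
    let ?g = "\<lambda>q. (fst q, \<lambda>k::nat. if k \<in> {0, 1} then (if k = 0 then 1 else snd q) / ?h q else 0)"
    show "continuous_on (level {0, 1} g V) ?f"
      by (intro continuous_intros) (auto simp: level_def torus_def)
    have c: "continuous_on ?D (\<lambda>q. (if k = 0 then 1 else snd q) / ?h q)" for k :: nat
      by (cases "k = 0"; simp; intro continuous_intros continuous_on_fst_compose[OF cont]; auto)
    show "continuous_on ?D ?g"
      by (intro continuous_on_Pair continuous_on_torus_map continuous_on_fst continuous_on_id c)
    fix p assume "p \<in> level {0, 1} g V"
    then obtain v z where p: "p = (v, z)" "v \<in> V" "z \<in> torus {0, 1}" "z 0 * g 0 v + z 1 * g 1 v = 1"
      by (auto simp: level_def)
    then have z: "z 0 \<noteq> 0" "z 1 \<noteq> 0" "\<And>k. k \<notin> {0, 1} \<Longrightarrow> z k = 0" by (auto simp: torus_def)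
    have h: "g 0 v + z 1 / z 0 * g 1 v = 1 / z 0" using p z by (simp add: field_simps)
    have zz: "(\<lambda>k. if k \<in> {0, 1} then (if k = 0 then 1 else z 1 / z 0) / (1 / z 0) else 0) = z"
      using z by (auto simp: fun_eq_iff)
    have "?f p \<in> ?D" using p(1,2) z h by simp
    moreover have "?g (?f p) = p" unfolding p(1) fst_conv snd_conv h zz by (rule refl)
    ultimately show "?f p \<in> ?D \<and> ?g (?f p) = p" ..
  next
    let ?h = "\<lambda>q. g 0 (fst q) + snd q * g 1 (fst q)"
    let ?f = "\<lambda>p::'a \<times> (nat \<Rightarrow> complex). (fst p, snd p 1 / snd p 0)"
    let ?g = "\<lambda>q. (fst q, \<lambda>k::nat. if k \<in> {0, 1} then (if k = 0 then 1 else snd q) / ?h q else 0)"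
    fix q assume "q \<in> ?D"
    then obtain v x where q: "q = (v, x)" "v \<in> V" "x \<noteq> 0" "g 0 v + x * g 1 v \<noteq> 0" by auto
    have "1 / (g 0 v + x * g 1 v) * g 0 v + x / (g 0 v + x * g 1 v) * g 1 v = 1"
      using q(4) by (simp flip: add_divide_distrib)
    then show "?g q \<in> level {0, 1} g V \<and> ?f (?g q) = q" using q by (simp add: level_def torus_def)
  qed
  moreover have "has_chi (level {0, 1} g V) ((- 1) ^ (card {0::nat, 1} - 1) * chi (complement {0, 1} g V))"
    by (rule level_has_chi) (use V cont in auto)
  ultimately show ?thesis by simp
qed

subsection \<open>A common line\<close>

lemma has_chi_normalized_torus:
  assumes "n \<ge> 1" "has_chi X x"
  shows "has_chi (X \<times> {z \<in> torus {..n}. z 0 = 1}) 0"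
proof -
  have "has_chi (X \<times> {z \<in> torus {..n}. z 0 = 1}) 0 \<longleftrightarrow> has_chi (X \<times> torus {1..n}) 0"
  proof (rule has_chi_homeomorphism)
    let ?f = "\<lambda>p::'a \<times> (nat \<Rightarrow> complex). (fst p, \<lambda>k. if k \<in> {1..n} then snd p k else 0)"
    let ?w = "\<lambda>(p::'a \<times> (nat \<Rightarrow> complex)) k. if k = 0 then 1 else snd p k"
    let ?g = "\<lambda>p::'a \<times> (nat \<Rightarrow> complex). (fst p, \<lambda>k. if k \<in> {..n} then ?w p k else 0)"
    show "continuous_on (X \<times> {z \<in> torus {..n}. z 0 = 1}) ?f"
      by (intro continuous_on_Pair continuous_on_torus_map continuous_intros)
    have "continuous_on (X \<times> torus {1..n}) (\<lambda>p. ?w p k)" for k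
      by (cases "k = 0"; simp add: continuous_intros)
    then show "continuous_on (X \<times> torus {1..n}) ?g"
      by (intro continuous_on_Pair continuous_on_torus_map continuous_intros)
    show "?f p \<in> X \<times> torus {1..n} \<and> ?g (?f p) = p" if "p \<in> X \<times> {z \<in> torus {..n}. z 0 = 1}" for p
      using that by (auto simp: torus_def fun_eq_iff prod_eq_iff)
    show "?g p \<in> X \<times> {z \<in> torus {..n}. z 0 = 1} \<and> ?f (?g p) = p" if "p \<in> X \<times> torus {1..n}" for p
      using that by (auto simp: torus_def fun_eq_iff prod_eq_iff)
  qed
  moreover have "has_chi (X \<times> torus {1..n}) (if {1..n} = {} then x else 0)"
    by (rule has_chi_times_torus) (use assms in auto)
  ultimately show ?thesis using assms by simp
qed

text \<open>The analogue of the hypersurface with y as its only base variable. By \<open>nc\<close>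
  there is no common zero, so \<open>hyper_has_chi\<close> covers the whole space, and the
  complement is the punctured plane without the roots.\<close>

lemma linear_hyper_has_chi:
  assumes n: "n \<ge> 1" and ab: "\<And>k. k \<le> n \<Longrightarrow> a k \<noteq> 0 \<and> b k \<noteq> (0::complex)"
    and nc: "\<exists>k\<le>n. \<exists>l\<le>n. a k / b k \<noteq> a l / b l"
  shows "has_chi (hyper n (\<lambda>k y. a k + b k * y) punctured_plane) ((- 1) ^ n * int (card ((\<lambda>k. - (a k / b k)) ` {..n})))"
proof -
  let ?g = "\<lambda>k (y::complex). a k + b k * y"
  have zero: "?g k y = 0 \<longleftrightarrow> y = - (a k / b k)" if "k \<le> n" for k y
    using ab[OF that] by (auto simp: field_simps eq_neg_iff_add_eq_0 add.commute)
  have "finite_lattice {..n} ?g punctured_plane"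
    by (rule finite_lattice_punctured_plane) (auto simp: zero)
  then have "has_chi {p \<in> hyper n ?g punctured_plane. \<exists>k\<le>n. ?g k (fst p) \<noteq> 0} ((- 1) ^ (n - 1) * chi (complement {..n} ?g punctured_plane))"
    using n by (intro hyper_has_chi continuous_intros) auto
  moreover have "{p \<in> hyper n ?g punctured_plane. \<exists>k\<le>n. ?g k (fst p) \<noteq> 0} = hyper n ?g punctured_plane"
  proof -
    have "\<exists>k\<le>n. ?g k y \<noteq> 0" for y
    proof (rule ccontr)
      assume "\<not> (\<exists>k\<le>n. ?g k y \<noteq> 0)"
      then have "y = - (a k / b k)" if "k \<le> n" for k using zero that by blast
      then show False using nc by (metis neg_equal_iff_equal)
    qed
    then show ?thesis by blast
  qed
  moreover let ?R = "(\<lambda>k. - (a k / b k)) ` {..n}"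
  have "complement {..n} ?g punctured_plane = punctured_plane - ?R"
    using zero by (auto simp: complement_def)
  moreover have "has_chi (punctured_plane - ?R) (- int (card ?R))"
    by (rule has_chi_punctured_plane_minus) (use ab in auto)
  moreover have "(- 1) ^ (n - 1) * - int (card ?R) = (- 1) ^ n * int (card ?R)"
    using n by (cases n) auto
  ultimately show ?thesis by (simp add: has_chi_def)
qed

text \<open>The common factor splits the equation: either x = \<alpha> with y and z arbitrary, or
  (y, z) solves the problem in y alone. The first component has value 0, so only the second, with x
  \<noteq> \<alpha>, contributes.\<close>

lemma shared_column_has_chi:
  assumes n: "n \<ge> 1" and \<alpha>: "\<alpha> \<noteq> 0" and ab: "\<And>k. k \<le> n \<Longrightarrow> a k \<noteq> 0 \<and> b k \<noteq> 0"
    and nc: "\<exists>k\<le>n. \<exists>l\<le>n. a k / b k \<noteq> a l / b l"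
    and f: "\<And>k v. k \<le> n \<Longrightarrow> f k v = (fst v - \<alpha>) * (a k + b k * snd v)"
  shows "has_chi (hyper n f unit_plane) ((- 1) ^ (n - 1) * int (card ((\<lambda>k. - (a k / b k)) ` {..n})))"
proof -
  let ?L = "hyper n (\<lambda>k y. a k + b k * y) punctured_plane"
  let ?E = "punctured_plane \<times> {z \<in> torus {..n}. z 0 = 1}"
  let ?c = "(- 1) ^ n * int (card ((\<lambda>k. - (a k / b k)) ` {..n}))"
  have L: "has_chi ?L ?c" by (rule linear_hyper_has_chi[OF n ab nc])
  have E: "has_chi ?E 0" by (rule has_chi_normalized_torus[OF n has_chi_punctured_plane])
  have "has_chi (?L \<times> (punctured_plane - {\<alpha>})) (- int (card {\<alpha>}) * ?c)"
    by (rule has_chi_Times_punctured_plane_minus[OF L]) (use \<alpha> in auto)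
  then have AL: "has_chi ((punctured_plane - {\<alpha>}) \<times> ?L) (- ?c)"
    by (simp add: has_chi_Times_swap[of "punctured_plane - {\<alpha>}" ?L])
  let ?X = "{(x, v). x \<in> punctured_plane \<and> v \<in> ?E \<and> (x = \<alpha> \<or> v \<in> ?L)}"
  have "has_chi ?X (- ?c + 0)"
    by (rule cross_has_chi[OF _ _ _ E L AL]) (use \<alpha> in \<open>auto simp: hyper_def open_Diff\<close>)
  moreover have "has_chi (hyper n f unit_plane) c \<longleftrightarrow> has_chi ?X c" for c
  proof (rule has_chi_homeomorphism)
    let ?f = "\<lambda>p::(complex \<times> complex) \<times> (nat \<Rightarrow> complex). (fst (fst p), (snd (fst p), snd p))"
    let ?g = "\<lambda>q::complex \<times> (complex \<times> (nat \<Rightarrow> complex)). ((fst q, fst (snd q)), snd (snd q))"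
    show "continuous_on (hyper n f unit_plane) ?f" "continuous_on ?X ?g" by (intro continuous_intros)+
    have sum: "(\<Sum>k\<le>n. z k * f k (x, y)) = (x - \<alpha>) * (\<Sum>k\<le>n. z k * (a k + b k * y))" for z x y
      unfolding sum_distrib_left by (rule sum.cong) (auto simp: f mult_ac)
    have "((x, y), z) \<in> hyper n f unit_plane \<longleftrightarrow> (x, (y, z)) \<in> ?X" for x y z
      by (auto simp: hyper_def unit_plane_def sum)
    then have iff: "p \<in> hyper n f unit_plane \<longleftrightarrow> ?f p \<in> ?X" for p
      by (cases p; cases "fst p") (simp only: fst_conv snd_conv)
    show "?f p \<in> ?X \<and> ?g (?f p) = p" if "p \<in> hyper n f unit_plane" for p
      using that unfolding iff by (intro conjI) simp_all
    show "?g q \<in> hyper n f unit_plane \<and> ?f (?g q) = q" if "q \<in> ?X" for q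
      using that unfolding iff by (intro conjI) (simp_all only: fst_conv snd_conv prod.collapse)
  qed
  moreover have "- ?c + 0 = (- 1) ^ (n - 1) * int (card ((\<lambda>k. - (a k / b k)) ` {..n}))"
    using n by (cases n) auto
  ultimately show ?thesis by simp
qed

section \<open>Bilinear curves in the torus\<close>

lemma has_chi_remove_plane_points:
  fixes U :: "(complex \<times> complex) set"
  assumes "finite F" "open U" "F \<subseteq> U" "has_chi U c"
  shows "has_chi (U - F) (c - int (card F))"
  using assms(1,3)
proof (induction F rule: finite_induct)
  case empty
  then show ?case using assms by simp
next
  case (insert a F)
  define V where "V = U - F"
  have V: "open V" "a \<in> V" "has_chi V (c - int (card F))"
    using insert assms by (auto simp: V_def open_Diff finite_imp_closed)
  let ?T = "(\<lambda>v. v - a) ` V"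
  have tr: "has_chi ((\<lambda>v. v - a) ` S) c \<longleftrightarrow> has_chi S c" for S c
    by (rule has_chi_homeomorphism[where f = "\<lambda>v. v + a" and g = "\<lambda>v. v - a"]) (auto intro!: continuous_intros)
  have T: "open ?T" "0 \<in> ?T" using V by (auto simp: open_translation_subtract image_iff)
  have "(0, 0) \<in> (UNIV :: (complex \<times> complex) set) \<times> ?T" using T by simp
  from open_contains_polydiscs[OF open_Times[OF open_UNIV T(1)] this]
  obtain e where e: "e > 0" "polydisc e \<times> polydisc e \<subseteq> UNIV \<times> ?T" by blast
  then have eT: "polydisc e \<subseteq> ?T" using zero_in_polydisc[of e] by blast
  have un: "polydisc e \<union> (?T - {0}) = ?T" and int: "polydisc e \<inter> (?T - {0}) = polydisc e - {0}"
    using eT e by auto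
  have "has_chi (?T - {0}) ((c - int (card F)) + 0 - 1)"
  proof (rule has_chi_part[of "polydisc e"])
    show "openin (top_of_set (polydisc e \<union> (?T - {0}))) (polydisc e)"
      "openin (top_of_set (polydisc e \<union> (?T - {0}))) (?T - {0})"
      by (intro open_subset open_polydisc open_Diff T; auto)+
    show "has_chi (polydisc e \<union> (?T - {0})) (c - int (card F))" unfolding un tr by (rule V)
    show "has_chi (polydisc e \<inter> (?T - {0})) 0" unfolding int by (rule has_chi_punctured_polydisc[OF e(1)])
  qed (rule has_chi_polydisc[OF e(1)])
  moreover have "?T - {0} = (\<lambda>v. v - a) ` (V - {a})" by auto
  moreover have "V - {a} = U - insert a F" by (auto simp: V_def)
  ultimately have "has_chi (U - insert a F) ((c - int (card F)) + 0 - 1)" by (simp only: tr)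
  then show ?case using insert by (simp add: algebra_simps)
qed

text \<open>Induction on the number of unions. By distributivity the union of \<open>?A\<close> and
  \<open>?B\<close> is again such an intersection, with fewer members than \<open>C\<close>, so
  Mayer-Vietoris yields their intersection.\<close>

lemma fin_hom_Inter_unions:
  fixes V :: "'a::topological_space set" and g :: "nat \<Rightarrow> 'a \<Rightarrow> complex"
  assumes U: "\<And>S. S \<subseteq> J \<Longrightarrow> fin_hom {v\<in>V. \<exists>k\<in>S. g k v \<noteq> 0}" and V: "fin_hom V"
    and cont: "\<And>k. k \<in> J \<Longrightarrow> continuous_on V (g k)"
    and "finite C" "\<And>S. S \<in> C \<Longrightarrow> S \<subseteq> J"
  shows "fin_hom {v\<in>V. \<forall>S\<in>C. \<exists>k\<in>S. g k v \<noteq> 0} \<and> openin (top_of_set V) {v\<in>V. \<forall>S\<in>C. \<exists>k\<in>S. g k v \<noteq> 0}"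
  using assms(4,5)
proof (induction "card C" arbitrary: C rule: less_induct)
  case less
  show ?case
  proof (cases "C = {}")
    case True
    then show ?thesis using V by simp
  next
    case False
    then obtain S0 where S0: "S0 \<in> C" by blast
    define C' where "C' = C - {S0}"
    have C': "finite C'" "\<And>S. S \<in> C' \<Longrightarrow> S \<subseteq> J" "S0 \<subseteq> J" "C = insert S0 C'"
      using less.prems S0 by (auto simp: C'_def)
    have card: "card C' < card C" using less.prems S0 unfolding C'_def by (meson card_Diff1_less)
    let ?A = "{v\<in>V. \<forall>S\<in>C'. \<exists>k\<in>S. g k v \<noteq> 0}" and ?B = "{v\<in>V. \<exists>k\<in>S0. g k v \<noteq> 0}"
    have A: "fin_hom ?A" "openin (top_of_set V) ?A" using less.hyps[OF card C'(1,2)] by auto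
    have "openin (top_of_set V) (V \<inter> g k -` (- {0}))" if "k \<in> S0" for k
      using that C' by (intro continuous_openin_preimage_gen cont) (auto simp: open_Compl)
    then have "openin (top_of_set V) (\<Union>k\<in>S0. V \<inter> g k -` (- {0}))" by (intro openin_Union) auto
    moreover have "(\<Union>k\<in>S0. V \<inter> g k -` (- {0})) = ?B" by auto
    ultimately have B: "fin_hom ?B" "openin (top_of_set V) ?B" using U[OF C'(3)] by auto
    let ?C = "(\<lambda>S. S \<union> S0) ` C'"
    have un: "?A \<union> ?B = {v\<in>V. \<forall>S\<in>?C. \<exists>k\<in>S. g k v \<noteq> 0}" by auto
    have "card ?C < card C" using card card_image_le[OF C'(1), of "\<lambda>S. S \<union> S0"] by linarith
    from less.hyps[OF this] have AB: "fin_hom (?A \<union> ?B)" unfolding un using C' by blast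
    have sub: "?A \<union> ?B \<subseteq> V" by auto
    have "fin_hom (?A \<inter> ?B)"
      using set_Mayer_Vietoris[OF openin_subset_trans[OF A(2) _ sub] openin_subset_trans[OF B(2) _ sub] refl] A B AB by auto
    moreover have "openin (top_of_set V) (?A \<inter> ?B)" using A B by (intro openin_Int) auto
    moreover have "?A \<inter> ?B = {v\<in>V. \<forall>S\<in>C. \<exists>k\<in>S. g k v \<noteq> 0}" using C'(4) by auto
    ultimately show ?thesis by simp
  qed
qed

text \<open>Conjunctive normal form of an up-closed family: a support is in \<open>F\<close> if and
  only if it meets \<open>J - A\<close> for every subset \<open>A\<close> of \<open>J\<close>
  outside \<open>F\<close>.\<close>

lemma finite_lattice_from_unions:
  fixes V :: "'a::topological_space set"
  assumes U: "\<And>S. S \<subseteq> J \<Longrightarrow> fin_hom {v\<in>V. \<exists>k\<in>S. g k v \<noteq> 0}" and V: "fin_hom V"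
    and cont: "\<And>k. k \<in> J \<Longrightarrow> continuous_on V (g k)" and J: "finite J"
  shows "finite_lattice J g V"
  unfolding finite_lattice_def
proof (intro allI impI)
  fix F assume F: "upclosed F"
  let ?C = "(\<lambda>A. J - A) ` (Pow J - F)"
  have "fin_hom {v\<in>V. \<forall>S\<in>?C. \<exists>k\<in>S. g k v \<noteq> 0}"
    by (rule conjunct1[OF fin_hom_Inter_unions[where C = ?C and J = J, OF U V cont]]) (use J in auto)
  moreover have "(\<forall>S\<in>?C. \<exists>k\<in>S. g k v \<noteq> 0) \<longleftrightarrow> nz_support J g v \<in> F" for v
  proof
    assume *: "\<forall>S\<in>?C. \<exists>k\<in>S. g k v \<noteq> 0"
    show "nz_support J g v \<in> F"
    proof (rule ccontr)
      assume "nz_support J g v \<notin> F"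
      then have "J - nz_support J g v \<in> ?C" by (auto simp: nz_support_def)
      from bspec[OF * this] obtain k where "k \<in> J - nz_support J g v" "g k v \<noteq> 0" by (rule bexE)
      then show False by (simp add: nz_support_def)
    qed
  next
    assume *: "nz_support J g v \<in> F"
    show "\<forall>S\<in>?C. \<exists>k\<in>S. g k v \<noteq> 0"
    proof clarify
      fix A assume "A \<subseteq> J" "A \<notin> F"
      then have "\<not> nz_support J g v \<subseteq> A" using * F unfolding upclosed_def by blast
      then show "\<exists>k\<in>J - A. g k v \<noteq> 0" by (auto simp: nz_support_def)
    qed
  qed
  ultimately show "fin_hom {v\<in>V. nz_support J g v \<in> F}" by simp
qed

lemma open_unit_plane: "open unit_plane"
  and has_chi_unit_plane: "has_chi unit_plane 0"
proof -
  have eq: "unit_plane = punctured_plane \<times> punctured_plane" by (auto simp: unit_plane_def)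
  show "open unit_plane" unfolding eq by (intro open_Times open_Diff) auto
  show "has_chi unit_plane 0"
    unfolding eq by (rule has_chi_punctured_factor[OF _ _ _ has_chi_punctured_plane]) auto
qed

text \<open>The \<open>y\<close>-coordinates at which the curve \<open>form W k = 0\<close> meets \<open>x = 0\<close> and \<open>x = \<infinity>\<close>.\<close>

definition root0 :: "coeffs \<Rightarrow> nat \<Rightarrow> complex" where "root0 W k = - (W 0 0 k / W 0 1 k)"
definition root1 :: "coeffs \<Rightarrow> nat \<Rightarrow> complex" where "root1 W k = - (W 1 0 k / W 1 1 k)"

declare One_nat_def [simp del]

lemma form_eq: "form W k (x, y) = (W 0 0 k + W 0 1 k * y) + x * (W 1 0 k + W 1 1 k * y)"
  by (simp add: form_def f_poly_def algebra_simps)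

lemma continuous_on_form [continuous_intros]: "continuous_on S (form W k)"
  unfolding form_def f_poly_def by (intro continuous_intros)

locale torus_coeffs =
  fixes W :: coeffs and n :: nat
  assumes in_torus: "in_torus n W"
begin

lemma nz: "k \<le> n \<Longrightarrow> W 0 0 k \<noteq> 0" "k \<le> n \<Longrightarrow> W 0 1 k \<noteq> 0" "k \<le> n \<Longrightarrow> W 1 0 k \<noteq> 0" "k \<le> n \<Longrightarrow> W 1 1 k \<noteq> 0"
  using in_torus by (auto simp: in_torus_def)

lemma root0: "k \<le> n \<Longrightarrow> W 0 0 k + W 0 1 k * y = 0 \<longleftrightarrow> y = root0 W k"
  and root1: "k \<le> n \<Longrightarrow> W 1 0 k + W 1 1 k * y = 0 \<longleftrightarrow> y = root1 W k"
  using nz[of k] by (auto simp: root0_def root1_def field_simps eq_neg_iff_add_eq_0 add.commute)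

lemma roots_nz: "k \<le> n \<Longrightarrow> root0 W k \<noteq> 0" "k \<le> n \<Longrightarrow> root1 W k \<noteq> 0"
  using nz[of k] by (auto simp: root0_def root1_def)

text \<open>The form is g_0(y) + x g_1(y), so \<open>bilinear_complement_has_chi\<close> reduces the
  count to the y-line without 0 and the two roots.\<close>

lemma form_nonzero_has_chi:
  assumes "k \<le> n"
  shows "has_chi {v \<in> unit_plane. form W k v \<noteq> 0} (int (card {root0 W k, root1 W k}))"
proof -
  define g where "g i y = (if i = 0 then W 0 0 k + W 0 1 k * y else W 1 0 k + W 1 1 k * y)" for i :: nat and y
  have g: "g 0 y = 0 \<longleftrightarrow> y = root0 W k" "g 1 y = 0 \<longleftrightarrow> y = root1 W k" for y
    using root0[OF assms] root1[OF assms] by (auto simp: g_def)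
  have "finite_lattice {0, 1} g punctured_plane"
    by (rule finite_lattice_punctured_plane) (use g in \<open>auto simp del: One_nat_def\<close>)
  moreover have "continuous_on punctured_plane (g i)" for i
    unfolding g_def by (cases "i = 0"; simp; intro continuous_intros)
  ultimately have "has_chi {(y, x). y \<in> punctured_plane \<and> x \<noteq> 0 \<and> g 0 y + x * g 1 y \<noteq> 0} (- chi (complement {0, 1} g punctured_plane))"
    by (intro bilinear_complement_has_chi)
  moreover have "complement {0, 1} g punctured_plane = punctured_plane - {root0 W k, root1 W k}"
    using g by (auto simp: complement_def)
  moreover have "has_chi (punctured_plane - {root0 W k, root1 W k}) (- int (card {root0 W k, root1 W k}))"
    by (rule has_chi_punctured_plane_minus) (use roots_nz[OF assms] in auto)
  ultimately have "has_chi {(y, x). y \<in> punctured_plane \<and> x \<noteq> 0 \<and> g 0 y + x * g 1 y \<noteq> 0} (int (card {root0 W k, root1 W k}))"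
    by (simp only: has_chi_def) simp
  moreover have "{v \<in> unit_plane. form W k v \<noteq> 0} = {(x, y). y \<in> punctured_plane \<and> x \<noteq> 0 \<and> g 0 y + x * g 1 y \<noteq> 0}"
    by (auto simp: unit_plane_def form_eq g_def)
  ultimately show ?thesis
    using has_chi_swap[of "\<lambda>y x. y \<in> punctured_plane \<and> x \<noteq> 0 \<and> g 0 y + x * g 1 y \<noteq> 0"] by simp
qed

lemma reducible_form:
  assumes "k \<le> n" "root0 W k = root1 W k"
  shows "form W k v = (fst v + W 0 1 k / W 1 1 k) * (W 1 0 k + W 1 1 k * snd v)"
proof -
  have "W 0 0 k = W 0 1 k * (W 1 0 k / W 1 1 k)"
    using assms(2) nz[OF assms(1)] by (simp add: root0_def root1_def field_simps)
  then show ?thesis using nz[OF assms(1)] by (cases v) (simp add: form_eq field_simps)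
qed

text \<open>If the two roots coincide, the curve is a vertical and a horizontal line that cross;
  otherwise x is a function of y away from the roots.\<close>

lemma form_zero_has_chi:
  assumes "k \<le> n"
  shows "has_chi {v \<in> unit_plane. form W k v = 0} (- int (card {root0 W k, root1 W k}))"
proof (cases "root0 W k = root1 W k")
  case True
  let ?a = "- (W 0 1 k / W 1 1 k)" and ?L = "{root1 W k}"
  have "has_chi ((punctured_plane - {?a}) \<times> ?L) (- 1)"
    using has_chi_Times_punctured_plane_minus[OF has_chi_singleton[of "root1 W k"], of "{?a}"] nz[OF assms(1)]
    by (subst has_chi_Times_swap) simp
  then have "has_chi {(x, v). x \<in> punctured_plane \<and> v \<in> punctured_plane \<and> (x = ?a \<or> v \<in> ?L)} (- 1 + 0)"
    using nz[OF assms] roots_nz[OF assms]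
    by (intro cross_has_chi[OF _ _ _ has_chi_punctured_plane has_chi_singleton]) (auto simp: open_Diff)
  moreover have "{(x, v). x \<in> punctured_plane \<and> v \<in> punctured_plane \<and> (x = ?a \<or> v \<in> ?L)} = {v \<in> unit_plane. form W k v = 0}"
  proof -
    have "form W k (x, y) = 0 \<longleftrightarrow> x = ?a \<or> y = root1 W k" for x y
    proof -
      have "form W k (x, y) = (x + W 0 1 k / W 1 1 k) * (W 1 0 k + W 1 1 k * y)"
        using reducible_form[OF assms True, of "(x, y)"] by simp
      then show ?thesis using root1[OF assms, of y] by (simp add: add_eq_0_iff2)
    qed
    then show ?thesis by (auto simp: unit_plane_def)
  qed
  ultimately show ?thesis using True by simp
next
  case False
  let ?P = "punctured_plane - {root0 W k, root1 W k}"
  have "has_chi {v \<in> unit_plane. form W k v = 0} c \<longleftrightarrow> has_chi ?P c" for c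
  proof (rule has_chi_homeomorphism)
    let ?g = "\<lambda>y. (- (W 0 0 k + W 0 1 k * y) / (W 1 0 k + W 1 1 k * y), y)"
    show "continuous_on {v \<in> unit_plane. form W k v = 0} snd" by (intro continuous_intros)
    show "continuous_on ?P ?g" by (intro continuous_intros) (use root1[OF assms] in \<open>auto simp del: One_nat_def\<close>)
    show "snd v \<in> ?P \<and> ?g (snd v) = v" if v: "v \<in> {v \<in> unit_plane. form W k v = 0}" for v
    proof -
      obtain x y where xy: "v = (x, y)" "x \<noteq> 0" "y \<noteq> 0" "(W 0 0 k + W 0 1 k * y) + x * (W 1 0 k + W 1 1 k * y) = 0"
        using v by (auto simp: unit_plane_def form_eq)
      have ne: "y \<noteq> root1 W k" using xy(4) root1[OF assms, of y] root0[OF assms, of y] False by auto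
      moreover have "y \<noteq> root0 W k" using xy(2,4) root1[OF assms, of y] root0[OF assms, of y] ne by auto
      moreover have "- (W 0 0 k + W 0 1 k * y) / (W 1 0 k + W 1 1 k * y) = x"
      proof -
        have "x * (W 1 0 k + W 1 1 k * y) = - (W 0 0 k + W 0 1 k * y)" using xy(4) by (metis add.commute eq_neg_iff_add_eq_0)
        then show ?thesis using ne root1[OF assms, of y] by (metis nonzero_mult_div_cancel_right)
      qed
      ultimately show ?thesis using xy by simp
    qed
    show "?g y \<in> {v \<in> unit_plane. form W k v = 0} \<and> snd (?g y) = y" if "y \<in> ?P" for y
    proof -
      define A B where "A = W 0 0 k + W 0 1 k * y" and "B = W 1 0 k + W 1 1 k * y"
      have "A \<noteq> 0" "B \<noteq> 0" "y \<noteq> 0"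
        using that root0[OF assms, of y] root1[OF assms, of y] by (auto simp: A_def B_def)
      then show ?thesis by (simp add: unit_plane_def form_eq A_def[symmetric] B_def[symmetric])
    qed
  qed
  moreover have "has_chi ?P (- int (card {root0 W k, root1 W k}))"
    by (rule has_chi_punctured_plane_minus) (use roots_nz[OF assms] in auto)
  ultimately show ?thesis by blast
qed

end

subsection \<open>Common zeros of two forms\<close>

text \<open>There are two roots on the projective line; a coincidence costs one, and so does each of
  0 and infinity. A double root at 0 or at infinity makes the discriminant vanish too and is counted
  correctly.\<close>

lemma card_nonzero_quadratic_roots:
  fixes a b c :: complex
  assumes "a \<noteq> 0 \<or> b \<noteq> 0 \<or> c \<noteq> 0"
  defines "Z \<equiv> {y. y \<noteq> 0 \<and> a + b * y + c * y\<^sup>2 = 0}"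
  shows "finite Z" "int (card Z) = 2 - of_bool (b\<^sup>2 - 4 * a * c = 0) - of_bool (a = 0) - of_bool (c = 0)"
proof -
  have "finite Z \<and> int (card Z) = 2 - of_bool (b\<^sup>2 - 4 * a * c = 0) - of_bool (a = 0) - of_bool (c = 0)"
  proof (cases "c = 0")
    case True
    show ?thesis
    proof (cases "a \<noteq> 0 \<and> b \<noteq> 0")
      case True
      then have "Z = {- a / b}" using \<open>c = 0\<close> by (auto simp: Z_def field_simps eq_neg_iff_add_eq_0 add.commute)
      then show ?thesis using True \<open>c = 0\<close> by simp
    next
      case False
      then have "Z = {}" using \<open>c = 0\<close> assms(1) by (auto simp: Z_def)
      then show ?thesis using False \<open>c = 0\<close> assms(1) by (cases "b = 0") auto
    qed
  next
    case False
    define s where "s = csqrt (b\<^sup>2 - 4 * a * c)"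
    define r1 r2 where "r1 = (- b + s) / (2 * c)" and "r2 = (- b - s) / (2 * c)"
    have s2: "s\<^sup>2 = b\<^sup>2 - 4 * a * c" by (simp add: s_def)
    have sum: "c * (r1 + r2) = - b" using False by (simp add: r1_def r2_def field_simps)
    have "4 * c * c * (r1 * r2) = b\<^sup>2 - s\<^sup>2"
      using False by (simp add: r1_def r2_def field_simps power2_eq_square)
    then have "4 * c * (c * (r1 * r2)) = 4 * c * a" unfolding s2 by (simp add: algebra_simps)
    then have prod: "c * (r1 * r2) = a" using False by simp
    have fac: "a + b * y + c * y\<^sup>2 = c * ((y - r1) * (y - r2))" for y
    proof -
      have "c * ((y - r1) * (y - r2)) = c * (r1 * r2) - c * (r1 + r2) * y + c * y\<^sup>2"
        by (simp add: algebra_simps power2_eq_square)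
      then show ?thesis unfolding sum prod by simp
    qed
    have Z: "Z = {r1, r2} - {0}" using False unfolding Z_def fac by auto
    have eq: "r1 = r2 \<longleftrightarrow> b\<^sup>2 - 4 * a * c = 0"
    proof -
      have "r1 - r2 = s / c" using False by (simp add: r1_def r2_def field_simps)
      then have "r1 = r2 \<longleftrightarrow> s = 0" using False by (metis divide_eq_0_iff right_minus_eq)
      then show ?thesis using s2 by (metis power2_eq_iff zero_power2 power_eq_0_iff)
    qed
    have a0: "a = 0 \<longleftrightarrow> r1 = 0 \<or> r2 = 0" using prod False by auto
    show ?thesis
    proof (cases "r1 = r2")
      case True
      then show ?thesis using Z eq a0 False by (cases "r1 = 0") auto
    next
      case ne: False
      then show ?thesis
        using Z eq a0 False by (cases "r1 = 0"; cases "r2 = 0") auto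
    qed
  qed
  then show "finite Z" "int (card Z) = 2 - of_bool (b\<^sup>2 - 4 * a * c = 0) - of_bool (a = 0) - of_bool (c = 0)"
    by auto
qed

text \<open>Three minors suffice to link all four coefficients, because none of the coefficients
  vanishes.\<close>

definition proportional :: "coeffs \<Rightarrow> nat \<Rightarrow> nat \<Rightarrow> bool" where
  "proportional W k l \<longleftrightarrow> F_row 0 k l W = 0 \<and> F_row 1 k l W = 0 \<and> F_col 0 k l W = 0"

text \<open>Both curves are then pairs of lines with the same vertical line; in
  \<open>shared_row\<close> it is the horizontal line.\<close>

definition shared_column :: "coeffs \<Rightarrow> nat \<Rightarrow> nat \<Rightarrow> bool" where
  "shared_column W k l \<longleftrightarrow> F_slice k W = 0 \<and> F_slice l W = 0 \<and> F_col 0 k l W = 0"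

definition shared_row :: "coeffs \<Rightarrow> nat \<Rightarrow> nat \<Rightarrow> bool" where
  "shared_row W k l \<longleftrightarrow> F_slice k W = 0 \<and> F_slice l W = 0 \<and> F_row 0 k l W = 0"

definition crossing_number :: "coeffs \<Rightarrow> nat \<Rightarrow> nat \<Rightarrow> int" where
  "crossing_number W k l = 2 - of_bool (H2 k l W = 0) - of_bool (F_col 0 k l W = 0) - of_bool (F_col 1 k l W = 0)
     - of_bool (F_row 0 k l W = 0) - of_bool (F_row 1 k l W = 0)"

definition slice_value :: "coeffs \<Rightarrow> nat \<Rightarrow> int" where
  "slice_value W k = (if F_slice k W = 0 then 1 else 2)"

text \<open>The Euler characteristic of the set where at least one of the two forms is nonzero:
  removing a line from the torus costs nothing, and removing a point costs 1.\<close>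

definition pair_value :: "coeffs \<Rightarrow> nat \<Rightarrow> nat \<Rightarrow> int" where
  "pair_value W k l = (if proportional W k l then slice_value W l
     else if shared_column W k l \<or> shared_row W k l then 0 else - crossing_number W k l)"

text \<open>The \<open>x\<close>-coordinate of the vertical component of a reducible form.\<close>

definition column_root :: "coeffs \<Rightarrow> nat \<Rightarrow> complex" where "column_root W k = - (W 0 1 k / W 1 1 k)"

definition common_zeros :: "coeffs \<Rightarrow> nat set \<Rightarrow> (complex \<times> complex) set" where
  "common_zeros W S = {v \<in> unit_plane. \<forall>k\<in>S. form W k v = 0}"

context torus_coeffs begin

lemma slice_iff: "k \<le> n \<Longrightarrow> F_slice k W = 0 \<longleftrightarrow> root0 W k = root1 W k"
  using nz[of k] by (auto simp: F_slice_def root0_def root1_def frac_eq_eq mult.commute)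

lemma row_iff:
  "k \<le> n \<Longrightarrow> l \<le> n \<Longrightarrow> F_row 0 k l W = 0 \<longleftrightarrow> root0 W k = root0 W l"
  "k \<le> n \<Longrightarrow> l \<le> n \<Longrightarrow> F_row 1 k l W = 0 \<longleftrightarrow> root1 W k = root1 W l"
  using nz[of k] nz[of l] by (auto simp: F_row_def root0_def root1_def frac_eq_eq mult.commute)

lemma slice_value_eq: "k \<le> n \<Longrightarrow> slice_value W k = int (card {root0 W k, root1 W k})"
  by (auto simp: slice_value_def slice_iff)

lemma column_root_nz: "k \<le> n \<Longrightarrow> column_root W k \<noteq> 0"
  using nz[of k] by (simp add: column_root_def)

lemma reducible_form_eq:
  assumes "k \<le> n" "F_slice k W = 0"
  shows "form W k v = (fst v - column_root W k) * (W 1 0 k + W 1 1 k * snd v)"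
  using reducible_form[OF assms(1)] slice_iff[OF assms(1)] assms(2) by (simp add: column_root_def)

lemma reducible_form_eq':
  assumes "k \<le> n" "F_slice k W = 0"
  shows "form W k v = (snd v - root1 W k) * (W 0 1 k + W 1 1 k * fst v)"
  unfolding reducible_form_eq[OF assms] using nz[OF assms(1)]
  by (simp add: column_root_def root1_def field_simps)

lemma shared_column_iff:
  assumes "k \<le> n" "l \<le> n" "F_slice k W = 0" "F_slice l W = 0"
  shows "F_col 0 k l W = 0 \<longleftrightarrow> column_root W k = column_root W l"
proof -
  have *: "W 0 0 i * W 1 1 i = W 0 1 i * W 1 0 i" if "i = k \<or> i = l" for i
    using that assms by (auto simp: F_slice_def)
  have "column_root W i = - (W 0 0 i / W 1 0 i)" if "i = k \<or> i = l" for i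
    using *[OF that] that assms nz[of i] by (auto simp: column_root_def frac_eq_eq mult.commute)
  then show ?thesis
    using nz[OF assms(1)] nz[OF assms(2)] by (auto simp: F_col_def frac_eq_eq mult.commute)
qed

lemma proportional_form:
  assumes "k \<le> n" "l \<le> n" "proportional W k l"
  shows "form W k v = W 0 0 k / W 0 0 l * form W l v"
proof -
  have e: "W 0 0 k * W 0 1 l = W 0 1 k * W 0 0 l" "W 0 0 k * W 1 0 l = W 1 0 k * W 0 0 l"
    "W 1 0 k * W 1 1 l = W 1 1 k * W 1 0 l"
    using assms(3) by (simp_all add: proportional_def F_row_def F_col_def)
  let ?c = "W 0 0 k / W 0 0 l"
  have 1: "W 0 1 k = ?c * W 0 1 l" "W 1 0 k = ?c * W 1 0 l"
    using e nz[OF assms(2)] by (simp_all add: field_simps)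
  have "W 1 0 l * W 1 1 k = W 1 0 l * (?c * W 1 1 l)" using e(3) 1(2) by (simp add: mult_ac)
  then have 2: "W 1 1 k = ?c * W 1 1 l"
    using nz[OF assms(2)] mult_left_cancel[of "W 1 0 l" "W 1 1 k" "?c * W 1 1 l"] by blast
  have 0: "W 0 0 k = ?c * W 0 0 l" using nz[OF assms(2)] by simp
  show ?thesis
    by (cases v) (simp only: form_eq, subst (1) 0, subst (1) 1(1), subst (1) 1(2), subst (1) 2, simp add: algebra_simps)
qed

text \<open>The hypotheses say that the resultant with respect to x, a quadratic in y, vanishes
  identically. If the roots \<open>root0\<close> agree, the forms are proportional; if not,
  evaluation at these roots shows that each is also the corresponding \<open>root1\<close>, so both
  forms are reducible.\<close>

lemma resultant_zero_cases:
  assumes k: "k \<le> n" and l: "l \<le> n" and c0: "F_col 0 k l W = 0" and c2: "F_col 1 k l W = 0"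
    and c1: "W 0 0 k * W 1 1 l + W 0 1 k * W 1 0 l - W 0 0 l * W 1 1 k - W 0 1 l * W 1 0 k = 0"
  shows "proportional W k l \<or> shared_column W k l"
proof -
  let ?a = "\<lambda>k y. W 0 0 k + W 0 1 k * y" and ?b = "\<lambda>k y. W 1 0 k + W 1 1 k * y"
  have R: "?a k y * ?b l y = ?a l y * ?b k y" for y
  proof -
    have "?a k y * ?b l y - ?a l y * ?b k y
      = F_col 0 k l W + (W 0 0 k * W 1 1 l + W 0 1 k * W 1 0 l - W 0 0 l * W 1 1 k - W 0 1 l * W 1 0 k) * y + F_col 1 k l W * y\<^sup>2"
      by (simp add: F_col_def algebra_simps power2_eq_square)
    then show ?thesis using c0 c1 c2 by simp
  qed
  have prp: "proportional W k l" if r: "root0 W k = root0 W l"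
  proof -
    have r0: "W 0 0 k * W 0 1 l = W 0 1 k * W 0 0 l"
      using row_iff(1)[OF k l] r by (simp add: F_row_def)
    have c0': "W 0 0 k * W 1 0 l = W 1 0 k * W 0 0 l" using c0 by (simp add: F_col_def)
    have c2': "W 0 1 k * W 1 1 l = W 1 1 k * W 0 1 l" using c2 by (simp add: F_col_def)
    have "(W 0 0 k * W 0 1 l) * (W 1 0 k * W 1 1 l) * W 0 0 l
        = (W 0 0 k * W 0 1 l) * (W 1 1 k * W 1 0 l) * W 0 0 l"
    proof -
      have "(W 0 0 k * W 0 1 l) * (W 1 0 k * W 1 1 l) * W 0 0 l = W 0 0 k * W 0 1 l * W 1 1 l * (W 1 0 k * W 0 0 l)" by (simp add: mult_ac)
      also have "\<dots> = W 0 0 k * W 0 1 l * W 1 1 l * (W 0 0 k * W 1 0 l)" by (simp only: c0')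
      also have "\<dots> = W 0 0 k * W 1 0 l * W 1 1 l * (W 0 0 k * W 0 1 l)" by (simp add: mult_ac)
      also have "\<dots> = W 0 0 k * W 1 0 l * W 0 0 l * (W 0 1 k * W 1 1 l)" unfolding r0 by (simp add: mult_ac)
      also have "\<dots> = (W 0 0 k * W 0 1 l) * (W 1 1 k * W 1 0 l) * W 0 0 l" unfolding c2' by (simp add: mult_ac)
      finally show ?thesis .
    qed
    then have "W 1 0 k * W 1 1 l = W 1 1 k * W 1 0 l" using nz[OF k] nz[OF l] by simp
    then show ?thesis using r0 c0 by (simp add: proportional_def F_row_def)
  qed
  show ?thesis
  proof (cases "root0 W k = root0 W l")
    case True
    then show ?thesis using prp by blast
  next
    case False
    have "?a k (root0 W k) = 0" "?a l (root0 W l) = 0" using root0[OF k] root0[OF l] by auto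
    then have "?a l (root0 W k) * ?b k (root0 W k) = 0" "?a k (root0 W l) * ?b l (root0 W l) = 0"
      using R[of "root0 W k"] R[of "root0 W l"] by auto
    then have "root0 W k = root1 W k" "root0 W l = root1 W l"
      using root0[OF l, of "root0 W k"] root1[OF k, of "root0 W k"] root0[OF k, of "root0 W l"] root1[OF l, of "root0 W l"] False
      by auto
    then show ?thesis using c0 slice_iff[OF k] slice_iff[OF l] by (simp add: shared_column_def)
  qed
qed

text \<open>Eliminating x leaves the quadratic \<open>R\<close> in y, of discriminant
  \<open>H2\<close>. Its nonzero roots are the y-coordinates of the crossings, except those where
  both curves meet x = 0 (\<open>B0\<close>) or x = infinity (\<open>B1\<close>).\<close>

lemma card_crossings:
  assumes k: "k \<le> n" and l: "l \<le> n" and np: "\<not> proportional W k l" and nc: "\<not> shared_column W k l" and nr: "\<not> shared_row W k l"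
  shows "finite (common_zeros W {k, l})" "int (card (common_zeros W {k, l})) = crossing_number W k l"
proof -
  let ?a = "\<lambda>k y. W 0 0 k + W 0 1 k * y" and ?b = "\<lambda>k y. W 1 0 k + W 1 1 k * y"
  define c1 where "c1 = W 0 0 k * W 1 1 l + W 0 1 k * W 1 0 l - W 0 0 l * W 1 1 k - W 0 1 l * W 1 0 k"
  define R where "R y = F_col 0 k l W + c1 * y + F_col 1 k l W * y\<^sup>2" for y
  have R: "R y = ?a k y * ?b l y - ?a l y * ?b k y" for y
    by (simp add: R_def c1_def F_col_def algebra_simps power2_eq_square)
  have disc: "c1\<^sup>2 - 4 * F_col 0 k l W * F_col 1 k l W = H2 k l W"
    by (simp add: c1_def F_col_def F_row_def H2_def algebra_simps power2_eq_square)
  define Z where "Z = {y. y \<noteq> 0 \<and> R y = 0}"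
  have nonzero: "F_col 0 k l W \<noteq> 0 \<or> c1 \<noteq> 0 \<or> F_col 1 k l W \<noteq> 0"
    using resultant_zero_cases[OF k l] np nc unfolding c1_def by blast
  have Z: "finite Z" "int (card Z) = 2 - of_bool (H2 k l W = 0) - of_bool (F_col 0 k l W = 0) - of_bool (F_col 1 k l W = 0)"
    using card_nonzero_quadratic_roots[OF nonzero] unfolding Z_def R_def disc by auto
  define B0 where "B0 = (if root0 W k = root0 W l then {root0 W k} else {})"
  define B1 where "B1 = (if root1 W k = root1 W l then {root1 W k} else {})"
  have B0: "y \<in> B0 \<longleftrightarrow> ?a k y = 0 \<and> ?a l y = 0" for y using root0[OF k, of y] root0[OF l, of y] by (auto simp: B0_def)
  have B1: "y \<in> B1 \<longleftrightarrow> ?b k y = 0 \<and> ?b l y = 0" for y using root1[OF k, of y] root1[OF l, of y] by (auto simp: B1_def)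
  have BZ: "B0 \<union> B1 \<subseteq> Z"
  proof
    fix y assume y: "y \<in> B0 \<union> B1"
    then have "y \<noteq> 0" using roots_nz[OF k] by (auto simp: B0_def B1_def split: if_splits)
    moreover have "R y = 0" using y B0[of y] B1[of y] unfolding R by auto
    ultimately show "y \<in> Z" by (simp add: Z_def)
  qed
  \<comment> \<open>Such a y would give a horizontal line contained in both curves.\<close>
  have disj: "B0 \<inter> B1 = {}"
  proof (rule ccontr)
    assume "B0 \<inter> B1 \<noteq> {}"
    then obtain y where "?a k y = 0" "?a l y = 0" "?b k y = 0" "?b l y = 0" using B0 B1 by blast
    then have "y = root0 W k" "y = root0 W l" "y = root1 W k" "y = root1 W l"
      using root0[OF k] root0[OF l] root1[OF k] root1[OF l] by blast+
    then show False
      using nr slice_iff[OF k] slice_iff[OF l] row_iff(1)[OF k l] by (simp add: shared_row_def)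
  qed
  have "bij_betw snd (common_zeros W {k, l}) (Z - (B0 \<union> B1))"
  proof (rule bij_betw_imageI)
    show "inj_on snd (common_zeros W {k, l})"
    proof (rule inj_onI)
      fix p q assume p: "p \<in> common_zeros W {k, l}" and q: "q \<in> common_zeros W {k, l}" and eq: "snd p = snd q"
      obtain x x' y where pq: "p = (x, y)" "q = (x', y)" using eq by (metis prod.collapse)
      have e: "?a i y + x * ?b i y = 0" "?a i y + x' * ?b i y = 0" if "i = k \<or> i = l" for i
        using that p q by (auto simp: pq common_zeros_def form_eq)
      have x0: "x \<noteq> 0" using p by (auto simp: pq common_zeros_def unit_plane_def)
      have d: "(x - x') * ?b i y = 0" if "i = k \<or> i = l" for i
      proof -
        have "(x - x') * ?b i y = (?a i y + x * ?b i y) - (?a i y + x' * ?b i y)" by (simp add: algebra_simps)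
        then show ?thesis using e[OF that] by simp
      qed
      show "p = q"
      proof (rule ccontr)
        assume "p \<noteq> q"
        then have "x - x' \<noteq> 0" using pq by auto
        then have b: "?b k y = 0" "?b l y = 0" using d by auto
        then have "?a k y = 0" "?a l y = 0" using e(1)[of k] e(1)[of l] by auto
        then have "y \<in> B0 \<inter> B1" using b B0 B1 by blast
        with disj show False by blast
      qed
    qed
    show "snd ` common_zeros W {k, l} = Z - (B0 \<union> B1)"
    proof
      show "snd ` common_zeros W {k, l} \<subseteq> Z - (B0 \<union> B1)"
      proof clarify
        fix x y assume p: "(x, y) \<in> common_zeros W {k, l}"
        then have x: "x \<noteq> 0" "y \<noteq> 0" and e: "?a k y + x * ?b k y = 0" "?a l y + x * ?b l y = 0"
          by (auto simp: common_zeros_def form_eq unit_plane_def)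
        have ak: "?a k y = - (x * ?b k y)" "?a l y = - (x * ?b l y)" using e by (simp_all only: eq_neg_iff_add_eq_0)
        have "R y = 0" unfolding R ak by (simp add: algebra_simps)
        moreover have "y \<notin> B0 \<union> B1"
        proof
          assume "y \<in> B0 \<union> B1"
          then have "y \<in> B0 \<and> y \<in> B1" unfolding Un_iff B0 B1 ak using x(1) by auto
          then show False using disj by blast
        qed
        ultimately show "snd (x, y) \<in> Z - (B0 \<union> B1)" using x by (simp add: Z_def)
      qed
      show "Z - (B0 \<union> B1) \<subseteq> snd ` common_zeros W {k, l}"
      proof
        fix y assume y: "y \<in> Z - (B0 \<union> B1)"
        then have y0: "y \<noteq> 0" and det: "?a k y * ?b l y = ?a l y * ?b k y" using R[of y] by (auto simp: Z_def)
        have na: "\<not> (?a k y = 0 \<and> ?a l y = 0)" "\<not> (?b k y = 0 \<and> ?b l y = 0)" using y B0 B1 by auto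
        have sol: "\<exists>x. x \<noteq> 0 \<and> a + x * b = 0 \<and> a' + x * b' = 0"
          if "a * b' = a' * b" "\<not> (a = 0 \<and> a' = 0)" "\<not> (b = 0 \<and> b' = 0)" for a b a' b' :: complex
        proof (cases "b = 0")
          case True
          then have "b' \<noteq> 0" "a = 0" using that by auto
          with True that show ?thesis by (intro exI[of _ "- a' / b'"]) auto
        next
          case False
          have "a \<noteq> 0" using that False by auto
          with False that(1) show ?thesis by (intro exI[of _ "- a / b"]) (auto simp: field_simps)
        qed
        obtain x where x: "x \<noteq> 0" "?a k y + x * ?b k y = 0" "?a l y + x * ?b l y = 0"
          using sol[OF det na] by blast
        then have "(x, y) \<in> common_zeros W {k, l}" using y0 by (auto simp: common_zeros_def form_eq unit_plane_def)
        then show "y \<in> snd ` common_zeros W {k, l}" by force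
      qed
    qed
  qed
  then have fin: "finite (common_zeros W {k, l})" and card: "card (common_zeros W {k, l}) = card (Z - (B0 \<union> B1))"
    using Z(1) bij_betw_finite bij_betw_same_card by blast+
  have finB: "finite B0" "finite B1" by (auto simp: B0_def B1_def)
  have "card (Z - (B0 \<union> B1)) = card Z - card (B0 \<union> B1)" using BZ finB by (intro card_Diff_subset) auto
  moreover have "card (B0 \<union> B1) \<le> card Z" using BZ Z(1) by (intro card_mono)
  moreover have "card (B0 \<union> B1) = card B0 + card B1" using finB disj by (intro card_Un_disjoint)
  moreover have "int (card B0) = of_bool (F_row 0 k l W = 0)" "int (card B1) = of_bool (F_row 1 k l W = 0)"
    using row_iff[OF k l] by (auto simp: B0_def B1_def)
  ultimately show "int (card (common_zeros W {k, l})) = crossing_number W k l"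
    using card Z(2) by (simp add: crossing_number_def)
  show "finite (common_zeros W {k, l})" by (rule fin)
qed

end

subsection \<open>Complements of the curves\<close>

lemma has_chi_Int_open:
  assumes "open A" "open B" "has_chi A a" "has_chi B b" "has_chi (A \<union> B) c"
  shows "has_chi (A \<inter> B) (a + b - c)"
  by (rule has_chi_Int[OF _ _ assms(3-5)]; rule open_subset; use assms in auto)

lemma has_chi_remove_vertical: "\<alpha> \<noteq> 0 \<Longrightarrow> has_chi (unit_plane - {v. fst v = \<alpha>}) 0"
  and has_chi_remove_horizontal: "\<beta> \<noteq> 0 \<Longrightarrow> has_chi (unit_plane - {v. snd v = \<beta>}) 0"
proof -
  have *: "has_chi (punctured_plane \<times> (punctured_plane - {\<beta>})) 0" if "\<beta> \<noteq> 0" for \<beta>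
    using has_chi_Times_punctured_plane_minus[OF has_chi_punctured_plane, of "{\<beta>}"] that by simp
  have "unit_plane - {v. snd v = \<beta>} = punctured_plane \<times> (punctured_plane - {\<beta>})" by (auto simp: unit_plane_def)
  then show "\<beta> \<noteq> 0 \<Longrightarrow> has_chi (unit_plane - {v. snd v = \<beta>}) 0" using *[of \<beta>] by simp
  have "unit_plane - {v. fst v = \<alpha>} = (punctured_plane - {\<alpha>}) \<times> punctured_plane" by (auto simp: unit_plane_def)
  then show "\<alpha> \<noteq> 0 \<Longrightarrow> has_chi (unit_plane - {v. fst v = \<alpha>}) 0"
    using *[of \<alpha>] has_chi_Times_swap[of "punctured_plane - {\<alpha>}" punctured_plane 0] by simp
qed

lemma open_form_nonzero: "open {v \<in> unit_plane. form W k v \<noteq> 0}"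
proof -
  have "{v \<in> unit_plane. form W k v \<noteq> 0} = unit_plane \<inter> {v. form W k v \<noteq> 0}" by auto
  moreover have "open {v. form W k v \<noteq> 0}" by (intro open_Collect_neq continuous_intros)
  ultimately show ?thesis using open_unit_plane by auto
qed

lemma finite_linear_zeros:
  fixes a b :: complex
  assumes "a + b * y0 \<noteq> 0"
  shows "finite {y. a + b * y = 0}"
proof (cases "b = 0")
  case False
  then have "{y. a + b * y = 0} = {- a / b}" by (auto simp: field_simps eq_neg_iff_add_eq_0 add.commute)
  then show ?thesis by simp
qed (use assms in simp)

context torus_coeffs begin

lemma column_zero: "k \<le> n \<Longrightarrow> W 0 1 k + W 1 1 k * x = 0 \<longleftrightarrow> x = column_root W k"
  using nz[of k] by (auto simp: column_root_def field_simps eq_neg_iff_add_eq_0 add.commute)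

text \<open>If the horizontal components agreed as well, the forms would be proportional.\<close>

lemma shared_column_zeros:
  assumes k: "k \<le> n" and l: "l \<le> n" and sc: "shared_column W k l" and np: "\<not> proportional W k l"
  shows "common_zeros W {k, l} = {v \<in> unit_plane. fst v = column_root W k}"
proof -
  have F: "F_slice k W = 0" "F_slice l W = 0" "F_col 0 k l W = 0" using sc by (auto simp: shared_column_def)
  have cr: "column_root W l = column_root W k" using shared_column_iff[OF k l F(1,2)] F(3) by simp
  have "root1 W k \<noteq> root1 W l"
  proof
    assume "root1 W k = root1 W l"
    then have "F_row 0 k l W = 0" "F_row 1 k l W = 0"
      using row_iff[OF k l] slice_iff[OF k] slice_iff[OF l] F by simp_all
    with F np show False by (simp add: proportional_def)
  qed
  then have "\<not> (W 1 0 k + W 1 1 k * y = 0 \<and> W 1 0 l + W 1 1 l * y = 0)" for y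
    using root1[OF k] root1[OF l] by auto
  then show ?thesis
    by (auto simp: common_zeros_def reducible_form_eq[OF k F(1)] reducible_form_eq[OF l F(2)] cr)
qed

lemma shared_row_zeros:
  assumes k: "k \<le> n" and l: "l \<le> n" and sr: "shared_row W k l" and np: "\<not> proportional W k l"
  shows "common_zeros W {k, l} = {v \<in> unit_plane. snd v = root1 W k}"
proof -
  have F: "F_slice k W = 0" "F_slice l W = 0" "F_row 0 k l W = 0" using sr by (auto simp: shared_row_def)
  have r: "root1 W l = root1 W k" using row_iff(1)[OF k l] slice_iff[OF k] slice_iff[OF l] F by simp
  have "column_root W k \<noteq> column_root W l"
  proof
    assume "column_root W k = column_root W l"
    then have "F_col 0 k l W = 0" using shared_column_iff[OF k l F(1,2)] by simp
    moreover have "F_row 1 k l W = 0" using row_iff(2)[OF k l] r by simp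
    ultimately show False using F np by (simp add: proportional_def)
  qed
  then have "\<not> (W 0 1 k + W 1 1 k * x = 0 \<and> W 0 1 l + W 1 1 l * x = 0)" for x
    using column_zero[OF k] column_zero[OF l] by auto
  then show ?thesis
    by (auto simp: common_zeros_def reducible_form_eq'[OF k F(1)] reducible_form_eq'[OF l F(2)] r)
qed

lemma proportional_zero:
  assumes "k \<le> n" "l \<le> n" "proportional W k l"
  shows "form W k v = 0 \<longleftrightarrow> form W l v = 0"
  using proportional_form[OF assms] nz[OF assms(1)] nz[OF assms(2)] by simp

lemma pair_has_chi:
  assumes k: "k \<le> n" and l: "l \<le> n"
  shows "has_chi {v \<in> unit_plane. form W k v \<noteq> 0 \<or> form W l v \<noteq> 0} (pair_value W k l)"
proof -
  have eq: "{v \<in> unit_plane. form W k v \<noteq> 0 \<or> form W l v \<noteq> 0} = unit_plane - common_zeros W {k, l}"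
    by (auto simp: common_zeros_def)
  consider (1) "proportional W k l" | (2) "\<not> proportional W k l" "shared_column W k l"
    | (3) "\<not> proportional W k l" "shared_row W k l"
    | (4) "\<not> proportional W k l" "\<not> shared_column W k l" "\<not> shared_row W k l" by blast
  then show ?thesis
  proof cases
    case 1
    then have "{v \<in> unit_plane. form W k v \<noteq> 0 \<or> form W l v \<noteq> 0} = {v \<in> unit_plane. form W l v \<noteq> 0}"
      using proportional_zero[OF k l] by auto
    then show ?thesis using form_nonzero_has_chi[OF l] 1 by (simp add: pair_value_def slice_value_eq[OF l])
  next
    case 2
    have "unit_plane - common_zeros W {k, l} = unit_plane - {v. fst v = column_root W k}"
      using shared_column_zeros[OF k l] 2 by auto
    then show ?thesis unfolding eq using 2 has_chi_remove_vertical[OF column_root_nz[OF k]] by (simp add: pair_value_def)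
  next
    case 3
    have "unit_plane - common_zeros W {k, l} = unit_plane - {v. snd v = root1 W k}"
      using shared_row_zeros[OF k l] 3 by auto
    then show ?thesis unfolding eq using 3 has_chi_remove_horizontal[OF roots_nz(2)[OF k]] by (simp add: pair_value_def)
  next
    case 4
    note c = card_crossings[OF k l 4]
    have "has_chi (unit_plane - common_zeros W {k, l}) (0 - int (card (common_zeros W {k, l})))"
      by (rule has_chi_remove_plane_points[OF c(1) open_unit_plane _ has_chi_unit_plane]) (auto simp: common_zeros_def)
    then show ?thesis unfolding eq using 4 c(2) by (simp add: pair_value_def)
  qed
qed

text \<open>Two forms that are not proportional already confine the common zeros to a line or to
  finitely many points; on that line every other form vanishes identically or finitely
  often.\<close>

lemma common_zeros_cases:
  assumes S: "S \<subseteq> {..n}" "S \<noteq> {}"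
  obtains (proportional) k where "k \<in> S" "\<forall>l\<in>S. proportional W l k"
  | (column) \<alpha> where "\<alpha> \<noteq> 0" "common_zeros W S = {v \<in> unit_plane. fst v = \<alpha>}" "\<forall>k\<in>S. \<forall>y. form W k (\<alpha>, y) = 0"
  | (row) \<beta> where "\<beta> \<noteq> 0" "common_zeros W S = {v \<in> unit_plane. snd v = \<beta>}" "\<forall>k\<in>S. \<forall>x. form W k (x, \<beta>) = 0"
  | (finite) "finite (common_zeros W S)"
proof -
  obtain k where k: "k \<in> S" using S by blast
  show ?thesis
  proof (cases "\<forall>l\<in>S. proportional W l k")
    case True
    then show ?thesis using that(1) k by blast
  next
    case False
    then obtain l where l: "l \<in> S" "\<not> proportional W l k" by blast
    have kl: "l \<le> n" "k \<le> n" using S k l by auto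
    have sub: "common_zeros W S \<subseteq> common_zeros W {l, k}" using k l by (auto simp: common_zeros_def)
    consider "shared_column W l k" | "shared_row W l k" | "\<not> shared_column W l k" "\<not> shared_row W l k" by blast
    then show ?thesis
    proof cases
      case 1
      let ?\<alpha> = "column_root W l"
      have C: "common_zeros W {l, k} = {v \<in> unit_plane. fst v = ?\<alpha>}" by (rule shared_column_zeros[OF kl 1 l(2)])
      show ?thesis
      proof (cases "\<forall>m\<in>S. \<forall>y. form W m (?\<alpha>, y) = 0")
        case True
        then have "form W m v = 0" if "m \<in> S" "fst v = ?\<alpha>" for m v using that by (cases v) auto
        then have "{v \<in> unit_plane. fst v = ?\<alpha>} \<subseteq> common_zeros W S" by (auto simp: common_zeros_def)
        with sub C have "common_zeros W S = {v \<in> unit_plane. fst v = ?\<alpha>}" by blast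
        then show ?thesis using that(2) True column_root_nz[OF kl(1)] by blast
      next
        case False
        then obtain m y0 where m: "m \<in> S" "form W m (?\<alpha>, y0) \<noteq> 0" by blast
        have e: "form W m (?\<alpha>, y) = (W 0 0 m + W 1 0 m * ?\<alpha>) + (W 0 1 m + W 1 1 m * ?\<alpha>) * y" for y
          by (simp add: form_eq algebra_simps)
        have "finite {y. form W m (?\<alpha>, y) = 0}" using m(2) finite_linear_zeros unfolding e by blast
        then have "finite ({?\<alpha>} \<times> {y. form W m (?\<alpha>, y) = 0})" by simp
        moreover have "common_zeros W S \<subseteq> {?\<alpha>} \<times> {y. form W m (?\<alpha>, y) = 0}"
        proof
          fix v assume v: "v \<in> common_zeros W S"
          then have "fst v = ?\<alpha>" "form W m v = 0" using sub C m(1) by (auto simp: common_zeros_def)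
          then show "v \<in> {?\<alpha>} \<times> {y. form W m (?\<alpha>, y) = 0}" by (cases v) simp
        qed
        ultimately show ?thesis using that(4) finite_subset by blast
      qed
    next
      case 2
      let ?\<beta> = "root1 W l"
      have C: "common_zeros W {l, k} = {v \<in> unit_plane. snd v = ?\<beta>}" by (rule shared_row_zeros[OF kl 2 l(2)])
      show ?thesis
      proof (cases "\<forall>m\<in>S. \<forall>x. form W m (x, ?\<beta>) = 0")
        case True
        then have "form W m v = 0" if "m \<in> S" "snd v = ?\<beta>" for m v using that by (cases v) auto
        then have "{v \<in> unit_plane. snd v = ?\<beta>} \<subseteq> common_zeros W S" by (auto simp: common_zeros_def)
        with sub C have "common_zeros W S = {v \<in> unit_plane. snd v = ?\<beta>}" by blast
        then show ?thesis using that(3) True roots_nz(2)[OF kl(1)] by blast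
      next
        case False
        then obtain m x0 where m: "m \<in> S" "form W m (x0, ?\<beta>) \<noteq> 0" by blast
        have e: "form W m (x, ?\<beta>) = (W 0 0 m + W 0 1 m * ?\<beta>) + (W 1 0 m + W 1 1 m * ?\<beta>) * x" for x
          by (simp add: form_eq algebra_simps)
        have "finite {x. form W m (x, ?\<beta>) = 0}" using m(2) finite_linear_zeros unfolding e by blast
        then have "finite ({x. form W m (x, ?\<beta>) = 0} \<times> {?\<beta>})" by simp
        moreover have "common_zeros W S \<subseteq> {x. form W m (x, ?\<beta>) = 0} \<times> {?\<beta>}"
        proof
          fix v assume v: "v \<in> common_zeros W S"
          then have "snd v = ?\<beta>" "form W m v = 0" using sub C m(1) by (auto simp: common_zeros_def)
          then show "v \<in> {x. form W m (x, ?\<beta>) = 0} \<times> {?\<beta>}" by (cases v) simp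
        qed
        ultimately show ?thesis using that(4) finite_subset by blast
      qed
    next
      case 3
      then have "finite (common_zeros W {l, k})" by (rule card_crossings(1)[OF kl l(2)])
      then show ?thesis using that(4) sub finite_subset by blast
    qed
  qed
qed

lemma finite_common_zeros_has_chi:
  assumes "finite (common_zeros W S)"
  shows "has_chi {v \<in> unit_plane. \<exists>k\<in>S. form W k v \<noteq> 0} (- int (card (common_zeros W S)))"
proof -
  have "has_chi (unit_plane - common_zeros W S) (0 - int (card (common_zeros W S)))"
    by (rule has_chi_remove_plane_points[OF assms open_unit_plane _ has_chi_unit_plane]) (auto simp: common_zeros_def)
  moreover have "{v \<in> unit_plane. \<exists>k\<in>S. form W k v \<noteq> 0} = unit_plane - common_zeros W S" by (auto simp: common_zeros_def)
  ultimately show ?thesis by simp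
qed

text \<open>Reduced to unions, finiteness concerns only complements of common zero sets, and
  \<open>common_zeros_cases\<close> lists those.\<close>

lemma finite_lattice_forms: "finite_lattice {..n} (form W) unit_plane"
proof (rule finite_lattice_from_unions)
  fix S assume S: "S \<subseteq> {..n}"
  have eq: "{v \<in> unit_plane. \<exists>k\<in>S. form W k v \<noteq> 0} = unit_plane - common_zeros W S" by (auto simp: common_zeros_def)
  show "fin_hom {v \<in> unit_plane. \<exists>k\<in>S. form W k v \<noteq> 0}"
  proof (cases "S = {}")
    case True
    then show ?thesis using has_chi_empty[where 'a = "complex \<times> complex"] by (simp add: has_chi_def)
  next
    case False
    show ?thesis
    proof (rule common_zeros_cases[OF S False])
      fix k assume k: "k \<in> S" "\<forall>l\<in>S. proportional W l k"
      have z: "form W l v = 0 \<longleftrightarrow> form W k v = 0" if "l \<in> S" for l v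
        using proportional_zero[of l k v] S that k by auto
      have "(\<exists>l\<in>S. form W l v \<noteq> 0) \<longleftrightarrow> form W k v \<noteq> 0" for v
        using z[of _ v] k(1) by blast
      then have "{v \<in> unit_plane. \<exists>k\<in>S. form W k v \<noteq> 0} = {v \<in> unit_plane. form W k v \<noteq> 0}" by simp
      then show ?thesis using form_nonzero_has_chi[of k] k S by (auto simp: has_chi_def)
    next
      fix \<alpha> assume "\<alpha> \<noteq> 0" "common_zeros W S = {v \<in> unit_plane. fst v = \<alpha>}"
      moreover from this have "unit_plane - common_zeros W S = unit_plane - {v. fst v = \<alpha>}" by auto
      ultimately show ?thesis unfolding eq using has_chi_remove_vertical by (simp add: has_chi_def)
    next
      fix \<beta> assume "\<beta> \<noteq> 0" "common_zeros W S = {v \<in> unit_plane. snd v = \<beta>}"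
      moreover from this have "unit_plane - common_zeros W S = unit_plane - {v. snd v = \<beta>}" by auto
      ultimately show ?thesis unfolding eq using has_chi_remove_horizontal by (simp add: has_chi_def)
    next
      assume "finite (common_zeros W S)"
      then show ?thesis using finite_common_zeros_has_chi by (simp add: has_chi_def)
    qed
  qed
qed (use has_chi_unit_plane in \<open>auto simp: has_chi_def intro!: continuous_intros\<close>)

text \<open>Without triple points the union \<open>?A \<union> ?B\<close> is the whole torus, of
  value 0, so the values of the pairs simply add up.\<close>

lemma pairs_has_chi:
  assumes l: "l \<le> n" and S: "finite S" "S \<subseteq> {..<l}"
    and triple: "\<And>j k. j \<in> S \<Longrightarrow> k \<in> S \<Longrightarrow> j \<noteq> k \<Longrightarrow> common_zeros W {j, k, l} = {}"
  shows "has_chi {v \<in> unit_plane. \<forall>k\<in>S. form W k v \<noteq> 0 \<or> form W l v \<noteq> 0} (\<Sum>k\<in>S. pair_value W k l)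
    \<and> open {v \<in> unit_plane. \<forall>k\<in>S. form W k v \<noteq> 0 \<or> form W l v \<noteq> 0}"
  using S triple
proof (induction S rule: finite_induct)
  case empty
  then show ?case using has_chi_unit_plane open_unit_plane by simp
next
  case (insert k S)
  let ?A = "{v \<in> unit_plane. \<forall>k\<in>S. form W k v \<noteq> 0 \<or> form W l v \<noteq> 0}"
  let ?B = "{v \<in> unit_plane. form W k v \<noteq> 0 \<or> form W l v \<noteq> 0}"
  have A: "has_chi ?A (\<Sum>k\<in>S. pair_value W k l)" "open ?A" using insert by auto
  have k: "k \<le> n" using insert l by auto
  have "?B = {v \<in> unit_plane. form W k v \<noteq> 0} \<union> {v \<in> unit_plane. form W l v \<noteq> 0}" by auto
  then have B: "has_chi ?B (pair_value W k l)" "open ?B"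
    using pair_has_chi[OF k l] by (auto simp: open_form_nonzero open_Un)
  have un: "?A \<union> ?B = unit_plane"
  proof
    show "unit_plane \<subseteq> ?A \<union> ?B"
    proof
      fix v assume v: "v \<in> unit_plane"
      show "v \<in> ?A \<union> ?B"
      proof (rule ccontr)
        assume "v \<notin> ?A \<union> ?B"
        then obtain j where "j \<in> S" "form W j v = 0" "form W l v = 0" "form W k v = 0" using v by auto
        then have "v \<in> common_zeros W {j, k, l}" using v by (auto simp: common_zeros_def)
        moreover have "j \<noteq> k" using \<open>j \<in> S\<close> insert.hyps by auto
        ultimately show False using insert.prems(2)[of j k] \<open>j \<in> S\<close> by auto
      qed
    qed
  qed auto
  have "has_chi (?A \<inter> ?B) ((\<Sum>k\<in>S. pair_value W k l) + pair_value W k l - 0)"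
    by (rule has_chi_Int_open[OF A(2) B(2) A(1) B(1)]) (simp only: un has_chi_unit_plane)
  moreover have "?A \<inter> ?B = {v \<in> unit_plane. \<forall>k\<in>insert k S. form W k v \<noteq> 0 \<or> form W l v \<noteq> 0}" by auto
  moreover have "open (?A \<inter> ?B)" using A B by (intro open_Int)
  ultimately show ?case using insert.hyps by (simp add: add.commute)
qed

text \<open>One form is adjoined at a time. The union of the previous complement with the new
  nonvanishing set is the intersection that \<open>pairs_has_chi\<close> evaluates.\<close>

lemma complement_has_chi:
  assumes "m \<le> n"
    and triple: "\<And>j k l. j < k \<Longrightarrow> k < l \<Longrightarrow> l \<le> m \<Longrightarrow> common_zeros W {j, k, l} = {}"
  shows "has_chi (complement {..m} (form W) unit_plane) ((\<Sum>k\<le>m. slice_value W k) - (\<Sum>l\<le>m. \<Sum>k<l. pair_value W k l))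
    \<and> open (complement {..m} (form W) unit_plane)"
  using assms
proof (induction m)
  case 0
  have "complement {..0} (form W) unit_plane = {v \<in> unit_plane. form W 0 v \<noteq> 0}" by (auto simp: complement_def)
  then show ?case using form_nonzero_has_chi[of 0] open_form_nonzero by (simp add: slice_value_eq)
next
  case (Suc m)
  let ?A = "complement {..m} (form W) unit_plane" and ?B = "{v \<in> unit_plane. form W (Suc m) v \<noteq> 0}"
  have A: "has_chi ?A ((\<Sum>k\<le>m. slice_value W k) - (\<Sum>l\<le>m. \<Sum>k<l. pair_value W k l))" "open ?A"
    using Suc by auto
  have B: "has_chi ?B (slice_value W (Suc m))"
    using form_nonzero_has_chi[OF Suc.prems(1)] slice_value_eq[OF Suc.prems(1)] by simp
  have tr: "common_zeros W {j, k, Suc m} = {}" if "j \<in> {..<Suc m}" "k \<in> {..<Suc m}" "j \<noteq> k" for j k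
  proof -
    have "common_zeros W {j, k, Suc m} = common_zeros W {min j k, max j k, Suc m}"
      by (auto simp: min_def max_def insert_commute)
    also have "\<dots> = {}" using that by (intro Suc.prems(2)) auto
    finally show ?thesis .
  qed
  have "?A \<union> ?B = {v \<in> unit_plane. \<forall>k\<in>{..<Suc m}. form W k v \<noteq> 0 \<or> form W (Suc m) v \<noteq> 0}"
    by (auto simp: complement_def less_Suc_eq_le)
  moreover have "has_chi {v \<in> unit_plane. \<forall>k\<in>{..<Suc m}. form W k v \<noteq> 0 \<or> form W (Suc m) v \<noteq> 0} (\<Sum>k<Suc m. pair_value W k (Suc m))"
    using pairs_has_chi[OF Suc.prems(1), of "{..<Suc m}"] tr by auto
  ultimately have un: "has_chi (?A \<union> ?B) (\<Sum>k<Suc m. pair_value W k (Suc m))" by simp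
  have "has_chi (?A \<inter> ?B) ((\<Sum>k\<le>m. slice_value W k) - (\<Sum>l\<le>m. \<Sum>k<l. pair_value W k l) + slice_value W (Suc m) - (\<Sum>k<Suc m. pair_value W k (Suc m)))"
    by (rule has_chi_Int_open[OF A(2) open_form_nonzero A(1) B un])
  moreover have "?A \<inter> ?B = complement {..Suc m} (form W) unit_plane"
    by (auto simp: complement_def le_Suc_eq)
  moreover have "open (?A \<inter> ?B)" using A open_form_nonzero by (intro open_Int)
  ultimately show ?case by (simp add: algebra_simps)
qed

text \<open>With triple points the union of \<open>?P 0\<close> and \<open>?P 1\<close> is only the
  torus without these points, which brings their number into the formula.\<close>

lemma complement_2_has_chi:
  assumes n: "n \<ge> 2" and fin: "finite (common_zeros W {..2})"
  shows "has_chi (complement {..2} (form W) unit_plane)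
    (slice_value W 0 + slice_value W 1 + slice_value W 2 - pair_value W 0 1 - pair_value W 0 2 - pair_value W 1 2
     - int (card (common_zeros W {..2})))"
proof -
  let ?A = "complement {..1} (form W) unit_plane" and ?B = "{v \<in> unit_plane. form W 2 v \<noteq> 0}"
  have A: "has_chi ?A (slice_value W 0 + slice_value W 1 - pair_value W 0 1)" "open ?A"
    using complement_has_chi[of 1] n by (auto simp: One_nat_def)
  have B: "has_chi ?B (slice_value W 2)"
    using form_nonzero_has_chi[OF n] slice_value_eq[OF n] by simp
  let ?P = "\<lambda>k. {v \<in> unit_plane. form W k v \<noteq> 0 \<or> form W 2 v \<noteq> 0}"
  have P: "has_chi (?P k) (pair_value W k 2)" "open (?P k)" if "k < 2" for k
  proof -
    show "has_chi (?P k) (pair_value W k 2)" using pair_has_chi[of k 2] that n by simp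
    have "?P k = {v \<in> unit_plane. form W k v \<noteq> 0} \<union> {v \<in> unit_plane. form W 2 v \<noteq> 0}" by auto
    then show "open (?P k)" by (simp add: open_form_nonzero open_Un)
  qed
  have set: "{..2::nat} = {0, 1, 2}" by auto
  have "?P 0 \<union> ?P 1 = {v \<in> unit_plane. \<exists>k\<in>{..2}. form W k v \<noteq> 0}" unfolding set by auto
  then have "has_chi (?P 0 \<union> ?P 1) (- int (card (common_zeros W {..2})))"
    using finite_common_zeros_has_chi[OF fin] by simp
  then have "has_chi (?P 0 \<inter> ?P 1) (pair_value W 0 2 + pair_value W 1 2 - - int (card (common_zeros W {..2})))"
    by (intro has_chi_Int_open P) auto
  moreover have "?P 0 \<inter> ?P 1 = ?A \<union> ?B" by (auto simp: complement_def le_Suc_eq One_nat_def)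
  ultimately have un: "has_chi (?A \<union> ?B) (pair_value W 0 2 + pair_value W 1 2 - - int (card (common_zeros W {..2})))" by simp
  have "has_chi (?A \<inter> ?B) (slice_value W 0 + slice_value W 1 - pair_value W 0 1 + slice_value W 2
      - (pair_value W 0 2 + pair_value W 1 2 - - int (card (common_zeros W {..2}))))"
    by (rule has_chi_Int_open[OF A(2) open_form_nonzero A(1) B un])
  moreover have "?A \<inter> ?B = complement {..2} (form W) unit_plane"
    by (auto simp: complement_def le_Suc_eq numeral_2_eq_2 One_nat_def)
  ultimately show ?thesis by (simp add: algebra_simps)
qed

end

section \<open>The Euler characteristic of the hypersurface\<close>

lemma form_germ:
  assumes "form W k p = 0"
  shows "form W k v = germ p (W 1 0 k + W 1 1 k * snd p) (W 0 1 k + W 1 1 k * fst p) (W 1 1 k) v"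
proof -
  have "form W k v - form W k p = germ p (W 1 0 k + W 1 1 k * snd p) (W 0 1 k + W 1 1 k * fst p) (W 1 1 k) v"
    by (cases v; cases p) (simp add: form_eq germ_def algebra_simps)
  then show ?thesis using assms by simp
qed

lemma proportional_if:
  assumes "\<And>i j. i \<le> 1 \<Longrightarrow> j \<le> 1 \<Longrightarrow> W i j k = c * W i j l"
  shows "proportional W k l"
  using assms[of 0 0] assms[of 0 1] assms[of 1 0] assms[of 1 1]
  by (simp add: proportional_def F_row_def F_col_def)

context torus_coeffs begin

text \<open>If no two linear parts are independent, all are multiples of one. If that one involves a
  single variable, all forms share a line through \<open>p\<close>. If it is zero, or if its
  multiples are proportional to the mixed terms, all forms are proportional.\<close>

lemma tame_common_zero:
  assumes p: "p \<in> common_zeros W {..n}"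
    and np: "\<not> (\<forall>k\<le>n. proportional W k 0)"
    and ncol: "\<not> (\<exists>\<alpha>. \<alpha> \<noteq> 0 \<and> (\<forall>k\<le>n. \<forall>y. form W k (\<alpha>, y) = 0))"
    and nrow: "\<not> (\<exists>\<beta>. \<beta> \<noteq> 0 \<and> (\<forall>k\<le>n. \<forall>x. form W k (x, \<beta>) = 0))"
  shows "tame_zero n (\<lambda>k. W 1 0 k + W 1 1 k * snd p) (\<lambda>k. W 0 1 k + W 1 1 k * fst p) (\<lambda>k. W 1 1 k)"
proof (rule ccontr)
  obtain s t where st: "p = (s, t)" by (cases p)
  define a b c where "a k = W 1 0 k + W 1 1 k * t" and "b k = W 0 1 k + W 1 1 k * s" and "c k = W 1 1 k" for k
  have st0: "s \<noteq> 0" "t \<noteq> 0" using p by (auto simp: st common_zeros_def unit_plane_def)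
  have f0: "form W k (s, t) = 0" if "k \<le> n" for k using p that by (auto simp: st common_zeros_def)
  have f: "form W k (x, y) = a k * (x - s) + b k * (y - t) + c k * ((x - s) * (y - t))" if "k \<le> n" for k x y
    using form_germ[OF f0[OF that], of "(x, y)"] by (simp add: germ_def a_def b_def c_def)
  have w: "W 1 1 k = c k" "W 1 0 k = a k - c k * t" "W 0 1 k = b k - c k * s" for k
    by (simp_all add: a_def b_def c_def)
  have w00: "W 0 0 k = c k * (s * t) - a k * s - b k * t" if "k \<le> n" for k
    using f0[OF that] unfolding form_eq by (simp add: a_def b_def c_def algebra_simps eq_neg_iff_add_eq_0)
  \<comment> \<open>Given the zero at \<open>p\<close>, the four coefficients are linear in
    \<open>a\<close>, \<open>b\<close> and \<open>c\<close>, so proportionality can be tested on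
    these.\<close>
  have prp: "proportional W k l" if "k \<le> n" "l \<le> n" "a k = q * a l" "b k = q * b l" "c k = q * c l" for k l q
  proof (rule proportional_if)
    fix i j :: nat assume "i \<le> 1" "j \<le> 1"
    then have "(i, j) \<in> {(0, 0), (0, 1), (1, 0), (1, 1)}" by auto
    moreover have "W 0 0 k = q * W 0 0 l" "W 0 1 k = q * W 0 1 l" "W 1 0 k = q * W 1 0 l" "W 1 1 k = q * W 1 1 l"
      unfolding w00[OF that(1)] w00[OF that(2)] w that(3-5) by (simp_all add: algebra_simps)
    ultimately show "W i j k = q * W i j l" by auto
  qed
  have c0: "c k \<noteq> 0" if "k \<le> n" for k using nz[OF that] by (simp add: c_def)
  assume "\<not> tame_zero n (\<lambda>k. W 1 0 k + W 1 1 k * snd p) (\<lambda>k. W 0 1 k + W 1 1 k * fst p) (\<lambda>k. W 1 1 k)"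
  then have nt: "\<not> tame_zero n a b c" by (simp add: st a_def b_def c_def cong: tame_zero_def)
  then have det: "a i * b j = a j * b i" if "i \<le> n" "j \<le> n" for i j
    using that unfolding tame_zero_def by auto
  show False
  proof (cases "\<forall>k\<le>n. a k = 0 \<and> b k = 0")
    case True
    have "proportional W k 0" if "k \<le> n" for k
      by (rule prp[of k 0 "c k / c 0"]) (use True that c0 in auto)
    with np show False by blast
  next
    case False
    then obtain j where j: "j \<le> n" "a j \<noteq> 0 \<or> b j \<noteq> 0" by blast
    have aj: "a j \<noteq> 0"
    proof
      assume 0: "a j = 0"
      then have "a k = 0" if "k \<le> n" for k using det[OF j(1) that] j(2) by auto
      then have "form W k (x, t) = 0" if "k \<le> n" for k x using f[OF that, of x t] that by simp
      with nrow st0 show False by blast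
    qed
    have bj: "b j \<noteq> 0"
    proof
      assume 0: "b j = 0"
      then have "b k = 0" if "k \<le> n" for k using det[OF j(1) that] aj by auto
      then have "form W k (s, y) = 0" if "k \<le> n" for k y using f[OF that, of s y] that by simp
      with ncol st0 show False by blast
    qed
    define m where "m k = a k / a j" for k
    have m: "a k = m k * a j \<and> b k = m k * b j" if "k \<le> n" for k
      using det[OF j(1) that] aj by (simp add: m_def field_simps)
    have mc: "m i * c k = m k * c i" if "i \<le> n" "k \<le> n" for i k
      using nt aj bj m that unfolding tame_zero_def by (metis right_minus_eq)
    have "proportional W k 0" if "k \<le> n" for k
    proof (rule prp[of k 0 "c k / c 0"])
      have "m k = c k / c 0 * m 0" using mc[OF that, of 0] c0[of 0] by (simp add: field_simps)
      then show "a k = c k / c 0 * a 0" "b k = c k / c 0 * b 0"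
        using m[OF that] m[of 0] by (metis mult.assoc le0)+
    qed (use that c0 in auto)
    with np show False by blast
  qed
qed

lemma hyper_no_common_zeros_has_chi:
  assumes "n \<ge> 1" "common_zeros W {..n} = {}"
  shows "has_chi (hyper n (form W) unit_plane) ((-1) ^ (n - 1) * chi (complement {..n} (form W) unit_plane))"
proof -
  have "has_chi {p \<in> hyper n (form W) unit_plane. \<exists>k\<le>n. form W k (fst p) \<noteq> 0} ((-1) ^ (n - 1) * chi (complement {..n} (form W) unit_plane))"
    by (rule hyper_has_chi[OF assms(1) finite_lattice_forms]) (intro continuous_intros)
  moreover have "{p \<in> hyper n (form W) unit_plane. \<exists>k\<le>n. form W k (fst p) \<noteq> 0} = hyper n (form W) unit_plane"
  proof -
    have "\<exists>k\<le>n. form W k v \<noteq> 0" if "v \<in> unit_plane" for v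
    proof -
      have "v \<notin> common_zeros W {..n}" using assms(2) by simp
      with that show ?thesis by (auto simp: common_zeros_def)
    qed
    then show ?thesis by (auto simp: hyper_def)
  qed
  ultimately show ?thesis by simp
qed

text \<open>The part over the torus without the common zeros is known from
  \<open>hyper_has_chi\<close>; the finitely many zeros are then restored one by one.\<close>

lemma hyper_nondegenerate_has_chi:
  assumes n: "n = 1 \<or> n = 2"
    and np: "\<not> (\<forall>k\<le>n. proportional W k 0)"
    and ncol: "\<not> (\<exists>\<alpha>. \<alpha> \<noteq> 0 \<and> (\<forall>k\<le>n. \<forall>y. form W k (\<alpha>, y) = 0))"
    and nrow: "\<not> (\<exists>\<beta>. \<beta> \<noteq> 0 \<and> (\<forall>k\<le>n. \<forall>x. form W k (x, \<beta>) = 0))"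
    and fin: "finite (common_zeros W {..n})"
  shows "has_chi (hyper n (form W) unit_plane) ((-1) ^ (n - 1) * chi (complement {..n} (form W) unit_plane))"
proof -
  let ?P = "common_zeros W {..n}" and ?c = "(-1) ^ (n - 1) * chi (complement {..n} (form W) unit_plane)"
  have "has_chi {p \<in> hyper n (form W) unit_plane. \<exists>k\<le>n. form W k (fst p) \<noteq> 0} ?c"
    by (rule hyper_has_chi[OF _ finite_lattice_forms]) (use n in \<open>auto intro!: continuous_intros\<close>)
  moreover have "{p \<in> hyper n (form W) unit_plane. \<exists>k\<le>n. form W k (fst p) \<noteq> 0} = hyper n (form W) (unit_plane - ?P)"
    by (auto simp: hyper_def common_zeros_def)
  ultimately have base: "has_chi (hyper n (form W) (unit_plane - ?P)) ?c" by simp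
  have "has_chi (hyper n (form W) (unit_plane - (?P - Q))) ?c" if "finite Q" "Q \<subseteq> ?P" for Q
    using that
  proof (induction Q rule: finite_induct)
    case empty
    then show ?case using base by simp
  next
    case (insert p Q)
    let ?V = "unit_plane - (?P - insert p Q)"
    have p: "p \<in> ?P" using insert by auto
    have "?V - {p} = unit_plane - (?P - Q)" using insert by (auto simp: common_zeros_def)
    moreover have "has_chi (hyper n (form W) (unit_plane - (?P - Q))) ?c" using insert by auto
    ultimately have x: "has_chi (hyper n (form W) (?V - {p})) ?c" by simp
    show ?case
    proof (rule tame_zero_has_chi[OF n tame_common_zero[OF p np ncol nrow] _ _ _ x])
      show "open ?V" using fin by (intro open_Diff open_unit_plane) (simp add: finite_imp_closed)
      show "p \<in> ?V" using p insert by (auto simp: common_zeros_def)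
      show "form W k = germ p (W 1 0 k + W 1 1 k * snd p) (W 0 1 k + W 1 1 k * fst p) (W 1 1 k)" if "k \<le> n" for k
        using p that by (intro ext form_germ) (auto simp: common_zeros_def)
    qed
  qed
  from this[OF fin] show ?thesis by simp
qed

text \<open>The equation factors as (1 + r z) f_0 = 0: the slice z = -1 / r crosses the product of
  the curve with the punctured plane.\<close>

lemma proportional_1_has_chi:
  assumes n: "n = 1" and prp: "\<forall>k\<le>n. proportional W k 0"
  shows "has_chi (hyper n (form W) unit_plane) (slice_value W 0)"
proof -
  define r where "r = W 0 0 1 / W 0 0 0"
  have r: "r \<noteq> 0" using nz[of 0] nz[of 1] n by (simp add: r_def)
  have f1: "form W 1 v = r * form W 0 v" for v
    using proportional_form[of 1 0] prp n by (simp add: r_def)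
  let ?L = "{v \<in> unit_plane. form W 0 v = 0}" and ?s = "slice_value W 0"
  have L: "has_chi ?L (- ?s)" using form_zero_has_chi[of 0] by (simp add: slice_value_eq)
  have "has_chi ((punctured_plane - {- 1 / r}) \<times> ?L) (- int (card {- 1 / r}) * - ?s)"
    using has_chi_Times_punctured_plane_minus[OF L, of "{- 1 / r}"] r
    by (subst has_chi_Times_swap) simp
  then have "has_chi {(x, v). x \<in> punctured_plane \<and> v \<in> unit_plane \<and> (x = - 1 / r \<or> v \<in> ?L)} (?s + 0)"
    using r by (intro cross_has_chi[OF _ _ _ has_chi_unit_plane L]) (auto simp: open_Diff)
  moreover have "has_chi (hyper 1 (form W) unit_plane) c
      \<longleftrightarrow> has_chi {(x, v). x \<in> punctured_plane \<and> v \<in> unit_plane \<and> (x = - 1 / r \<or> v \<in> ?L)} c" (is "_ \<longleftrightarrow> has_chi ?X c") for c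
  proof (rule has_chi_homeomorphism)
    let ?f = "\<lambda>p::(complex \<times> complex) \<times> (nat \<Rightarrow> complex). (snd p 1, fst p)"
    let ?w = "\<lambda>(q::complex \<times> (complex \<times> complex)) (k::nat). if k = 0 then 1 else fst q"
    let ?g = "\<lambda>q::complex \<times> (complex \<times> complex). (snd q, \<lambda>k. if k \<in> {..1::nat} then ?w q k else 0)"
    have set: "{..1::nat} = {0, 1}" by auto
    show "continuous_on (hyper 1 (form W) unit_plane) ?f" by (intro continuous_intros)
    have c: "continuous_on ?X (\<lambda>q. ?w q k)" for k by (cases "k = 0"; simp add: continuous_intros)
    show "continuous_on ?X ?g"
      by (intro continuous_on_Pair continuous_on_torus_map continuous_on_snd continuous_on_id c)
    have eq: "form W 0 v + z * form W 1 v = 0 \<longleftrightarrow> z = - 1 / r \<or> form W 0 v = 0" for v z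
    proof -
      have "form W 0 v + z * form W 1 v = (1 + z * r) * form W 0 v" by (simp add: f1 algebra_simps)
      moreover have "1 + z * r = 0 \<longleftrightarrow> z = - 1 / r" using r by (auto simp: field_simps eq_neg_iff_add_eq_0 add.commute)
      ultimately show ?thesis by auto
    qed
    show "?f p \<in> ?X \<and> ?g (?f p) = p" if "p \<in> hyper 1 (form W) unit_plane" for p
    proof -
      obtain v z where p: "p = (v, z)" by (metis prod.collapse)
      have *: "v \<in> unit_plane" "z \<in> torus {..1}" "z 0 = 1" "form W 0 v + z 1 * form W 1 v = 0"
        using that by (auto simp: hyper_def p set)
      have z: "z 1 \<noteq> 0" "\<And>k. k \<notin> {0, 1} \<Longrightarrow> z k = 0" using *(2) by (auto simp: torus_def set)
      have zz: "(\<lambda>k. if k \<in> {..1::nat} then (if k = 0 then 1 else z 1) else 0) = z"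
        using z(2) *(3) unfolding set by (auto simp: fun_eq_iff)
      have "?g (?f p) = p" unfolding p fst_conv snd_conv zz by (rule refl)
      moreover have "?f p \<in> ?X" using * z(1) eq by (auto simp: p)
      ultimately show ?thesis by (rule conjI[rotated])
    qed
    show "?g q \<in> hyper 1 (form W) unit_plane \<and> ?f (?g q) = q" if "q \<in> ?X" for q
    proof -
      obtain t v where q: "q = (t, v)" by (metis prod.collapse)
      have *: "v \<in> unit_plane" "t \<noteq> 0" "form W 0 v + t * form W 1 v = 0" using that eq by (auto simp: q)
      then show ?thesis by (simp add: q hyper_def torus_def set)
    qed
  qed
  ultimately show ?thesis using n by simp
qed

text \<open>The equation factors as (1 + r1 x + r2 y) f_0 = 0, where x and y now denote z_1 and z_2.
  The line can be straightened only for x \<noteq> t0, which is the part \<open>?A\<close>; the part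
  \<open>?B\<close> off the line covers the rest, because x = t0 on the line would force y =
  0.\<close>

lemma proportional_2_has_chi:
  assumes n: "n = 2" and prp: "\<forall>k\<le>n. proportional W k 0"
  shows "has_chi (hyper n (form W) unit_plane) (- slice_value W 0)"
proof -
  define r1 r2 where "r1 = W 0 0 1 / W 0 0 0" and "r2 = W 0 0 2 / W 0 0 0"
  have r: "r1 \<noteq> 0" "r2 \<noteq> 0" using nz[of 0] nz[of 1] nz[of 2] n by (auto simp: r1_def r2_def)
  have f: "form W 1 v = r1 * form W 0 v" "form W 2 v = r2 * form W 0 v" for v
    using proportional_form[of 1 0] proportional_form[of 2 0] prp n by (auto simp: r1_def r2_def)
  let ?L = "{v \<in> unit_plane. form W 0 v = 0}" and ?s = "slice_value W 0"
  have L: "has_chi ?L (- ?s)" using form_zero_has_chi[of 0] by (simp add: slice_value_eq)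
  let ?S = "sol (form W 0) (form W 1) (form W 2) (punctured_plane \<times> punctured_plane) unit_plane"
  have eq: "form W 0 v + x * form W 1 v + y * form W 2 v = (1 + r1 * x + r2 * y) * form W 0 v" for v x y
    by (simp add: f algebra_simps)
  have S: "(v, (x, y)) \<in> ?S \<longleftrightarrow> v \<in> unit_plane \<and> x \<noteq> 0 \<and> y \<noteq> 0 \<and> (1 + r1 * x + r2 * y = 0 \<or> form W 0 v = 0)" for v x y
    by (auto simp: sol_def eq)
  define t0 where "t0 = - 1 / r1"
  have t0: "1 + r1 * x = 0 \<longleftrightarrow> x = t0" for x using r by (auto simp: t0_def field_simps eq_neg_iff_add_eq_0 add.commute)
  have t00: "t0 \<noteq> 0" using r by (simp add: t0_def)
  let ?Q = "punctured_plane - {t0}"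
  let ?A = "{(v, (x, y)). (v, (x, y)) \<in> ?S \<and> x \<noteq> t0}"
  let ?B = "{(v, (x, y)). v \<in> ?L \<and> x \<noteq> 0 \<and> y \<noteq> 0 \<and> 1 + r1 * x + r2 * y \<noteq> 0}"
  have E: "has_chi (unit_plane \<times> ?Q) 0"
    using has_chi_Times_punctured_plane_minus[OF has_chi_unit_plane, of "{t0}"] t00 by simp
  have LQ: "has_chi (?L \<times> ?Q) ?s"
    using has_chi_Times_punctured_plane_minus[OF L, of "{t0}"] t00 by simp
  have P: "has_chi ((punctured_plane - {1}) \<times> (?L \<times> ?Q)) (- ?s)"
    using has_chi_Times_punctured_plane_minus[OF LQ, of "{1}"] by (subst has_chi_Times_swap) simp
  let ?X = "{(t, e). t \<in> punctured_plane \<and> e \<in> unit_plane \<times> ?Q \<and> (t = 1 \<or> e \<in> ?L \<times> ?Q)}"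
  have X: "has_chi ?X (- ?s + 0)"
    by (rule cross_has_chi[OF _ _ _ E LQ P]) (auto simp: open_Diff)
  \<comment> \<open>The new coordinate - r2 y / (1 + r1 x) equals 1 exactly on the line, which makes
    \<open>?A\<close> a cross.\<close>
  let ?f = "\<lambda>q::(complex \<times> complex) \<times> (complex \<times> complex). (- r2 * snd (snd q) / (1 + r1 * fst (snd q)), (fst q, fst (snd q)))"
  let ?g = "\<lambda>q::complex \<times> ((complex \<times> complex) \<times> complex). (fst (snd q), (snd (snd q), - (1 + r1 * snd (snd q)) * fst q / r2))"
  have cf: "continuous_on D ?f" if "\<And>q. q \<in> D \<Longrightarrow> fst (snd q) \<noteq> t0" for D
    by (intro continuous_intros) (use that t0 in auto)
  have cg: "continuous_on D ?g" for D
    by (intro continuous_intros) (use r in auto)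
  have cancel: "- d * (- r2 * y / d) / r2 = y" "- r2 * (- d * y / r2) / d = y" if "d \<noteq> 0" for d y
    using that r by auto
  have gf: "?g (?f (v, (x, y))) = (v, (x, y))" if "x \<noteq> t0" for v x y
    using that t0[of x] by (simp only: fst_conv snd_conv cancel not_False_eq_True)
  have fg: "?f (?g (t, (v, x))) = (t, (v, x))" if "x \<noteq> t0" for v x t
    using that t0[of x] by (simp only: fst_conv snd_conv cancel not_False_eq_True)
  have cond: "1 + r1 * x + r2 * y = 0 \<longleftrightarrow> - r2 * y / (1 + r1 * x) = 1" if "x \<noteq> t0" for x y
    using that t0[of x] by (simp only: divide_eq_1_iff) (metis add.commute add_eq_0_iff minus_minus mult_minus_left)
  have "has_chi ?A c \<longleftrightarrow> has_chi ?X c" for c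
  proof (rule has_chi_homeomorphism[where f = ?f and g = ?g])
    show "?f q \<in> ?X \<and> ?g (?f q) = q" if "q \<in> ?A" for q
    proof -
      obtain v x y where q: "q = (v, (x, y))" by (metis prod.collapse)
      have *: "v \<in> unit_plane" "x \<noteq> 0" "y \<noteq> 0" "x \<noteq> t0" "1 + r1 * x + r2 * y = 0 \<or> form W 0 v = 0"
        using that unfolding q by (auto simp only: S mem_Collect_eq case_prod_conv)
      have "- r2 * y / (1 + r1 * x) \<noteq> 0" using * r t0[of x] by simp
      then have "?f q \<in> ?X" using * cond[OF *(4), of y] by (auto simp: q)
      then show ?thesis using gf[OF *(4)] by (simp only: q)
    qed
    show "?g q \<in> ?A \<and> ?f (?g q) = q" if "q \<in> ?X" for q
    proof -
      obtain t v x where q: "q = (t, (v, x))" by (metis prod.collapse)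
      have *: "t \<noteq> 0" "v \<in> unit_plane" "x \<noteq> 0" "x \<noteq> t0" "t = 1 \<or> form W 0 v = 0"
        using that by (auto simp: q)
      define y where "y = - (1 + r1 * x) * t / r2"
      have y: "y \<noteq> 0" "- r2 * y / (1 + r1 * x) = t" using * r t0[of x] cancel(2)[of "1 + r1 * x" t] by (auto simp: y_def)
      have "(v, (x, y)) \<in> ?S" unfolding S using * y cond[OF *(4), of y] by auto
      then have "?g q \<in> ?A" using *(4) by (simp add: q y_def)
      then show ?thesis using fg[OF *(4)] by (simp only: q)
    qed
  qed (rule cf, force, rule cg)
  with X have A: "has_chi ?A (- ?s)" by simp
  have "has_chi (?A \<inter> ?B) c \<longleftrightarrow> has_chi ((punctured_plane - {1}) \<times> (?L \<times> ?Q)) c" for c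
  proof (rule has_chi_homeomorphism[where f = ?f and g = ?g])
    show "?f q \<in> (punctured_plane - {1}) \<times> (?L \<times> ?Q) \<and> ?g (?f q) = q" if "q \<in> ?A \<inter> ?B" for q
    proof -
      obtain v x y where q: "q = (v, (x, y))" by (metis prod.collapse)
      have *: "v \<in> ?L" "x \<noteq> 0" "y \<noteq> 0" "x \<noteq> t0" "1 + r1 * x + r2 * y \<noteq> 0"
        using that unfolding q by (auto simp only: Int_iff mem_Collect_eq case_prod_conv)
      have "- r2 * y / (1 + r1 * x) \<noteq> 0" using * r t0[of x] by simp
      then have "?f q \<in> (punctured_plane - {1}) \<times> (?L \<times> ?Q)" using * cond[OF *(4), of y] by (auto simp: q)
      then show ?thesis using gf[OF *(4)] by (simp only: q)
    qed
    show "?g q \<in> ?A \<inter> ?B \<and> ?f (?g q) = q" if "q \<in> (punctured_plane - {1}) \<times> (?L \<times> ?Q)" for q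
    proof -
      obtain t v x where q: "q = (t, (v, x))" by (metis prod.collapse)
      have *: "t \<noteq> 0" "t \<noteq> 1" "v \<in> ?L" "x \<noteq> 0" "x \<noteq> t0" using that by (auto simp: q)
      define y where "y = - (1 + r1 * x) * t / r2"
      have y: "y \<noteq> 0" "- r2 * y / (1 + r1 * x) = t" using * r t0[of x] cancel(2)[of "1 + r1 * x" t] by (auto simp: y_def)
      have "(v, (x, y)) \<in> ?S" unfolding S using * y by auto
      moreover have "1 + r1 * x + r2 * y \<noteq> 0" using cond[OF *(5), of y] y *(2) by simp
      ultimately have "?g q \<in> ?A \<inter> ?B" using * y by (simp add: q y_def)
      then show ?thesis using fg[OF *(5)] by (simp only: q)
    qed
  qed (rule cf, force, rule cg)
  with P have AB: "has_chi (?A \<inter> ?B) (- ?s)" by simp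
  define g where "g i x = (if i = 0 then 1 + r1 * x else r2)" for i :: nat and x
  let ?V = "?L \<times> punctured_plane"
  have g0: "g 0 x = 0 \<longleftrightarrow> x = t0" "g 1 x \<noteq> 0" for x using t0 r by (auto simp: g_def)
  have "finite_lattice {0, 1} (\<lambda>i p. g i (snd p)) ?V"
    by (rule finite_lattice_line[OF _ _ L]) (use g0 in auto)
  moreover have "continuous_on ?V (\<lambda>p. g i (snd p))" for i
    unfolding g_def by (cases "i = 0"; simp; intro continuous_intros)
  ultimately have "has_chi {(v, y). v \<in> ?V \<and> y \<noteq> 0 \<and> g 0 (snd v) + y * g 1 (snd v) \<noteq> 0}
      (- chi (complement {0, 1} (\<lambda>i p. g i (snd p)) ?V))"
    by (intro bilinear_complement_has_chi)
  moreover have "complement {0, 1} (\<lambda>i p. g i (snd p)) ?V = ?L \<times> ?Q"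
    using g0 by (auto simp: complement_def)
  ultimately have "has_chi {(v, y). v \<in> ?V \<and> y \<noteq> 0 \<and> g 0 (snd v) + y * g 1 (snd v) \<noteq> 0} (- ?s)"
    using LQ by (simp add: has_chi_def)
  moreover have "has_chi ?B c \<longleftrightarrow> has_chi {(v, y). v \<in> ?V \<and> y \<noteq> 0 \<and> g 0 (snd v) + y * g 1 (snd v) \<noteq> 0} c" for c
    by (rule has_chi_homeomorphism[where f = "\<lambda>q. ((fst q, fst (snd q)), snd (snd q))" and g = "\<lambda>q. (fst (fst q), (snd (fst q), snd q))"])
       (auto simp: g_def mult.commute intro!: continuous_intros)
  ultimately have B: "has_chi ?B (- ?s)" by simp
  have un: "?A \<union> ?B = ?S"
  proof (rule Set.set_eqI)
    fix q :: "(complex \<times> complex) \<times> (complex \<times> complex)"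
    obtain v x y where q: "q = (v, (x, y))" by (metis prod.collapse)
    have "x \<noteq> t0" if "1 + r1 * x + r2 * y = 0" "y \<noteq> 0" using that t0[of x] r by auto
    then show "q \<in> ?A \<union> ?B \<longleftrightarrow> q \<in> ?S"
      unfolding q Un_iff mem_Collect_eq case_prod_conv S by auto
  qed
  have "openin (top_of_set (?A \<union> ?B)) ?A" unfolding un
  proof (rule openin_Int_open)
    show "open {q::(complex \<times> complex) \<times> (complex \<times> complex). fst (snd q) \<noteq> t0}"
      by (intro open_Collect_neq continuous_intros)
  qed auto
  moreover have "openin (top_of_set (?A \<union> ?B)) ?B" unfolding un
  proof (rule openin_Int_open)
    show "open {q::(complex \<times> complex) \<times> (complex \<times> complex). 1 + r1 * fst (snd q) + r2 * snd (snd q) \<noteq> 0}"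
      by (intro open_Collect_neq continuous_intros)
    show "?B = ?S \<inter> {q. 1 + r1 * fst (snd q) + r2 * snd (snd q) \<noteq> 0}"
      by (auto simp: sol_def eq)
  qed
  ultimately have "has_chi (?A \<union> ?B) (- ?s + - ?s - - ?s)" using A B AB by (intro has_chi_Un)
  then have "has_chi ?S (- ?s)" unfolding un by simp
  then show ?thesis using hyper_2_has_chi[of "form W" unit_plane "- ?s"] n by simp
qed

end

section \<open>Dependence on the vanishing pattern\<close>

lemma card_image_eq_if_same_fibres:
  assumes "\<And>k l. k \<in> A \<Longrightarrow> l \<in> A \<Longrightarrow> f k = f l \<longleftrightarrow> g k = g l"
  shows "card (f ` A) = card (g ` A)"
proof (rule bij_betw_same_card[OF bij_betw_imageI])
  have *: "f (inv_into A f (f k)) = f k" "inv_into A f (f k) \<in> A" if "k \<in> A" for k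
    using that by (auto intro: f_inv_into_f inv_into_into)
  have eq: "g (inv_into A f (f k)) = g k" if "k \<in> A" for k
    using assms[OF *(2)[OF that] that] *(1)[OF that] by blast
  show "inj_on (\<lambda>u. g (inv_into A f u)) (f ` A)" using assms eq by (auto simp: inj_on_def)
  show "(\<lambda>u. g (inv_into A f u)) ` f ` A = g ` A" using eq by (force simp: image_image)
qed

lemma shared_row_has_chi:
  assumes n: "n \<ge> 1" and \<beta>: "\<beta> \<noteq> 0" and ab: "\<And>k. k \<le> n \<Longrightarrow> a k \<noteq> 0 \<and> b k \<noteq> 0"
    and nc: "\<exists>k\<le>n. \<exists>l\<le>n. a k / b k \<noteq> a l / b l"
    and f: "\<And>k v. k \<le> n \<Longrightarrow> f k v = (snd v - \<beta>) * (a k + b k * fst v)"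
  shows "has_chi (hyper n f unit_plane) ((- 1) ^ (n - 1) * int (card ((\<lambda>k. - (a k / b k)) ` {..n})))"
proof -
  let ?g = "\<lambda>k v. f k (prod.swap v)" and ?s = "\<lambda>q::(complex \<times> complex) \<times> (nat \<Rightarrow> complex). (prod.swap (fst q), snd q)"
  have "has_chi (hyper n ?g unit_plane) ((- 1) ^ (n - 1) * int (card ((\<lambda>k. - (a k / b k)) ` {..n})))"
    by (rule shared_column_has_chi[OF n \<beta> ab nc]) (use f in auto)
  moreover have "has_chi (hyper n ?g unit_plane) c \<longleftrightarrow> has_chi (hyper n f unit_plane) c" for c
    by (rule has_chi_homeomorphism[of _ ?s _ ?s])
      (auto simp: hyper_def unit_plane_def prod.swap_def intro!: continuous_intros)
  ultimately show ?thesis by blast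
qed

lemma affine_zero_iff:
  fixes a b :: complex
  shows "(\<forall>y. a + b * y = 0) \<longleftrightarrow> a = 0 \<and> b = 0"
proof
  assume *: "\<forall>y. a + b * y = 0"
  show "a = 0 \<and> b = 0" using *[rule_format, of 0] *[rule_format, of 1] by simp
qed simp

text \<open>With discriminant 0 the form is a square up to a constant, as completing the square
  shows, so (1, y) and (s, t) solve the same linear equation.\<close>

lemma binary_form_double_zero:
  fixes a b c y s t :: complex
  assumes disc: "b\<^sup>2 - 4 * a * c = 0" and nz: "a \<noteq> 0 \<or> b \<noteq> 0 \<or> c \<noteq> 0"
    and y: "a + b * y + c * y\<^sup>2 = 0" and st: "a * s\<^sup>2 + b * s * t + c * t\<^sup>2 = 0"
  shows "t = y * s"
proof -
  have c: "c \<noteq> 0" using disc nz y by auto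
  have sq: "(b + 2 * c * y)\<^sup>2 = (b\<^sup>2 - 4 * a * c) + 4 * c * (a + b * y + c * y\<^sup>2)"
    "(b * s + 2 * c * t)\<^sup>2 = (b\<^sup>2 - 4 * a * c) * s\<^sup>2 + 4 * c * (a * s\<^sup>2 + b * s * t + c * t\<^sup>2)"
    by (simp_all add: algebra_simps power2_eq_square)
  have "b + 2 * c * y = 0" "b * s + 2 * c * t = 0" using sq unfolding disc y st by simp_all
  moreover have "2 * c * (t - y * s) = (b * s + 2 * c * t) - (b + 2 * c * y) * s" by (simp add: algebra_simps)
  ultimately show ?thesis using c by simp
qed

context torus_coeffs begin

lemma common_column_iff:
  "(\<exists>\<alpha>. \<alpha> \<noteq> 0 \<and> (\<forall>k\<le>n. \<forall>y. form W k (\<alpha>, y) = 0)) \<longleftrightarrow> (\<forall>k\<le>n. shared_column W k 0)"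
proof
  assume "\<exists>\<alpha>. \<alpha> \<noteq> 0 \<and> (\<forall>k\<le>n. \<forall>y. form W k (\<alpha>, y) = 0)"
  then obtain \<alpha> where \<alpha>: "\<And>k y. k \<le> n \<Longrightarrow> form W k (\<alpha>, y) = 0" by blast
  have e: "form W k (\<alpha>, y) = (W 0 0 k + W 1 0 k * \<alpha>) + (W 0 1 k + W 1 1 k * \<alpha>) * y" for k y
    by (simp add: form_eq algebra_simps)
  have z: "W 0 0 k + W 1 0 k * \<alpha> = 0" "W 0 1 k + W 1 1 k * \<alpha> = 0" if "k \<le> n" for k
    using \<alpha>[OF that] affine_zero_iff unfolding e by blast+
  have s: "F_slice k W = 0" if "k \<le> n" for k
  proof -
    have "W 0 0 k = - (W 1 0 k * \<alpha>)" "W 0 1 k = - (W 1 1 k * \<alpha>)" using z[OF that] by (simp_all only: eq_neg_iff_add_eq_0)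
    then show ?thesis by (simp add: F_slice_def)
  qed
  show "\<forall>k\<le>n. shared_column W k 0"
    using z(2) s column_zero shared_column_iff[of _ 0] by (auto simp: shared_column_def)
next
  assume *: "\<forall>k\<le>n. shared_column W k 0"
  have "form W k (column_root W 0, y) = 0" if "k \<le> n" for k y
  proof -
    have "F_slice k W = 0" "column_root W k = column_root W 0"
      using * that shared_column_iff[of k 0] by (auto simp: shared_column_def)
    then show ?thesis using reducible_form_eq[OF that] by simp
  qed
  then show "\<exists>\<alpha>. \<alpha> \<noteq> 0 \<and> (\<forall>k\<le>n. \<forall>y. form W k (\<alpha>, y) = 0)" using column_root_nz[of 0] by blast
qed

lemma common_row_iff:
  "(\<exists>\<beta>. \<beta> \<noteq> 0 \<and> (\<forall>k\<le>n. \<forall>x. form W k (x, \<beta>) = 0)) \<longleftrightarrow> (\<forall>k\<le>n. shared_row W k 0)"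
proof
  assume "\<exists>\<beta>. \<beta> \<noteq> 0 \<and> (\<forall>k\<le>n. \<forall>x. form W k (x, \<beta>) = 0)"
  then obtain \<beta> where \<beta>: "\<And>k x. k \<le> n \<Longrightarrow> form W k (x, \<beta>) = 0" by blast
  have e: "form W k (x, \<beta>) = (W 0 0 k + W 0 1 k * \<beta>) + (W 1 0 k + W 1 1 k * \<beta>) * x" for k x
    by (simp add: form_eq algebra_simps)
  have "W 0 0 k + W 0 1 k * \<beta> = 0 \<and> W 1 0 k + W 1 1 k * \<beta> = 0" if "k \<le> n" for k
    using \<beta>[OF that] affine_zero_iff unfolding e by blast
  then have "\<beta> = root0 W k" "\<beta> = root1 W k" if "k \<le> n" for k using that root0 root1 by auto
  then show "\<forall>k\<le>n. shared_row W k 0"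
    using slice_iff row_iff(1)[of _ 0] by (metis shared_row_def zero_le)
next
  assume *: "\<forall>k\<le>n. shared_row W k 0"
  have "form W k (x, root1 W 0) = 0" if "k \<le> n" for k x
  proof -
    have "F_slice k W = 0" "root1 W k = root1 W 0"
      using * that slice_iff[of k] slice_iff[of 0] row_iff(1)[of k 0] by (auto simp: shared_row_def)
    then show ?thesis using reducible_form_eq'[OF that] by simp
  qed
  then show "\<exists>\<beta>. \<beta> \<noteq> 0 \<and> (\<forall>k\<le>n. \<forall>x. form W k (x, \<beta>) = 0)" using roots_nz(2)[of 0] by blast
qed

lemma proportional_if_shared:
  assumes k: "k \<le> n" and l: "l \<le> n" and "shared_column W k l" "shared_row W k l"
  shows "proportional W k l"
  using assms slice_iff[OF k] slice_iff[OF l] row_iff[OF k l]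
  by (simp add: proportional_def shared_column_def shared_row_def)

text \<open>As the forms are not all proportional, their horizontal components do not all agree;
  this is condition \<open>nc\<close> of \<open>shared_column_has_chi\<close>.\<close>

lemma common_column_has_chi:
  assumes n: "n \<ge> 1" and np: "\<not> (\<forall>k\<le>n. proportional W k 0)" and col: "\<forall>k\<le>n. shared_column W k 0"
  shows "has_chi (hyper n (form W) unit_plane) ((-1) ^ (n - 1) * int (card (root1 W ` {..n})))"
proof -
  have s: "F_slice k W = 0" "column_root W k = column_root W 0" if "k \<le> n" for k
    using col that shared_column_iff[of k 0] by (auto simp: shared_column_def)
  obtain k where k: "k \<le> n" "\<not> proportional W k 0" using np by blast
  have "\<not> shared_row W k 0" using proportional_if_shared[of k 0] k col by auto
  then have "root1 W k \<noteq> root1 W 0"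
    using slice_iff[OF k(1)] slice_iff[of 0] s[OF k(1)] s[of 0] row_iff(1)[of k 0] k(1) by (auto simp: shared_row_def)
  then have "\<exists>k\<le>n. \<exists>l\<le>n. W 1 0 k / W 1 1 k \<noteq> W 1 0 l / W 1 1 l" using k(1) by (auto simp: root1_def)
  then have "has_chi (hyper n (form W) unit_plane) ((-1) ^ (n - 1) * int (card ((\<lambda>k. - (W 1 0 k / W 1 1 k)) ` {..n})))"
    using reducible_form_eq s nz by (intro shared_column_has_chi[OF n column_root_nz[OF le0]]) metis+
  then show ?thesis by (simp add: root1_def[abs_def])
qed

lemma common_row_has_chi:
  assumes n: "n \<ge> 1" and np: "\<not> (\<forall>k\<le>n. proportional W k 0)" and row: "\<forall>k\<le>n. shared_row W k 0"
  shows "has_chi (hyper n (form W) unit_plane) ((-1) ^ (n - 1) * int (card (column_root W ` {..n})))"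
proof -
  have s: "F_slice k W = 0" "root1 W k = root1 W 0" if "k \<le> n" for k
    using row that slice_iff[of k] slice_iff[of 0] row_iff(1)[of k 0] by (auto simp: shared_row_def)
  obtain k where k: "k \<le> n" "\<not> proportional W k 0" using np by blast
  have "\<not> shared_column W k 0" using proportional_if_shared[of k 0] k row by auto
  then have "column_root W k \<noteq> column_root W 0"
    using s[OF k(1)] s[of 0] shared_column_iff[of k 0] k(1) by (auto simp: shared_column_def)
  then have "\<exists>k\<le>n. \<exists>l\<le>n. W 0 1 k / W 1 1 k \<noteq> W 0 1 l / W 1 1 l" using k(1) by (auto simp: column_root_def)
  then have "has_chi (hyper n (form W) unit_plane) ((-1) ^ (n - 1) * int (card ((\<lambda>k. - (W 0 1 k / W 1 1 k)) ` {..n})))"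
    using reducible_form_eq' s nz by (intro shared_row_has_chi[OF n roots_nz(2)[OF le0]]) metis+
  then show ?thesis by (simp add: column_root_def[abs_def])
qed

lemma column_root_eq_iff: "k \<le> n \<Longrightarrow> l \<le> n \<Longrightarrow> F_col 1 k l W = 0 \<longleftrightarrow> column_root W k = column_root W l"
  using nz[of k] nz[of l] by (auto simp: F_col_def column_root_def frac_eq_eq mult.commute)

lemma H3_nonzero_common_zeros:
  assumes "H3 j k l W \<noteq> 0"
  shows "common_zeros W {j, k, l} = {}"
proof (rule ccontr)
  assume "common_zeros W {j, k, l} \<noteq> {}"
  then obtain x y where "form W j (x, y) = 0" "form W k (x, y) = 0" "form W l (x, y) = 0"
    by (auto simp: common_zeros_def)
  then have "\<exists>x0 x1 y0 y1. (x0 \<noteq> 0 \<or> x1 \<noteq> 0) \<and> (y0 \<noteq> 0 \<or> y1 \<noteq> 0) \<and>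
        q_form W j x0 x1 y0 y1 = 0 \<and> q_form W k x0 x1 y0 y1 = 0 \<and> q_form W l x0 x1 y0 y1 = 0"
    by (intro exI[of _ 1] exI[of _ x] exI[of _ y]) (auto simp: q_form_def form_eq algebra_simps)
  with assms show False unfolding H3_eq_0_iff by (rule notE)
qed

text \<open>With \<open>H2\<close> zero the resultant of forms \<open>k\<close> and \<open>l\<close>
  has a single projective root. The common zero provided by \<open>H3\<close> therefore has the same
  y-coordinate as the given crossing, and y determines x unless the two curves share a horizontal
  line.\<close>

lemma double_crossing:
  assumes k: "k \<le> n" and l: "l \<le> n" and H2: "H2 k l W = 0"
    and np: "\<not> proportional W k l" and nc: "\<not> shared_column W k l" and nr: "\<not> shared_row W k l"
    and H3: "H3 k l m W = 0"
  shows "common_zeros W {k, l, m} = common_zeros W {k, l}"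
proof
  show "common_zeros W {k, l, m} \<subseteq> common_zeros W {k, l}" by (auto simp: common_zeros_def)
  show "common_zeros W {k, l} \<subseteq> common_zeros W {k, l, m}"
  proof clarify
    fix x y assume v: "(x, y) \<in> common_zeros W {k, l}"
    obtain X0 X1 Y0 Y1 where X: "X0 \<noteq> 0 \<or> X1 \<noteq> 0" and Y: "Y0 \<noteq> 0 \<or> Y1 \<noteq> 0"
      and q: "q_form W k X0 X1 Y0 Y1 = 0" "q_form W l X0 X1 Y0 Y1 = 0" "q_form W m X0 X1 Y0 Y1 = 0"
      using H3[unfolded H3_eq_0_iff] by (elim exE conjE) blast
    define c1 where "c1 = W 0 0 k * W 1 1 l + W 0 1 k * W 1 0 l - W 0 0 l * W 1 1 k - W 0 1 l * W 1 0 k"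
    define R where "R s t = F_col 0 k l W * s\<^sup>2 + c1 * s * t + F_col 1 k l W * t\<^sup>2" for s t
    let ?a = "\<lambda>k s t. W 0 0 k * s + W 0 1 k * t" and ?b = "\<lambda>k s t. W 1 0 k * s + W 1 1 k * t"
    have R: "R s t = ?a k s t * ?b l s t - ?a l s t * ?b k s t" for s t
      by (simp add: R_def c1_def F_col_def algebra_simps power2_eq_square)
    have qf: "q_form W i x0 x1 s t = x0 * ?a i s t + x1 * ?b i s t" for i x0 x1 s t
      by (simp add: q_form_def algebra_simps)
    \<comment> \<open>Elimination of x0 and x1: a common zero in the product of projective lines
      gives a projective root of \<open>R\<close>.\<close>
    have R0: "R s t = 0" if "x0 \<noteq> 0 \<or> x1 \<noteq> 0" "q_form W k x0 x1 s t = 0" "q_form W l x0 x1 s t = 0" for x0 x1 s t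
    proof -
      have "x0 * R s t = q_form W k x0 x1 s t * ?b l s t - q_form W l x0 x1 s t * ?b k s t"
        "x1 * R s t = q_form W l x0 x1 s t * ?a k s t - q_form W k x0 x1 s t * ?a l s t"
        unfolding R qf by (simp_all add: algebra_simps)
      then show ?thesis using that by auto
    qed
    have f: "form W i (x, y) = q_form W i 1 x 1 y" for i by (simp add: form_eq qf)
    have v0: "q_form W k 1 x 1 y = 0" "q_form W l 1 x 1 y = 0" using v by (auto simp: common_zeros_def f)
    have "R 1 y = 0" using R0[of 1 x 1 y] v0 by simp
    then have y: "F_col 0 k l W + c1 * y + F_col 1 k l W * y\<^sup>2 = 0" by (simp add: R_def)
    have Y0: "F_col 0 k l W * Y0\<^sup>2 + c1 * Y0 * Y1 + F_col 1 k l W * Y1\<^sup>2 = 0"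
      using R0[OF X q(1,2)] by (simp add: R_def)
    have disc: "c1\<^sup>2 - 4 * F_col 0 k l W * F_col 1 k l W = 0"
      using H2 by (simp add: c1_def F_col_def F_row_def H2_def algebra_simps power2_eq_square)
    have "F_col 0 k l W \<noteq> 0 \<or> c1 \<noteq> 0 \<or> F_col 1 k l W \<noteq> 0"
      using resultant_zero_cases[OF k l] np nc unfolding c1_def by blast
    then have Y1: "Y1 = y * Y0" by (rule binary_form_double_zero[OF disc _ y Y0])
    with Y have Y00: "Y0 \<noteq> 0" by auto
    have qY: "q_form W i X0 X1 Y0 Y1 = Y0 * (X0 * ?a i 1 y + X1 * ?b i 1 y)" for i
      by (simp add: q_form_def Y1 algebra_simps)
    have e: "X0 * ?a i 1 y + X1 * ?b i 1 y = 0" if "i \<in> {k, l, m}" for i using q Y00 that unfolding qY by auto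
    have e': "?a i 1 y = - (x * ?b i 1 y)" if "i \<in> {k, l}" for i
      using v0 that unfolding qf by (auto simp: eq_neg_iff_add_eq_0)
    have d: "(X1 - x * X0) * ?b i 1 y = 0" if "i \<in> {k, l}" for i
    proof -
      have "(X1 - x * X0) * ?b i 1 y = X0 * - (x * ?b i 1 y) + X1 * ?b i 1 y" by (simp add: algebra_simps)
      also have "\<dots> = 0" using e[of i] that unfolding e'[OF that] by auto
      finally show ?thesis .
    qed
    have X1: "X1 = x * X0"
    proof (rule ccontr)
      assume "X1 \<noteq> x * X0"
      then have b: "?b i 1 y = 0" if "i \<in> {k, l}" for i using d[OF that] by auto
      then have "?a i 1 y = 0" if "i \<in> {k, l}" for i using e'[OF that] that by auto
      then have "y = root0 W k" "y = root0 W l" "y = root1 W k" "y = root1 W l"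
        using b root0[OF k, of y] root0[OF l, of y] root1[OF k, of y] root1[OF l, of y] by auto
      then show False
        using nr slice_iff[OF k] slice_iff[OF l] row_iff(1)[OF k l] by (simp add: shared_row_def)
    qed
    with X have "X0 \<noteq> 0" by auto
    moreover have "X0 * (?a m 1 y + x * ?b m 1 y) = 0" using e[of m] unfolding X1 by (simp add: algebra_simps)
    ultimately have "form W m (x, y) = 0" unfolding f qf by simp
    then show "(x, y) \<in> common_zeros W {k, l, m}" using v by (auto simp: common_zeros_def)
  qed
qed

end

text \<open>The number of triple points when \<open>H2 k l\<close> and \<open>H3\<close> vanish. In
  the first three cases forms \<open>k\<close> and \<open>l\<close> share a curve, on which the
  zeros of form \<open>m\<close> are counted; in the last their double crossing is the triple
  point.\<close>

definition triple_value :: "coeffs \<Rightarrow> nat \<Rightarrow> nat \<Rightarrow> nat \<Rightarrow> int" where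
  "triple_value W k l m = (if proportional W k l then crossing_number W k m
     else if shared_column W k l then of_bool (F_col 0 k m W \<noteq> 0 \<and> F_col 1 k m W \<noteq> 0)
     else if shared_row W k l then of_bool (F_row 0 k m W \<noteq> 0 \<and> F_row 1 k m W \<noteq> 0)
     else crossing_number W k l)"

lemma card_nonzero_affine_root:
  fixes a b :: complex
  assumes "a \<noteq> 0 \<or> b \<noteq> 0"
  shows "finite {y. y \<noteq> 0 \<and> a + b * y = 0}" "int (card {y. y \<noteq> 0 \<and> a + b * y = 0}) = of_bool (a \<noteq> 0 \<and> b \<noteq> 0)"
proof -
  have "{y. y \<noteq> 0 \<and> a + b * y = 0} = (if a \<noteq> 0 \<and> b \<noteq> 0 then {- a / b} else {})"
    using assms by (auto simp: field_simps eq_neg_iff_add_eq_0 add.commute)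
  then show "finite {y. y \<noteq> 0 \<and> a + b * y = 0}" "int (card {y. y \<noteq> 0 \<and> a + b * y = 0}) = of_bool (a \<noteq> 0 \<and> b \<noteq> 0)"
    by auto
qed

context torus_coeffs begin

lemma col_iff: "k \<le> n \<Longrightarrow> l \<le> n \<Longrightarrow> F_col 0 k l W = 0 \<longleftrightarrow> W 0 0 k / W 1 0 k = W 0 0 l / W 1 0 l"
  using nz[of k] nz[of l] by (auto simp: F_col_def frac_eq_eq mult.commute)

lemma proportional_slice:
  assumes "k \<le> n" "l \<le> n" "proportional W k l"
  shows "F_slice k W = 0 \<longleftrightarrow> F_slice l W = 0"
  using assms slice_iff[of k] slice_iff[of l] row_iff[of k l] by (auto simp: proportional_def)

text \<open>Only degeneracies common to all three forms are excluded; the pair \<open>k\<close>,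
  \<open>l\<close> may still be degenerate and is then cut by form \<open>m\<close>.\<close>

lemma triple_common_zeros:
  assumes k: "k \<le> n" and l: "l \<le> n" and m: "m \<le> n" and H2: "H2 k l W = 0" and H3: "H3 k l m W = 0"
    and np: "\<not> (proportional W k l \<and> proportional W k m)"
    and nc: "\<not> (shared_column W k l \<and> shared_column W k m)"
    and nr: "\<not> (shared_row W k l \<and> shared_row W k m)"
  shows "finite (common_zeros W {k, l, m}) \<and> int (card (common_zeros W {k, l, m})) = triple_value W k l m"
proof -
  consider (prp) "proportional W k l" | (col) "\<not> proportional W k l" "shared_column W k l"
    | (row) "\<not> proportional W k l" "\<not> shared_column W k l" "shared_row W k l"
    | (other) "\<not> proportional W k l" "\<not> shared_column W k l" "\<not> shared_row W k l" by blast
  then show ?thesis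
  proof cases
    case prp
    have s: "F_slice k W = 0 \<longleftrightarrow> F_slice l W = 0" by (rule proportional_slice[OF k l prp])
    have "F_col 0 k l W = 0" "F_row 0 k l W = 0" using prp by (auto simp: proportional_def)
    then have "\<not> proportional W k m" "\<not> shared_column W k m" "\<not> shared_row W k m"
      using np nc nr prp s by (auto simp: shared_column_def shared_row_def)
    note card_crossings[OF k m this]
    moreover have "common_zeros W {k, l, m} = common_zeros W {k, m}"
      using proportional_zero[OF k l prp] by (auto simp: common_zeros_def)
    ultimately show ?thesis using prp by (simp add: triple_value_def)
  next
    case col
    let ?\<alpha> = "column_root W k"
    \<comment> \<open>The restriction of form \<open>m\<close> to the shared line is
      \<open>A + B * y\<close>; were it identically zero, all three forms would share that
      column.\<close>
    define A B where "A = W 0 0 m + W 1 0 m * ?\<alpha>" and "B = W 0 1 m + W 1 1 m * ?\<alpha>"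
    have s: "F_slice k W = 0" using col by (simp add: shared_column_def)
    have "W 0 0 k + W 1 0 k * ?\<alpha> = 0" using s nz[OF k] by (simp add: column_root_def F_slice_def field_simps)
    then have al: "?\<alpha> = - (W 0 0 k / W 1 0 k)" using nz[OF k] by (simp add: field_simps eq_neg_iff_add_eq_0 add.commute)
    have A: "A = 0 \<longleftrightarrow> F_col 0 k m W = 0"
      using nz[OF k] unfolding A_def al by (auto simp: F_col_def field_simps)
    have B: "B = 0 \<longleftrightarrow> F_col 1 k m W = 0"
      using column_zero[OF m, of ?\<alpha>] column_root_eq_iff[OF k m] unfolding B_def by simp
    have AB: "A \<noteq> 0 \<or> B \<noteq> 0"
    proof (rule ccontr)
      assume "\<not> (A \<noteq> 0 \<or> B \<noteq> 0)"
      then have z: "A = 0" "B = 0" by auto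
      then have "W 0 0 m = - (W 1 0 m * ?\<alpha>)" "W 0 1 m = - (W 1 1 m * ?\<alpha>)"
        unfolding A_def B_def by (simp_all only: eq_neg_iff_add_eq_0)
      then have "F_slice m W = 0" by (simp add: F_slice_def)
      then show False using nc col s z A by (auto simp: shared_column_def)
    qed
    have "form W m (?\<alpha>, y) = A + B * y" for y by (simp add: form_eq A_def B_def algebra_simps)
    then have "{v \<in> unit_plane. fst v = ?\<alpha> \<and> form W m v = 0} = (\<lambda>y. (?\<alpha>, y)) ` {y. y \<noteq> 0 \<and> A + B * y = 0}"
      using column_root_nz[OF k] by (auto simp: unit_plane_def)
    moreover have "common_zeros W {k, l, m} = common_zeros W {k, l} \<inter> {v. form W m v = 0}" by (auto simp: common_zeros_def)
    then have "common_zeros W {k, l, m} = {v \<in> unit_plane. fst v = ?\<alpha> \<and> form W m v = 0}"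
      unfolding shared_column_zeros[OF k l col(2,1)] by blast
    moreover have "inj_on (\<lambda>y. (?\<alpha>, y)) S" for S :: "complex set" by (auto simp: inj_on_def)
    ultimately show ?thesis
      using card_nonzero_affine_root[OF AB] col A B by (simp add: triple_value_def card_image)
  next
    case row
    let ?\<beta> = "root1 W k"
    define A B where "A = W 0 0 m + W 0 1 m * ?\<beta>" and "B = W 1 0 m + W 1 1 m * ?\<beta>"
    have s: "root0 W k = ?\<beta>" using row slice_iff[OF k] by (simp add: shared_row_def)
    have A: "A = 0 \<longleftrightarrow> F_row 0 k m W = 0" using root0[OF m, of ?\<beta>] row_iff(1)[OF k m] s by (simp add: A_def)
    have B: "B = 0 \<longleftrightarrow> F_row 1 k m W = 0" using root1[OF m, of ?\<beta>] row_iff(2)[OF k m] by (simp add: B_def)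
    have AB: "A \<noteq> 0 \<or> B \<noteq> 0"
    proof (rule ccontr)
      assume "\<not> (A \<noteq> 0 \<or> B \<noteq> 0)"
      then have "F_row 0 k m W = 0" "F_row 1 k m W = 0" using A B by auto
      then have "shared_row W k m"
        using row row_iff[OF k m] slice_iff[OF k] slice_iff[OF m] s by (simp add: shared_row_def)
      with nr row show False by blast
    qed
    have "form W m (x, ?\<beta>) = A + B * x" for x by (simp add: form_eq A_def B_def algebra_simps)
    then have "{v \<in> unit_plane. snd v = ?\<beta> \<and> form W m v = 0} = (\<lambda>x. (x, ?\<beta>)) ` {x. x \<noteq> 0 \<and> A + B * x = 0}"
      using roots_nz(2)[OF k] by (auto simp: unit_plane_def)
    moreover have "common_zeros W {k, l, m} = common_zeros W {k, l} \<inter> {v. form W m v = 0}" by (auto simp: common_zeros_def)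
    then have "common_zeros W {k, l, m} = {v \<in> unit_plane. snd v = ?\<beta> \<and> form W m v = 0}"
      unfolding shared_row_zeros[OF k l row(3,1)] by blast
    moreover have "inj_on (\<lambda>x. (x, ?\<beta>)) S" for S :: "complex set" by (auto simp: inj_on_def)
    ultimately show ?thesis
      using card_nonzero_affine_root[OF AB] row A B by (simp add: triple_value_def card_image)
  next
    case other
    then show ?thesis
      using card_crossings[OF k l other] double_crossing[OF k l H2 other H3] by (simp add: triple_value_def)
  qed
qed

lemma hyper_no_triple_has_chi:
  assumes n: "n \<ge> 2" and H3: "\<And>j k l. j < k \<Longrightarrow> k < l \<Longrightarrow> l \<le> n \<Longrightarrow> H3 j k l W \<noteq> 0"
  shows "has_chi (hyper n (form W) unit_plane)
    ((-1) ^ (n - 1) * ((\<Sum>k\<le>n. slice_value W k) - (\<Sum>l\<le>n. \<Sum>k<l. pair_value W k l)))"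
proof -
  have "common_zeros W {..n} \<subseteq> common_zeros W {0, 1, 2}" using n by (auto simp: common_zeros_def)
  also have "\<dots> = {}" using H3[of 0 1 2] n by (intro H3_nonzero_common_zeros) auto
  finally have e: "common_zeros W {..n} = {}" by simp
  have "has_chi (complement {..n} (form W) unit_plane) ((\<Sum>k\<le>n. slice_value W k) - (\<Sum>l\<le>n. \<Sum>k<l. pair_value W k l))"
    using complement_has_chi[of n] H3_nonzero_common_zeros H3 by simp
  then have "chi (complement {..n} (form W) unit_plane) = (\<Sum>k\<le>n. slice_value W k) - (\<Sum>l\<le>n. \<Sum>k<l. pair_value W k l)"
    by (simp add: has_chi_def)
  then show ?thesis using hyper_no_common_zeros_has_chi[OF _ e] n by simp
qed

end

section \<open>Values in the degenerate and in the nondegenerate case\<close>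

definition degenerate_value :: "coeffs \<Rightarrow> nat \<Rightarrow> int" where
  "degenerate_value W n = (if \<forall>k\<le>n. proportional W k 0 then (if n = 1 then slice_value W 0 else - slice_value W 0)
     else (-1) ^ (n - 1) * (if \<forall>k\<le>n. shared_column W k 0 then int (card (root1 W ` {..n}))
       else int (card (column_root W ` {..n}))))"

definition degenerate :: "coeffs \<Rightarrow> nat \<Rightarrow> bool" where
  "degenerate W n \<longleftrightarrow> (\<forall>k\<le>n. proportional W k 0) \<or> (\<forall>k\<le>n. shared_column W k 0) \<or> (\<forall>k\<le>n. shared_row W k 0)"

context torus_coeffs begin

lemma degenerate_has_chi:
  assumes n: "n = 1 \<or> n = 2" and d: "degenerate W n"
  shows "has_chi (hyper n (form W) unit_plane) (degenerate_value W n)"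
proof -
  consider (prp) "\<forall>k\<le>n. proportional W k 0" | (col) "\<not> (\<forall>k\<le>n. proportional W k 0)" "\<forall>k\<le>n. shared_column W k 0"
    | (row) "\<not> (\<forall>k\<le>n. proportional W k 0)" "\<not> (\<forall>k\<le>n. shared_column W k 0)" "\<forall>k\<le>n. shared_row W k 0"
    using d unfolding degenerate_def by blast
  then show ?thesis
  proof cases
    case prp
    show ?thesis using n proportional_1_has_chi[OF _ prp] proportional_2_has_chi[OF _ prp]
      unfolding degenerate_value_def if_P[OF prp] by (elim disjE) simp_all
  next
    case col
    show ?thesis unfolding degenerate_value_def if_not_P[OF col(1)] if_P[OF col(2)]
      by (rule common_column_has_chi[OF _ col]) (use n in auto)
  next
    case row
    show ?thesis unfolding degenerate_value_def if_not_P[OF row(1)] if_not_P[OF row(2)]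
      by (rule common_row_has_chi[OF _ row(1,3)]) (use n in auto)
  qed
qed

text \<open>The infinite alternatives of \<open>common_zeros_cases\<close> are exactly the
  degenerate ones, so here the common zeros are finite in number.\<close>

lemma nondegenerate_has_chi:
  assumes n: "n = 1 \<or> n = 2" and d: "\<not> degenerate W n"
    and C: "finite (common_zeros W {..n}) \<Longrightarrow> has_chi (complement {..n} (form W) unit_plane) c"
  shows "has_chi (hyper n (form W) unit_plane) ((-1) ^ (n - 1) * c)"
proof -
  have np: "\<not> (\<forall>k\<le>n. proportional W k 0)" using d unfolding degenerate_def by blast
  have nc: "\<not> (\<exists>\<alpha>. \<alpha> \<noteq> 0 \<and> (\<forall>k\<le>n. \<forall>y. form W k (\<alpha>, y) = 0))"
    using d unfolding degenerate_def common_column_iff by blast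
  have nr: "\<not> (\<exists>\<beta>. \<beta> \<noteq> 0 \<and> (\<forall>k\<le>n. \<forall>x. form W k (x, \<beta>) = 0))"
    using d unfolding degenerate_def common_row_iff by blast
  have fin: "finite (common_zeros W {..n})"
  proof (rule common_zeros_cases)
    show "{..n} \<subseteq> {..n}" "{..n} \<noteq> {}" by auto
  next
    fix k assume k: "k \<in> {..n}" "\<forall>l\<in>{..n}. proportional W l k"
    have "proportional W l 0" if l: "l \<le> n" for l
    proof -
      have "proportional W l k" "proportional W 0 k" using k l by auto
      then show ?thesis
        using row_iff[of l k] row_iff[of 0 k] row_iff[of l 0] col_iff[of l k] col_iff[of 0 k] col_iff[of l 0] k(1) l
        by (simp add: proportional_def)
    qed
    with np show ?thesis by blast
  next
    fix \<alpha> assume "\<alpha> \<noteq> 0" "\<forall>k\<in>{..n}. \<forall>y. form W k (\<alpha>, y) = 0"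
    then have "\<exists>\<alpha>. \<alpha> \<noteq> 0 \<and> (\<forall>k\<le>n. \<forall>y. form W k (\<alpha>, y) = 0)" by (intro exI[of _ \<alpha>]) simp
    with nc show ?thesis by (rule notE)
  next
    fix \<beta> assume "\<beta> \<noteq> 0" "\<forall>k\<in>{..n}. \<forall>x. form W k (x, \<beta>) = 0"
    then have "\<exists>\<beta>. \<beta> \<noteq> 0 \<and> (\<forall>k\<le>n. \<forall>x. form W k (x, \<beta>) = 0)" by (intro exI[of _ \<beta>]) simp
    with nr show ?thesis by (rule notE)
  next
    assume "finite (common_zeros W {..n})"
    then show ?thesis .
  qed
  show ?thesis using hyper_nondegenerate_has_chi[OF n np nc nr fin] C[OF fin] by (simp add: has_chi_def)
qed

end

section \<open>The values depend only on the vanishing pattern\<close>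

locale same_vanishing = A: torus_coeffs W n + B: torus_coeffs W' n for W W' :: coeffs and n :: nat +
  assumes same: "\<And>G. G \<in> EA_factors n \<Longrightarrow> G W = 0 \<longleftrightarrow> G W' = 0"
begin

lemma slice_cong: "k \<le> n \<Longrightarrow> F_slice k W = 0 \<longleftrightarrow> F_slice k W' = 0"
  by (rule same) (auto simp: EA_factors_def)

text \<open>The factors are indexed by pairs k < l; antisymmetry and vanishing on the diagonal
  extend the agreement to all pairs.\<close>

lemma row_cong: "i \<le> 1 \<Longrightarrow> k \<le> n \<Longrightarrow> l \<le> n \<Longrightarrow> F_row i k l W = 0 \<longleftrightarrow> F_row i k l W' = 0"
proof -
  assume *: "i \<le> 1" "k \<le> n" "l \<le> n"
  have sym: "F_row i k l V = 0 \<longleftrightarrow> F_row i l k V = 0" and diag: "F_row i k k V = 0" for k l V by (auto simp: F_row_def mult.commute)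
  have lt: "F_row i k l W = 0 \<longleftrightarrow> F_row i k l W' = 0" if "k < l" "l \<le> n" for k l
    by (rule same) (use that *(1) in \<open>auto simp: EA_factors_def\<close>)
  show ?thesis by (cases k l rule: linorder_cases) (metis lt sym diag *)+
qed

lemma col_cong: "j \<le> 1 \<Longrightarrow> k \<le> n \<Longrightarrow> l \<le> n \<Longrightarrow> F_col j k l W = 0 \<longleftrightarrow> F_col j k l W' = 0"
proof -
  assume *: "j \<le> 1" "k \<le> n" "l \<le> n"
  have sym: "F_col j k l V = 0 \<longleftrightarrow> F_col j l k V = 0" and diag: "F_col j k k V = 0" for k l V by (auto simp: F_col_def mult.commute)
  have lt: "F_col j k l W = 0 \<longleftrightarrow> F_col j k l W' = 0" if "k < l" "l \<le> n" for k l
    by (rule same) (use that *(1) in \<open>auto simp: EA_factors_def\<close>)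
  show ?thesis by (cases k l rule: linorder_cases) (metis lt sym diag *)+
qed

lemma H2_cong: "k \<le> n \<Longrightarrow> l \<le> n \<Longrightarrow> H2 k l W = 0 \<longleftrightarrow> H2 k l W' = 0"
proof -
  assume *: "k \<le> n" "l \<le> n"
  have sym: "H2 k l V = H2 l k V" and diag: "H2 k k V = 0" for k l V by (simp_all add: H2_def F_row_def power2_eq_square algebra_simps)
  have lt: "H2 k l W = 0 \<longleftrightarrow> H2 k l W' = 0" if "k < l" "l \<le> n" for k l
    by (rule same) (use that in \<open>auto simp: EA_factors_def\<close>)
  show ?thesis by (cases k l rule: linorder_cases) (metis lt sym diag *)+
qed

lemma H3_cong: "j < k \<Longrightarrow> k < l \<Longrightarrow> l \<le> n \<Longrightarrow> H3 j k l W = 0 \<longleftrightarrow> H3 j k l W' = 0"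
  by (rule same) (auto simp: EA_factors_def)

lemma proportional_cong: "k \<le> n \<Longrightarrow> l \<le> n \<Longrightarrow> proportional W k l \<longleftrightarrow> proportional W' k l"
  using row_cong[of 0 k l] row_cong[of 1 k l] col_cong[of 0 k l] by (simp add: proportional_def)

lemma shared_cong:
  assumes "k \<le> n" "l \<le> n"
  shows "shared_column W k l \<longleftrightarrow> shared_column W' k l" "shared_row W k l \<longleftrightarrow> shared_row W' k l"
  using assms slice_cong[of k] slice_cong[of l] row_cong[of 0 k l] col_cong[of 0 k l]
  by (simp_all add: shared_column_def shared_row_def)

lemma slice_value_cong: "k \<le> n \<Longrightarrow> slice_value W k = slice_value W' k"
  by (simp add: slice_value_def slice_cong)

lemma crossing_number_cong:
  "k \<le> n \<Longrightarrow> l \<le> n \<Longrightarrow> crossing_number W k l = crossing_number W' k l"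
  using row_cong[of 0 k l] row_cong[of 1 k l] col_cong[of 0 k l] col_cong[of 1 k l] H2_cong[of k l]
  by (simp add: crossing_number_def)

lemma pair_value_cong: "k \<le> n \<Longrightarrow> l \<le> n \<Longrightarrow> pair_value W k l = pair_value W' k l"
  using proportional_cong[of k l] shared_cong[of k l] slice_value_cong[of l] crossing_number_cong[of k l]
  by (simp add: pair_value_def)

lemma triple_value_cong:
  "k \<le> n \<Longrightarrow> l \<le> n \<Longrightarrow> m \<le> n \<Longrightarrow> triple_value W k l m = triple_value W' k l m"
  using proportional_cong[of k l] shared_cong[of k l] crossing_number_cong[of k l] crossing_number_cong[of k m]
    row_cong[of 0 k m] row_cong[of 1 k m] col_cong[of 0 k m] col_cong[of 1 k m]
  by (simp add: triple_value_def)

lemma sums_cong: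
  "(\<Sum>k\<le>n. slice_value W k) - (\<Sum>l\<le>n. \<Sum>k<l. pair_value W k l)
    = (\<Sum>k\<le>n. slice_value W' k) - (\<Sum>l\<le>n. \<Sum>k<l. pair_value W' k l)"
  by (intro arg_cong2[where f = "(-)"] sum.cong) (simp_all add: slice_value_cong pair_value_cong)

lemma all_cong:
  "(\<forall>k\<le>n. proportional W k 0) \<longleftrightarrow> (\<forall>k\<le>n. proportional W' k 0)"
  "(\<forall>k\<le>n. shared_column W k 0) \<longleftrightarrow> (\<forall>k\<le>n. shared_column W' k 0)"
  "(\<forall>k\<le>n. shared_row W k 0) \<longleftrightarrow> (\<forall>k\<le>n. shared_row W' k 0)"
  using proportional_cong[of _ 0] shared_cong[of _ 0] by auto

lemma degenerate_cong: "degenerate W n \<longleftrightarrow> degenerate W' n"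
  unfolding degenerate_def all_cong ..

text \<open>The number of distinct roots depends only on which of them coincide, and the 2-minors
  record this.\<close>

lemma degenerate_value_cong: "degenerate_value W n = degenerate_value W' n"
proof -
  have "card (root1 W ` {..n}) = card (root1 W' ` {..n})"
    by (rule card_image_eq_if_same_fibres)
      (use row_cong[of 1] A.row_iff(2) B.row_iff(2) in auto)
  moreover have "card (column_root W ` {..n}) = card (column_root W' ` {..n})"
    by (rule card_image_eq_if_same_fibres)
      (use col_cong[of 1] A.column_root_eq_iff B.column_root_eq_iff in auto)
  ultimately show ?thesis
    unfolding degenerate_value_def all_cong using slice_value_cong[of 0] by (simp only: zero_le)
qed

lemma chi_eqI:
  assumes "has_chi (hyper n (form W) unit_plane) c" "has_chi (hyper n (form W') unit_plane) c'" "c = c'"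
  shows "chi (hyper n (form W) unit_plane) = chi (hyper n (form W') unit_plane)"
  using assms by (simp add: has_chi_def)

lemma chi_eq_no_triple:
  assumes "n \<ge> 2" and H3: "\<And>j k l. j < k \<Longrightarrow> k < l \<Longrightarrow> l \<le> n \<Longrightarrow> H3 j k l W \<noteq> 0"
  shows "chi (hyper n (form W) unit_plane) = chi (hyper n (form W') unit_plane)"
proof (rule chi_eqI)
  have "\<And>j k l. j < k \<Longrightarrow> k < l \<Longrightarrow> l \<le> n \<Longrightarrow> H3 j k l W' \<noteq> 0" using H3 H3_cong by blast
  then show "has_chi (hyper n (form W') unit_plane)
    ((-1) ^ (n - 1) * ((\<Sum>k\<le>n. slice_value W' k) - (\<Sum>l\<le>n. \<Sum>k<l. pair_value W' k l)))"
    by (rule B.hyper_no_triple_has_chi[OF assms(1)])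
  show "has_chi (hyper n (form W) unit_plane)
    ((-1) ^ (n - 1) * ((\<Sum>k\<le>n. slice_value W k) - (\<Sum>l\<le>n. \<Sum>k<l. pair_value W k l)))"
    by (rule A.hyper_no_triple_has_chi[OF assms])
qed (simp only: sums_cong)

lemma chi_eq_1:
  assumes n: "n = 1"
  shows "chi (hyper n (form W) unit_plane) = chi (hyper n (form W') unit_plane)"
proof (cases "degenerate W n")
  case True
  then show ?thesis
    using A.degenerate_has_chi B.degenerate_has_chi n degenerate_cong degenerate_value_cong by (intro chi_eqI) auto
next
  case False
  have "has_chi (complement {..n} (form W) unit_plane) ((\<Sum>k\<le>n. slice_value W k) - (\<Sum>l\<le>n. \<Sum>k<l. pair_value W k l))"
    using A.complement_has_chi[of n] n by auto
  note a = A.nondegenerate_has_chi[OF disjI1[OF n] False this]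
  have "has_chi (complement {..n} (form W') unit_plane) ((\<Sum>k\<le>n. slice_value W' k) - (\<Sum>l\<le>n. \<Sum>k<l. pair_value W' k l))"
    using B.complement_has_chi[of n] n by auto
  note b = B.nondegenerate_has_chi[OF disjI1[OF n] False[unfolded degenerate_cong] this]
  show ?thesis using chi_eqI[OF a b] sums_cong by simp
qed

end

context torus_coeffs begin

text \<open>The indices are named so that \<open>k\<close>, \<open>l\<close> is a pair with
  vanishing \<open>H2\<close> and \<open>m\<close> is the third index; this is the order in which
  \<open>triple_value\<close> counts.\<close>

lemma nondegenerate_2_has_chi:
  assumes n: "n = 2" and d: "\<not> degenerate W n"
    and klm: "{k, l, m} = {..2}" "k < l" "H2 k l W = 0" "H3 0 1 2 W = 0"
  shows "has_chi (hyper n (form W) unit_plane)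
    ((-1) ^ (n - 1) * (slice_value W 0 + slice_value W 1 + slice_value W 2
      - pair_value W 0 1 - pair_value W 0 2 - pair_value W 1 2 - triple_value W k l m))"
proof (rule nondegenerate_has_chi[OF disjI2[OF n] d])
  have le: "k \<le> n" "l \<le> n" "m \<le> n" using klm(1) n by blast+
  have all: "P k \<and> P l \<and> P m \<longleftrightarrow> (\<forall>i\<le>n. P i)" for P :: "nat \<Rightarrow> bool"
    using klm(1) n by (metis atMost_iff insert_iff singletonD)
  \<comment> \<open>By \<open>H3_eq_0_iff\<close> the vanishing of \<open>H3\<close> is symmetric in
    the three indices.\<close>
  have H3: "H3 k l m W = 0"
  proof -
    have set: "{..2::nat} = {0, 1, 2}" by auto
    obtain x0 x1 y0 y1 where x: "x0 \<noteq> 0 \<or> x1 \<noteq> 0" "y0 \<noteq> 0 \<or> y1 \<noteq> 0"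
      and q: "\<forall>i\<in>{..2}. q_form W i x0 x1 y0 y1 = 0"
      using klm(4)[unfolded H3_eq_0_iff] unfolding set by blast
    have "q_form W k x0 x1 y0 y1 = 0" "q_form W l x0 x1 y0 y1 = 0" "q_form W m x0 x1 y0 y1 = 0"
      using q unfolding klm(1)[symmetric] by blast+
    with x show ?thesis unfolding H3_eq_0_iff by blast
  qed
  have z: "0 \<in> {k, l, m}" using klm(1) by blast
  have np: "\<not> (proportional W k l \<and> proportional W k m)"
  proof
    assume *: "proportional W k l \<and> proportional W k m"
    have "proportional W i 0" if "i \<in> {k, l, m}" for i
      using * z that row_iff[of k l] row_iff[of k m] row_iff[of i 0] col_iff[of k l] col_iff[of k m] col_iff[of i 0] le
      by (auto simp: proportional_def)
    then show False using d all[of "\<lambda>i. proportional W i 0"] unfolding degenerate_def by blast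
  qed
  have nc: "\<not> (shared_column W k l \<and> shared_column W k m)"
  proof
    assume *: "shared_column W k l \<and> shared_column W k m"
    have "shared_column W i 0" if "i \<in> {k, l, m}" for i
      using * z that shared_column_iff[of k l] shared_column_iff[of k m] shared_column_iff[of i 0] le
      by (auto simp: shared_column_def)
    then show False using d all[of "\<lambda>i. shared_column W i 0"] unfolding degenerate_def by blast
  qed
  have nr: "\<not> (shared_row W k l \<and> shared_row W k m)"
  proof
    assume *: "shared_row W k l \<and> shared_row W k m"
    have "shared_row W i 0" if "i \<in> {k, l, m}" for i
      using * z that row_iff(1)[of k l] row_iff(1)[of k m] row_iff(1)[of i 0] le
      by (auto simp: shared_row_def)
    then show False using d all[of "\<lambda>i. shared_row W i 0"] unfolding degenerate_def by blast
  qed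
  have "finite (common_zeros W {..2})" "int (card (common_zeros W {..2})) = triple_value W k l m"
    using triple_common_zeros[OF le klm(3) H3 np nc nr] unfolding klm(1) by auto
  then show "has_chi (complement {..n} (form W) unit_plane) (slice_value W 0 + slice_value W 1 + slice_value W 2
      - pair_value W 0 1 - pair_value W 0 2 - pair_value W 1 2 - triple_value W k l m)"
    using complement_2_has_chi n by simp
qed

end

context same_vanishing begin

lemma chi_eq_2:
  assumes n: "n = 2" and H3: "H3 0 1 2 W = 0" and H2: "H2 0 1 W = 0 \<or> H2 0 2 W = 0 \<or> H2 1 2 W = 0"
  shows "chi (hyper n (form W) unit_plane) = chi (hyper n (form W') unit_plane)"
proof (cases "degenerate W n")
  case True
  then show ?thesis
    using A.degenerate_has_chi B.degenerate_has_chi n degenerate_cong degenerate_value_cong by (intro chi_eqI) auto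
next
  case False
  have H3': "H3 0 1 2 W' = 0" using H3_cong[of 0 1 2] n H3 by simp
  \<comment> \<open>The same labelling serves \<open>W'\<close>, since \<open>H2\<close> vanishes
    there for the same pairs.\<close>
  have "\<exists>k l m. {k, l, m} = {..2::nat} \<and> k < l \<and> H2 k l W = 0"
  proof -
    have "{0, 1, 2} = {..2::nat}" "{0, 2, 1} = {..2::nat}" "{1, 2, 0} = {..2::nat}" by auto
    moreover have "0 < (1::nat)" "0 < (2::nat)" "1 < (2::nat)" by auto
    ultimately show ?thesis using H2 by metis
  qed
  then obtain k l m where klm: "{k, l, m} = {..2::nat}" "k < l" "H2 k l W = 0" by blast
  have le: "k \<le> n" "l \<le> n" "m \<le> n" using klm(1) n by blast+
  have "H2 k l W' = 0" using H2_cong le klm(3) by blast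
  note b = B.nondegenerate_2_has_chi[OF n False[unfolded degenerate_cong] klm(1,2) this H3']
  note a = A.nondegenerate_2_has_chi[OF n False klm H3]
  show ?thesis
    by (rule chi_eqI[OF a b]) (use n le in \<open>simp add: triple_value_cong slice_value_cong pair_value_cong\<close>)
qed

end

theorem theorem1p6:
  fixes n :: nat and W W' :: coeffs
  assumes "n \<ge> 1"
    and "in_torus n W" and "in_torus n W'"
    and "\<forall>G\<in>EA_factors n. G W = 0 \<longleftrightarrow> G W' = 0"
  shows "(n = 1 \<longrightarrow>
            euler_characteristic (Y_hyp W 1) = euler_characteristic (Y_hyp W' 1))
       \<and> (n = 2 \<and> (H3 0 1 2 W \<noteq> 0 \<or> H2 0 1 W = 0 \<or> H2 0 2 W = 0 \<or> H2 1 2 W = 0) \<longrightarrow>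
            euler_characteristic (Y_hyp W 2) = euler_characteristic (Y_hyp W' 2))
       \<and> (n > 2 \<and> (\<forall>k1 k2 k3. k1 < k2 \<and> k2 < k3 \<and> k3 \<le> n \<longrightarrow> H3 k1 k2 k3 W \<noteq> 0) \<longrightarrow>
            euler_characteristic (Y_hyp W n) = euler_characteristic (Y_hyp W' n))"
proof (intro conjI impI)
  interpret same_vanishing W W' n
    by unfold_locales (use assms in auto)
  show "euler_characteristic (Y_hyp W 1) = euler_characteristic (Y_hyp W' 1)" if "n = 1"
    using chi_eq_1[OF that] that by (simp add: euler_characteristic_Y_hyp)
  show "euler_characteristic (Y_hyp W 2) = euler_characteristic (Y_hyp W' 2)"
    if "n = 2 \<and> (H3 0 1 2 W \<noteq> 0 \<or> H2 0 1 W = 0 \<or> H2 0 2 W = 0 \<or> H2 1 2 W = 0)"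
  \<comment> \<open>If \<open>H3\<close> vanishes, the hypothesis leaves a vanishing
    \<open>H2\<close>; if not, there are no triple points and the argument for n > 2
    applies.\<close>
  proof (cases "H3 0 1 2 W = 0")
    case True
    then show ?thesis using chi_eq_2[OF _ True] that by (auto simp: euler_characteristic_Y_hyp)
  next
    case False
    have "H3 j k l W \<noteq> 0" if *: "j < k" "k < l" "l \<le> n" for j k l
    proof -
      have "j = 0" "k = 1" "l = 2" using * \<open>n = 2 \<and> _\<close> by auto
      then show ?thesis using False by simp
    qed
    with that show ?thesis using chi_eq_no_triple by (auto simp: euler_characteristic_Y_hyp)
  qed
  show "euler_characteristic (Y_hyp W n) = euler_characteristic (Y_hyp W' n)"
    if "n > 2 \<and> (\<forall>k1 k2 k3. k1 < k2 \<and> k2 < k3 \<and> k3 \<le> n \<longrightarrow> H3 k1 k2 k3 W \<noteq> 0)"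
    using chi_eq_no_triple that by (auto simp: euler_characteristic_Y_hyp)
qed

end
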